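(* Let $g$ be an admissible probability weight, let $\mathcal H_0$ be an admissible energy, let $\ell>0$, $T>0$, $\sigma=\mathrm{diag}(\sigma_1,\dots,\sigma_n)$, and let $(F,h)$ be admissible costs. Assume: (1) there are constants $C_1,C_2>0$ such that for all $(\rho,x)\in\mathcal P^\circ(G)\times\mathbb R^n$ and $\mathbb V\in B_\ell$, $\|D_x\mathcal H_0^{\mathbb V}(\rho,x)\|+\sum_{i=1}^n\big|\frac{\partial^2\mathcal H_0^{\mathbb V}}{\partial x_i^2}(\rho,x)\big|\le C_1\mathcal H_0^{\mathbb V}(\rho,x)+C_2$; (2) $\sum_{i=1}^n(D_x\mathcal H_0(\rho,x))_i=0$ for every $(\rho,x)\in\mathcal P^\circ(G)\times\mathbb R^n$; (3) for some $\beta\in(0,1)$, $$\lim_{R\to\infty}\ \sup_{(\rho,x)\in\mathcal P^\circ(G)\times\mathbb R^n}\mathbf 1_{\{\mathcal H_0(\rho,x)\in(R,2R)\}}\Big[\frac1R\|D_x^2\mathcal H_0(\rho,x)\|+\frac1{R^{2-\beta}}\|D_x\mathcal H_0(\rho,x)\|^2\Big]=0;$$ (4) $F$ and $h$ are uniformly bounded. Then there exists a unique bounded viscosity solution $U$ in $(0,T)\times\mathcal P^\circ(G)\times\mathbb R^n$ of $$\frac{\partial U}{\partial t}+H(t,\rho,x,\partial_\rho U,D_xU,D_x^2U)=0,\qquad U(T,\rho,x)=h(\rho,x).$$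
   Context: **Graph and simplex.** $G=(V,E,\omega)$ is a finite undirected connected weighted graph, $V=\{1,\dots,n\}$, $\omega_{jl}=\omega_{lj}>0$ if $(j,l)\in E$ and $\omega_{jl}=0$ otherwise. $\mathcal P(G)=\{\rho\in[0,1]^n:\sum_i\rho_i=1\}$; $\mathcal P^\circ(G)$ is its (relative) interior. $\|\cdot\|$ is the Euclidean norm. $D_x,D_\rho,D_x^2$ are Euclidean gradients/Hessian (a function of $\rho\in\mathcal P^\circ(G)$ whose Euclidean $\rho$-gradient is taken is understood to be given as a function of $\rho$ on a neighbourhood in $\mathbb R^n$). **Admissible probability weight.** A symmetric function $g:[0,\infty)^2\to[0,\infty)$ such that: $g$ is continuous on $[0,\infty)^2$ and smooth on $(0,\infty)^2$; $\min\{t,r\}\le g(t,r)\le\max\{t,r\}$; $g(\lambda t,\lambda r)=\lambda g(t,r)$ for $\lambda,t,r\ge0$; $g$ is concave; $\int_0^1 g(r,1-r)^{-1/2}\,dr<\infty$. **Locally Lipschitz.** $f:\mathcal P^\circ(G)\times\mathbb R^n\to\mathbb R$ is locally Lipschitz if for all $R_1\in(0,\frac1n)$, $R_2>0$ there is $C=C(R_1,R_2)>0$ with $|f(\rho,x)-f(\mu,y)|\le C(\|\rho-\mu\|+\|x-y\|)$ whenever $\min_i\rho_i\wedge\min_i\mu_i\ge R_1$ and $\max_{(i,j)\in E}|x_i-x_j|\vee\max_{(i,j)\in E}|y_i-y_j|\le R_2$. **Class $(\mathrm{Pr})$.** $\eta\in(\mathrm{Pr})$ if: (i) $\eta\in C^1(\mathcal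 P^\circ(G)\times\mathbb R^n;\mathbb R)$ is bounded below; (ii) for each $R>0$ there are $c\in(0,1)$, $C_1,C_2>0$ depending on $R$ such that $\eta(\rho,x)\le R$ implies $\|D_\rho\eta\|\vee\|D_x\eta\|\le C_1$, $\min_i\rho_i\ge c$, $\sup_{(i,j)\in E}|x_i-x_j|\le C_2$; (iii) $\eta(\rho,x)\to+\infty$ as $\rho\to\partial\mathcal P(G)$ or $|x_i-x_j|\to+\infty$ with $(i,j)\in E$. **Admissible energy.** $\mathcal H_0\in(\mathrm{Pr})$ such that $\mathcal H_0$ and its Euclidean partial derivatives are locally Lipschitz. For a control value $\mathbb V\in\mathbb R^n$ put $\mathcal H_0^{\mathbb V}(\rho,x)=\mathcal H_0(\rho,x)+\sum_i\mathbb V_i\rho_i$. $B_\ell=\{x\in\mathbb R^n:\|x\|\le\ell\}$. **Admissible costs.** $F:[0,T]\times\mathcal P^\circ(G)\times\mathbb R^n\times B_\ell\to\mathbb R$ and $h:\mathcal P^\circ(G)\times\mathbb R^n\to\mathbb R$ such that: (i) $F,h$ are nonnegative and continuous; (ii) for $s\in[0,T]$, $\mathbb V\in B_\ell$, $F(s,\cdot,\cdot,\mathbb V)$ and $h$ are locally Lipschitz; (iii) for $(\rho,x,\mathbb V)$, $F(\cdot,\rho,x,\mathbb V)$ is globally Lipschitz on $[0,T]$; (iv) there are $p_1\ge0$ and $C=C(T,p_1,\ell)>0$ with $F(s,\rho,x,\mathbb V)\vee h(\rho,x)\le C(|\mathcal H_0(\rho,x)|^{p_1}+1)$ for all $s,\rho,x,\mathbb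 V$. **Hamiltonian.** $H(t,\rho,x,p,q,Q)=\inf_{\mathbb V\in B_\ell}\{\langle p,D_x\mathcal H_0^{\mathbb V}(\rho,x)\rangle-\langle q,D_\rho\mathcal H_0^{\mathbb V}(\rho,x)\rangle+\frac12\mathrm{tr}(\sigma\sigma^\top Q)+F(t,\rho,x,\mathbb V)\}$ for $p,q\in\mathbb R^n$, $Q$ symmetric $n\times n$. **Fréchet derivative.** $f:\mathcal P(G)\to\mathbb R$ has Fréchet derivative $\partial_\rho f(\rho)=p$ at $\rho$ if $\sum_ip_i=0$ and $\lim_{s\to0}\frac{f((1-s)\rho+s\mu)-f(\rho)}{s}=\langle p,\mu-\rho\rangle$ for all $\mu\in\mathcal P(G)$; for smooth $f$, $\partial_\rho f=Df-\frac1n(Df^\top\mathbf 1)\mathbf 1$ with $\mathbf 1=(1,\dots,1)^\top$. **Viscosity solution.** A continuous $U$ (on $(0,T]\times\mathcal P^\circ(G)\times\mathbb R^n$) is a viscosity subsolution (resp. supersolution) if $U(T,\cdot)\le h$ (resp. $\ge h$) and for every $z_0=(t_0,\rho_0,x_0)\in(0,T)\times\mathcal P^\circ(G)\times\mathbb R^n$ and every $\varphi\in C^{1,1,2}((0,T)\times\mathcal P^\circ(G)\times\mathbb R^n)$ ($C^1$ in $t$, $C^1$ in $\rho$, $C^2$ in $x$) such that $U-\varphi$ has a local maximum (resp. minimum) at $z_0$, $\frac{\partial\varphi}{\partial t}(z_0)+H(z_0,\partial_\rho\varphi(z_0),D_x\varphi(z_0),D_x^2\varphi(z_0))\ge0$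 (resp. $\le0$). A viscosity solution is both a sub- and a supersolution. *)

theory Defs
  imports "HOL-Analysis.Analysis"
begin

section \<open>Weighted graphs and the probability simplex\<close>

text \<open>The vertex set is the finite type \<open>'n\<close>, so that \<open>n = CARD('n)\<close>.\<close>

definition weighted_graph :: "('n::finite \<times> 'n) set \<Rightarrow> ('n \<Rightarrow> 'n \<Rightarrow> real) \<Rightarrow> bool" where
  "weighted_graph E \<omega> \<longleftrightarrow>
     sym E \<and>
     (\<forall>j l. \<omega> j l = \<omega> l j) \<and>
     (\<forall>j l. (j, l) \<in> E \<longrightarrow> 0 < \<omega> j l) \<and>
     (\<forall>j l. (j, l) \<notin> E \<longrightarrow> \<omega> j l = 0) \<and>
     (\<forall>j l. (j, l) \<in> E\<^sup>*)"

definition prob_simplex :: "(real ^ 'n::finite) set" where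
  "prob_simplex = {\<rho>. (\<forall>i. 0 \<le> \<rho> $ i \<and> \<rho> $ i \<le> 1) \<and> (\<Sum>i\<in>UNIV. \<rho> $ i) = 1}"

abbreviation prob_simplex_int :: "(real ^ 'n::finite) set" where
  "prob_simplex_int \<equiv> rel_interior prob_simplex"


section \<open>Derivatives\<close>

primrec Ck_on :: "nat \<Rightarrow> 'a::euclidean_space set \<Rightarrow> ('a \<Rightarrow> real) \<Rightarrow> bool" where
  "Ck_on 0 S f \<longleftrightarrow> continuous_on S f"
| "Ck_on (Suc k) S f \<longleftrightarrow>
     (\<forall>z\<in>S. f differentiable (at z)) \<and>
     (\<forall>b\<in>Basis. Ck_on k S (\<lambda>z. frechet_derivative f (at z) b))"

definition smooth_on :: "'a::euclidean_space set \<Rightarrow> ('a \<Rightarrow> real) \<Rightarrow> bool" where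
  "smooth_on S f \<longleftrightarrow> (\<forall>k. Ck_on k S f)"

definition grad :: "(real ^ 'n::finite \<Rightarrow> real) \<Rightarrow> real ^ 'n \<Rightarrow> real ^ 'n" where
  "grad f x = (\<chi> i. frechet_derivative f (at x) (axis i 1))"

definition hessian :: "(real ^ 'n::finite \<Rightarrow> real) \<Rightarrow> real ^ 'n \<Rightarrow> real ^ 'n ^ 'n" where
  "hessian f x = jacobian (grad f) (at x)"

definition D_\<rho> :: "(real ^ 'n::finite \<Rightarrow> real ^ 'n \<Rightarrow> real) \<Rightarrow> real ^ 'n \<Rightarrow> real ^ 'n \<Rightarrow> real ^ 'n" where
  "D_\<rho> f \<rho> x = grad (\<lambda>r. f r x) \<rho>"

definition D_x :: "(real ^ 'n::finite \<Rightarrow> real ^ 'n \<Rightarrow> real) \<Rightarrow> real ^ 'n \<Rightarrow> real ^ 'n \<Rightarrow> real ^ 'n" where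
  "D_x f \<rho> x = grad (f \<rho>) x"

definition D2_x ::
  "(real ^ 'n::finite \<Rightarrow> real ^ 'n \<Rightarrow> real) \<Rightarrow> real ^ 'n \<Rightarrow> real ^ 'n \<Rightarrow> real ^ 'n ^ 'n" where
  "D2_x f \<rho> x = hessian (f \<rho>) x"

definition twice_differentiable_at :: "(real ^ 'n::finite \<Rightarrow> real) \<Rightarrow> real ^ 'n \<Rightarrow> bool" where
  "twice_differentiable_at f x \<longleftrightarrow>
     (\<forall>\<^sub>F y in nhds x. f differentiable (at y)) \<and> grad f differentiable (at x)"

text \<open>
  The Frechet derivative on the simplex. The limit \<open>s \<rightarrow> 0\<close> runs over those \<open>s\<close> for which the
  point \<open>(1 - s) \<rho> + s \<mu>\<close> stays in the simplex; at a relative interior point \<open>\<rho>\<close> this is the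
  two-sided limit.
\<close>

definition has_simplex_derivative ::
  "(real ^ 'n::finite \<Rightarrow> real) \<Rightarrow> real ^ 'n \<Rightarrow> real ^ 'n \<Rightarrow> bool" where
  "has_simplex_derivative f p \<rho> \<longleftrightarrow>
     (\<Sum>i\<in>UNIV. p $ i) = 0 \<and>
     (\<forall>\<mu>\<in>prob_simplex.
        ((\<lambda>s. (f ((1 - s) *\<^sub>R \<rho> + s *\<^sub>R \<mu>) - f \<rho>) / s) \<longlongrightarrow> p \<bullet> (\<mu> - \<rho>))
          (at 0 within {s. (1 - s) *\<^sub>R \<rho> + s *\<^sub>R \<mu> \<in> prob_simplex}))"

definition simplex_derivative :: "(real ^ 'n::finite \<Rightarrow> real) \<Rightarrow> real ^ 'n \<Rightarrow> real ^ 'n" where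
  "simplex_derivative f \<rho> = (THE p. has_simplex_derivative f p \<rho>)"


section \<open>Admissible weights, energies and costs\<close>

definition admissible_weight :: "(real \<Rightarrow> real \<Rightarrow> real) \<Rightarrow> bool" where
  "admissible_weight g \<longleftrightarrow>
     (\<forall>t\<ge>0. \<forall>r\<ge>0. 0 \<le> g t r) \<and>
     (\<forall>t\<ge>0. \<forall>r\<ge>0. g t r = g r t) \<and>
     continuous_on ({0..} \<times> {0..}) (\<lambda>(t, r). g t r) \<and>
     smooth_on ({0<..} \<times> {0<..}) (\<lambda>(t, r). g t r) \<and>
     (\<forall>t\<ge>0. \<forall>r\<ge>0. min t r \<le> g t r \<and> g t r \<le> max t r) \<and>
     (\<forall>c\<ge>0. \<forall>t\<ge>0. \<forall>r\<ge>0. g (c * t) (c * r) = c * g t r) \<and>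
     concave_on ({0..} \<times> {0..}) (\<lambda>(t, r). g t r) \<and>
     (\<integral>\<^sup>+ r\<in>{0<..<1}. ennreal (g r (1 - r) powr (- 1 / 2)) \<partial>lborel) < \<infinity>"

text \<open>
  The bounds on minima over vertices and maxima over edges are written pointwise, which also
  covers the one-vertex graph without edges.
\<close>

definition locally_lipschitz ::
  "('n::finite \<times> 'n) set \<Rightarrow> (real ^ 'n \<Rightarrow> real ^ 'n \<Rightarrow> real) \<Rightarrow> bool" where
  "locally_lipschitz E f \<longleftrightarrow>
     (\<forall>R1 R2. 0 < R1 \<and> R1 < 1 / real CARD('n) \<and> 0 < R2 \<longrightarrow>
       (\<exists>C>0. \<forall>\<rho>\<in>prob_simplex_int. \<forall>\<mu>\<in>prob_simplex_int. \<forall>x y.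
          (\<forall>i. R1 \<le> \<rho> $ i \<and> R1 \<le> \<mu> $ i) \<and>
          (\<forall>(i, j)\<in>E. \<bar>x $ i - x $ j\<bar> \<le> R2 \<and> \<bar>y $ i - y $ j\<bar> \<le> R2) \<longrightarrow>
          \<bar>f \<rho> x - f \<mu> y\<bar> \<le> C * (norm (\<rho> - \<mu>) + norm (x - y))))"

text \<open>
  A function on \<open>prob_simplex_int \<times> UNIV\<close> is given on a neighbourhood \<open>W\<close> of this set in the
  Euclidean space, and \<open>C\<^sup>1\<close> refers to \<open>W\<close>, so that the Euclidean gradient \<open>D_\<rho>\<close> makes sense.
  The blow-up condition at the boundary is stated through boundary points at distance less than
  \<open>\<delta>\<close>: \<open>infdist\<close> would be 0 for the empty boundary of a one-point simplex.
\<close>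

definition class_Pr ::
  "('n::finite \<times> 'n) set \<Rightarrow> (real ^ 'n \<Rightarrow> real ^ 'n \<Rightarrow> real) \<Rightarrow> bool" where
  "class_Pr E \<eta> \<longleftrightarrow>
     (\<exists>W. open W \<and> prob_simplex_int \<times> UNIV \<subseteq> W \<and> Ck_on 1 W (\<lambda>(\<rho>, x). \<eta> \<rho> x)) \<and>
     (\<exists>m. \<forall>\<rho>\<in>prob_simplex_int. \<forall>x. m \<le> \<eta> \<rho> x) \<and>
     (\<forall>R>0. \<exists>c C1 C2. 0 < c \<and> c < 1 \<and> 0 < C1 \<and> 0 < C2 \<and>
        (\<forall>\<rho>\<in>prob_simplex_int. \<forall>x. \<eta> \<rho> x \<le> R \<longrightarrow>
           norm (D_\<rho> \<eta> \<rho> x) \<le> C1 \<and> norm (D_x \<eta> \<rho> x) \<le> C1 \<and>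
           (\<forall>i. c \<le> \<rho> $ i) \<and> (\<forall>(i, j)\<in>E. \<bar>x $ i - x $ j\<bar> \<le> C2))) \<and>
     (\<forall>M. \<exists>\<delta>>0. \<forall>\<rho>\<in>prob_simplex_int. \<forall>x.
        (\<exists>\<mu>\<in>rel_frontier prob_simplex. dist \<rho> \<mu> < \<delta>) \<longrightarrow> M \<le> \<eta> \<rho> x) \<and>
     (\<forall>M. \<exists>K. \<forall>\<rho>\<in>prob_simplex_int. \<forall>x.
        (\<exists>(i, j)\<in>E. K < \<bar>x $ i - x $ j\<bar>) \<longrightarrow> M \<le> \<eta> \<rho> x)"

definition admissible_energy ::
  "('n::finite \<times> 'n) set \<Rightarrow> (real ^ 'n \<Rightarrow> real ^ 'n \<Rightarrow> real) \<Rightarrow> bool" where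
  "admissible_energy E H0 \<longleftrightarrow>
     class_Pr E H0 \<and>
     locally_lipschitz E H0 \<and>
     (\<forall>i. locally_lipschitz E (\<lambda>\<rho> x. D_\<rho> H0 \<rho> x $ i)) \<and>
     (\<forall>i. locally_lipschitz E (\<lambda>\<rho> x. D_x H0 \<rho> x $ i))"

definition controlled_energy ::
  "(real ^ 'n::finite \<Rightarrow> real ^ 'n \<Rightarrow> real) \<Rightarrow> real ^ 'n \<Rightarrow> real ^ 'n \<Rightarrow> real ^ 'n \<Rightarrow> real" where
  "controlled_energy H0 V \<rho> x = H0 \<rho> x + (\<Sum>i\<in>UNIV. V $ i * \<rho> $ i)"

definition admissible_costs ::
  "('n::finite \<times> 'n) set \<Rightarrow> (real ^ 'n \<Rightarrow> real ^ 'n \<Rightarrow> real) \<Rightarrow> real \<Rightarrow> real \<Rightarrow>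
   (real \<Rightarrow> real ^ 'n \<Rightarrow> real ^ 'n \<Rightarrow> real ^ 'n \<Rightarrow> real) \<Rightarrow> (real ^ 'n \<Rightarrow> real ^ 'n \<Rightarrow> real) \<Rightarrow> bool" where
  "admissible_costs E H0 T l F h \<longleftrightarrow>
     (\<forall>s\<in>{0..T}. \<forall>\<rho>\<in>prob_simplex_int. \<forall>x. \<forall>V\<in>cball 0 l. 0 \<le> F s \<rho> x V) \<and>
     (\<forall>\<rho>\<in>prob_simplex_int. \<forall>x. 0 \<le> h \<rho> x) \<and>
     continuous_on ({0..T} \<times> prob_simplex_int \<times> UNIV \<times> cball 0 l) (\<lambda>(s, \<rho>, x, V). F s \<rho> x V) \<and>
     continuous_on (prob_simplex_int \<times> UNIV) (\<lambda>(\<rho>, x). h \<rho> x) \<and>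
     (\<forall>s\<in>{0..T}. \<forall>V\<in>cball 0 l. locally_lipschitz E (\<lambda>\<rho> x. F s \<rho> x V)) \<and>
     locally_lipschitz E h \<and>
     (\<forall>\<rho>\<in>prob_simplex_int. \<forall>x. \<forall>V\<in>cball 0 l. \<exists>L. L-lipschitz_on {0..T} (\<lambda>s. F s \<rho> x V)) \<and>
     (\<exists>p1\<ge>0. \<exists>C>0. \<forall>s\<in>{0..T}. \<forall>\<rho>\<in>prob_simplex_int. \<forall>x. \<forall>V\<in>cball 0 l.
        max (F s \<rho> x V) (h \<rho> x) \<le> C * (\<bar>H0 \<rho> x\<bar> powr p1 + 1))"


section \<open>The Hamiltonian and viscosity solutions\<close>

definition diag_mat :: "real ^ 'n::finite \<Rightarrow> real ^ 'n ^ 'n" where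
  "diag_mat s = (\<chi> i j. if i = j then s $ i else 0)"

definition hamiltonian ::
  "(real ^ 'n::finite \<Rightarrow> real ^ 'n \<Rightarrow> real) \<Rightarrow> real ^ 'n ^ 'n \<Rightarrow> real \<Rightarrow>
   (real \<Rightarrow> real ^ 'n \<Rightarrow> real ^ 'n \<Rightarrow> real ^ 'n \<Rightarrow> real) \<Rightarrow>
   real \<Rightarrow> real ^ 'n \<Rightarrow> real ^ 'n \<Rightarrow> real ^ 'n \<Rightarrow> real ^ 'n \<Rightarrow> real ^ 'n ^ 'n \<Rightarrow> real" where
  "hamiltonian H0 \<sigma> l F t \<rho> x p q Q =
     (INF V\<in>cball 0 l.
        p \<bullet> D_x (controlled_energy H0 V) \<rho> x - q \<bullet> D_\<rho> (controlled_energy H0 V) \<rho> x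
        + 1 / 2 * trace (\<sigma> ** transpose \<sigma> ** Q) + F t \<rho> x V)"

definition C112_on :: "real \<Rightarrow> (real \<Rightarrow> real ^ 'n::finite \<Rightarrow> real ^ 'n \<Rightarrow> real) \<Rightarrow> bool" where
  "C112_on T \<phi> \<longleftrightarrow>
     (let D = {0<..<T} \<times> prob_simplex_int \<times> UNIV in
        (\<forall>(t, \<rho>, x)\<in>D.
           (\<lambda>s. \<phi> s \<rho> x) differentiable (at t) \<and>
           (\<exists>p. has_simplex_derivative (\<lambda>r. \<phi> t r x) p \<rho>) \<and>
           twice_differentiable_at (\<phi> t \<rho>) x) \<and>
        continuous_on D (\<lambda>(t, \<rho>, x). \<phi> t \<rho> x) \<and>
        continuous_on D (\<lambda>(t, \<rho>, x). deriv (\<lambda>s. \<phi> s \<rho> x) t) \<and>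
        continuous_on D (\<lambda>(t, \<rho>, x). simplex_derivative (\<lambda>r. \<phi> t r x) \<rho>) \<and>
        continuous_on D (\<lambda>(t, \<rho>, x). D_x (\<phi> t) \<rho> x) \<and>
        continuous_on D (\<lambda>(t, \<rho>, x). D2_x (\<phi> t) \<rho> x))"

definition viscosity_operator ::
  "(real ^ 'n::finite \<Rightarrow> real ^ 'n \<Rightarrow> real) \<Rightarrow> real ^ 'n ^ 'n \<Rightarrow> real \<Rightarrow>
   (real \<Rightarrow> real ^ 'n \<Rightarrow> real ^ 'n \<Rightarrow> real ^ 'n \<Rightarrow> real) \<Rightarrow>
   (real \<Rightarrow> real ^ 'n \<Rightarrow> real ^ 'n \<Rightarrow> real) \<Rightarrow> real \<Rightarrow> real ^ 'n \<Rightarrow> real ^ 'n \<Rightarrow> real" where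
  "viscosity_operator H0 \<sigma> l F \<phi> t \<rho> x =
     deriv (\<lambda>s. \<phi> s \<rho> x) t
     + hamiltonian H0 \<sigma> l F t \<rho> x
         (simplex_derivative (\<lambda>r. \<phi> t r x) \<rho>) (D_x (\<phi> t) \<rho> x) (D2_x (\<phi> t) \<rho> x)"

definition viscosity_subsolution ::
  "(real ^ 'n::finite \<Rightarrow> real ^ 'n \<Rightarrow> real) \<Rightarrow> real ^ 'n ^ 'n \<Rightarrow> real \<Rightarrow> real \<Rightarrow>
   (real \<Rightarrow> real ^ 'n \<Rightarrow> real ^ 'n \<Rightarrow> real ^ 'n \<Rightarrow> real) \<Rightarrow> (real ^ 'n \<Rightarrow> real ^ 'n \<Rightarrow> real) \<Rightarrow>
   (real \<Rightarrow> real ^ 'n \<Rightarrow> real ^ 'n \<Rightarrow> real) \<Rightarrow> bool" where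
  "viscosity_subsolution H0 \<sigma> l T F h U \<longleftrightarrow>
     continuous_on ({0<..T} \<times> prob_simplex_int \<times> UNIV) (\<lambda>(t, \<rho>, x). U t \<rho> x) \<and>
     (\<forall>\<rho>\<in>prob_simplex_int. \<forall>x. U T \<rho> x \<le> h \<rho> x) \<and>
     (\<forall>\<phi>. C112_on T \<phi> \<longrightarrow>
        (\<forall>t0\<in>{0<..<T}. \<forall>\<rho>0\<in>prob_simplex_int. \<forall>x0.
           (\<forall>\<^sub>F (t, \<rho>, x) in at (t0, \<rho>0, x0) within {0<..<T} \<times> prob_simplex_int \<times> UNIV.
              U t \<rho> x - \<phi> t \<rho> x \<le> U t0 \<rho>0 x0 - \<phi> t0 \<rho>0 x0) \<longrightarrow>
           0 \<le> viscosity_operator H0 \<sigma> l F \<phi> t0 \<rho>0 x0))"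

definition viscosity_supersolution ::
  "(real ^ 'n::finite \<Rightarrow> real ^ 'n \<Rightarrow> real) \<Rightarrow> real ^ 'n ^ 'n \<Rightarrow> real \<Rightarrow> real \<Rightarrow>
   (real \<Rightarrow> real ^ 'n \<Rightarrow> real ^ 'n \<Rightarrow> real ^ 'n \<Rightarrow> real) \<Rightarrow> (real ^ 'n \<Rightarrow> real ^ 'n \<Rightarrow> real) \<Rightarrow>
   (real \<Rightarrow> real ^ 'n \<Rightarrow> real ^ 'n \<Rightarrow> real) \<Rightarrow> bool" where
  "viscosity_supersolution H0 \<sigma> l T F h U \<longleftrightarrow>
     continuous_on ({0<..T} \<times> prob_simplex_int \<times> UNIV) (\<lambda>(t, \<rho>, x). U t \<rho> x) \<and>
     (\<forall>\<rho>\<in>prob_simplex_int. \<forall>x. h \<rho> x \<le> U T \<rho> x) \<and>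
     (\<forall>\<phi>. C112_on T \<phi> \<longrightarrow>
        (\<forall>t0\<in>{0<..<T}. \<forall>\<rho>0\<in>prob_simplex_int. \<forall>x0.
           (\<forall>\<^sub>F (t, \<rho>, x) in at (t0, \<rho>0, x0) within {0<..<T} \<times> prob_simplex_int \<times> UNIV.
              U t0 \<rho>0 x0 - \<phi> t0 \<rho>0 x0 \<le> U t \<rho> x - \<phi> t \<rho> x) \<longrightarrow>
           viscosity_operator H0 \<sigma> l F \<phi> t0 \<rho>0 x0 \<le> 0))"

definition viscosity_solution ::
  "(real ^ 'n::finite \<Rightarrow> real ^ 'n \<Rightarrow> real) \<Rightarrow> real ^ 'n ^ 'n \<Rightarrow> real \<Rightarrow> real \<Rightarrow>
   (real \<Rightarrow> real ^ 'n \<Rightarrow> real ^ 'n \<Rightarrow> real ^ 'n \<Rightarrow> real) \<Rightarrow> (real ^ 'n \<Rightarrow> real ^ 'n \<Rightarrow> real) \<Rightarrow>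
   (real \<Rightarrow> real ^ 'n \<Rightarrow> real ^ 'n \<Rightarrow> real) \<Rightarrow> bool" where
  "viscosity_solution H0 \<sigma> l T F h U \<longleftrightarrow>
     viscosity_subsolution H0 \<sigma> l T F h U \<and> viscosity_supersolution H0 \<sigma> l T F h U"

definition bounded_viscosity_solution ::
  "(real ^ 'n::finite \<Rightarrow> real ^ 'n \<Rightarrow> real) \<Rightarrow> real ^ 'n ^ 'n \<Rightarrow> real \<Rightarrow> real \<Rightarrow>
   (real \<Rightarrow> real ^ 'n \<Rightarrow> real ^ 'n \<Rightarrow> real ^ 'n \<Rightarrow> real) \<Rightarrow> (real ^ 'n \<Rightarrow> real ^ 'n \<Rightarrow> real) \<Rightarrow>
   (real \<Rightarrow> real ^ 'n \<Rightarrow> real ^ 'n \<Rightarrow> real) \<Rightarrow> bool" where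
  "bounded_viscosity_solution H0 \<sigma> l T F h U \<longleftrightarrow>
     viscosity_solution H0 \<sigma> l T F h U \<and>
     (\<exists>M. \<forall>t\<in>{0<..T}. \<forall>\<rho>\<in>prob_simplex_int. \<forall>x. \<bar>U t \<rho> x\<bar> \<le> M)"

end

theory Submission
  imports Defs
begin

text \<open>
 On the region where a penalty \<open>\<epsilon> * G\<close> built from the Lyapunov function \<open>H0\<close> is bounded, the drift is
 Lipschitz and can be extended to the whole space. For the extended equation a monotone
 semi-discrete scheme with piecewise constant controls, mollified in space and averaged in time,
 yields a smooth function \<open>W\<close> that is a subsolution up to \<open>\<epsilon>\<close> and that lies, up to \<open>\<epsilon>\<close>, above every
 function which satisfies the comparison principle against smooth supersolutions of the linear
 equations with one frozen control. The maximum principle gives this property for viscosity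
 subsolutions minus the penalty, because the penalty is a strict supersolution of all these linear
 equations. Hence bounded subsolutions are at most \<open>W + \<epsilon> * G\<close>, bounded supersolutions are at least
 \<open>W - \<epsilon> * G\<close>, and the positive part of \<open>W - \<epsilon> * G\<close> is itself a subsolution. Comparison follows
 without doubling of variables, and the supremum of all bounded subsolutions is a locally uniform
 limit of the functions \<open>W\<close>; so it is continuous, and Perron's method shows that it is a solution.
\<close>


subsection \<open>Poisson averages\<close>

text \<open>Doubling of variables would need the second order theory of jets of nonsmooth functions.
  Here one of the two functions compared always has an expansion of second order, so the elementary
  maximum principle is enough. No classical solution is at hand, since the noise acts in
  \<open>x\<close> only and may degenerate; hence the detour through a scheme. Three features make
  it work. The number of steps is Poisson distributed, so the scheme satisfies an exact differential
  equation in time. Its Lipschitz constants are uniform in the step \<open>d\<close>, so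
  mollification at scale \<open>\<delta>\<close> commutes with one step up to order
  \<open>d * \<delta>\<close>, which leaves order \<open>\<delta>\<close> after division by
  \<open>d\<close>. A subsolution of the full equation is one for every single control, so on a grid
  interval it is compared with a linear evolution, and the infimum over controls is taken only at
  grid times. Two mollification scales occur: the one used for comparison is paid once per grid
  interval and is chosen after their number, the one in \<open>W\<close> is fixed at the
  start.\<close>

definition exp_bounded :: "(nat \<Rightarrow> real) \<Rightarrow> bool" where
 "exp_bounded a \<longleftrightarrow> (\<exists>C c. \<forall>k. \<bar>a k\<bar> \<le> C * c ^ k)"

text \<open>The expectation of \<open>a\<close> at a Poisson variable with mean \<open>x\<close>, as
  a power series in a real \<open>x\<close>, so that it can be differentiated in the mean.\<close>

definition poisson_mean :: "real \<Rightarrow> (nat \<Rightarrow> real) \<Rightarrow> real" where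
 "poisson_mean x a = exp (- x) * (\<Sum>k. a k / fact k * x ^ k)"

lemma exp_bounded_summable:
 assumes "exp_bounded a"
 shows "summable (\<lambda>k. a k / fact k * x ^ k)"
proof -
 obtain C c where c: "\<And>k. \<bar>a k\<bar> \<le> C * c ^ k"
  using assms by (auto simp: exp_bounded_def)
 have "summable (\<lambda>k. C * (inverse (fact k) * (\<bar>c\<bar> * \<bar>x\<bar>) ^ k))"
  by (intro summable_mult summable_exp)
 moreover have "norm (a k / fact k * x ^ k) \<le> C * (inverse (fact k) * (\<bar>c\<bar> * \<bar>x\<bar>) ^ k)" for k
 proof -
  have C: "C \<ge> 0" using c[of 0] by simp
  have "C * c ^ k \<le> C * \<bar>c\<bar> ^ k"
   using mult_left_mono[OF abs_ge_self[of "c ^ k"] C] by (simp only: power_abs)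
  then have "\<bar>a k\<bar> \<le> C * \<bar>c\<bar> ^ k"
   using c[of k] by linarith
  then have "\<bar>a k\<bar> * (inverse (fact k) * \<bar>x\<bar> ^ k) \<le> C * \<bar>c\<bar> ^ k * (inverse (fact k) * \<bar>x\<bar> ^ k)"
   by (intro mult_right_mono) auto
  moreover have "norm (a k / fact k * x ^ k) = \<bar>a k\<bar> * (inverse (fact k) * \<bar>x\<bar> ^ k)"
   by (simp add: abs_mult power_abs divide_inverse)
  moreover have "C * \<bar>c\<bar> ^ k * (inverse (fact k) * \<bar>x\<bar> ^ k) = C * (inverse (fact k) * (\<bar>c\<bar> * \<bar>x\<bar>) ^ k)"
   unfolding power_mult_distrib by simp
  ultimately show ?thesis by linarith
 qed
 ultimately show ?thesis
  by (rule summable_comparison_test'[where N=0])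
qed

lemma exp_bounded_shift: "exp_bounded a \<Longrightarrow> exp_bounded (\<lambda>k. a (Suc k))"
 unfolding exp_bounded_def
proof safe
 fix C c assume "\<forall>k. \<bar>a k\<bar> \<le> C * c ^ k"
 then have "\<forall>k. \<bar>a (Suc k)\<bar> \<le> (C * c) * c ^ k"
  by (auto simp: mult.assoc simp flip: power_Suc)
 then show "\<exists>C c. \<forall>k. \<bar>a (Suc k)\<bar> \<le> C * c ^ k" by blast
qed

lemma exp_bounded_add: "exp_bounded a \<Longrightarrow> exp_bounded b \<Longrightarrow> exp_bounded (\<lambda>k. a k + b k)"
 unfolding exp_bounded_def
proof safe
 fix C c D d assume a: "\<forall>k. \<bar>a k\<bar> \<le> C * c ^ k" and b: "\<forall>k. \<bar>b k\<bar> \<le> D * d ^ k"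
 have C: "C \<ge> 0" "D \<ge> 0" using spec[OF a, of 0] spec[OF b, of 0] by auto
 have "\<bar>a k + b k\<bar> \<le> (C + D) * (max \<bar>c\<bar> \<bar>d\<bar>) ^ k" for k
 proof -
  have "c ^ k \<le> (max \<bar>c\<bar> \<bar>d\<bar>) ^ k" "d ^ k \<le> (max \<bar>c\<bar> \<bar>d\<bar>) ^ k"
   using abs_ge_self[of "c ^ k"] abs_ge_self[of "d ^ k"]
    power_mono[of "\<bar>c\<bar>" "max \<bar>c\<bar> \<bar>d\<bar>" k] power_mono[of "\<bar>d\<bar>" "max \<bar>c\<bar> \<bar>d\<bar>" k]
   by (auto simp: power_abs)
  then have "C * c ^ k \<le> C * (max \<bar>c\<bar> \<bar>d\<bar>) ^ k" "D * d ^ k \<le> D * (max \<bar>c\<bar> \<bar>d\<bar>) ^ k"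
   using C by (auto intro: mult_left_mono)
  then show ?thesis using spec[OF a, of k] spec[OF b, of k] abs_triangle_ineq[of "a k" "b k"] by (simp add: algebra_simps)
 qed
 then show "\<exists>C c. \<forall>k. \<bar>a k + b k\<bar> \<le> C * c ^ k" by blast
qed

lemma exp_bounded_cmult: "exp_bounded a \<Longrightarrow> exp_bounded (\<lambda>k. r * a k)"
 unfolding exp_bounded_def
proof safe
 fix C c assume "\<forall>k. \<bar>a k\<bar> \<le> C * c ^ k"
 then have "\<forall>k. \<bar>r * a k\<bar> \<le> (\<bar>r\<bar> * C) * c ^ k"
  by (auto simp: abs_mult mult.assoc intro: mult_left_mono)
 then show "\<exists>C c. \<forall>k. \<bar>r * a k\<bar> \<le> C * c ^ k" by blast
qed

lemma exp_bounded_const: "exp_bounded (\<lambda>k. c)"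
 unfolding exp_bounded_def by (intro exI[of _ "\<bar>c\<bar>"] exI[of _ 1]) auto

lemma exp_bounded_power: "exp_bounded (\<lambda>k. c ^ k)"
 unfolding exp_bounded_def by (intro exI[of _ 1] exI[of _ "\<bar>c\<bar>"]) (auto simp: power_abs)

lemma exp_bounded_diff: "exp_bounded a \<Longrightarrow> exp_bounded b \<Longrightarrow> exp_bounded (\<lambda>k. a k - b k)"
 using exp_bounded_add[of a "\<lambda>k. -1 * b k"] exp_bounded_cmult[of b "-1"] by simp

lemma exp_bounded_of_nat: "exp_bounded real"
 unfolding exp_bounded_def
 by (intro exI[of _ 1] exI[of _ 2])
   (auto simp: of_nat_less_two_power less_imp_le)

lemma poisson_mean_0 [simp]: "poisson_mean 0 a = a 0"
 unfolding poisson_mean_def using powser_zero[of "\<lambda>k. a k / fact k"] by simp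

lemma poisson_mean_add:
 assumes "exp_bounded a" "exp_bounded b"
 shows "poisson_mean x (\<lambda>k. a k + b k) = poisson_mean x a + poisson_mean x b"
 unfolding poisson_mean_def distrib_left[symmetric]
  suminf_add[OF exp_bounded_summable[OF assms(1), of x] exp_bounded_summable[OF assms(2), of x]]
 by (simp add: add_divide_distrib distrib_right)

lemma poisson_mean_cmult:
 assumes "exp_bounded a"
 shows "poisson_mean x (\<lambda>k. r * a k) = r * poisson_mean x a"
 unfolding poisson_mean_def
 using suminf_mult[OF exp_bounded_summable[OF assms, of x], of r]
 by (simp add: algebra_simps)

lemma poisson_mean_diff:
 assumes "exp_bounded a" "exp_bounded b"
 shows "poisson_mean x (\<lambda>k. a k - b k) = poisson_mean x a - poisson_mean x b"
 using poisson_mean_add[OF assms(1) exp_bounded_cmult[OF assms(2)], of x "-1"]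
  poisson_mean_cmult[OF assms(2), of x "-1"] by simp

text \<open>This is the probability generating function of the Poisson law.\<close>

lemma poisson_mean_power: "poisson_mean x (\<lambda>k. c ^ k) = exp (x * (c - 1))"
proof -
 have "(\<Sum>k. c ^ k / fact k * x ^ k) = exp (c * x)"
  unfolding exp_def by (simp add: power_mult_distrib field_simps)
 then show ?thesis unfolding poisson_mean_def by (simp add: exp_add[symmetric] algebra_simps)
qed

lemma poisson_mean_const [simp]: "poisson_mean x (\<lambda>k. c) = c"
 using poisson_mean_cmult[OF exp_bounded_power[of 1], of x c] poisson_mean_power[of x 1] by simp

lemma poisson_mean_mono:
 assumes "exp_bounded a" "exp_bounded b" "0 \<le> x" "\<And>k. a k \<le> b k"
 shows "poisson_mean x a \<le> poisson_mean x b"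
 unfolding poisson_mean_def
 by (intro mult_left_mono suminf_le mult_right_mono divide_right_mono
    exp_bounded_summable assms) (use assms in auto)

lemma poisson_mean_abs_le:
 assumes "exp_bounded a" "exp_bounded b" "0 \<le> x" "\<And>k. \<bar>a k\<bar> \<le> b k"
 shows "\<bar>poisson_mean x a\<bar> \<le> poisson_mean x b"
 using poisson_mean_mono[OF assms(1,2,3)] poisson_mean_mono[OF exp_bounded_cmult[OF assms(1), of "-1"] assms(2,3)]
  poisson_mean_cmult[OF assms(1), of x "-1"] assms(4)
 by (fastforce simp: abs_le_iff)

lemma poisson_mean_sum:
 assumes "finite I" "\<And>i. i \<in> I \<Longrightarrow> exp_bounded (a i)"
 shows "exp_bounded (\<lambda>k. \<Sum>i\<in>I. a i k) \<and>
  poisson_mean x (\<lambda>k. \<Sum>i\<in>I. a i k) = (\<Sum>i\<in>I. poisson_mean x (a i))"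
 using assms
 by (induction I) (auto simp: exp_bounded_const exp_bounded_add poisson_mean_add)

text \<open>The generator of the Poisson process is the forward difference: termwise differentiation
  shifts the coefficients, and the factor \<open>exp (- x)\<close> contributes the negative
  term.\<close>

lemma poisson_mean_deriv:
 assumes "exp_bounded a"
 shows "((\<lambda>x. poisson_mean x a) has_real_derivative
  poisson_mean x (\<lambda>k. a (Suc k)) - poisson_mean x a) (at x)"
proof -
 let ?c = "\<lambda>k. a k / fact k"
 have *: "DERIV (\<lambda>x. \<Sum>n. ?c n * x ^ n) x :> (\<Sum>n. diffs ?c n * x ^ n)"
  by (intro termdiffs_strong_converges_everywhere exp_bounded_summable assms)
 have "diffs ?c = (\<lambda>k. a (Suc k) / fact k)"
  unfolding diffs_def by (simp add: fun_eq_iff fact_Suc del: of_nat_Suc)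
 with * have "DERIV (\<lambda>x. \<Sum>n. ?c n * x ^ n) x :> (\<Sum>n. a (Suc n) / fact n * x ^ n)" by simp
 then show ?thesis
  unfolding poisson_mean_def
  by (auto intro!: derivative_eq_intros simp: algebra_simps)
qed

text \<open>The second derivative in the mean is the Poisson mean of second differences, which are
  at most \<open>2 * c\<close>; two applications of the mean value inequality give the remainder. It
  is explicit because it has to be uniform when \<open>a\<close> depends on a point in
  space.\<close>

lemma poisson_mean_quadratic:
 assumes a: "exp_bounded a" and x: "0 \<le> x" and y: "0 \<le> y"
  and c: "\<And>k. \<bar>a (Suc k) - a k\<bar> \<le> c"
 shows "\<bar>poisson_mean y a - poisson_mean x a - (y - x) * (poisson_mean x (\<lambda>k. a (Suc k)) - poisson_mean x a)\<bar>
  \<le> 2 * c * (y - x)\<^sup>2"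
proof -
 define a1 where "a1 k = a (Suc k) - a k" for k
 have e1: "exp_bounded a1" unfolding a1_def
  using a exp_bounded_shift exp_bounded_diff by blast
 have d0: "((\<lambda>x. poisson_mean x a) has_real_derivative poisson_mean x a1) (at x)" for x
  using poisson_mean_deriv[OF a, of x] poisson_mean_diff[OF exp_bounded_shift[OF a] a]
  unfolding a1_def by simp
 have d1: "((\<lambda>x. poisson_mean x a1) has_real_derivative poisson_mean x (\<lambda>k. a1 (Suc k) - a1 k)) (at x)" for x
  using poisson_mean_deriv[OF e1, of x] poisson_mean_diff[OF exp_bounded_shift[OF e1] e1] by simp
 have b: "\<bar>poisson_mean u (\<lambda>k. a1 (Suc k) - a1 k)\<bar> \<le> 2 * c" if "u \<ge> 0" for u
 proof -
  have "\<bar>a1 (Suc k) - a1 k\<bar> \<le> 2 * c" for k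
   using c[of k] c[of "Suc k"] unfolding a1_def by linarith
  then have "\<bar>poisson_mean u (\<lambda>k. a1 (Suc k) - a1 k)\<bar> \<le> poisson_mean u (\<lambda>k. 2 * c)"
   by (rule poisson_mean_abs_le[OF exp_bounded_diff[OF exp_bounded_shift[OF e1] e1] exp_bounded_const that])
  then show ?thesis by simp
 qed
 let ?S = "closed_segment x y"
 have pos: "u \<ge> 0" if "u \<in> ?S" for u using that x y by (auto simp: closed_segment_eq_real_ivl split: if_splits)
 have lip: "\<bar>poisson_mean u a1 - poisson_mean x a1\<bar> \<le> 2 * c * \<bar>u - x\<bar>" if "u \<in> ?S" for u
 proof -
  have "norm (poisson_mean u a1 - poisson_mean x a1) \<le> 2 * c * norm (u - x)"
   by (rule field_differentiable_bound[of ?S _ "\<lambda>u. poisson_mean u (\<lambda>k. a1 (Suc k) - a1 k)"])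
     (use that b pos in \<open>auto intro!: has_field_derivative_at_within[OF d1]\<close>)
  then show ?thesis by simp
 qed
 have c0: "c \<ge> 0" using c[of 0] by simp
 let ?g = "\<lambda>u. poisson_mean u a - (u - x) * poisson_mean x a1"
 have dg: "(?g has_real_derivative poisson_mean u a1 - poisson_mean x a1) (at u within ?S)" for u
  by (rule has_field_derivative_at_within) (auto intro!: derivative_eq_intros d0)
 have gb: "norm (poisson_mean u a1 - poisson_mean x a1) \<le> 2 * c * \<bar>y - x\<bar>" if "u \<in> ?S" for u
 proof -
  have "\<bar>u - x\<bar> \<le> \<bar>y - x\<bar>" using that by (auto simp: closed_segment_eq_real_ivl split: if_splits)
  then show ?thesis using lip[OF that] c0
   by (smt (verit) mult_left_mono real_norm_def)
 qed
 have "norm (?g y - ?g x) \<le> 2 * c * \<bar>y - x\<bar> * norm (y - x)"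
  using field_differentiable_bound[OF convex_closed_segment, of x y ?g "\<lambda>u. poisson_mean u a1 - poisson_mean x a1"
    "2 * c * \<bar>y - x\<bar>" y x, OF dg gb] by simp
 then show ?thesis
  using poisson_mean_diff[OF exp_bounded_shift[OF a] a, of x]
  by (simp add: a1_def[abs_def] power2_eq_square algebra_simps flip: abs_mult)
qed

subsection \<open>A semi-discrete scheme for one control\<close>

text \<open>One step of a random walk with running cost: the drift \<open>d *\<^sub>R b z\<close>,
  then a jump along plus or minus \<open>\<sigma> i\<close> with uniformly chosen \<open>i\<close>
  and sign. The length \<open>sqrt (CARD('i) * d)\<close> compensates the probability
  \<open>1 / CARD('i)\<close> of a direction, so that the jump contributes \<open>d / 2\<close>
  times the sum of the second derivatives along the \<open>\<sigma> i\<close>.\<close>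

definition stp :: "('i::finite \<Rightarrow> 'a::real_normed_vector) \<Rightarrow> real \<Rightarrow> ('a \<Rightarrow> 'a) \<Rightarrow> ('a \<Rightarrow> real) \<Rightarrow>
  ('a \<Rightarrow> real) \<Rightarrow> 'a \<Rightarrow> real" where
 "stp \<sigma> d b g \<phi> z =
   (\<Sum>i\<in>UNIV. \<phi> (z + d *\<^sub>R b z + sqrt (real CARD('i) * d) *\<^sub>R \<sigma> i)
       + \<phi> (z + d *\<^sub>R b z - sqrt (real CARD('i) * d) *\<^sub>R \<sigma> i)) / (2 * real CARD('i)) + d * g z"

text \<open>The same walk with a Poisson number of steps of mean \<open>r / d\<close>. Unlike an
  iterate with a fixed number of steps, it is differentiable in the elapsed time
  \<open>r\<close>.\<close>

definition ev :: "('i::finite \<Rightarrow> 'a::real_normed_vector) \<Rightarrow> real \<Rightarrow> ('a \<Rightarrow> 'a) \<Rightarrow> ('a \<Rightarrow> real) \<Rightarrow>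
  real \<Rightarrow> ('a \<Rightarrow> real) \<Rightarrow> 'a \<Rightarrow> real" where
 "ev \<sigma> d b g r \<phi> z = poisson_mean (r / d) (\<lambda>k. (stp \<sigma> d b g ^^ k) \<phi> z)"

lemma stp_mono:
 assumes "\<And>y. \<phi> y \<le> \<psi> y"
 shows "stp \<sigma> d b g \<phi> z \<le> stp \<sigma> d b g \<psi> z"
 unfolding stp_def using assms
 by (intro add_mono divide_right_mono sum_mono) auto

lemma stp_add_const: "stp \<sigma> d b g (\<lambda>y. \<phi> y + c) z = stp \<sigma> d b g \<phi> z + c"
 for \<sigma> :: "'i::finite \<Rightarrow> 'a::real_normed_vector"
proof -
 have "real CARD('i) \<noteq> 0" by simp
 then show ?thesis
  unfolding stp_def by (simp add: sum.distrib add_divide_distrib)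
qed

lemma stp_const_bounds:
 assumes "\<And>y. m \<le> \<phi> y" "\<And>y. \<phi> y \<le> M" "0 \<le> g z" "g z \<le> B" "0 \<le> d"
 shows "m \<le> stp \<sigma> d b g \<phi> z" "stp \<sigma> d b g \<phi> z \<le> M + d * B"
proof -
 have e: "stp \<sigma> d b g (\<lambda>y. 0) z = d * g z" by (simp add: stp_def)
 have "stp \<sigma> d b g (\<lambda>y. 0 + m) z \<le> stp \<sigma> d b g \<phi> z" "stp \<sigma> d b g \<phi> z \<le> stp \<sigma> d b g (\<lambda>y. 0 + M) z"
  using assms by (intro stp_mono; simp)+
 then have *: "d * g z + m \<le> stp \<sigma> d b g \<phi> z" "stp \<sigma> d b g \<phi> z \<le> d * g z + M"
  unfolding stp_add_const e by auto
 have "0 \<le> d * g z" "d * g z \<le> d * B" using assms by (auto intro: mult_left_mono)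
 with * show "m \<le> stp \<sigma> d b g \<phi> z" "stp \<sigma> d b g \<phi> z \<le> M + d * B" by linarith+
qed

text \<open>Monotonicity and commutation with constants force nonexpansiveness in the supremum
  norm.\<close>

lemma stp_dist:
 assumes "\<And>y. \<bar>\<phi> y - \<psi> y\<bar> \<le> c"
 shows "\<bar>stp \<sigma> d b g \<phi> z - stp \<sigma> d b g \<psi> z\<bar> \<le> c"
proof -
 have "\<phi> y \<le> \<psi> y + c" "\<psi> y \<le> \<phi> y + c" for y using assms[of y] by linarith+
 then have "stp \<sigma> d b g \<phi> z \<le> stp \<sigma> d b g (\<lambda>y. \<psi> y + c) z" "stp \<sigma> d b g \<psi> z \<le> stp \<sigma> d b g (\<lambda>y. \<phi> y + c) z"
  by (intro stp_mono; blast)+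
 then show ?thesis unfolding stp_add_const by linarith
qed

definition lip :: "real \<Rightarrow> ('a::real_normed_vector \<Rightarrow> real) \<Rightarrow> bool" where
 "lip L \<phi> \<longleftrightarrow> (\<forall>y z. \<bar>\<phi> y - \<phi> z\<bar> \<le> L * norm (y - z))"

lemma lipD: "lip L \<phi> \<Longrightarrow> \<bar>\<phi> y - \<phi> z\<bar> \<le> L * norm (y - z)"
 unfolding lip_def by blast

lemma lip_nonneg: "lip L (\<phi> :: 'a::euclidean_space \<Rightarrow> real) \<Longrightarrow> 0 \<le> L"
proof -
 assume l: "lip L \<phi>"
 obtain u :: 'a where "u \<in> Basis" using nonempty_Basis by blast
 with lipD[OF l, of u 0] show "0 \<le> L" by simp
qed

lemma lip_mono: "lip L \<phi> \<Longrightarrow> L \<le> L' \<Longrightarrow> lip L' \<phi>"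
 unfolding lip_def by (meson mult_right_mono norm_ge_zero order_trans)

lemma lip_continuous: "lip L \<phi> \<Longrightarrow> continuous_on S \<phi>"
proof -
 assume l: "lip L \<phi>"
 then have "lip (max L 0) \<phi>" by (rule lip_mono) simp
 then have "(max L 0)-lipschitz_on UNIV \<phi>"
  by (intro lipschitz_onI) (auto simp: lip_def dist_norm)
 then show ?thesis using lipschitz_on_continuous_on continuous_on_subset by blast
qed

text \<open>In terms of \<open>\<Lambda> + 1\<close> the new constant is a mere multiple by
  \<open>1 + d * L\<close>, which explains the shape \<open>c * (\<Lambda> + 1) - 1\<close> of the
  later bounds.\<close>

lemma stp_lip:
 fixes \<sigma> :: "'i::finite \<Rightarrow> 'a::real_normed_vector" and \<phi> g :: "'a \<Rightarrow> real" and b :: "'a \<Rightarrow> 'a"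
 assumes \<phi>: "lip \<Lambda> \<phi>" and b: "\<And>y z. norm (b y - b z) \<le> L * norm (y - z)"
  and g: "lip L g" and d: "0 \<le> d" and \<Lambda>: "0 \<le> \<Lambda>"
 shows "lip ((1 + d * L) * \<Lambda> + d * L) (stp \<sigma> d b g \<phi>)"
 unfolding lip_def
proof safe
 fix y z :: 'a
 let ?n = "real CARD('i)"
 define N where "N = norm (y - z)"
 have s: "\<bar>\<phi> (y + d *\<^sub>R b y + w) - \<phi> (z + d *\<^sub>R b z + w)\<bar> \<le> \<Lambda> * ((1 + d * L) * N)" for w
 proof -
  have "norm ((y + d *\<^sub>R b y + w) - (z + d *\<^sub>R b z + w)) = norm ((y - z) + d *\<^sub>R (b y - b z))"
   by (simp add: algebra_simps)
  also have "\<dots> \<le> norm (y - z) + d * norm (b y - b z)"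
   using norm_triangle_ineq[of "y - z" "d *\<^sub>R (b y - b z)"] d by simp
  also have "\<dots> \<le> N + d * (L * N)"
   unfolding N_def using b d by (intro add_mono mult_left_mono) auto
  finally have "norm ((y + d *\<^sub>R b y + w) - (z + d *\<^sub>R b z + w)) \<le> (1 + d * L) * N"
   by (simp add: algebra_simps)
  then show ?thesis using lipD[OF \<phi>] \<Lambda> by (meson mult_left_mono order_trans)
 qed
 let ?S = "\<lambda>y. \<Sum>i\<in>(UNIV::'i set). \<phi> (y + d *\<^sub>R b y + sqrt (?n * d) *\<^sub>R \<sigma> i) + \<phi> (y + d *\<^sub>R b y - sqrt (?n * d) *\<^sub>R \<sigma> i)"
 have "\<bar>?S y - ?S z\<bar> \<le> (\<Sum>i\<in>(UNIV::'i set). 2 * (\<Lambda> * ((1 + d * L) * N)))"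
  unfolding sum_subtractf[symmetric]
 proof (rule order_trans[OF sum_abs sum_mono])
  fix i
  show "\<bar>\<phi> (y + d *\<^sub>R b y + sqrt (?n * d) *\<^sub>R \<sigma> i) + \<phi> (y + d *\<^sub>R b y - sqrt (?n * d) *\<^sub>R \<sigma> i) -
   (\<phi> (z + d *\<^sub>R b z + sqrt (?n * d) *\<^sub>R \<sigma> i) + \<phi> (z + d *\<^sub>R b z - sqrt (?n * d) *\<^sub>R \<sigma> i))\<bar>
   \<le> 2 * (\<Lambda> * ((1 + d * L) * N))"
   using s[of "sqrt (?n * d) *\<^sub>R \<sigma> i"] s[of "- (sqrt (?n * d) *\<^sub>R \<sigma> i)"] by simp
 qed
 also have "\<dots> = (2 * ?n) * (\<Lambda> * ((1 + d * L) * N))" by simp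
 finally have *: "\<bar>?S y - ?S z\<bar> / (2 * ?n) \<le> \<Lambda> * ((1 + d * L) * N)"
  by (simp add: divide_le_eq mult.commute)
 have "stp \<sigma> d b g \<phi> y - stp \<sigma> d b g \<phi> z = (?S y - ?S z) / (2 * ?n) + d * (g y - g z)"
  unfolding stp_def by (simp add: algebra_simps diff_divide_distrib)
 moreover have "\<bar>(?S y - ?S z) / (2 * ?n)\<bar> = \<bar>?S y - ?S z\<bar> / (2 * ?n)" by (simp add: abs_divide)
 moreover have "\<bar>d * (g y - g z)\<bar> \<le> d * (L * N)"
  unfolding N_def abs_mult using d lipD[OF g, of y z] by (simp add: mult_left_mono)
 ultimately have "\<bar>stp \<sigma> d b g \<phi> y - stp \<sigma> d b g \<phi> z\<bar> \<le> \<Lambda> * ((1 + d * L) * N) + d * (L * N)"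
  using * by linarith
 also have "\<dots> = ((1 + d * L) * \<Lambda> + d * L) * N" by (simp add: algebra_simps)
 finally show "\<bar>stp \<sigma> d b g \<phi> y - stp \<sigma> d b g \<phi> z\<bar> \<le> ((1 + d * L) * \<Lambda> + d * L) * norm (y - z)"
  unfolding N_def .
qed

text \<open>The derivative in the mean is 1 and the value at 0 is 0. This turns a cost of at most
  \<open>d * B\<close> per step into at most \<open>r * B\<close> over time
  \<open>r\<close>.\<close>

lemma poisson_mean_of_nat: "poisson_mean x real = x"
proof -
 have "((\<lambda>x. poisson_mean x real) has_real_derivative 1) (at x)" for x
  using poisson_mean_deriv[OF exp_bounded_of_nat, of x]
   poisson_mean_add[OF exp_bounded_const[of 1] exp_bounded_of_nat, of x] by simp
 then have "((\<lambda>x. poisson_mean x real - x) has_real_derivative 0) (at x)" for x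
  by (auto intro!: derivative_eq_intros)
 then have "poisson_mean x real - x = poisson_mean 0 real - 0"
  by (intro DERIV_isconst_all[of "\<lambda>x. poisson_mean x real - x"]) auto
 then show ?thesis by simp
qed

locale one_control =
 fixes \<sigma> :: "'i::finite \<Rightarrow> 'a::euclidean_space" and d :: real and b :: "'a \<Rightarrow> 'a" and g :: "'a \<Rightarrow> real"
  and L B :: real
 assumes d_pos: "0 < d" and L_ge: "1 \<le> L" and B_nonneg: "0 \<le> B"
  and b_lip: "\<And>y z. norm (b y - b z) \<le> L * norm (y - z)"
  and g_lip: "lip L g"
  and g_bounds: "\<And>z. 0 \<le> g z" "\<And>z. g z \<le> B"
begin

abbreviation S :: "('a \<Rightarrow> real) \<Rightarrow> 'a \<Rightarrow> real" where "S \<equiv> stp \<sigma> d b g"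
abbreviation P :: "real \<Rightarrow> ('a \<Rightarrow> real) \<Rightarrow> 'a \<Rightarrow> real" where "P \<equiv> ev \<sigma> d b g"

lemma iter_lip:
 assumes "lip \<Lambda> \<phi>"
 shows "lip ((1 + d * L) ^ k * (\<Lambda> + 1) - 1) ((S ^^ k) \<phi>)"
proof (induction k)
 case 0 then show ?case using assms by simp
next
 case (Suc k)
 have "1 \<le> (1 + d * L) ^ k" using d_pos L_ge by (intro one_le_power) simp
 then have "1 * 1 \<le> (1 + d * L) ^ k * (\<Lambda> + 1)"
  using lip_nonneg[OF assms] by (intro mult_mono) auto
 then have "lip ((1 + d * L) * ((1 + d * L) ^ k * (\<Lambda> + 1) - 1) + d * L) ((S ^^ Suc k) \<phi>)"
  using stp_lip[OF Suc b_lip g_lip, of d \<sigma>] d_pos by simp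
 then show ?case by (simp add: algebra_simps)
qed

lemma iter_bounds:
 assumes "\<And>y. 0 \<le> \<phi> y" "\<And>y. \<phi> y \<le> M"
 shows "0 \<le> (S ^^ k) \<phi> z \<and> (S ^^ k) \<phi> z \<le> M + k * (d * B)"
proof (induction k arbitrary: z)
 case (Suc k)
 have b: "0 \<le> g z" "g z \<le> B" "0 \<le> d" using g_bounds d_pos by auto
 have "0 \<le> S ((S ^^ k) \<phi>) z" "S ((S ^^ k) \<phi>) z \<le> M + k * (d * B) + d * B"
  using stp_const_bounds[where m=0 and \<phi>="(S ^^ k) \<phi>" and M="M + k * (d * B)" and \<sigma>=\<sigma> and b=b and g=g and B=B
    and d=d and z=z] Suc b by simp_all
 then show ?case by (simp add: algebra_simps)
qed (use assms in auto)

lemma iter_exp_bounded: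
 assumes "\<And>y. 0 \<le> \<phi> y" "\<And>y. \<phi> y \<le> M"
 shows "exp_bounded (\<lambda>k. (S ^^ k) \<phi> z)"
proof -
 have "exp_bounded (\<lambda>k. M + (d * B) * k)"
  by (intro exp_bounded_add exp_bounded_const exp_bounded_cmult exp_bounded_of_nat)
 then obtain C c where "\<And>k. \<bar>M + (d * B) * real k\<bar> \<le> C * c ^ k" unfolding exp_bounded_def by blast
 moreover have "\<bar>(S ^^ k) \<phi> z\<bar> \<le> \<bar>M + (d * B) * real k\<bar>" for k
  using iter_bounds[of \<phi> M k z] assms by (simp add: mult.commute)
 ultimately show ?thesis unfolding exp_bounded_def by (meson order_trans)
qed

lemma P_0 [simp]: "P 0 \<phi> = \<phi>"
 unfolding ev_def by (simp add: fun_eq_iff)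

text \<open>The generating function replaces the factor \<open>(1 + d * L) ^ k\<close> of
  \<open>k\<close> steps by \<open>exp (r * L)\<close>, so the Lipschitz bound does not depend on
  the step \<open>d\<close>.\<close>

lemma P_lip:
 assumes "lip \<Lambda> \<phi>" "\<And>y. 0 \<le> \<phi> y" "\<And>y. \<phi> y \<le> M" "0 \<le> r"
 shows "lip (exp (r * L) * (\<Lambda> + 1) - 1) (P r \<phi>)"
 unfolding lip_def
proof safe
 fix y z :: 'a
 let ?N = "norm (y - z)"
 have p: "exp_bounded (\<lambda>k. (\<Lambda> + 1) * (1 + d * L) ^ k)" "exp_bounded (\<lambda>k. (\<Lambda> + 1) * (1 + d * L) ^ k - 1)"
  by (intro exp_bounded_cmult exp_bounded_power exp_bounded_diff exp_bounded_const)+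
 have "P r \<phi> y - P r \<phi> z = poisson_mean (r / d) (\<lambda>k. (S ^^ k) \<phi> y - (S ^^ k) \<phi> z)"
  unfolding ev_def by (simp add: poisson_mean_diff iter_exp_bounded[OF assms(2,3)])
 also have "\<bar>\<dots>\<bar> \<le> poisson_mean (r / d) (\<lambda>k. ?N * ((\<Lambda> + 1) * (1 + d * L) ^ k - 1))"
 proof (rule poisson_mean_abs_le)
  show "\<bar>(S ^^ k) \<phi> y - (S ^^ k) \<phi> z\<bar> \<le> ?N * ((\<Lambda> + 1) * (1 + d * L) ^ k - 1)" for k
   using lipD[OF iter_lip[OF assms(1)], of k y z] by (simp add: mult.commute)
  show "exp_bounded (\<lambda>k. (S ^^ k) \<phi> y - (S ^^ k) \<phi> z)"
   by (intro exp_bounded_diff iter_exp_bounded[OF assms(2,3)])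
 qed (use assms d_pos p in \<open>auto intro: exp_bounded_cmult\<close>)
 also have "\<dots> = ?N * ((\<Lambda> + 1) * poisson_mean (r / d) (\<lambda>k. (1 + d * L) ^ k) - 1)"
  unfolding poisson_mean_cmult[OF p(2)] poisson_mean_diff[OF p(1) exp_bounded_const]
   poisson_mean_cmult[OF exp_bounded_power] by simp
 also have "\<dots> = (exp (r * L) * (\<Lambda> + 1) - 1) * ?N"
  unfolding poisson_mean_power using d_pos by (simp add: mult.commute)
 finally show "\<bar>P r \<phi> y - P r \<phi> z\<bar> \<le> (exp (r * L) * (\<Lambda> + 1) - 1) * ?N" by simp
qed

lemma P_bounds:
 assumes "\<And>y. 0 \<le> \<phi> y" "\<And>y. \<phi> y \<le> M" "0 \<le> r"
 shows "0 \<le> P r \<phi> z" "P r \<phi> z \<le> M + r * B"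
proof -
 have e: "exp_bounded (\<lambda>k. d * B * real k)"
  by (intro exp_bounded_cmult exp_bounded_of_nat)
 have m: "poisson_mean (r / d) (\<lambda>k. M + d * B * real k) = M + r * B"
  using d_pos by (simp add: poisson_mean_add exp_bounded_const e poisson_mean_cmult[OF exp_bounded_of_nat]
    poisson_mean_of_nat)
 have x: "0 \<le> r / d" using assms(3) d_pos by simp
 have "poisson_mean (r / d) (\<lambda>k. 0) \<le> P r \<phi> z" "P r \<phi> z \<le> poisson_mean (r / d) (\<lambda>k. M + d * B * real k)"
  unfolding ev_def
  using iter_bounds[of \<phi> M _ z] assms
  by (intro poisson_mean_mono iter_exp_bounded[OF assms(1,2)] exp_bounded_const exp_bounded_add e x;
    simp add: mult.commute)+
 then show "0 \<le> P r \<phi> z" "P r \<phi> z \<le> M + r * B" unfolding m by simp_all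
qed

text \<open>A step is a finite average plus a term independent of \<open>\<phi>\<close>, so it may
  be taken inside the Poisson mean, where it shifts the index. Together with
  \<open>poisson_mean_deriv\<close> this is the evolution equation: the derivative of
  \<open>P r \<phi>\<close> in \<open>r\<close> is
  \<open>(S (P r \<phi>) - P r \<phi>) / d\<close>.\<close>

lemma S_P:
 assumes "\<And>y. 0 \<le> \<phi> y" "\<And>y. \<phi> y \<le> M"
 shows "S (P r \<phi>) z = poisson_mean (r / d) (\<lambda>k. (S ^^ Suc k) \<phi> z)"
proof -
 let ?x = "r / d" and ?n = "real CARD('i)"
 let ?p = "\<lambda>i. z + d *\<^sub>R b z + sqrt (?n * d) *\<^sub>R \<sigma> i" and ?m = "\<lambda>i. z + d *\<^sub>R b z - sqrt (?n * d) *\<^sub>R \<sigma> i"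
 let ?a = "\<lambda>i k. (S ^^ k) \<phi> (?p i) + (S ^^ k) \<phi> (?m i)"
 note eb = iter_exp_bounded[of \<phi> M, OF assms]
 have ea: "exp_bounded (?a i)" for i by (intro exp_bounded_add eb)
 have s: "exp_bounded (\<lambda>k. \<Sum>i\<in>UNIV. ?a i k)"
   "poisson_mean ?x (\<lambda>k. \<Sum>i\<in>UNIV. ?a i k) = (\<Sum>i\<in>UNIV. poisson_mean ?x (?a i))"
  using poisson_mean_sum[of UNIV ?a ?x] ea by auto
 have "poisson_mean ?x (\<lambda>k. (S ^^ Suc k) \<phi> z)
   = poisson_mean ?x (\<lambda>k. 1 / (2 * ?n) * (\<Sum>i\<in>UNIV. ?a i k) + d * g z)"
  by (simp add: stp_def[of \<sigma> d b g])
 also have "\<dots> = 1 / (2 * ?n) * (\<Sum>i\<in>UNIV. poisson_mean ?x (?a i)) + d * g z"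
  unfolding poisson_mean_add[OF exp_bounded_cmult[OF s(1)] exp_bounded_const] poisson_mean_cmult[OF s(1)] s(2)
  by simp
 also have "\<dots> = S (P r \<phi>) z"
  unfolding stp_def[of \<sigma> d b g "P r \<phi>"] ev_def poisson_mean_add[OF eb eb] by simp
 finally show ?thesis by simp
qed

text \<open>The evolution equation with a remainder that is uniform in \<open>z\<close>; the
  uniformity allows it to be mollified in space.\<close>

lemma P_time:
 assumes "\<And>y. 0 \<le> \<phi> y" "\<And>y. \<phi> y \<le> M" "0 \<le> r" "0 \<le> r'"
 shows "\<bar>P r' \<phi> z - P r \<phi> z - (r' - r) * ((S (P r \<phi>) z - P r \<phi> z) / d)\<bar>
  \<le> 2 * (M + d * B) / d\<^sup>2 * (r' - r)\<^sup>2"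
proof -
 let ?a = "\<lambda>k. (S ^^ k) \<phi> z"
 \<comment> \<open>The bounds on \<open>\<phi>\<close> and on one step control the first increment,
   and nonexpansiveness of the step hands the bound on to all later ones.\<close>
 have 1: "\<bar>(S ^^ Suc k) \<phi> y - (S ^^ k) \<phi> y\<bar> \<le> M + d * B" for k y
 proof (induction k arbitrary: y)
  case 0
  have "0 \<le> S \<phi> y \<and> S \<phi> y \<le> M + d * B" using iter_bounds[of \<phi> M 1 y] assms(1,2) by simp
  moreover have "0 \<le> d * B" using d_pos B_nonneg by simp
  ultimately have "\<bar>S \<phi> y - \<phi> y\<bar> \<le> M + d * B" using assms(1)[of y] assms(2)[of y] by linarith
  then show ?case by simp
 next
  case (Suc k) then show ?case using stp_dist[of "(S ^^ Suc k) \<phi>" "(S ^^ k) \<phi>" "M + d * B" \<sigma> d b g y] by simp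
 qed
 have x: "0 \<le> r / d" "0 \<le> r' / d" using assms d_pos by simp_all
 have "\<bar>poisson_mean (r' / d) ?a - poisson_mean (r / d) ?a
   - (r' / d - r / d) * (poisson_mean (r / d) (\<lambda>k. ?a (Suc k)) - poisson_mean (r / d) ?a)\<bar>
  \<le> 2 * (M + d * B) * (r' / d - r / d)\<^sup>2"
  by (rule poisson_mean_quadratic[OF iter_exp_bounded[of \<phi> M, OF assms(1,2)] x 1])
 moreover have "2 * (M + d * B) * (r' / d - r / d)\<^sup>2 = 2 * (M + d * B) / d\<^sup>2 * (r' - r)\<^sup>2"
  by (simp add: diff_divide_distrib[symmetric] power_divide)
 ultimately show ?thesis
  unfolding S_P[of \<phi> M, OF assms(1,2)] ev_def by (simp add: diff_divide_distrib[symmetric])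
qed

end

subsection \<open>Mollification\<close>

text \<open>The kernel is centred at \<open>z\<close> and evaluated at \<open>y - z\<close>; hence a
  derivative in \<open>z\<close> falls on the kernel with a minus sign, as in
  \<open>mk1\<close>.\<close>

definition conv :: "('a::euclidean_space \<Rightarrow> real) \<Rightarrow> ('a \<Rightarrow> real) \<Rightarrow> 'a \<Rightarrow> real" where
 "conv k \<phi> z = (\<integral>y. \<phi> y * k (y - z) \<partial>lborel)"

lemma integrable_lborel_compact_support:
 fixes f :: "'a::euclidean_space \<Rightarrow> real"
 assumes "continuous_on UNIV f" "\<And>y. norm (y - z) > \<rho> \<Longrightarrow> f y = 0"
 shows "integrable lborel f"
proof -
 have "integrable lborel (\<lambda>y. indicator (cball z \<rho>) y *\<^sub>R f y)"
  by (rule borel_integrable_compact) (use assms(1) continuous_on_subset in auto)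
 also have "(\<lambda>y. indicator (cball z \<rho>) y *\<^sub>R f y) = f"
  using assms(2) by (auto simp: fun_eq_iff indicator_def dist_norm norm_minus_commute)
 finally show ?thesis .
qed

definition kern :: "real \<Rightarrow> ('a::euclidean_space \<Rightarrow> real) \<Rightarrow> bool" where
 "kern \<rho> k \<longleftrightarrow> continuous_on UNIV k \<and> (\<forall>u. \<rho> < norm u \<longrightarrow> k u = 0)"

lemma kern_integrable:
 assumes "kern \<rho> k" "continuous_on UNIV \<phi>"
 shows "integrable lborel (\<lambda>y. \<phi> y * k (y - z))"
 by (rule integrable_lborel_compact_support[where z=z and \<rho>=\<rho>])
   (use assms in \<open>auto simp: kern_def intro!: continuous_intros intro: continuous_on_compose2[of UNIV k]\<close>)

text \<open>Translation invariance of Lebesgue measure. For an integrand that is not measurable both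
  integrals have the default value 0, so the identity holds for every \<open>\<phi>\<close>.\<close>

lemma conv_translate: "conv k \<phi> z = (\<integral>y. \<phi> (z + y) * k y \<partial>lborel)"
proof (cases "(\<lambda>y. \<phi> y * k (y - z)) \<in> borel_measurable borel")
 case True
 have "conv k \<phi> z = (\<integral>y. \<phi> y * k (y - z) \<partial>distr lborel borel ((+) z))"
  unfolding conv_def by (simp add: lborel_distr_plus)
 also have "\<dots> = (\<integral>y. \<phi> (z + y) * k y \<partial>lborel)"
  using True by (subst integral_distr) (auto simp: cong: measurable_cong_sets)
 finally show ?thesis .
next
 case False
 have "\<not> integrable lborel (\<lambda>y. \<phi> y * k (y - z))" using False by auto
 moreover have "(\<lambda>y. \<phi> (z + y) * k y) \<notin> borel_measurable borel"
 proof
  assume a: "(\<lambda>y. \<phi> (z + y) * k y) \<in> borel_measurable borel"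
  have "(\<lambda>y. \<phi> (z + (y - z)) * k (y - z)) \<in> borel_measurable borel"
   by (rule measurable_compose[OF _ a]) auto
  with False show False by simp
 qed
 then have "\<not> integrable lborel (\<lambda>y. \<phi> (z + y) * k y)" by auto
 ultimately show ?thesis unfolding conv_def by (simp add: not_integrable_integral_eq)
qed

lemma conv_add:
 assumes "kern \<rho> k" "continuous_on UNIV \<phi>" "continuous_on UNIV \<psi>"
 shows "conv k (\<lambda>y. \<phi> y + \<psi> y) z = conv k \<phi> z + conv k \<psi> z"
 unfolding conv_def using kern_integrable[OF assms(1,2)] kern_integrable[OF assms(1,3)]
 by (simp add: distrib_right)

lemma conv_cmult: "conv k (\<lambda>y. c * \<phi> y) z = c * conv k \<phi> z"
 unfolding conv_def by (simp add: mult.assoc)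

lemma conv_diff:
 assumes "kern \<rho> k" "continuous_on UNIV \<phi>" "continuous_on UNIV \<psi>"
 shows "conv k (\<lambda>y. \<phi> y - \<psi> y) z = conv k \<phi> z - conv k \<psi> z"
 unfolding conv_def using kern_integrable[OF assms(1,2)] kern_integrable[OF assms(1,3)]
 by (simp add: left_diff_distrib)

lemma conv_kern_cmult: "conv (\<lambda>u. c * k u) \<phi> z = c * conv k \<phi> z"
 unfolding conv_def by (simp add: mult.left_commute)

lemma conv_kern_add:
 assumes "kern \<rho> k" "kern \<rho> k'" "continuous_on UNIV \<phi>"
 shows "conv (\<lambda>u. k u + k' u) \<phi> z = conv k \<phi> z + conv k' \<phi> z"
 unfolding conv_def using kern_integrable[OF assms(1,3)] kern_integrable[OF assms(2,3)]
 by (simp add: distrib_left)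

lemma conv_mono:
 assumes "kern \<rho> k" "continuous_on UNIV \<phi>" "continuous_on UNIV \<psi>" "\<And>u. 0 \<le> k u" "\<And>y. \<phi> y \<le> \<psi> y"
 shows "conv k \<phi> z \<le> conv k \<psi> z"
 unfolding conv_def using kern_integrable[OF assms(1,2)] kern_integrable[OF assms(1,3)] assms(4,5)
 by (intro integral_mono mult_right_mono) auto

lemma conv_bound:
 fixes k :: "'a::euclidean_space \<Rightarrow> real"
 assumes k: "\<And>u. \<bar>k u\<bar> \<le> c * indicator (cball 0 \<rho>) u" and m: "\<And>y. \<bar>\<phi> y\<bar> \<le> m"
 shows "\<bar>conv k \<phi> z\<bar> \<le> m * c * measure lborel (cball (0::'a) \<rho>)"
proof -
 have m0: "0 \<le> m" using m[of 0] by linarith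
 have "\<bar>conv k \<phi> z\<bar> \<le> (\<integral>y. m * c * indicator (cball 0 \<rho>) (y::'a) \<partial>lborel)"
  unfolding conv_translate real_norm_def[symmetric]
 proof (rule order_trans[OF integral_norm_bound])
  show "(\<integral>y. norm (\<phi> (z + y) * k y) \<partial>lborel) \<le> (\<integral>y. m * c * indicator (cball 0 \<rho>) (y::'a) \<partial>lborel)"
  proof (rule integral_mono')
   show "integrable lborel (\<lambda>y::'a. m * c * indicator (cball 0 \<rho>) y)"
    by (intro integrable_mult_right integrable_real_indicator) (auto intro: emeasure_bounded_finite[OF bounded_cball, unfolded infinity_ennreal_def])
   show "norm (\<phi> (z + y) * k y) \<le> m * c * indicator (cball 0 \<rho>) y" for y :: 'a
    unfolding real_norm_def abs_mult mult.assoc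
    by (intro mult_mono k m m0) auto
   show "0 \<le> m * c * indicator (cball 0 \<rho>) y" for y :: 'a
    using order_trans[OF abs_ge_zero k[of y]] m0 by (simp add: mult.assoc)
  qed
 qed
 also have "\<dots> = m * c * measure lborel (cball (0::'a) \<rho>)" by simp
 finally show ?thesis .
qed

text \<open>A piecewise polynomial profile in place of the usual smooth bump: its second derivative
  is locally Lipschitz, which is what a cubic Taylor remainder needs, and all constants stay
  explicit. \<open>bump1\<close> and \<open>bump2\<close> are its first two derivatives.\<close>

definition bump0 :: "real \<Rightarrow> real" where "bump0 r = max 0 (1 - r) ^ 4"
definition bump1 :: "real \<Rightarrow> real" where "bump1 r = - 4 * max 0 (1 - r) ^ 3"
definition bump2 :: "real \<Rightarrow> real" where "bump2 r = 12 * max 0 (1 - r) ^ 2"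

text \<open>With \<open>p = 1 - r\<close> the remainder is exactly
  \<open>(d - 4 * p) * d ^ 3\<close> as long as both points lie in the support. If the kink
  separates them, then \<open>p\<close> or \<open>p - d\<close> lies between 0 and
  \<open>\<bar>d\<bar>\<close> and the terms are estimated one by one; 11 is the sum of the
  coefficients 1, 4 and 6.\<close>

lemma bump_taylor:
 assumes "0 \<le> r"
 shows "\<bar>bump0 (r + d) - bump0 r - bump1 r * d - bump2 r / 2 * d\<^sup>2\<bar> \<le> (4 + 11 * \<bar>d\<bar>) * \<bar>d\<bar> ^ 3"
proof -
 let ?E = "bump0 (r + d) - bump0 r - bump1 r * d - bump2 r / 2 * d\<^sup>2"
 have d4: "\<bar>d\<bar> * \<bar>d\<bar> ^ 3 = d ^ 4" by (simp add: power3_eq_cube power4_eq_xxxx mult.assoc abs_mult[symmetric])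
 have d3: "0 \<le> \<bar>d\<bar> ^ 3" "0 \<le> d ^ 4" by auto
 define p where "p = 1 - r"
 have p1: "p \<le> 1" using assms by (simp add: p_def)
 consider "p \<le> 0" "p - d \<le> 0" | "p \<le> 0" "0 < p - d" | "0 < p" "p - d \<le> 0" | "0 < p" "0 < p - d" by linarith
 then show ?thesis
 proof cases
  case 1
  then show ?thesis using d3 by (simp add: bump0_def bump1_def bump2_def p_def)
 next
  case 2
  then have "\<bar>?E\<bar> = (p - d) ^ 4"
   by (simp add: bump0_def bump1_def bump2_def p_def diff_diff_eq)
  also have "\<dots> \<le> \<bar>d\<bar> ^ 4" using 2 by (intro power_mono) auto
  also have "\<dots> = \<bar>d\<bar> * \<bar>d\<bar> ^ 3" by (simp add: power3_eq_cube power4_eq_xxxx)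
  also have "\<dots> \<le> (4 + 11 * \<bar>d\<bar>) * \<bar>d\<bar> ^ 3" by (intro mult_right_mono) auto
  finally show ?thesis .
 next
  case 3
  then have "\<bar>?E\<bar> = \<bar>p ^ 4 - 4 * p ^ 3 * d + 6 * p\<^sup>2 * d\<^sup>2\<bar>"
   by (simp add: bump0_def bump1_def bump2_def p_def abs_minus_commute)
  also have "\<dots> \<le> p ^ 4 + 4 * p ^ 3 * d + 6 * p\<^sup>2 * d\<^sup>2"
   using 3 by (auto simp: abs_le_iff)
  also have "\<dots> \<le> d ^ 4 + 4 * d ^ 3 * d + 6 * d\<^sup>2 * d\<^sup>2"
   using 3 by (intro add_mono mult_mono power_mono) auto
  also have "\<dots> = 11 * \<bar>d\<bar> * \<bar>d\<bar> ^ 3" using 3 by (simp add: power3_eq_cube power4_eq_xxxx power2_eq_square)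
  also have "\<dots> \<le> (4 + 11 * \<bar>d\<bar>) * \<bar>d\<bar> ^ 3" by (intro mult_right_mono) auto
  finally show ?thesis .
 next
  case 4
  then have "?E = (p - d) ^ 4 - p ^ 4 + 4 * p ^ 3 * d - 6 * p\<^sup>2 * d\<^sup>2"
   by (simp add: bump0_def bump1_def bump2_def p_def diff_diff_eq)
  also have "\<dots> = (d - 4 * p) * d ^ 3"
   by (simp add: power3_eq_cube power4_eq_xxxx power2_eq_square algebra_simps)
  finally have "\<bar>?E\<bar> = \<bar>d - 4 * p\<bar> * \<bar>d\<bar> ^ 3"
   by (simp add: abs_mult power_abs)
  also have "\<dots> \<le> (4 + 11 * \<bar>d\<bar>) * \<bar>d\<bar> ^ 3"
   using 4 p1 by (intro mult_right_mono) auto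
  finally show ?thesis .
 qed
qed

lemma bump_bounds:
 assumes "0 \<le> r"
 shows "0 \<le> bump0 r" "bump0 r \<le> 1" "\<bar>bump1 r\<bar> \<le> 4" "\<bar>bump2 r\<bar> \<le> 12"
 using assms power_le_one[of "max 0 (1 - r)"]
 by (auto simp: bump0_def bump1_def bump2_def)

lemma bump_zero: "1 \<le> r \<Longrightarrow> bump0 r = 0" "1 \<le> r \<Longrightarrow> bump1 r = 0" "1 \<le> r \<Longrightarrow> bump2 r = 0"
 by (auto simp: bump0_def bump1_def bump2_def)

lemma continuous_bump [continuous_intros]:
 assumes "continuous_on A f"
 shows "continuous_on A (\<lambda>u. bump0 (f u))" "continuous_on A (\<lambda>u. bump1 (f u))" "continuous_on A (\<lambda>u. bump2 (f u))"
 unfolding bump0_def bump1_def bump2_def using assms by (auto intro!: continuous_intros)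


definition mk0 :: "real \<Rightarrow> 'a::euclidean_space \<Rightarrow> real" where
 "mk0 \<delta> u = bump0 ((norm u / \<delta>)\<^sup>2)"

text \<open>\<open>mk1 \<delta> e\<close> and \<open>mk2 \<delta> e e'\<close> are the first and
  second derivatives of the translated kernel with respect to the translation:
  \<open>mk0 \<delta> (u - e)\<close> is
  \<open>mk0 \<delta> u + mk1 \<delta> e u + mk2 \<delta> e e u / 2\<close> up to third order in
  \<open>e\<close>.\<close>

definition mk1 :: "real \<Rightarrow> 'a \<Rightarrow> 'a::euclidean_space \<Rightarrow> real" where
 "mk1 \<delta> e u = - (2 / \<delta>\<^sup>2) * bump1 ((norm u / \<delta>)\<^sup>2) * (u \<bullet> e)"

definition mk2 :: "real \<Rightarrow> 'a \<Rightarrow> 'a \<Rightarrow> 'a::euclidean_space \<Rightarrow> real" where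
 "mk2 \<delta> e e' u = 2 / \<delta>\<^sup>2 * bump1 ((norm u / \<delta>)\<^sup>2) * (e \<bullet> e')
   + 4 / \<delta> ^ 4 * bump2 ((norm u / \<delta>)\<^sup>2) * ((u \<bullet> e) * (u \<bullet> e'))"

lemma scaled_ge_one: "0 < \<delta> \<Longrightarrow> \<delta> < norm u \<Longrightarrow> 1 \<le> (norm u / \<delta>)\<^sup>2"
 by (simp add: one_le_power)

lemma kern_mk:
 assumes "0 < \<delta>"
 shows "kern \<delta> (mk0 \<delta>)" "kern \<delta> (mk1 \<delta> e)" "kern \<delta> (mk2 \<delta> e e')"
 unfolding kern_def mk0_def mk1_def mk2_def
 using assms scaled_ge_one bump_zero by (auto intro!: continuous_intros)

lemma mk_zero:
 assumes "0 < \<delta>" "\<delta> < norm u"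
 shows "mk0 \<delta> u = 0" "mk1 \<delta> e u = 0" "mk2 \<delta> e e' u = 0"
 unfolding mk0_def mk1_def mk2_def using scaled_ge_one[OF assms] bump_zero by auto

lemma mk0_nonneg: "0 \<le> mk0 \<delta> u"
 unfolding mk0_def by (rule bump_bounds) simp

lemma mk_bounds:
 assumes d: "0 < \<delta>"
 shows "\<bar>mk1 \<delta> e u\<bar> \<le> 8 / \<delta> * norm e * indicator (cball 0 \<delta>) u"
  "\<bar>mk2 \<delta> e e' u\<bar> \<le> 56 / \<delta>\<^sup>2 * (norm e * norm e') * indicator (cball 0 \<delta>) u"
proof -
 let ?r = "(norm u / \<delta>)\<^sup>2"
 have b: "\<bar>bump1 ?r\<bar> \<le> 4" "\<bar>bump2 ?r\<bar> \<le> 12" by (intro bump_bounds; simp)+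
 have "\<bar>mk1 \<delta> e u\<bar> \<le> 8 / \<delta> * norm e \<and> \<bar>mk2 \<delta> e e' u\<bar> \<le> 56 / \<delta>\<^sup>2 * (norm e * norm e')" if u: "norm u \<le> \<delta>"
 proof
  have ue: "\<bar>u \<bullet> e\<bar> \<le> \<delta> * norm e" for e :: 'a
   using Cauchy_Schwarz_ineq2[of u e] u by (meson mult_right_mono norm_ge_zero order_trans)
  have "\<bar>mk1 \<delta> e u\<bar> = 2 / \<delta>\<^sup>2 * (\<bar>bump1 ?r\<bar> * \<bar>u \<bullet> e\<bar>)"
   unfolding mk1_def by (simp add: abs_mult)
  also have "\<dots> \<le> 2 / \<delta>\<^sup>2 * (4 * (\<delta> * norm e))"
   using b ue by (intro mult_left_mono mult_mono) auto
  also have "\<dots> = 8 / \<delta> * norm e" using d by (simp add: power2_eq_square)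
  finally show "\<bar>mk1 \<delta> e u\<bar> \<le> 8 / \<delta> * norm e" .
  have "\<bar>mk2 \<delta> e e' u\<bar> \<le> \<bar>2 / \<delta>\<^sup>2 * bump1 ?r * (e \<bullet> e')\<bar> + \<bar>4 / \<delta> ^ 4 * bump2 ?r * ((u \<bullet> e) * (u \<bullet> e'))\<bar>"
   unfolding mk2_def by (rule abs_triangle_ineq)
  also have "\<dots> = 2 / \<delta>\<^sup>2 * (\<bar>bump1 ?r\<bar> * \<bar>e \<bullet> e'\<bar>) + 4 / \<delta> ^ 4 * (\<bar>bump2 ?r\<bar> * (\<bar>u \<bullet> e\<bar> * \<bar>u \<bullet> e'\<bar>))"
   by (simp add: abs_mult)
  also have "\<dots> \<le> 2 / \<delta>\<^sup>2 * (4 * (norm e * norm e')) + 4 / \<delta> ^ 4 * (12 * ((\<delta> * norm e) * (\<delta> * norm e')))"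
   using b ue Cauchy_Schwarz_ineq2[of e e'] d
   by (intro add_mono mult_left_mono mult_mono) auto
  also have "\<dots> = 56 / \<delta>\<^sup>2 * (norm e * norm e')"
   using d by (simp add: power2_eq_square power4_eq_xxxx field_simps)
  finally show "\<bar>mk2 \<delta> e e' u\<bar> \<le> 56 / \<delta>\<^sup>2 * (norm e * norm e')" .
 qed
 then show "\<bar>mk1 \<delta> e u\<bar> \<le> 8 / \<delta> * norm e * indicator (cball 0 \<delta>) u"
  "\<bar>mk2 \<delta> e e' u\<bar> \<le> 56 / \<delta>\<^sup>2 * (norm e * norm e') * indicator (cball 0 \<delta>) u"
  using mk_zero(2)[OF d, of u e] mk_zero(3)[OF d, of u e e'] d by (auto simp: indicator_def)
qed

text \<open>The one-dimensional expansion is used at \<open>(norm u / \<delta>)\<^sup>2\<close> with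
  the increment caused by \<open>e\<close>. That increment is itself quadratic in \<open>e\<close>,
  so its square produces terms beyond \<open>mk2\<close>, which account for the second estimate. The
  7375 below is \<open>59 * 5 ^ 3\<close>; since \<open>\<delta>\<close> and \<open>norm e\<close>
  are at most 1, everything vanishes outside the ball of radius 2.\<close>

lemma mk_taylor:
 assumes d: "0 < \<delta>" "\<delta> \<le> 1" and e: "norm e \<le> 1"
 shows "\<bar>mk0 \<delta> (u - e) - mk0 \<delta> u - mk1 \<delta> e u - mk2 \<delta> e e u / 2\<bar>
   \<le> 8000 / \<delta> ^ 8 * norm e ^ 3 * indicator (cball 0 2) u"
proof (cases "norm u \<le> 2")
 case False
 have "norm u - norm e \<le> norm (u - e)" by (rule norm_triangle_ineq2)
 then have "\<delta> < norm (u - e)" "\<delta> < norm u" using False d e by linarith+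
 then show ?thesis using False d(1) by (simp add: mk_zero)
next
 case True
 let ?N = "norm e"
 define k where "k = 1 / \<delta>\<^sup>2"
 have k1: "1 \<le> k" unfolding k_def using d by (simp add: power_le_one)
 define r where "r = k * (norm u)\<^sup>2"
 define s where "s = u \<bullet> e"
 define h where "h = k * (?N\<^sup>2 - 2 * s)"
 have r: "(norm u / \<delta>)\<^sup>2 = r" unfolding r_def k_def by (simp add: power_divide)
 have "(norm (u - e))\<^sup>2 = (norm u)\<^sup>2 + (?N\<^sup>2 - 2 * s)"
  unfolding s_def power2_norm_eq_inner by (simp add: inner_diff inner_commute)
 then have rh: "(norm (u - e) / \<delta>)\<^sup>2 = r + h"
  unfolding r_def h_def k_def by (simp add: power_divide add_divide_distrib)
 have k2: "2 / \<delta>\<^sup>2 = 2 * k" "4 / \<delta> ^ 4 = 4 * k\<^sup>2" "1 / \<delta> ^ 8 = k ^ 4"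
  unfolding k_def by (simp_all add: power_divide flip: power_mult)
 have s2: "\<bar>s\<bar> \<le> 2 * ?N"
  unfolding s_def using Cauchy_Schwarz_ineq2[of u e] True by (meson mult_right_mono norm_ge_zero order_trans)
 have N2: "?N\<^sup>2 \<le> ?N" using e by (simp add: power2_eq_square mult_left_le)
 have "\<bar>?N\<^sup>2 - 2 * s\<bar> \<le> 5 * ?N" using s2 N2 zero_le_power2[of ?N] by linarith
 then have h: "\<bar>h\<bar> \<le> k * (5 * ?N)" unfolding h_def abs_mult using k1 by (simp add: mult_left_mono)
 have h5: "\<bar>h\<bar> \<le> 5 * k" using h e k1 mult_left_mono[of "5 * ?N" 5 k] by linarith
 have "r \<ge> 0" unfolding r_def using k1 by simp
 note bt = bump_taylor[OF this, of h]
 have "(4 + 11 * \<bar>h\<bar>) * \<bar>h\<bar> ^ 3 \<le> (4 * k + 55 * k) * (k * (5 * ?N)) ^ 3"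
  using h h5 k1 by (intro mult_mono power_mono) auto
 also have "\<dots> = 7375 * k ^ 4 * ?N ^ 3" by (simp add: power_mult_distrib power3_eq_cube power4_eq_xxxx)
 finally have 1: "\<bar>bump0 (r + h) - bump0 r - bump1 r * h - bump2 r / 2 * h\<^sup>2\<bar> \<le> 7375 * k ^ 4 * ?N ^ 3"
  using bt by linarith
 have 2: "\<bar>bump2 r / 2 * (k\<^sup>2 * (?N ^ 4 - 4 * s * ?N\<^sup>2))\<bar> \<le> 60 * k ^ 4 * ?N ^ 3"
 proof -
  have "\<bar>?N ^ 4 - 4 * s * ?N\<^sup>2\<bar> \<le> ?N ^ 4 + 4 * \<bar>s\<bar> * ?N\<^sup>2"
   using abs_triangle_ineq4[of "?N ^ 4" "4 * s * ?N\<^sup>2"] by (simp add: abs_mult)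
  also have "\<dots> \<le> ?N ^ 3 + 4 * (2 * ?N) * ?N\<^sup>2"
   using s2 e power_decreasing[of 3 4 ?N] by (intro add_mono mult_right_mono) auto
  also have "\<dots> = 9 * ?N ^ 3" by (simp add: power3_eq_cube power2_eq_square)
  finally have a: "\<bar>?N ^ 4 - 4 * s * ?N\<^sup>2\<bar> \<le> 9 * ?N ^ 3" .
  have "\<bar>bump2 r / 2 * (k\<^sup>2 * (?N ^ 4 - 4 * s * ?N\<^sup>2))\<bar> = \<bar>bump2 r\<bar> / 2 * (k\<^sup>2 * \<bar>?N ^ 4 - 4 * s * ?N\<^sup>2\<bar>)"
   by (simp add: abs_mult)
  also have "\<dots> \<le> 6 * (k ^ 4 * (9 * ?N ^ 3))"
   using a k1 bump_bounds(4)[OF \<open>r \<ge> 0\<close>] power_increasing[of 2 4 k]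
   by (intro mult_mono) auto
  also have "\<dots> \<le> 60 * k ^ 4 * ?N ^ 3" using k1 by (simp add: mult_right_mono)
  finally show ?thesis .
 qed
 have "mk0 \<delta> (u - e) - mk0 \<delta> u - mk1 \<delta> e u - mk2 \<delta> e e u / 2 =
  (bump0 (r + h) - bump0 r - bump1 r * h - bump2 r / 2 * h\<^sup>2) + bump2 r / 2 * (k\<^sup>2 * (?N ^ 4 - 4 * s * ?N\<^sup>2))"
  unfolding mk0_def mk1_def mk2_def r rh k2 h_def s_def[symmetric] power2_norm_eq_inner[symmetric]
  by (simp add: power2_eq_square power4_eq_xxxx algebra_simps)
 then have "\<bar>mk0 \<delta> (u - e) - mk0 \<delta> u - mk1 \<delta> e u - mk2 \<delta> e e u / 2\<bar> \<le> 8000 * k ^ 4 * ?N ^ 3"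
  using 1 2 mult_nonneg_nonneg[of "k ^ 4" "?N ^ 3"] k1 by linarith
 then show ?thesis using True by (simp add: k2(3)[symmetric])
qed


definition mknorm :: "real \<Rightarrow> 'a::euclidean_space itself \<Rightarrow> real" where
 "mknorm \<delta> _ = (\<integral>u. mk0 \<delta> (u::'a) \<partial>lborel)"

lemma mknorm_pos:
 assumes d: "0 < \<delta>"
 shows "0 < mknorm \<delta> TYPE('a::euclidean_space)"
proof -
 have fin: "integrable lborel (\<lambda>u::'a. (3 / 4) ^ 4 * indicator (cball 0 (\<delta> / 2)) u :: real)"
  by (intro integrable_mult_right integrable_real_indicator)
    (auto intro: emeasure_bounded_finite[OF bounded_cball, unfolded infinity_ennreal_def])
 have "0 < (3 / 4) ^ 4 * measure lborel (cball (0::'a) (\<delta> / 2))" using d by simp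
 also have "\<dots> = (\<integral>u. (3 / 4) ^ 4 * indicator (cball (0::'a) (\<delta> / 2)) u \<partial>lborel)" by simp
 also have "\<dots> \<le> (\<integral>u. mk0 \<delta> (u::'a) \<partial>lborel)"
 proof (rule integral_mono[OF fin])
  show "integrable lborel (mk0 \<delta> :: 'a \<Rightarrow> real)"
   using kern_integrable[OF kern_mk(1)[OF d], of "\<lambda>_. 1" 0] by simp
  show "(3 / 4) ^ 4 * indicator (cball 0 (\<delta> / 2)) u \<le> mk0 \<delta> u" for u :: 'a
  proof (cases "norm u \<le> \<delta> / 2")
   case True
   then have "(norm u / \<delta>)\<^sup>2 \<le> (1 / 2)\<^sup>2" using d by (intro power_mono) (auto simp: field_simps)
   then have "3 / 4 \<le> 1 - (norm u / \<delta>)\<^sup>2" by (simp add: power2_eq_square)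
   then have "(3 / 4) ^ 4 \<le> mk0 \<delta> u" unfolding mk0_def bump0_def by (intro power_mono) auto
   then show ?thesis using True by simp
  qed (simp add: mk0_nonneg)
 qed
 finally show ?thesis unfolding mknorm_def .
qed

definition moll :: "real \<Rightarrow> ('a::euclidean_space \<Rightarrow> real) \<Rightarrow> 'a \<Rightarrow> real" where
 "moll \<delta> \<phi> z = conv (mk0 \<delta>) \<phi> z / mknorm \<delta> TYPE('a)"

text \<open>\<open>moll1\<close> and \<open>moll2\<close> are the first and second derivatives of
  \<open>moll \<delta> \<phi>\<close>, defined by differentiating the kernel: \<open>\<phi>\<close>
  itself need only be continuous, and both are controlled by its supremum.\<close>

definition moll1 :: "real \<Rightarrow> ('a::euclidean_space \<Rightarrow> real) \<Rightarrow> 'a \<Rightarrow> 'a \<Rightarrow> real" where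
 "moll1 \<delta> \<phi> z e = conv (mk1 \<delta> e) \<phi> z / mknorm \<delta> TYPE('a)"

definition moll2 :: "real \<Rightarrow> ('a::euclidean_space \<Rightarrow> real) \<Rightarrow> 'a \<Rightarrow> 'a \<Rightarrow> 'a \<Rightarrow> real" where
 "moll2 \<delta> \<phi> z e e' = conv (mk2 \<delta> e e') \<phi> z / mknorm \<delta> TYPE('a)"

lemma moll_mono:
 fixes \<phi> :: "'a::euclidean_space \<Rightarrow> real"
 assumes "0 < \<delta>" "continuous_on UNIV \<phi>" "continuous_on UNIV \<psi>" "\<And>y. \<phi> y \<le> \<psi> y"
 shows "moll \<delta> \<phi> z \<le> moll \<delta> \<psi> z"
 unfolding moll_def using mknorm_pos[OF assms(1), where 'a='a]
 by (intro divide_right_mono conv_mono[OF kern_mk(1)[OF assms(1)]] assms mk0_nonneg) (simp add: less_imp_le)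

lemma moll_const: "0 < \<delta> \<Longrightarrow> moll \<delta> (\<lambda>y. c) (z :: 'a::euclidean_space) = c"
 unfolding moll_def conv_translate using mknorm_pos[of \<delta>, where 'a='a] by (simp add: mknorm_def)

lemma moll_add:
 assumes "0 < \<delta>" "continuous_on UNIV \<phi>" "continuous_on UNIV \<psi>"
 shows "moll \<delta> (\<lambda>y. \<phi> y + \<psi> y) z = moll \<delta> \<phi> z + moll \<delta> \<psi> z"
 unfolding moll_def conv_add[OF kern_mk(1)[OF assms(1)] assms(2,3)] by (rule add_divide_distrib)

lemma moll_diff:
 assumes "0 < \<delta>" "continuous_on UNIV \<phi>" "continuous_on UNIV \<psi>"
 shows "moll \<delta> (\<lambda>y. \<phi> y - \<psi> y) z = moll \<delta> \<phi> z - moll \<delta> \<psi> z"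
 unfolding moll_def conv_diff[OF kern_mk(1)[OF assms(1)] assms(2,3)] by (rule diff_divide_distrib)

lemma moll_cmult: "moll \<delta> (\<lambda>y. c * \<phi> y) z = c * moll \<delta> \<phi> z"
 unfolding moll_def conv_cmult by simp

lemma moll_shift: "moll \<delta> (\<lambda>y. \<phi> (y + w)) z = moll \<delta> \<phi> (z + w)"
 unfolding moll_def conv_translate by (simp add: add_ac)

lemma moll_bounds:
 fixes \<phi> :: "'a::euclidean_space \<Rightarrow> real"
 assumes "0 < \<delta>" "continuous_on UNIV \<phi>"
 shows "(\<And>y. \<phi> y \<le> M) \<Longrightarrow> moll \<delta> \<phi> z \<le> M" "(\<And>y. m \<le> \<phi> y) \<Longrightarrow> m \<le> moll \<delta> \<phi> z"
 using moll_mono[OF assms(1,2), of "\<lambda>_. M" z] moll_mono[OF assms(1) _ assms(2), of "\<lambda>_. m" z] moll_const[OF assms(1), of _ z]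
 by simp_all

lemma moll_dist:
 fixes \<phi> :: "'a::euclidean_space \<Rightarrow> real"
 assumes "0 < \<delta>" "continuous_on UNIV \<phi>" "continuous_on UNIV \<psi>" "\<And>y. \<bar>\<phi> y - \<psi> y\<bar> \<le> c"
 shows "\<bar>moll \<delta> \<phi> z - moll \<delta> \<psi> z\<bar> \<le> c"
proof -
 have c: "continuous_on UNIV (\<lambda>y. \<phi> y - \<psi> y)" by (intro continuous_intros assms)
 have "\<phi> y - \<psi> y \<le> c" "- c \<le> \<phi> y - \<psi> y" for y using assms(4)[of y] by linarith+
 then show ?thesis
  using moll_bounds[OF assms(1) c, of c z] moll_bounds(2)[OF assms(1) c, of "-c" z] moll_diff[OF assms(1-3), of z] by (simp add: abs_le_iff)
qed

text \<open>Clipping \<open>\<phi>\<close> to \<open>[t - c, t + c]\<close> does not change it where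
  the kernel lives, so the global bounds apply under a hypothesis on the
  \<open>\<delta>\<close>-ball only.\<close>

lemma moll_near:
 assumes d: "0 < \<delta>" and c: "continuous_on UNIV \<phi>" and n: "\<And>y. norm (y - z) \<le> \<delta> \<Longrightarrow> \<bar>\<phi> y - t\<bar> \<le> c"
 shows "\<bar>moll \<delta> \<phi> z - t\<bar> \<le> c"
proof -
 define \<psi> where "\<psi> y = max (t - c) (min (t + c) (\<phi> y))" for y
 have "\<phi> y * mk0 \<delta> (y - z) = \<psi> y * mk0 \<delta> (y - z)" for y
  using n[of y] mk_zero(1)[OF d, of "y - z"] unfolding \<psi>_def
  by (cases "norm (y - z) \<le> \<delta>") (auto simp: max_def min_def abs_le_iff)
 then have "moll \<delta> \<phi> z = moll \<delta> \<psi> z" unfolding moll_def conv_def by presburger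
 moreover have "continuous_on UNIV \<psi>" unfolding \<psi>_def using c by (intro continuous_intros)
 moreover have "0 \<le> c" using n[of z] d by simp
 then have "t - c \<le> \<psi> y" "\<psi> y \<le> t + c" for y unfolding \<psi>_def by auto
 ultimately have "t - c \<le> moll \<delta> \<phi> z" "moll \<delta> \<phi> z \<le> t + c"
  using moll_bounds[OF d, of \<psi>] by simp_all
 then show ?thesis by linarith
qed

lemma moll_lip_near:
 assumes "0 < \<delta>" "lip \<Lambda> \<phi>" shows "\<bar>moll \<delta> \<phi> z - \<phi> z\<bar> \<le> \<Lambda> * \<delta>"
proof (rule moll_near[OF assms(1) lip_continuous[OF assms(2)]])
 fix y assume "norm (y - z) \<le> \<delta>"
 then show "\<bar>\<phi> y - \<phi> z\<bar> \<le> \<Lambda> * \<delta>"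
  using lipD[OF assms(2), of y z] mult_left_mono[OF _ lip_nonneg[OF assms(2)]] by (meson order_trans)
qed

lemma moll_lip:
 assumes "0 < \<delta>" "lip \<Lambda> \<phi>" shows "lip \<Lambda> (moll \<delta> \<phi>)"
 unfolding lip_def
proof safe
 fix y z :: 'a
 have "\<bar>moll \<delta> (\<lambda>u. \<phi> (u + (y - z))) z - moll \<delta> \<phi> z\<bar> \<le> \<Lambda> * norm (y - z)"
 proof (rule moll_dist[OF assms(1)])
  show "continuous_on UNIV (\<lambda>u. \<phi> (u + (y - z)))"
   by (rule continuous_on_compose2[OF lip_continuous[OF assms(2), of UNIV]]) (auto intro!: continuous_intros)
  show "\<bar>\<phi> (u + (y - z)) - \<phi> u\<bar> \<le> \<Lambda> * norm (y - z)" for u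
   using lipD[OF assms(2), of "u + (y - z)" u] by simp
 qed (rule lip_continuous[OF assms(2)])
 then show "\<bar>moll \<delta> \<phi> y - moll \<delta> \<phi> z\<bar> \<le> \<Lambda> * norm (y - z)" by (simp add: moll_shift)
qed

lemma moll1_diff:
 assumes "0 < \<delta>" "continuous_on UNIV \<phi>" "continuous_on UNIV \<psi>"
 shows "moll1 \<delta> (\<lambda>y. \<phi> y - \<psi> y) z e = moll1 \<delta> \<phi> z e - moll1 \<delta> \<psi> z e"
  "moll2 \<delta> (\<lambda>y. \<phi> y - \<psi> y) z e e' = moll2 \<delta> \<phi> z e e' - moll2 \<delta> \<psi> z e e'"
 unfolding moll1_def moll2_def conv_diff[OF kern_mk(2)[OF assms(1)] assms(2,3)]
  conv_diff[OF kern_mk(3)[OF assms(1)] assms(2,3)] by (rule diff_divide_distrib)+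

lemma moll1_linear:
 assumes "0 < \<delta>" "continuous_on UNIV \<phi>"
 shows "linear (moll1 \<delta> \<phi> z)"
proof (rule linearI)
 fix e f :: 'a and c :: real
 have "mk1 \<delta> (e + f) = (\<lambda>u. mk1 \<delta> e u + mk1 \<delta> f u)" "mk1 \<delta> (c *\<^sub>R e) = (\<lambda>u. c * mk1 \<delta> e u)"
  unfolding mk1_def by (auto simp: fun_eq_iff inner_add_right algebra_simps add_divide_distrib)
 then show "moll1 \<delta> \<phi> z (e + f) = moll1 \<delta> \<phi> z e + moll1 \<delta> \<phi> z f" "moll1 \<delta> \<phi> z (c *\<^sub>R e) = c *\<^sub>R moll1 \<delta> \<phi> z e"
  unfolding moll1_def using conv_kern_add[OF kern_mk(2)[OF assms(1)] kern_mk(2)[OF assms(1)] assms(2)]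
  by (simp_all add: conv_kern_cmult add_divide_distrib)
qed

lemma moll2_linear:
 assumes "0 < \<delta>" "continuous_on UNIV \<phi>"
 shows "linear (moll2 \<delta> \<phi> z e)"
proof (rule linearI)
 fix e' f :: 'a and c :: real
 have "mk2 \<delta> e (e' + f) = (\<lambda>u. mk2 \<delta> e e' u + mk2 \<delta> e f u)" "mk2 \<delta> e (c *\<^sub>R e') = (\<lambda>u. c * mk2 \<delta> e e' u)"
  unfolding mk2_def by (auto simp: fun_eq_iff inner_add_right algebra_simps add_divide_distrib)
 then show "moll2 \<delta> \<phi> z e (e' + f) = moll2 \<delta> \<phi> z e e' + moll2 \<delta> \<phi> z e f" "moll2 \<delta> \<phi> z e (c *\<^sub>R e') = c *\<^sub>R moll2 \<delta> \<phi> z e e'"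
  unfolding moll2_def using conv_kern_add[OF kern_mk(3)[OF assms(1)] kern_mk(3)[OF assms(1)] assms(2)]
  by (simp_all add: conv_kern_cmult add_divide_distrib)
qed

lemma moll2_sym: "moll2 \<delta> \<phi> z e e' = moll2 \<delta> \<phi> z e' e"
proof -
 have "mk2 \<delta> e e' = mk2 \<delta> e' e" unfolding mk2_def by (auto simp: fun_eq_iff inner_commute)
 then show ?thesis unfolding moll2_def by simp
qed

text \<open>The constant depends on \<open>\<delta>\<close> and on the dimension, not on
  \<open>\<phi>\<close>. This uniformity is essential, because the functions to be mollified change
  with the step of the scheme and only their bound \<open>m\<close> is stable.\<close>

lemma moll_taylor:
 assumes d: "0 < \<delta>" "\<delta> \<le> 1"
 shows "\<exists>C\<ge>0. \<forall>(\<phi> :: 'a::euclidean_space \<Rightarrow> real) m. continuous_on UNIV \<phi> \<and> (\<forall>y. \<bar>\<phi> y\<bar> \<le> m) \<longrightarrow>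
  (\<forall>z e e'. \<bar>moll1 \<delta> \<phi> z e\<bar> \<le> C * m * norm e \<and> \<bar>moll2 \<delta> \<phi> z e e'\<bar> \<le> C * m * (norm e * norm e') \<and>
   (norm e \<le> 1 \<longrightarrow> \<bar>moll \<delta> \<phi> (z + e) - moll \<delta> \<phi> z - moll1 \<delta> \<phi> z e - moll2 \<delta> \<phi> z e e / 2\<bar> \<le> C * m * norm e ^ 3))"
proof -
 let ?N = "mknorm \<delta> TYPE('a)"
 let ?V = "measure lborel (cball (0::'a) \<delta>)" and ?W = "measure lborel (cball (0::'a) 2)"
 have N: "0 < ?N" by (rule mknorm_pos[OF d(1)])
 define C where "C = (8 / \<delta> * ?V + 56 / \<delta>\<^sup>2 * ?V + 8000 / \<delta> ^ 8 * ?W) / ?N"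
 have p: "0 \<le> 8 / \<delta> * ?V / ?N" "0 \<le> 56 / \<delta>\<^sup>2 * ?V / ?N" "0 \<le> 8000 / \<delta> ^ 8 * ?W / ?N"
  using d N by simp_all
 have C: "C \<ge> 0" "8 / \<delta> * ?V / ?N \<le> C" "56 / \<delta>\<^sup>2 * ?V / ?N \<le> C" "8000 / \<delta> ^ 8 * ?W / ?N \<le> C"
  unfolding C_def add_divide_distrib using p by linarith+
 show ?thesis
 proof (rule exI[of _ C], intro conjI allI impI C(1), goal_cases)
  case (1 \<phi> m z e e')
  then have m: "\<bar>\<phi> y\<bar> \<le> m" "0 \<le> m" for y by (auto intro: order_trans[of _ "\<bar>\<phi> 0\<bar>"])
  have "\<bar>conv (mk1 \<delta> e) \<phi> z\<bar> / ?N \<le> m * (8 / \<delta> * norm e) * ?V / ?N"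
   using N by (intro divide_right_mono conv_bound mk_bounds d m) auto
  also have "\<dots> = 8 / \<delta> * ?V / ?N * (m * norm e)" by simp
  also have "\<dots> \<le> C * (m * norm e)" by (rule mult_right_mono[OF C(2)]) (use m in auto)
  finally show ?case using N by (simp add: moll1_def abs_divide mult.assoc)
 next
  case (2 \<phi> m z e e')
  then have m: "\<bar>\<phi> y\<bar> \<le> m" "0 \<le> m" for y by (auto intro: order_trans[of _ "\<bar>\<phi> 0\<bar>"])
  have "\<bar>conv (mk2 \<delta> e e') \<phi> z\<bar> / ?N \<le> m * (56 / \<delta>\<^sup>2 * (norm e * norm e')) * ?V / ?N"
   using N by (intro divide_right_mono conv_bound mk_bounds d m) auto
  also have "\<dots> = 56 / \<delta>\<^sup>2 * ?V / ?N * (m * (norm e * norm e'))" by simp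
  also have "\<dots> \<le> C * (m * (norm e * norm e'))" by (rule mult_right_mono[OF C(3)]) (use m in auto)
  finally show ?case using N by (simp add: moll2_def abs_divide mult.assoc)
 next
  case (3 \<phi> m z e e')
  then have m: "\<bar>\<phi> y\<bar> \<le> m" "0 \<le> m" for y by (auto intro: order_trans[of _ "\<bar>\<phi> 0\<bar>"])
  have c: "continuous_on UNIV \<phi>" using 3 by simp
  let ?k = "\<lambda>u. mk0 \<delta> (u - e) - mk0 \<delta> u - mk1 \<delta> e u - mk2 \<delta> e e u / 2"
  note ki = kern_integrable[OF kern_mk(1)[OF d(1)] c] kern_integrable[OF kern_mk(2)[OF d(1)] c] kern_integrable[OF kern_mk(3)[OF d(1)] c]
  have "conv ?k \<phi> z = (\<integral>y. \<phi> y * mk0 \<delta> (y - (z + e)) - \<phi> y * mk0 \<delta> (y - z) - \<phi> y * mk1 \<delta> e (y - z)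
    - \<phi> y * mk2 \<delta> e e (y - z) / 2 \<partial>lborel)"
   unfolding conv_def by (simp add: algebra_simps)
  also have "\<dots> = conv (mk0 \<delta>) \<phi> (z + e) - conv (mk0 \<delta>) \<phi> z - conv (mk1 \<delta> e) \<phi> z - conv (mk2 \<delta> e e) \<phi> z / 2"
   unfolding conv_def using ki by simp
  finally have e: "moll \<delta> \<phi> (z + e) - moll \<delta> \<phi> z - moll1 \<delta> \<phi> z e - moll2 \<delta> \<phi> z e e / 2 = conv ?k \<phi> z / ?N"
   unfolding moll_def moll1_def moll2_def by (simp add: diff_divide_distrib)
  have "\<bar>conv ?k \<phi> z\<bar> / ?N \<le> m * (8000 / \<delta> ^ 8 * norm e ^ 3) * ?W / ?N"
   using N by (intro divide_right_mono conv_bound mk_taylor d m 3) auto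
  also have "\<dots> = 8000 / \<delta> ^ 8 * ?W / ?N * (m * norm e ^ 3)" by simp
  also have "\<dots> \<le> C * (m * norm e ^ 3)" by (rule mult_right_mono[OF C(4)]) (use m in auto)
  finally show ?case unfolding e using N by (simp add: abs_divide mult.assoc)
 qed
qed

text \<open>An expansion of first order in time and second order in space with an explicit
  remainder. It is kept as data \<open>a\<close>, \<open>p\<close>, \<open>Q\<close> at one point,
  because the functions constructed here are known through such estimates rather than through
  derivatives computed by rules.\<close>

definition has_jet :: "(real \<Rightarrow> 'a::real_normed_vector \<Rightarrow> real) \<Rightarrow> real \<Rightarrow> 'a \<Rightarrow> real \<Rightarrow> ('a \<Rightarrow> real) \<Rightarrow>
  ('a \<Rightarrow> 'a \<Rightarrow> real) \<Rightarrow> bool" where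
 "has_jet w t z a p Q \<longleftrightarrow> linear p \<and> (\<forall>e. linear (Q e)) \<and> (\<forall>e e'. Q e e' = Q e' e) \<and>
   (\<exists>C r. 0 < r \<and> (\<forall>t' e. \<bar>t' - t\<bar> < r \<and> norm e < r \<longrightarrow>
    \<bar>w t' (z + e) - w t z - (t' - t) * a - p e - Q e e / 2\<bar>
     \<le> C * ((t' - t)\<^sup>2 + \<bar>t' - t\<bar> * norm e + norm e ^ 3)))"

text \<open>Mollification preserves the uniform quadratic expansion in time, and
  \<open>moll_taylor\<close> expands in space. The mixed remainder arises because the time
  derivative is needed at \<open>z + e\<close> but recorded at \<open>z\<close>.\<close>

lemma moll_jet:
 fixes \<phi> :: "real \<Rightarrow> 'a::euclidean_space \<Rightarrow> real"
 assumes \<delta>: "0 < \<delta>" "\<delta> \<le> 1" and r: "0 < r"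
  and c: "\<And>t'. \<bar>t' - t\<bar> < r \<Longrightarrow> continuous_on UNIV (\<phi> t')" and c': "continuous_on UNIV \<phi>'"
  and m: "\<And>y. \<bar>\<phi> t y\<bar> \<le> m" "\<And>y. \<bar>\<phi>' y\<bar> \<le> m"
  and D: "\<And>t' y. \<bar>t' - t\<bar> < r \<Longrightarrow> \<bar>\<phi> t' y - \<phi> t y - (t' - t) * \<phi>' y\<bar> \<le> K * (t' - t)\<^sup>2"
 shows "has_jet (\<lambda>t. moll \<delta> (\<phi> t)) t z (moll \<delta> \<phi>' z) (moll1 \<delta> (\<phi> t) z) (moll2 \<delta> (\<phi> t) z)"
proof -
 have ct: "continuous_on UNIV (\<phi> t)" using c[of t] r by simp
 obtain C where C: "0 \<le> C" and T: "\<And>(\<phi> :: 'a \<Rightarrow> real) m z e e'. continuous_on UNIV \<phi> \<Longrightarrow> (\<And>y. \<bar>\<phi> y\<bar> \<le> m) \<Longrightarrow>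
   \<bar>moll1 \<delta> \<phi> z e\<bar> \<le> C * m * norm e \<and> \<bar>moll2 \<delta> \<phi> z e e'\<bar> \<le> C * m * (norm e * norm e') \<and>
   (norm e \<le> 1 \<longrightarrow> \<bar>moll \<delta> \<phi> (z + e) - moll \<delta> \<phi> z - moll1 \<delta> \<phi> z e - moll2 \<delta> \<phi> z e e / 2\<bar> \<le> C * m * norm e ^ 3)"
  using moll_taylor[OF \<delta>, where 'a='a] by (metis (no_types, lifting))
 have m0: "0 \<le> m" using m(1)[of 0] by linarith
 have "\<bar>moll \<delta> (\<phi> t') (z + e) - moll \<delta> (\<phi> t) z - (t' - t) * moll \<delta> \<phi>' z - moll1 \<delta> (\<phi> t) z e - moll2 \<delta> (\<phi> t) z e e / 2\<bar>
   \<le> (\<bar>K\<bar> + 3 * C * m) * ((t' - t)\<^sup>2 + \<bar>t' - t\<bar> * norm e + norm e ^ 3)"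
  if t': "\<bar>t' - t\<bar> < min r 1" and e: "norm e < min r 1" for t' e
 proof -
  let ?h = "t' - t" and ?N = "norm e"
  have cc: "continuous_on UNIV (\<phi> t')" using c t' by simp
  have e1: "?N \<le> 1" using e by simp
  have "\<bar>moll \<delta> (\<lambda>y. \<phi> t' y - \<phi> t y) (z + e) - moll \<delta> (\<lambda>y. ?h * \<phi>' y) (z + e)\<bar> \<le> K * ?h\<^sup>2"
   by (rule moll_dist) (use \<delta> cc ct c' D t' in \<open>auto intro!: continuous_intros\<close>)
  then have 1: "\<bar>moll \<delta> (\<phi> t') (z + e) - moll \<delta> (\<phi> t) (z + e) - ?h * moll \<delta> \<phi>' (z + e)\<bar> \<le> K * ?h\<^sup>2"
   unfolding moll_diff[OF \<delta>(1) cc ct] moll_cmult by simp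
  have 2: "\<bar>moll \<delta> \<phi>' (z + e) - moll \<delta> \<phi>' z\<bar> \<le> 3 * C * m * ?N"
  proof -
   have "?N * ?N \<le> ?N" "?N ^ 3 \<le> ?N"
    using e1 power_decreasing[of 1 3 ?N] by (simp_all add: mult_left_le)
   then have "C * m * (?N * ?N) \<le> C * m * ?N" "C * m * ?N ^ 3 \<le> C * m * ?N"
    using C m0 by (auto intro!: mult_left_mono)
   then show ?thesis using T[OF c' m(2), of z e e] e1 C m0 by (auto simp: abs_le_iff)
  qed
  then have 2: "\<bar>?h * moll \<delta> \<phi>' (z + e) - ?h * moll \<delta> \<phi>' z\<bar> \<le> 3 * C * m * (\<bar>?h\<bar> * ?N)"
   unfolding right_diff_distrib[symmetric] abs_mult
   using mult_left_mono[OF 2, of "\<bar>?h\<bar>"] by (simp add: mult_ac)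
  have 3: "\<bar>moll \<delta> (\<phi> t) (z + e) - moll \<delta> (\<phi> t) z - moll1 \<delta> (\<phi> t) z e - moll2 \<delta> (\<phi> t) z e e / 2\<bar> \<le> C * m * ?N ^ 3"
   using T[OF ct m(1), of z e e] e1 by blast
  have Cm: "0 \<le> C * m" using C m0 by simp
  have "K * ?h\<^sup>2 \<le> \<bar>K\<bar> * ?h\<^sup>2" by (intro mult_right_mono) auto
  moreover have "C * m * ?N ^ 3 \<le> 3 * C * m * ?N ^ 3" using Cm by (simp add: mult_right_mono)
  moreover have "0 \<le> 3 * C * m * ?h\<^sup>2" "0 \<le> \<bar>K\<bar> * (\<bar>?h\<bar> * ?N)" "0 \<le> \<bar>K\<bar> * ?N ^ 3" using Cm by simp_all
  moreover have "(\<bar>K\<bar> + 3 * C * m) * (?h\<^sup>2 + \<bar>?h\<bar> * ?N + ?N ^ 3) =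
   \<bar>K\<bar> * ?h\<^sup>2 + 3 * C * m * (\<bar>?h\<bar> * ?N) + 3 * C * m * ?N ^ 3 + (3 * C * m * ?h\<^sup>2 + \<bar>K\<bar> * (\<bar>?h\<bar> * ?N) + \<bar>K\<bar> * ?N ^ 3)"
   by (simp add: algebra_simps)
  ultimately show ?thesis using 1 2 3 by linarith
 qed
 then show ?thesis
  unfolding has_jet_def
  using moll1_linear[OF \<delta>(1) ct] moll2_linear[OF \<delta>(1) ct] moll2_sym r
  by (intro conjI allI exI[of _ "\<bar>K\<bar> + 3 * C * m"] exI[of _ "min r 1"]) auto
qed

text \<open>The generator of the diffusion with drift vector \<open>v\<close>, applied to
  \<open>moll \<delta> \<phi>\<close> at \<open>z\<close>.\<close>

definition gen :: "('i::finite \<Rightarrow> 'a::euclidean_space) \<Rightarrow> real \<Rightarrow> 'a \<Rightarrow> ('a \<Rightarrow> real) \<Rightarrow> 'a \<Rightarrow> real" where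
 "gen \<sigma> \<delta> v \<phi> z = moll1 \<delta> \<phi> z v + (\<Sum>i\<in>UNIV. moll2 \<delta> \<phi> z (\<sigma> i) (\<sigma> i)) / 2"

lemma gen_diff:
 assumes "0 < \<delta>" "continuous_on UNIV \<phi>" "continuous_on UNIV \<psi>"
 shows "gen \<sigma> \<delta> v (\<lambda>y. \<phi> y - \<psi> y) z = gen \<sigma> \<delta> v \<phi> z - gen \<sigma> \<delta> v \<psi> z"
 unfolding gen_def moll1_diff[OF assms] by (simp add: sum_subtractf diff_divide_distrib)

text \<open>Pairing the jumps with opposite signs cancels all terms that are odd in the noise. A
  displacement of order \<open>sqrt d\<close> leaves a cubic remainder of order
  \<open>d * sqrt d\<close>, hence \<open>sqrt d\<close> after division by \<open>d\<close>; the
  second derivative along the drift is of order \<open>d\<close> after that division. The constants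
  do not depend on \<open>\<phi>\<close> beyond its bound \<open>m\<close>.\<close>

lemma gen_consistency:
 fixes \<sigma> :: "'i::finite \<Rightarrow> 'a::euclidean_space"
 assumes \<delta>: "0 < \<delta>" "\<delta> \<le> 1" and \<beta>: "0 \<le> \<beta>"
 shows "\<exists>C\<ge>0. \<exists>d0>0. \<forall>(\<phi>::'a \<Rightarrow> real) m v z. continuous_on UNIV \<phi> \<and> (\<forall>y. \<bar>\<phi> y\<bar> \<le> m) \<and> norm v \<le> \<beta> \<longrightarrow>
   \<bar>gen \<sigma> \<delta> v \<phi> z\<bar> \<le> C * m \<and>
   (\<forall>d b g. 0 < d \<and> d \<le> d0 \<and> b z = v \<longrightarrow>
    \<bar>(stp \<sigma> d b g (moll \<delta> \<phi>) z - moll \<delta> \<phi> z) / d - gen \<sigma> \<delta> v \<phi> z - g z\<bar> \<le> C * m * sqrt d)"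
proof -
 obtain C0 where C: "0 \<le> C0" and T: "\<And>(\<phi> :: 'a \<Rightarrow> real) m z e e'. continuous_on UNIV \<phi> \<Longrightarrow> (\<And>y. \<bar>\<phi> y\<bar> \<le> m) \<Longrightarrow>
   \<bar>moll1 \<delta> \<phi> z e\<bar> \<le> C0 * m * norm e \<and> \<bar>moll2 \<delta> \<phi> z e e'\<bar> \<le> C0 * m * (norm e * norm e') \<and>
   (norm e \<le> 1 \<longrightarrow> \<bar>moll \<delta> \<phi> (z + e) - moll \<delta> \<phi> z - moll1 \<delta> \<phi> z e - moll2 \<delta> \<phi> z e e / 2\<bar> \<le> C0 * m * norm e ^ 3)"
  using moll_taylor[OF \<delta>, where 'a='a] by (metis (no_types, lifting))
 let ?n = "real CARD('i)"
 define s where "s = (\<Sum>i\<in>UNIV. norm (\<sigma> i))"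
 have s0: "0 \<le> s" unfolding s_def by (simp add: sum_nonneg)
 have si: "norm (\<sigma> i) \<le> s" for i unfolding s_def by (rule member_le_sum) auto
 define K where "K = \<beta> + sqrt ?n * s + 1"
 have K1: "1 \<le> K" unfolding K_def using \<beta> s0 by simp
 define C where "C = C0 * (\<beta> + ?n * s\<^sup>2 + \<beta>\<^sup>2 + K ^ 3)"
 have C_ge: "C0 * (\<beta> + ?n * s\<^sup>2) \<le> C" "C0 * (\<beta>\<^sup>2 + K ^ 3) \<le> C" "0 \<le> C"
  unfolding C_def using C \<beta> K1 by (auto intro!: mult_left_mono)
 show ?thesis
 \<comment> \<open>Displacements are at most \<open>sqrt d * K\<close>, so
   \<open>1 / K\<^sup>2\<close> keeps them within the unit ball in which \<open>moll_taylor\<close>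
   is valid.\<close>
 proof (rule exI[of _ C], rule conjI[OF C_ge(3)], rule exI[of _ "1 / K\<^sup>2"], intro conjI allI impI, goal_cases)
  case 1 show ?case using K1 by simp
 next
  case (2 \<phi> m v z)
  then have c: "continuous_on UNIV \<phi>" and m: "\<And>y. \<bar>\<phi> y\<bar> \<le> m" and v: "norm v \<le> \<beta>" by auto
  have m0: "0 \<le> C0 * m" using m[of 0] C by (intro mult_nonneg_nonneg) linarith+
  have "\<bar>moll1 \<delta> \<phi> z v\<bar> \<le> C0 * m * \<beta>"
   using T[OF c m, of z v v] mult_left_mono[OF v m0] by linarith
  moreover have "\<bar>\<Sum>i\<in>(UNIV::'i set). moll2 \<delta> \<phi> z (\<sigma> i) (\<sigma> i)\<bar> \<le> (\<Sum>i\<in>(UNIV::'i set). C0 * m * s\<^sup>2)"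
  proof (rule order_trans[OF sum_abs sum_mono])
   fix i
   have "norm (\<sigma> i) * norm (\<sigma> i) \<le> s\<^sup>2" unfolding power2_eq_square by (intro mult_mono si s0 norm_ge_zero)
   then show "\<bar>moll2 \<delta> \<phi> z (\<sigma> i) (\<sigma> i)\<bar> \<le> C0 * m * s\<^sup>2"
    using T[OF c m, of z "\<sigma> i" "\<sigma> i"] mult_left_mono[OF _ m0] by (meson order_trans)
  qed
  moreover have "0 \<le> ?n * (C0 * m * s\<^sup>2)" using m0 by simp
  ultimately have "\<bar>gen \<sigma> \<delta> v \<phi> z\<bar> \<le> C0 * m * \<beta> + ?n * (C0 * m * s\<^sup>2)"
   unfolding gen_def by (simp add: abs_le_iff)
  also have "\<dots> = C0 * (\<beta> + ?n * s\<^sup>2) * m" by (simp add: algebra_simps)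
  also have "\<dots> \<le> C * m" using C_ge m[of 0] by (intro mult_right_mono) linarith+
  finally show ?case .
 next
  case (3 \<phi> m v z d b g)
  then have c: "continuous_on UNIV \<phi>" and m: "\<And>y. \<bar>\<phi> y\<bar> \<le> m" and v: "norm v \<le> \<beta>"
   and d: "0 < d" "d \<le> 1 / K\<^sup>2" and bz: "b z = v" by auto
  have m0: "0 \<le> C0 * m" using m[of 0] C by (intro mult_nonneg_nonneg) linarith+
  let ?r = "sqrt d"
  have "?r \<le> sqrt (1 / K\<^sup>2)" using d by (intro real_sqrt_le_mono)
  then have rK: "?r * K \<le> 1" using K1 by (simp add: real_sqrt_divide pos_le_divide_eq)
  have r1: "?r \<le> 1" using rK mult_left_mono[OF K1, of ?r] d by linarith
  have rr: "?r * ?r = d" using d by simp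
  have dr: "d \<le> ?r" using r1 mult_left_mono[of ?r 1 ?r] rr d by simp
  define w where "w i = sqrt (?n * d) *\<^sub>R \<sigma> i" for i
  have wn: "norm (w i) \<le> ?r * (sqrt ?n * s)" for i
   unfolding w_def using si[of i] d by (simp add: real_sqrt_mult mult_left_mono mult.commute mult.left_commute)
  have dv: "norm (d *\<^sub>R v) \<le> ?r * \<beta>" using v dr d by (simp add: mult_mono)
  have ne: "norm (d *\<^sub>R v + w i) \<le> ?r * K" "norm (d *\<^sub>R v - w i) \<le> ?r * K" for i
  proof -
   have "?r * K = ?r * \<beta> + ?r * (sqrt ?n * s) + ?r" by (simp add: K_def algebra_simps)
   moreover have "0 \<le> ?r" using d by simp
   ultimately have "norm (d *\<^sub>R v) + norm (w i) \<le> ?r * K" using dv wn[of i] by linarith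
   then show "norm (d *\<^sub>R v + w i) \<le> ?r * K" "norm (d *\<^sub>R v - w i) \<le> ?r * K"
    using norm_triangle_ineq[of "d *\<^sub>R v" "w i"] norm_triangle_ineq4[of "d *\<^sub>R v" "w i"] by linarith+
  qed
  let ?Q = "moll2 \<delta> \<phi> z" and ?p = "moll1 \<delta> \<phi> z"
  have lp: "linear ?p" "linear (?Q e)" for e by (intro moll1_linear moll2_linear \<delta> c)+
  have R: "\<bar>moll \<delta> \<phi> (z + e) - moll \<delta> \<phi> z - ?p e - ?Q e e / 2\<bar> \<le> C0 * m * (K ^ 3 * (d * ?r))" if "norm e \<le> ?r * K" for e
  proof -
   have "norm e ^ 3 \<le> (?r * K) ^ 3" using that by (intro power_mono) auto
   also have "\<dots> = K ^ 3 * (d * ?r)" using rr by (simp add: power_mult_distrib power3_eq_cube)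
   finally show ?thesis using T[OF c m, of z e e] mult_left_mono[OF _ m0] rK that by (meson order_trans)
  qed
  have Qadd: "?Q (x + y) (x + y) + ?Q (x - y) (x - y) = 2 * ?Q x x + 2 * ?Q y y" for x y
  proof -
   have q: "?Q (a + b) e = ?Q a e + ?Q b e" "?Q (a - b) e = ?Q a e - ?Q b e" for a b e
    unfolding moll2_sym[of \<delta> \<phi> z _ e] using linear_add[OF lp(2)] linear_diff[OF lp(2)] by auto
   show ?thesis unfolding q linear_add[OF lp(2)] linear_diff[OF lp(2)] using moll2_sym[of \<delta> \<phi> z x y]
    by simp
  qed
  have Qs: "?Q (a *\<^sub>R x) (a *\<^sub>R x) = a\<^sup>2 * ?Q x x" for a x
   using linear_scale[OF lp(2)] moll2_sym[of \<delta> \<phi> z "a *\<^sub>R x" x] by (simp add: power2_eq_square)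
  let ?A = "\<lambda>i. moll \<delta> \<phi> (z + d *\<^sub>R b z + w i) + moll \<delta> \<phi> (z + d *\<^sub>R b z - w i)"
  let ?B = "\<lambda>i. 2 * moll \<delta> \<phi> z + 2 * d * ?p v + d\<^sup>2 * ?Q v v + ?n * d * ?Q (\<sigma> i) (\<sigma> i)"
  have AB: "\<bar>?A i - ?B i\<bar> \<le> 2 * (C0 * m * (K ^ 3 * (d * ?r)))" for i
  proof -
   have "?p (d *\<^sub>R v + w i) + ?p (d *\<^sub>R v - w i) = 2 * d * ?p v"
    using linear_add[OF lp(1)] linear_diff[OF lp(1)] linear_scale[OF lp(1)] by simp
   moreover have "?Q (d *\<^sub>R v + w i) (d *\<^sub>R v + w i) + ?Q (d *\<^sub>R v - w i) (d *\<^sub>R v - w i)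
     = 2 * (d\<^sup>2 * ?Q v v) + 2 * (?n * d * ?Q (\<sigma> i) (\<sigma> i))"
    unfolding Qadd Qs w_def using d by simp
   moreover have e: "z + d *\<^sub>R b z + w i = z + (d *\<^sub>R v + w i)" "z + d *\<^sub>R b z - w i = z + (d *\<^sub>R v - w i)"
    by (simp_all add: bz algebra_simps)
   ultimately show ?thesis using R[OF ne(1)[of i]] R[OF ne(2)[of i]] unfolding e by linarith
  qed
  have "\<bar>(\<Sum>i\<in>UNIV. ?A i) - (\<Sum>i\<in>UNIV. ?B i)\<bar> \<le> (\<Sum>i\<in>(UNIV::'i set). 2 * (C0 * m * (K ^ 3 * (d * ?r))))"
   unfolding sum_subtractf[symmetric] by (rule order_trans[OF sum_abs sum_mono]) (rule AB)
  then have "\<bar>(\<Sum>i\<in>UNIV. ?A i) - (\<Sum>i\<in>UNIV. ?B i)\<bar> / (2 * ?n * d) \<le> C0 * m * (K ^ 3 * ?r)"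
   using d by (simp add: divide_le_eq mult_ac)
  moreover have "(stp \<sigma> d b g (moll \<delta> \<phi>) z - moll \<delta> \<phi> z) / d - gen \<sigma> \<delta> v \<phi> z - g z
    = ((\<Sum>i\<in>UNIV. ?A i) - (\<Sum>i\<in>UNIV. ?B i)) / (2 * ?n * d) + d * ?Q v v / 2"
   unfolding stp_def w_def[symmetric] gen_def using d
   by (simp add: sum.distrib sum_distrib_left[symmetric] field_simps power2_eq_square)
  moreover have "\<bar>d * ?Q v v / 2\<bar> \<le> C0 * m * (\<beta>\<^sup>2 * ?r)"
  proof -
   have "norm v * norm v \<le> \<beta>\<^sup>2" unfolding power2_eq_square using v \<beta> by (intro mult_mono) auto
   then have "\<bar>?Q v v\<bar> \<le> C0 * m * \<beta>\<^sup>2"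
    using T[OF c m, of z v v] mult_left_mono[OF _ m0] by (meson order_trans)
   then have "d * \<bar>?Q v v\<bar> \<le> ?r * (C0 * m * \<beta>\<^sup>2)" using dr d by (intro mult_mono) auto
   moreover have "\<bar>d * ?Q v v / 2\<bar> = d * \<bar>?Q v v\<bar> / 2" using d by (simp add: abs_mult)
   moreover have "0 \<le> d * \<bar>?Q v v\<bar>" "?r * (C0 * m * \<beta>\<^sup>2) = C0 * m * (\<beta>\<^sup>2 * ?r)" using d by simp_all
   ultimately show ?thesis by linarith
  qed
  moreover have "\<bar>((\<Sum>i\<in>UNIV. ?A i) - (\<Sum>i\<in>UNIV. ?B i)) / (2 * ?n * d)\<bar> = \<bar>(\<Sum>i\<in>UNIV. ?A i) - (\<Sum>i\<in>UNIV. ?B i)\<bar> / (2 * ?n * d)"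
   using d by (simp add: abs_divide)
  ultimately have "\<bar>(stp \<sigma> d b g (moll \<delta> \<phi>) z - moll \<delta> \<phi> z) / d - gen \<sigma> \<delta> v \<phi> z - g z\<bar>
    \<le> C0 * m * (K ^ 3 * ?r) + C0 * m * (\<beta>\<^sup>2 * ?r)" by linarith
  also have "\<dots> = C0 * (\<beta>\<^sup>2 + K ^ 3) * m * ?r" by (simp add: algebra_simps)
  also have "\<dots> \<le> C * m * ?r" using C_ge m[of 0] d by (intro mult_right_mono) auto
  finally show ?case .
 qed
qed

context one_control
begin

lemma moll_stp_commutator:
 assumes \<delta>: "0 < \<delta>" and \<phi>: "lip \<Lambda> \<phi>"
 shows "\<bar>moll \<delta> (S \<phi>) z - S (moll \<delta> \<phi>) z\<bar> \<le> d * (\<delta> * (L * (\<Lambda> + 1)))"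
proof -
 let ?n = "real CARD('i)"
 define w where "w i = sqrt (?n * d) *\<^sub>R \<sigma> i" for i
 define F where "F = stp \<sigma> d (\<lambda>_. b z) (\<lambda>_. g z) \<phi>"
 note \<Lambda> = lip_nonneg[OF \<phi>]
 have lF: "lip \<Lambda> F"
  using stp_lip[OF \<phi>, of "\<lambda>_. b z" 0 "\<lambda>_. g z" d \<sigma>] d_pos \<Lambda> unfolding F_def by (simp add: lip_def)
 have lS: "lip ((1 + d * L) * \<Lambda> + d * L) (S \<phi>)"
  using stp_lip[OF \<phi> b_lip g_lip, of d \<sigma>] d_pos \<Lambda> by simp
 have cc: "continuous_on UNIV \<phi>" "continuous_on UNIV F" "continuous_on UNIV (S \<phi>)"
  using \<phi> lF lS by (auto intro: lip_continuous)
 have near: "\<bar>(S \<phi> y - F y) - 0\<bar> \<le> d * (\<delta> * (L * (\<Lambda> + 1)))" if y: "norm (y - z) \<le> \<delta>" for y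
 proof -
  have Ly: "L * norm (y - z) \<le> L * \<delta>" using y L_ge by (intro mult_left_mono) auto
  have s: "\<bar>\<phi> (y + d *\<^sub>R b y + v) - \<phi> (y + d *\<^sub>R b z + v)\<bar> \<le> \<Lambda> * (d * (L * \<delta>))" for v
  proof -
   have "norm ((y + d *\<^sub>R b y + v) - (y + d *\<^sub>R b z + v)) = d * norm (b y - b z)"
    using d_pos by (simp add: scaleR_diff_right[symmetric])
   also have "\<dots> \<le> d * (L * \<delta>)"
    using order_trans[OF b_lip Ly] d_pos by (intro mult_left_mono) auto
   finally show ?thesis using lipD[OF \<phi>] mult_left_mono[OF _ \<Lambda>] by (meson order_trans)
  qed
  define D where "D i = (\<phi> (y + d *\<^sub>R b y + w i) - \<phi> (y + d *\<^sub>R b z + w i))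
    + (\<phi> (y + d *\<^sub>R b y - w i) - \<phi> (y + d *\<^sub>R b z - w i))" for i
  have 1: "S \<phi> y - F y = (\<Sum>i\<in>UNIV. D i) / (2 * ?n) + d * (g y - g z)"
   unfolding F_def stp_def w_def[symmetric] D_def
   by (simp add: sum_subtractf sum.distrib algebra_simps diff_divide_distrib add_divide_distrib)
  have 2: "\<bar>d * (g y - g z)\<bar> \<le> d * (L * \<delta>)"
   using order_trans[OF lipD[OF g_lip] Ly] d_pos by (simp add: abs_mult)
  have "\<bar>\<Sum>i\<in>UNIV. D i\<bar> \<le> (\<Sum>i\<in>(UNIV::'i set). 2 * (\<Lambda> * (d * (L * \<delta>))))"
  proof (rule order_trans[OF sum_abs sum_mono])
   show "\<bar>D i\<bar> \<le> 2 * (\<Lambda> * (d * (L * \<delta>)))" for i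
    using s[of "w i"] s[of "- w i"] unfolding D_def by simp
  qed
  then have "\<bar>(\<Sum>i\<in>UNIV. D i) / (2 * ?n)\<bar> \<le> \<Lambda> * (d * (L * \<delta>))"
   by (simp add: abs_divide divide_le_eq mult_ac)
  then have "\<bar>S \<phi> y - F y\<bar> \<le> \<Lambda> * (d * (L * \<delta>)) + d * (L * \<delta>)"
   unfolding 1 using 2 by linarith
  then show ?thesis by (simp add: algebra_simps)
 qed
 have "\<bar>moll \<delta> (\<lambda>y. S \<phi> y - F y) z - 0\<bar> \<le> d * (\<delta> * (L * (\<Lambda> + 1)))"
  by (rule moll_near[OF \<delta> _ near]) (intro continuous_intros cc)
 moreover have "moll \<delta> F z = S (moll \<delta> \<phi>) z"
 proof -
  have sh: "continuous_on UNIV (\<lambda>y. \<phi> (y + v))" for v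
   by (rule continuous_on_compose2[OF cc(1)]) (auto intro!: continuous_intros)
  have sm: "moll \<delta> (\<lambda>y. \<Sum>i\<in>I. \<phi> (y + u i) + \<phi> (y + v i)) z = (\<Sum>i\<in>I. moll \<delta> \<phi> (z + u i) + moll \<delta> \<phi> (z + v i))"
   if "finite I" for I :: "'i set" and u v
   using that
  proof (induction I)
   case empty then show ?case using moll_const[OF \<delta>, of 0 z] by simp
  next
   case (insert i I)
   then show ?case
    by (simp add: moll_add[OF \<delta>] continuous_on_add continuous_on_sum sh moll_shift)
  qed
  let ?u = "\<lambda>i. d *\<^sub>R b z + w i" and ?v = "\<lambda>i. d *\<^sub>R b z - w i"
  have "F = (\<lambda>y. 1 / (2 * ?n) * (\<Sum>i\<in>UNIV. \<phi> (y + ?u i) + \<phi> (y + ?v i)) + d * g z)"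
   unfolding F_def stp_def w_def[symmetric] by (simp add: add.assoc add_diff_eq fun_eq_iff)
  moreover have "continuous_on UNIV (\<lambda>y. 1 / (2 * ?n) * (\<Sum>i\<in>UNIV. \<phi> (y + ?u i) + \<phi> (y + ?v i)))"
   by (intro continuous_intros sh)
  ultimately have "moll \<delta> F z = 1 / (2 * ?n) * (\<Sum>i\<in>UNIV. moll \<delta> \<phi> (z + ?u i) + moll \<delta> \<phi> (z + ?v i)) + d * g z"
   by (simp add: moll_add[OF \<delta>] moll_const[OF \<delta>] moll_cmult[where \<delta>=\<delta> and c="1 / (2 * ?n)"] sm del: times_divide_eq_left)
  then show ?thesis unfolding stp_def w_def[symmetric] by (simp add: add.assoc add_diff_eq)
 qed
 ultimately show ?thesis by (simp add: moll_diff[OF \<delta> cc(3,2)])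
qed


end

text \<open>Names the constants of \<open>gen_consistency\<close> so that they can be fixed before
  the step \<open>d\<close>: they depend on the noise, on \<open>\<delta>\<close> and on the drift
  bound \<open>\<beta>\<close> only.\<close>

definition gen_const :: "('i::finite \<Rightarrow> 'a::euclidean_space) \<Rightarrow> real \<Rightarrow> real \<Rightarrow> real \<Rightarrow> real \<Rightarrow> bool" where
 "gen_const \<sigma> \<delta> \<beta> C d0 \<longleftrightarrow> 0 \<le> C \<and> 0 < d0 \<and>
   (\<forall>(\<phi>::'a \<Rightarrow> real) m v z. continuous_on UNIV \<phi> \<and> (\<forall>y. \<bar>\<phi> y\<bar> \<le> m) \<and> norm v \<le> \<beta> \<longrightarrow>
   \<bar>gen \<sigma> \<delta> v \<phi> z\<bar> \<le> C * m \<and>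
   (\<forall>d b g. 0 < d \<and> d \<le> d0 \<and> b z = v \<longrightarrow>
    \<bar>(stp \<sigma> d b g (moll \<delta> \<phi>) z - moll \<delta> \<phi> z) / d - gen \<sigma> \<delta> v \<phi> z - g z\<bar> \<le> C * m * sqrt d))"

lemma gen_const_exists:
 assumes "0 < \<delta>" "\<delta> \<le> 1" "0 \<le> \<beta>"
 obtains C d0 where "gen_const \<sigma> \<delta> \<beta> C d0"
 using gen_consistency[OF assms, of \<sigma>] unfolding gen_const_def by blast

lemma gen_dist:
 assumes "gen_const \<sigma> \<delta> \<beta> C d0" "0 < \<delta>" "continuous_on UNIV \<phi>" "continuous_on UNIV \<psi>" "\<And>y. \<bar>\<phi> y - \<psi> y\<bar> \<le> c" "norm v \<le> \<beta>"
 shows "\<bar>gen \<sigma> \<delta> v \<phi> z - gen \<sigma> \<delta> v \<psi> z\<bar> \<le> C * c"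
proof -
 have "continuous_on UNIV (\<lambda>y. \<phi> y - \<psi> y)" by (intro continuous_intros assms)
 then show ?thesis
  using assms(1,5,6) unfolding gen_const_def gen_diff[OF assms(2-4), symmetric] by blast
qed

lemma has_real_derivative_quadratic:
 assumes "\<And>y. y \<in> S \<Longrightarrow> \<bar>F y - F x - (y - x) * a\<bar> \<le> C * (y - x)\<^sup>2"
 shows "(F has_real_derivative a) (at x within S)"
proof -
 have "((\<lambda>y. (F y - F x) / (y - x) - a) \<longlongrightarrow> 0) (at x within S)"
 proof (rule Lim_null_comparison)
  show "\<forall>\<^sub>F y in at x within S. norm ((F y - F x) / (y - x) - a) \<le> \<bar>C\<bar> * \<bar>y - x\<bar>"
   unfolding eventually_at_filter
  proof (rule always_eventually, intro allI impI)
   fix y assume y: "y \<noteq> x" "y \<in> S"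
   have "\<bar>(F y - F x) / (y - x) - a\<bar> = \<bar>F y - F x - (y - x) * a\<bar> / \<bar>y - x\<bar>"
   proof -
    have "(F y - F x) / (y - x) - a = (F y - F x - (y - x) * a) / (y - x)"
     using y by (simp add: diff_divide_distrib)
    then show ?thesis by (simp only: abs_divide)
   qed
   also have "\<dots> \<le> \<bar>C\<bar> * (y - x)\<^sup>2 / \<bar>y - x\<bar>"
    using assms[OF y(2)] mult_right_mono[OF abs_ge_self[of C], of "(y - x)\<^sup>2"]
    by (intro divide_right_mono) auto
   also have "\<dots> = \<bar>C\<bar> * \<bar>y - x\<bar>"
    using y unfolding power2_eq_square abs_mult_self_eq[of "y - x", symmetric]
    by (simp del: abs_mult_self_eq)
   finally show "norm ((F y - F x) / (y - x) - a) \<le> \<bar>C\<bar> * \<bar>y - x\<bar>" by simp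
  qed
  show "((\<lambda>y. \<bar>C\<bar> * \<bar>y - x\<bar>) \<longlongrightarrow> 0) (at x within S)"
   by (intro tendsto_eq_intros | simp)+
 qed
 then show ?thesis
  unfolding has_field_derivative_iff by (simp add: LIM_zero_iff)
qed

context one_control
begin

text \<open>The derivative of \<open>P r \<phi> y\<close> in \<open>r\<close>, written as the
  right-hand side of the evolution equation.\<close>

definition Pd :: "real \<Rightarrow> ('a \<Rightarrow> real) \<Rightarrow> 'a \<Rightarrow> real" where
 "Pd r \<phi> y = (S (P r \<phi>) y - P r \<phi> y) / d"

lemma Pd_props:
 assumes "lip \<Lambda> \<phi>" "\<And>y. 0 \<le> \<phi> y" "\<And>y. \<phi> y \<le> M" "0 \<le> r"
 shows "continuous_on UNIV (P r \<phi>)" "continuous_on UNIV (S (P r \<phi>))" "continuous_on UNIV (Pd r \<phi>)"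
  "\<bar>Pd r \<phi> y\<bar> \<le> (M + r * B + d * B) / d"
proof -
 note l = P_lip[OF assms]
 note b = P_bounds[of \<phi> M, OF assms(2-4)]
 show c: "continuous_on UNIV (P r \<phi>)" by (rule lip_continuous[OF l])
 show c2: "continuous_on UNIV (S (P r \<phi>))"
  using stp_lip[OF l b_lip g_lip, of d \<sigma>] d_pos lip_nonneg[OF l] by (auto intro: lip_continuous)
 show "continuous_on UNIV (Pd r \<phi>)" unfolding Pd_def[abs_def] by (intro continuous_intros c c2) (use d_pos in auto)
 have "0 \<le> S (P r \<phi>) y" "S (P r \<phi>) y \<le> M + r * B + d * B"
  using stp_const_bounds[where m=0 and \<phi>="P r \<phi>" and M="M + r * B" and \<sigma>=\<sigma> and b=b and g=g and B=B
    and d=d and z=y] b g_bounds d_pos by simp_all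
 moreover have "0 \<le> d * B" using d_pos B_nonneg by simp
 ultimately have "\<bar>S (P r \<phi>) y - P r \<phi> y\<bar> \<le> M + r * B + d * B" using b[of y] by linarith
 then show "\<bar>Pd r \<phi> y\<bar> \<le> (M + r * B + d * B) / d" unfolding Pd_def using d_pos by (simp add: abs_divide divide_right_mono)
qed

lemma P_quadratic:
 assumes "\<And>y. 0 \<le> \<phi> y" "\<And>y. \<phi> y \<le> M" "0 \<le> r" "0 \<le> r'"
 shows "\<bar>P r' \<phi> y - P r \<phi> y - (r' - r) * Pd r \<phi> y\<bar> \<le> 2 * (M + d * B) / d\<^sup>2 * (r' - r)\<^sup>2"
 unfolding Pd_def by (rule P_time) (use assms in auto)

text \<open>The constant deteriorates as \<open>d\<close> tends to 0. It serves only to show that a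
  barrier made from \<open>P r \<phi>\<close> is Lipschitz in time with some constant.\<close>

lemma P_time_lip:
 assumes "lip \<Lambda> \<phi>" "\<And>y. 0 \<le> \<phi> y" "\<And>y. \<phi> y \<le> M" "0 \<le> r" "0 \<le> r'" "r \<le> R" "r' \<le> R"
 shows "\<bar>P r' \<phi> y - P r \<phi> y\<bar> \<le> (M + R * B + d * B) / d * \<bar>r' - r\<bar>"
proof -
 have "norm (P r' \<phi> y - P r \<phi> y) \<le> (M + R * B + d * B) / d * norm (r' - r)"
 proof (rule field_differentiable_bound[of "{0..R}" "\<lambda>r. P r \<phi> y" "\<lambda>r. Pd r \<phi> y"])
  fix s assume s: "s \<in> {0..R}"
  show "((\<lambda>r. P r \<phi> y) has_real_derivative Pd s \<phi> y) (at s within {0..R})"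
   by (rule has_real_derivative_quadratic[where C="2 * (M + d * B) / d\<^sup>2"]) (use s P_quadratic[of \<phi> M] assms in auto)
  have "s * B \<le> R * B" using s B_nonneg by (intro mult_right_mono) auto
  then show "norm (Pd s \<phi> y) \<le> (M + R * B + d * B) / d"
   using Pd_props(4)[OF assms(1,2,3), of s y] s d_pos
   by (auto intro!: order_trans[OF Pd_props(4)[OF assms(1,2,3), of s y]] divide_right_mono)
 qed (use assms in auto)
 then show ?thesis by simp
qed

text \<open>The remainder of \<open>P_quadratic\<close> is uniform in space and so survives
  mollification. At \<open>r = 0\<close> the claim concerns the derivative from the right.\<close>

lemma moll_P_deriv:
 assumes \<delta>: "0 < \<delta>" and \<phi>: "lip \<Lambda> \<phi>" "\<And>y. 0 \<le> \<phi> y" "\<And>y. \<phi> y \<le> M" and r: "0 \<le> r"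
 shows "((\<lambda>r. moll \<delta> (P r \<phi>) z) has_real_derivative moll \<delta> (Pd r \<phi>) z) (at r within {0..})"
proof (rule has_real_derivative_quadratic)
 fix r' :: real assume r': "r' \<in> {0..}"
 note c = Pd_props(1)[OF \<phi>, of r'] Pd_props(1)[OF \<phi> r] Pd_props(3)[OF \<phi> r]
 have "\<bar>moll \<delta> (\<lambda>y. P r' \<phi> y - P r \<phi> y) z - moll \<delta> (\<lambda>y. (r' - r) * Pd r \<phi> y) z\<bar>
   \<le> 2 * (M + d * B) / d\<^sup>2 * (r' - r)\<^sup>2"
  by (rule moll_dist[OF \<delta>]) (use c r r' P_quadratic[of \<phi> M, OF \<phi>(2,3)] in \<open>auto intro!: continuous_intros\<close>)
 then show "\<bar>moll \<delta> (P r' \<phi>) z - moll \<delta> (P r \<phi>) z - (r' - r) * moll \<delta> (Pd r \<phi>) z\<bar> \<le> 2 * (M + d * B) / d\<^sup>2 * (r' - r)\<^sup>2"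
  using c r' by (simp add: moll_diff[OF \<delta>] moll_cmult)
qed

text \<open>The time derivative of the mollified evolution is a step applied to the mollified
  function, up to the commutator, and that step is consistent with the generator. Hence
  \<open>moll \<delta> (P r \<phi>)\<close> solves the linear equation up to an error made small by
  first choosing \<open>\<delta>\<close> and then \<open>d\<close>.\<close>

lemma moll_Pd:
 assumes G: "gen_const \<sigma> \<delta> \<beta> C d0" and d: "d \<le> d0" and b: "norm (b z) \<le> \<beta>" and \<delta>: "0 < \<delta>"
  and \<phi>: "lip \<Lambda> \<phi>" "\<And>y. 0 \<le> \<phi> y" "\<And>y. \<phi> y \<le> M" and r: "0 \<le> r"
  and m: "M + r * B \<le> m" and \<Lambda>': "exp (r * L) * (\<Lambda> + 1) - 1 \<le> \<Lambda>'"
 shows "\<bar>moll \<delta> (Pd r \<phi>) z - gen \<sigma> \<delta> (b z) (P r \<phi>) z - g z\<bar> \<le> \<delta> * (L * (\<Lambda>' + 1)) + C * m * sqrt d"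
proof -
 let ?u = "P r \<phi>"
 note c = Pd_props[OF \<phi> r]
 have l: "lip \<Lambda>' ?u" using P_lip[OF \<phi> r] \<Lambda>' by (rule lip_mono)
 have um: "\<bar>?u y\<bar> \<le> m" for y using P_bounds[of \<phi> M r y, OF \<phi>(2,3) r] m by simp
 have 1: "\<bar>(S (moll \<delta> ?u) z - moll \<delta> ?u z) / d - gen \<sigma> \<delta> (b z) ?u z - g z\<bar> \<le> C * m * sqrt d"
  using G c(1) um b d d_pos unfolding gen_const_def by blast
 have "Pd r \<phi> = (\<lambda>y. (1 / d) * (S ?u y - ?u y))" unfolding Pd_def by auto
 then have 2: "moll \<delta> (Pd r \<phi>) z = (1 / d) * (moll \<delta> (S ?u) z - moll \<delta> ?u z)"
  using moll_diff[OF \<delta> c(2,1)] moll_cmult[of \<delta> "1 / d" "\<lambda>y. S ?u y - ?u y" z] by metis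
 have "\<bar>moll \<delta> (S ?u) z - S (moll \<delta> ?u) z\<bar> / d \<le> \<delta> * (L * (\<Lambda>' + 1))"
  using moll_stp_commutator[OF \<delta> l, of z] d_pos by (simp add: divide_le_eq mult.commute)
 then have "\<bar>(moll \<delta> (S ?u) z - S (moll \<delta> ?u) z) / d\<bar> \<le> \<delta> * (L * (\<Lambda>' + 1))"
  using d_pos by (simp add: abs_divide)
 moreover have "moll \<delta> (Pd r \<phi>) z = (moll \<delta> (S ?u) z - S (moll \<delta> ?u) z) / d + (S (moll \<delta> ?u) z - moll \<delta> ?u z) / d"
  unfolding 2 by (simp add: add_divide_distrib[symmetric])
 ultimately show ?thesis using 1 by linarith
qed

end

section \<open>Continuity of the evolution at time zero, uniformly in the step\<close>

text \<open>Increments of single steps would give a rate of order \<open>1 / d\<close>. The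
  mollified function, however, moves at a speed bounded in terms of \<open>\<delta>\<close> alone by
  \<open>moll_Pd\<close>, and mollification costs at most the Lipschitz constant times
  \<open>\<delta>\<close> at either end. So the time \<open>s0\<close> can be chosen before
  \<open>d\<close>.\<close>

lemma P_near_id:
 fixes \<sigma> :: "'i::finite \<Rightarrow> 'a::euclidean_space"
 assumes \<eta>: "0 < \<eta>" and \<Lambda>: "0 \<le> \<Lambda>" and M: "0 \<le> M" and L: "1 \<le> L" and B: "0 \<le> B" and \<beta>: "0 \<le> \<beta>"
 shows "\<exists>s0 d0. 0 < s0 \<and> 0 < d0 \<and> (\<forall>d (b::'a \<Rightarrow> 'a) g \<phi> r z. one_control d b g L B \<and> d \<le> d0 \<and> (\<forall>z. norm (b z) \<le> \<beta>)
   \<and> lip \<Lambda> \<phi> \<and> (\<forall>y. 0 \<le> \<phi> y \<and> \<phi> y \<le> M) \<and> 0 \<le> r \<and> r \<le> s0 \<longrightarrow> \<bar>ev \<sigma> d b g r \<phi> z - \<phi> z\<bar> \<le> \<eta>)"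
proof -
 define \<Lambda>' where "\<Lambda>' = exp L * (\<Lambda> + 1)"
 have L1: "1 \<le> exp L" using L by simp
 have \<Lambda>': "\<Lambda> + 1 \<le> \<Lambda>'" unfolding \<Lambda>'_def using mult_right_mono[OF L1, of "\<Lambda> + 1"] \<Lambda> by simp
 define m where "m = M + B"
 \<comment> \<open>Each of the two mollification errors gets \<open>\<eta> / 4\<close>; the motion
   of the mollified function, at speed at most \<open>K\<close> during time \<open>s0\<close>, gets
   the remaining \<open>\<eta> / 2\<close>.\<close>
 define \<delta> where "\<delta> = min 1 (\<eta> / (4 * \<Lambda>'))"
 have \<delta>: "0 < \<delta>" "\<delta> \<le> 1" unfolding \<delta>_def using \<eta> \<Lambda>' \<Lambda> by auto
 have "\<Lambda>' * \<delta> \<le> \<Lambda>' * (\<eta> / (4 * \<Lambda>'))" unfolding \<delta>_def using \<Lambda>' \<Lambda> by (intro mult_left_mono) auto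
 also have "\<dots> = \<eta> / 4" using \<Lambda>' \<Lambda> by simp
 finally have \<Lambda>\<delta>: "\<Lambda>' * \<delta> \<le> \<eta> / 4" .
 obtain C d0 where G: "gen_const \<sigma> \<delta> \<beta> C d0" using gen_const_exists[OF \<delta> \<beta>] by blast
 then have C: "0 \<le> C" "0 < d0" by (auto simp: gen_const_def)
 define K where "K = 2 * (C * m) + B + \<delta> * (L * (\<Lambda>' + 1)) + 1"
 have K: "0 < K" unfolding K_def m_def using C B M L \<delta> \<Lambda>' \<Lambda> by (intro add_nonneg_pos add_nonneg_nonneg) auto
 define s0 where "s0 = min 1 (\<eta> / (2 * K))"
 have s0: "0 < s0" "s0 \<le> 1" unfolding s0_def using \<eta> K by auto
 have "K * s0 \<le> K * (\<eta> / (2 * K))" unfolding s0_def using K by (intro mult_left_mono) auto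
 also have "\<dots> = \<eta> / 2" using K by simp
 finally have Ks: "K * s0 \<le> \<eta> / 2" .
 show ?thesis
 proof (rule exI[of _ s0], rule exI[of _ "min d0 1"], intro conjI allI impI s0(1), goal_cases)
  case 1 show ?case using C by simp
 next
  case (2 d b g \<phi> r z)
  then interpret one_control \<sigma> d b g L B by simp
  have \<phi>: "lip \<Lambda> \<phi>" "\<And>y. 0 \<le> \<phi> y" "\<And>y. \<phi> y \<le> M" and r: "0 \<le> r" "r \<le> s0" and bb: "\<And>z. norm (b z) \<le> \<beta>"
   and d: "d \<le> d0" "d \<le> 1" using 2 by auto
  have ex: "exp (s * L) * (\<Lambda> + 1) - 1 \<le> \<Lambda>'" if "s \<le> s0" for s
  proof -
   have "s * L \<le> 1 * L" using that s0 L by (intro mult_right_mono) auto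
   then have "exp (s * L) * (\<Lambda> + 1) \<le> \<Lambda>'" unfolding \<Lambda>'_def using \<Lambda> by (intro mult_right_mono) auto
   then show ?thesis by simp
  qed
  have sB: "s * B \<le> B" if "s \<le> s0" for s using that s0 mult_right_mono[of s 1 B] B by simp
  have "norm (moll \<delta> (P r \<phi>) z - moll \<delta> (P 0 \<phi>) z) \<le> K * norm (r - 0)"
  proof (rule field_differentiable_bound[of "{0..s0}" "\<lambda>r. moll \<delta> (P r \<phi>) z" "\<lambda>r. moll \<delta> (Pd r \<phi>) z"])
   fix s assume s: "s \<in> {0..s0}"
   show "((\<lambda>r. moll \<delta> (P r \<phi>) z) has_real_derivative moll \<delta> (Pd s \<phi>) z) (at s within {0..s0})"
    by (rule DERIV_subset[OF moll_P_deriv[OF \<delta>(1) \<phi>]]) (use s in auto)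
   have m: "M + s * B \<le> m" unfolding m_def using sB s by simp
   have cP: "continuous_on UNIV (P s \<phi>)" using Pd_props(1)[OF \<phi>] s by auto
   have "\<bar>P s \<phi> y\<bar> \<le> m" for y using P_bounds[of \<phi> M s y, OF \<phi>(2,3)] s m by simp
   then have g: "\<bar>gen \<sigma> \<delta> (b z) (P s \<phi>) z\<bar> \<le> C * m" using G cP bb unfolding gen_const_def by blast
   have "C * m * sqrt d \<le> C * m * 1" using d d_pos C M B unfolding m_def by (intro mult_left_mono) auto
   moreover have "\<bar>moll \<delta> (Pd s \<phi>) z - gen \<sigma> \<delta> (b z) (P s \<phi>) z - g z\<bar> \<le> \<delta> * (L * (\<Lambda>' + 1)) + C * m * sqrt d"
    by (rule moll_Pd[OF G d(1) bb \<delta>(1) \<phi> _ m ex]) (use s in auto)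
   moreover have "\<bar>g z\<bar> \<le> B" using g_bounds[of z] by simp
   ultimately show "norm (moll \<delta> (Pd s \<phi>) z) \<le> K" unfolding K_def real_norm_def using g by linarith
  qed (use r s0 in auto)
  also have "\<dots> \<le> K * s0" using r K by simp
  finally have "\<bar>moll \<delta> (P r \<phi>) z - moll \<delta> \<phi> z\<bar> \<le> \<eta> / 2" using Ks by simp
  moreover have "\<bar>moll \<delta> (P r \<phi>) z - P r \<phi> z\<bar> \<le> \<Lambda>' * \<delta>"
   by (rule moll_lip_near[OF \<delta>(1) lip_mono[OF P_lip[OF \<phi> r(1)] ex[OF r(2)]]])
  moreover have "\<bar>moll \<delta> \<phi> z - \<phi> z\<bar> \<le> \<Lambda>' * \<delta>"
   by (rule moll_lip_near[OF \<delta>(1) lip_mono[OF \<phi>(1)]]) (use \<Lambda>' in simp)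
  ultimately show ?case using \<Lambda>\<delta> by linarith
 qed
qed

section \<open>Infima over controls and the scheme with piecewise constant controls\<close>

lemma INF_near:
 fixes F :: "'v \<Rightarrow> real"
 assumes "Vs \<noteq> {}" "\<And>V. V \<in> Vs \<Longrightarrow> \<bar>F V - c\<bar> \<le> e"
 shows "\<bar>(INF V\<in>Vs. F V) - c\<bar> \<le> e"
proof -
 have b: "c - e \<le> F V" "F V \<le> c + e" if "V \<in> Vs" for V using assms(2)[OF that] by linarith+
 have "c - e \<le> (INF V\<in>Vs. F V)" by (rule cINF_greatest[OF assms(1) b(1)])
 moreover obtain V where V: "V \<in> Vs" using assms(1) by blast
 have "bdd_below (F ` Vs)" by (rule bdd_belowI2[of _ "c - e"]) (rule b)
 then have "(INF V\<in>Vs. F V) \<le> F V" by (rule cINF_lower[OF _ V])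
 ultimately show ?thesis using b(2)[OF V] by linarith
qed

lemma INF_lip:
 assumes ne: "Vs \<noteq> {}" and l: "\<And>V. V \<in> Vs \<Longrightarrow> lip \<Lambda> (F V)" and p: "\<And>V z. V \<in> Vs \<Longrightarrow> 0 \<le> F V z"
 shows "lip \<Lambda> (\<lambda>z. INF V\<in>Vs. F V z)"
 unfolding lip_def
proof safe
 have bd: "bdd_below ((\<lambda>V. F V z) ` Vs)" for z by (rule bdd_belowI2[of _ 0]) (rule p)
 have 1: "(INF V\<in>Vs. F V y) - \<Lambda> * norm (y - z) \<le> (INF V\<in>Vs. F V z)" for y z
 proof (rule cINF_greatest[OF ne])
  fix V assume V: "V \<in> Vs"
  have "(INF V\<in>Vs. F V y) \<le> F V y" by (rule cINF_lower[OF bd V])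
  then show "(INF V\<in>Vs. F V y) - \<Lambda> * norm (y - z) \<le> F V z" using lipD[OF l[OF V], of y z] by linarith
 qed
 show "\<bar>(INF V\<in>Vs. F V y) - (INF V\<in>Vs. F V z)\<bar> \<le> \<Lambda> * norm (y - z)" for y z
  using 1[of y z] 1[of z y] by (simp add: norm_minus_commute abs_le_iff)
qed

locale scheme =
 fixes \<sigma> :: "'i::finite \<Rightarrow> 'a::euclidean_space" and b :: "'v \<Rightarrow> 'a \<Rightarrow> 'a" and f :: "real \<Rightarrow> 'v \<Rightarrow> 'a \<Rightarrow> real"
  and h :: "'a \<Rightarrow> real" and Vs :: "'v set" and L B \<beta> T :: real
 assumes L_ge: "1 \<le> L" and B_nonneg: "0 \<le> B" and \<beta>_nonneg: "0 \<le> \<beta>" and T_pos: "0 < T" and Vs_ne: "Vs \<noteq> {}"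
  and b_lip: "\<And>V y z. V \<in> Vs \<Longrightarrow> norm (b V y - b V z) \<le> L * norm (y - z)"
  and b_bound: "\<And>V z. V \<in> Vs \<Longrightarrow> norm (b V z) \<le> \<beta>"
  and f_lip: "\<And>t V. V \<in> Vs \<Longrightarrow> lip L (f t V)"
  and f_bounds: "\<And>t V z. V \<in> Vs \<Longrightarrow> 0 \<le> f t V z" "\<And>t V z. V \<in> Vs \<Longrightarrow> f t V z \<le> B"
  and f_time: "\<And>e. 0 < e \<Longrightarrow> \<exists>r>0. \<forall>t t'. \<forall>V\<in>Vs. \<forall>z. \<bar>t - t'\<bar> \<le> r \<longrightarrow> \<bar>f t V z - f t' V z\<bar> \<le> e"
  and h_lip: "lip L h" and h_bounds: "\<And>z. 0 \<le> h z" "\<And>z. h z \<le> B"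
begin

text \<open>\<open>Lam\<close> and \<open>Mx\<close> bound Lipschitz constants and values up to time
  \<open>3 * T\<close>: the interpolation in time uses two grid points beyond the horizon, and
  \<open>N + 2 \<le> 3 * N\<close>.\<close>

definition Lam :: real where "Lam = exp (3 * T * L) * (L + 1)"
definition Mx :: real where "Mx = B + 3 * T * B"

lemma oc: "V \<in> Vs \<Longrightarrow> 0 < d \<Longrightarrow> one_control d (b V) (f t V) L B"
 by unfold_locales (use L_ge B_nonneg b_lip f_lip f_bounds in auto)

text \<open>
 Comparison with smooth supersolutions of the linear equation for one frozen control: this is all
 that the scheme needs to know about a viscosity subsolution.
\<close>

definition CP :: "'a set \<Rightarrow> (real \<Rightarrow> 'a \<Rightarrow> real) \<Rightarrow> bool" where
 "CP D U \<longleftrightarrow> (\<forall>V\<in>Vs. \<forall>s s' w K. 0 < s \<and> s < s' \<and> s' \<le> T \<and>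
   (\<forall>t\<in>{s..s'}. \<forall>t'\<in>{s..s'}. \<forall>z z'. \<bar>w t z - w t' z'\<bar> \<le> K * (\<bar>t - t'\<bar> + norm (z - z'))) \<and>
   (\<forall>t\<in>{s..s'}. \<forall>z. 0 \<le> w t z) \<and>
   (\<forall>t\<in>{s<..<s'}. \<forall>z. \<exists>a p Q. has_jet w t z a p Q \<and> a + p (b V z) + (\<Sum>i\<in>UNIV. Q (\<sigma> i) (\<sigma> i)) / 2 + f t V z \<le> 0) \<and>
   (\<forall>z\<in>D. U s' z \<le> w s' z) \<longrightarrow>
   (\<forall>z\<in>D. \<forall>t\<in>{s..s'}. U t z \<le> w t z))"

end

text \<open>The assumption \<open>near\<close> ties the grid length \<open>\<tau>\<close> to the
  tolerance \<open>\<eta>\<close>: an evolution over at most one grid interval moves admissible data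
  by at most \<open>\<eta>\<close>. It is supplied by \<open>P_near_id\<close>.\<close>

locale scheme_run = scheme \<sigma> b f h Vs L B \<beta> T
 for \<sigma> :: "'i::finite \<Rightarrow> 'a::euclidean_space" and b :: "'v \<Rightarrow> 'a \<Rightarrow> 'a" and f h Vs L B \<beta> T +
 fixes N :: nat and \<tau> d \<eta> :: real
 assumes N_pos: "0 < N" and \<tau>_def: "\<tau> * N = T" and d_pos: "0 < d" and \<eta>_pos: "0 < \<eta>"
  and near: "\<And>V t \<phi> r z. V \<in> Vs \<Longrightarrow> lip Lam \<phi> \<Longrightarrow> (\<And>y. 0 \<le> \<phi> y) \<Longrightarrow> (\<And>y. \<phi> y \<le> Mx) \<Longrightarrow> 0 \<le> r \<Longrightarrow> r \<le> \<tau> \<Longrightarrow>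
   \<bar>ev \<sigma> d (b V) (f t V) r \<phi> z - \<phi> z\<bar> \<le> \<eta>"
begin

lemma \<tau>_pos: "0 < \<tau>"
 using \<tau>_def T_pos N_pos by (metis of_nat_0_less_iff zero_less_mult_pos2)

text \<open>Backward dynamic programming with the control and the cost frozen on each interval:
  \<open>v j\<close> stands for the value function at time \<open>T - j * \<tau>\<close>, and the
  cost is sampled at the earlier end of the interval.\<close>

primrec v :: "nat \<Rightarrow> 'a \<Rightarrow> real" where
 "v 0 = h"
| "v (Suc j) = (\<lambda>z. INF V\<in>Vs. ev \<sigma> d (b V) (f (T - Suc j * \<tau>) V) \<tau> (v j) z)"

lemma v_props: "lip (exp (j * \<tau> * L) * (L + 1) - 1) (v j) \<and> (\<forall>z. 0 \<le> v j z \<and> v j z \<le> B + j * \<tau> * B)"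
proof (induction j)
 case 0 then show ?case using h_lip h_bounds by simp
next
 case (Suc j)
 let ?\<Lambda> = "exp (j * \<tau> * L) * (L + 1) - 1"
 have s: "lip ?\<Lambda> (v j)" "\<And>y. 0 \<le> v j y" "\<And>y. v j y \<le> B + j * \<tau> * B" using Suc by auto
 have e: "exp (\<tau> * L) * (?\<Lambda> + 1) - 1 = exp (Suc j * \<tau> * L) * (L + 1) - 1"
  by (simp add: exp_add[symmetric] algebra_simps)
 let ?F = "\<lambda>V. ev \<sigma> d (b V) (f (T - Suc j * \<tau>) V) \<tau> (v j)"
 have 1: "lip (exp (Suc j * \<tau> * L) * (L + 1) - 1) (?F V)" "0 \<le> ?F V z" "?F V z \<le> B + Suc j * \<tau> * B" if V: "V \<in> Vs" for V z
 proof -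
  interpret one_control \<sigma> d "b V" "f (T - Suc j * \<tau>) V" L B using oc[OF V d_pos] .
  show "lip (exp (Suc j * \<tau> * L) * (L + 1) - 1) (?F V)"
   using P_lip[OF s less_imp_le[OF \<tau>_pos]] unfolding e .
  show "0 \<le> ?F V z" "?F V z \<le> B + Suc j * \<tau> * B"
   using P_bounds[of "v j" "B + j * \<tau> * B" \<tau>, OF s(2,3)] \<tau>_pos by (simp_all add: algebra_simps)
 qed
 have "0 \<le> v (Suc j) z \<and> v (Suc j) z \<le> B + Suc j * \<tau> * B" for z
 proof
  show "0 \<le> v (Suc j) z" using 1 Vs_ne by (auto intro!: cINF_greatest)
  obtain V where V: "V \<in> Vs" using Vs_ne by blast
  have "bdd_below ((\<lambda>V. ?F V z) ` Vs)" by (rule bdd_belowI2[of _ 0]) (rule 1)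
  then have "v (Suc j) z \<le> ?F V z" unfolding v.simps by (rule cINF_lower[OF _ V])
  then show "v (Suc j) z \<le> B + Suc j * \<tau> * B" using 1(3)[OF V, of z] by simp
 qed
 then show ?case using INF_lip[OF Vs_ne 1(1,2)] by simp
qed

lemma j\<tau>: "j \<le> N + 2 \<Longrightarrow> j * \<tau> \<le> 3 * T"
proof -
 assume "j \<le> N + 2"
 then have "j * \<tau> \<le> (3 * N) * \<tau>" using N_pos \<tau>_pos by (intro mult_right_mono) auto
 then show ?thesis using \<tau>_def by (simp add: mult_ac)
qed

lemma exp_j: "j \<le> N + 2 \<Longrightarrow> exp (j * \<tau> * L) * (L + 1) - 1 \<le> Lam - 1"
 unfolding Lam_def using j\<tau>[of j] L_ge by (auto intro!: mult_right_mono)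

lemma v_lip: "j \<le> N + 2 \<Longrightarrow> lip Lam (v j)"
 using v_props[of j] exp_j[of j] lip_mono[of _ "v j" Lam] by auto

lemma v_bounds: "0 \<le> v j z" "j \<le> N + 2 \<Longrightarrow> v j z \<le> Mx"
proof -
 show "0 \<le> v j z" using v_props[of j] by simp
 assume "j \<le> N + 2"
 then have "j * \<tau> * B \<le> 3 * T * B" using j\<tau> B_nonneg by (intro mult_right_mono) auto
 then show "v j z \<le> Mx" using v_props[of j] unfolding Mx_def by (smt (verit))
qed

lemma v_step: "j \<le> N + 1 \<Longrightarrow> \<bar>v (Suc j) z - v j z\<bar> \<le> \<eta>"
 unfolding v.simps using near v_lip[of j] v_bounds[of j] \<tau>_pos by (intro INF_near[OF Vs_ne]) auto

lemma v_le: "V \<in> Vs \<Longrightarrow> j \<le> N + 1 \<Longrightarrow> v (Suc j) z \<le> ev \<sigma> d (b V) (f (T - Suc j * \<tau>) V) \<tau> (v j) z"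
 unfolding v.simps
proof (rule cINF_lower)
 assume j: "j \<le> N + 1"
 show "bdd_below ((\<lambda>V. ev \<sigma> d (b V) (f (T - real (Suc j) * \<tau>) V) \<tau> (v j) z) ` Vs)"
 proof (rule bdd_belowI2[of _ 0])
  fix V assume "V \<in> Vs"
  then interpret one_control \<sigma> d "b V" "f (T - Suc j * \<tau>) V" L B using oc d_pos by blast
  show "0 \<le> ev \<sigma> d (b V) (f (T - real (Suc j) * \<tau>) V) \<tau> (v j) z"
   using P_bounds(1)[of "v j" Mx \<tau> z] v_bounds j \<tau>_pos by simp
 qed
qed

end

lemma has_jet_add_affine:
 assumes "has_jet w t z a p Q"
 shows "has_jet (\<lambda>t z. w t z + (\<alpha> + \<gamma> * t)) t z (a + \<gamma>) p Q"
proof -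
 have *: "w t' (z + e) + (\<alpha> + \<gamma> * t') - (w t z + (\<alpha> + \<gamma> * t)) - (t' - t) * (a + \<gamma>) - p e - Q e e / 2
   = w t' (z + e) - w t z - (t' - t) * a - p e - Q e e / 2" for t' e
  by (simp add: algebra_simps)
 show ?thesis using assms unfolding has_jet_def * .
qed

context scheme_run
begin

lemma P_const:
 assumes "j \<le> N + 1" "0 \<le> r" "r \<le> \<tau>"
 shows "exp (r * L) * ((exp (j * \<tau> * L) * (L + 1) - 1) + 1) - 1 \<le> Lam" "(B + j * \<tau> * B) + r * B \<le> Mx"
proof -
 have *: "j * \<tau> + r \<le> 3 * T" using j\<tau>[of "Suc j"] assms by (simp add: algebra_simps)
 have "exp (r * L) * ((exp (j * \<tau> * L) * (L + 1) - 1) + 1) = exp ((j * \<tau> + r) * L) * (L + 1)"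
  by (simp add: exp_add[symmetric] algebra_simps)
 also have "\<dots> \<le> exp (3 * T * L) * (L + 1)"
  using * L_ge by (intro mult_right_mono) auto
 finally show "exp (r * L) * ((exp (j * \<tau> * L) * (L + 1) - 1) + 1) - 1 \<le> Lam" unfolding Lam_def by simp
 have "(j * \<tau> + r) * B \<le> 3 * T * B" using * B_nonneg by (rule mult_right_mono)
 then show "(B + j * \<tau> * B) + r * B \<le> Mx" unfolding Mx_def by (simp add: algebra_simps)
qed

lemma moll_Pd_v:
 assumes V: "V \<in> Vs" and j: "j \<le> N + 1" and \<delta>: "0 < \<delta>" and G: "gen_const \<sigma> \<delta> \<beta> C d0" and d: "d \<le> d0"
  and r: "0 \<le> r" "r \<le> \<tau>"
 shows "\<bar>moll \<delta> (one_control.Pd \<sigma> d (b V) (f t V) r (v j)) z - gen \<sigma> \<delta> (b V z) (ev \<sigma> d (b V) (f t V) r (v j)) z - f t V z\<bar>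
   \<le> \<delta> * (L * (Lam + 1)) + C * Mx * sqrt d"
proof -
 interpret one_control \<sigma> d "b V" "f t V" L B using oc[OF V d_pos] .
 show ?thesis
  by (rule moll_Pd[OF G d b_bound[OF V] \<delta> _ _ _ r(1) P_const(2)[OF j r] P_const(1)[OF j r]]) (use v_props[of j] in auto)
qed

text \<open>The discrete form of the subsolution inequality. The infimum is at most the evolution
  with the given control, and mollification preserves this order. The mollified evolution is then
  integrated over one interval; replacing the generator of \<open>P r (v j)\<close> by that of
  \<open>v j\<close> costs \<open>C * \<eta>\<close> by \<open>near\<close>.\<close>

lemma moll_v_step:
 assumes V: "V \<in> Vs" and j: "j \<le> N + 1" and \<delta>: "0 < \<delta>" and G: "gen_const \<sigma> \<delta> \<beta> C d0" and d: "d \<le> d0"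
 shows "moll \<delta> (v (Suc j)) z \<le> moll \<delta> (v j) z + \<tau> * (gen \<sigma> \<delta> (b V z) (v j) z + f (T - Suc j * \<tau>) V z
   + (\<delta> * (L * (Lam + 1)) + C * Mx * sqrt d + C * \<eta>))"
proof -
 let ?t = "T - Suc j * \<tau>"
 let ?e = "\<delta> * (L * (Lam + 1)) + C * Mx * sqrt d + C * \<eta>"
 interpret one_control \<sigma> d "b V" "f ?t V" L B using oc[OF V d_pos] .
 have vl: "lip Lam (v j)" "\<And>y. 0 \<le> v j y" "\<And>y. v j y \<le> Mx" using v_lip v_bounds j by auto
 define c where "c = gen \<sigma> \<delta> (b V z) (v j) z + f ?t V z"
 \<comment> \<open>Subtracting \<open>c * r\<close> leaves a function of \<open>r\<close> whose
   derivative is only the consistency error.\<close>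
 have "norm ((moll \<delta> (P \<tau> (v j)) z - c * \<tau>) - (moll \<delta> (P 0 (v j)) z - c * 0)) \<le> ?e * norm (\<tau> - 0)"
 proof (rule field_differentiable_bound[of "{0..\<tau>}" "\<lambda>r. moll \<delta> (P r (v j)) z - c * r" "\<lambda>r. moll \<delta> (Pd r (v j)) z - c"])
  fix r assume r: "r \<in> {0..\<tau>}"
  have "((\<lambda>r. moll \<delta> (P r (v j)) z) has_real_derivative moll \<delta> (Pd r (v j)) z) (at r within {0..\<tau>})"
   by (rule DERIV_subset[OF moll_P_deriv[OF \<delta> vl]]) (use r in auto)
  then show "((\<lambda>r. moll \<delta> (P r (v j)) z - c * r) has_real_derivative moll \<delta> (Pd r (v j)) z - c) (at r within {0..\<tau>})"
   by (auto intro!: derivative_eq_intros)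
  have "\<bar>gen \<sigma> \<delta> (b V z) (P r (v j)) z - gen \<sigma> \<delta> (b V z) (v j) z\<bar> \<le> C * \<eta>"
   by (rule gen_dist[OF G \<delta>]) (use Pd_props(1)[OF vl] vl lip_continuous near V r b_bound in auto)
  moreover have "\<bar>moll \<delta> (Pd r (v j)) z - gen \<sigma> \<delta> (b V z) (P r (v j)) z - f ?t V z\<bar> \<le> \<delta> * (L * (Lam + 1)) + C * Mx * sqrt d"
   using moll_Pd_v[OF V j \<delta> G d, of r ?t z] r by simp
  ultimately show "norm (moll \<delta> (Pd r (v j)) z - c) \<le> ?e" unfolding c_def real_norm_def by linarith
 qed (use \<tau>_pos in auto)
 then have "moll \<delta> (P \<tau> (v j)) z \<le> moll \<delta> (v j) z + \<tau> * (c + ?e)"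
  using \<tau>_pos unfolding P_0 by (simp add: abs_le_iff algebra_simps)
 moreover have "moll \<delta> (v (Suc j)) z \<le> moll \<delta> (P \<tau> (v j)) z"
  by (rule moll_mono[OF \<delta>]) (use v_lip[of "Suc j"] Pd_props(1)[OF vl, of \<tau>] \<tau>_pos v_le[OF V j] j lip_continuous in auto)
 ultimately show ?thesis unfolding c_def by linarith
qed

text \<open>The mollified evolution of \<open>v j\<close> under the single control \<open>V\<close>
  is turned into an exact smooth supersolution and fed to \<open>CP\<close>. The term
  \<open>2 * Lam * \<delta>\<close> pays for mollification at the two ends of the interval, and the
  slope \<open>e2\<close> absorbs the consistency error and the variation of the cost in
  time.\<close>

lemma CP_step:
 assumes V: "V \<in> Vs" and j: "j < N" and \<delta>: "0 < \<delta>" "\<delta> \<le> 1" and G: "gen_const \<sigma> \<delta> \<beta> C d0" and d: "d \<le> d0"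
  and CP: "CP D U" and s': "s' = T - j * \<tau>" and s: "0 < s" "s < s'" "T - Suc j * \<tau> \<le> s"
  and c: "0 \<le> c" and U: "\<And>z. z \<in> D \<Longrightarrow> U s' z \<le> v j z + c"
  and ft: "\<And>t t' z. \<bar>t - t'\<bar> \<le> \<tau> \<Longrightarrow> \<bar>f t V z - f t' V z\<bar> \<le> e3"
  and e2: "e3 + \<delta> * (L * (Lam + 1)) + C * Mx * sqrt d \<le> e2"
  and z: "z \<in> D"
 shows "U s z \<le> ev \<sigma> d (b V) (f (T - Suc j * \<tau>) V) (s' - s) (v j) z + 2 * Lam * \<delta> + c + e2 * (s' - s)"
proof -
 let ?t = "T - Suc j * \<tau>"
 interpret one_control \<sigma> d "b V" "f ?t V" L B using oc[OF V d_pos] .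
 have vp: "lip (exp (j * \<tau> * L) * (L + 1) - 1) (v j)" "\<And>y. 0 \<le> v j y" "\<And>y. v j y \<le> B + j * \<tau> * B"
  using v_props[of j] by auto
 have vl: "lip Lam (v j)" "\<And>y. v j y \<le> Mx" using v_lip v_bounds j by auto
 have Lam0: "0 \<le> Lam" using lip_nonneg[OF vl(1)] .
 have st: "s' - t \<le> \<tau>" if "s \<le> t" for t using s s' that by (simp add: algebra_simps)
 have lP: "lip Lam (P r (v j))" if "0 \<le> r" "r \<le> \<tau>" for r
  using P_lip[OF vp that(1)] P_const(1)[of j r] j that by (intro lip_mono[of _ "P r (v j)" Lam]) auto
 have bP: "0 \<le> P r (v j) y" "P r (v j) y \<le> Mx" if "0 \<le> r" "r \<le> \<tau>" for r y
  using P_bounds[of "v j" "B + j * \<tau> * B" r y, OF vp(2,3) that(1)] P_const(2)[of j r] j that by auto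
 have e3: "0 \<le> e3" using ft[of 0 0 0] \<tau>_pos by simp
 have C: "0 \<le> C" using G by (simp add: gen_const_def)
 have Mx0: "0 \<le> Mx" using order_trans[OF bP] \<tau>_pos by (metis order_refl less_imp_le)
 have e2_0: "0 \<le> e2" using e2 e3 \<delta> L_ge Lam0 C Mx0 d_pos
  by (intro order_trans[OF _ e2] add_nonneg_nonneg mult_nonneg_nonneg) auto
 \<comment> \<open>The constant \<open>Lam * \<delta> + c\<close> gives domination at time
   \<open>s'\<close>; the part \<open>e2 * (s' - t)\<close> decreases in \<open>t\<close> and
   supplies the negative sign in the supersolution inequality.\<close>
 define w where "w t y = moll \<delta> (P (s' - t) (v j)) y + ((Lam * \<delta> + c + e2 * s') + (- e2) * t)" for t y
 define K where "K = (Mx + \<tau> * B + d * B) / d"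
 have cP: "continuous_on UNIV (P r (v j))" if "0 \<le> r" for r using Pd_props(1)[OF vp that] .
 have PK: "\<bar>P r' (v j) y - P r (v j) y\<bar> \<le> K * \<bar>r' - r\<bar>" if "0 \<le> r" "0 \<le> r'" "r \<le> \<tau>" "r' \<le> \<tau>" for r r' y
  unfolding K_def by (rule P_time_lip[OF vl(1) vp(2) vl(2) that])
 have w1: "\<bar>w t y - w t' y'\<bar> \<le> max Lam (K + e2) * (\<bar>t - t'\<bar> + norm (y - y'))"
  if t: "t \<in> {s..s'}" "t' \<in> {s..s'}" for t t' y y'
 proof -
  have "\<bar>moll \<delta> (P (s' - t) (v j)) y - moll \<delta> (P (s' - t) (v j)) y'\<bar> \<le> Lam * norm (y - y')"
   by (rule lipD[OF moll_lip[OF \<delta>(1) lP]]) (use t st in auto)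
  moreover have "\<bar>moll \<delta> (P (s' - t) (v j)) y' - moll \<delta> (P (s' - t') (v j)) y'\<bar> \<le> K * \<bar>t - t'\<bar>"
  proof (rule moll_dist[OF \<delta>(1)])
   show "\<bar>P (s' - t) (v j) x - P (s' - t') (v j) x\<bar> \<le> K * \<bar>t - t'\<bar>" for x
    using PK[of "s' - t'" "s' - t" x] t st by (simp add: abs_minus_commute)
  qed (use cP t in auto)
  moreover have "\<bar>e2 * t - e2 * t'\<bar> = e2 * \<bar>t - t'\<bar>"
   using e2_0 by (simp add: right_diff_distrib[symmetric] abs_mult)
  moreover have "(K + e2) * \<bar>t - t'\<bar> \<le> max Lam (K + e2) * \<bar>t - t'\<bar>" "Lam * norm (y - y') \<le> max Lam (K + e2) * norm (y - y')"
   by (intro mult_right_mono; simp)+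
  ultimately show ?thesis unfolding w_def by (simp add: distrib_left distrib_right) linarith
 qed
 have w2: "0 \<le> w t y" if t: "t \<in> {s..s'}" for t y
 proof -
  have "0 \<le> moll \<delta> (P (s' - t) (v j)) y" by (rule moll_bounds(2)[OF \<delta>(1)]) (use t cP bP st in auto)
  moreover have "0 \<le> e2 * (s' - t)" "0 \<le> Lam * \<delta>" using e2_0 t Lam0 \<delta> by auto
  ultimately show ?thesis unfolding w_def using c by (simp add: algebra_simps)
 qed
 have w3: "\<exists>a p Q. has_jet w t y a p Q \<and> a + p (b V y) + (\<Sum>i\<in>UNIV. Q (\<sigma> i) (\<sigma> i)) / 2 + f t V y \<le> 0"
  if t: "t \<in> {s<..<s'}" for t y
 proof -
  let ?r = "s' - t"
  have r: "0 < ?r" "?r \<le> \<tau>" using t st by auto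
  define m where "m = max Mx ((Mx + ?r * B + d * B) / d)"
  have c1: "continuous_on UNIV (\<lambda>y. - 1 * Pd ?r (v j) y)" using Pd_props(3)[OF vp, of ?r] r by (intro continuous_intros) auto
  have "has_jet (\<lambda>t. moll \<delta> (P (s' - t) (v j))) t y (moll \<delta> (\<lambda>y. -1 * Pd ?r (v j) y) y) (moll1 \<delta> (P ?r (v j)) y) (moll2 \<delta> (P ?r (v j)) y)"
  proof (rule moll_jet[OF \<delta> r(1), where m=m])
   show "\<bar>P (s' - t) (v j) x\<bar> \<le> m" for x unfolding m_def using bP[of ?r x] r by auto
   show "\<bar>- 1 * Pd (s' - t) (v j) x\<bar> \<le> m" for x
    unfolding m_def using Pd_props(4)[OF vl(1) vp(2) vl(2), of ?r x] r by auto
   show "\<bar>P (s' - t') (v j) x - P (s' - t) (v j) x - (t' - t) * (- 1 * Pd (s' - t) (v j) x)\<bar> \<le> 2 * (Mx + d * B) / d\<^sup>2 * (t' - t)\<^sup>2"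
    if "\<bar>t' - t\<bar> < s' - t" for t' x
    using P_quadratic[of "v j" Mx ?r "s' - t'" x, OF vp(2) vl(2)] r that
    by (simp add: power2_commute[of t t'] algebra_simps)
  qed (use cP c1 r in auto)
  then have j1: "has_jet w t y (- 1 * moll \<delta> (Pd ?r (v j)) y + - e2) (moll1 \<delta> (P ?r (v j)) y) (moll2 \<delta> (P ?r (v j)) y)"
   unfolding w_def[abs_def] moll_cmult by (rule has_jet_add_affine)
  have "\<bar>moll \<delta> (Pd ?r (v j)) y - gen \<sigma> \<delta> (b V y) (P ?r (v j)) y - f ?t V y\<bar> \<le> \<delta> * (L * (Lam + 1)) + C * Mx * sqrt d"
   using moll_Pd_v[OF V _ \<delta>(1) G d, of j ?r ?t y] j r by simp
  moreover have "\<bar>f t V y - f ?t V y\<bar> \<le> e3" by (rule ft) (use t s s' in \<open>simp add: algebra_simps\<close>)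
  ultimately have "(- 1 * moll \<delta> (Pd ?r (v j)) y + - e2) + gen \<sigma> \<delta> (b V y) (P ?r (v j)) y + f t V y \<le> 0"
   using e2 by linarith
  then show ?thesis using j1 unfolding gen_def by (intro exI conjI) (auto simp: algebra_simps)
 qed
 have w4: "U s' y \<le> w s' y" if "y \<in> D" for y
  using U[OF that] moll_lip_near[OF \<delta>(1) vl(1), of y] unfolding w_def diff_self P_0 by (simp add: abs_le_iff algebra_simps)
 have "U s z \<le> w s z"
  using CP[unfolded CP_def, rule_format, OF V, of s s' w "max Lam (K + e2)"] w1 w2 w3 w4 s s' z \<tau>_pos by auto
 also have "\<dots> \<le> ev \<sigma> d (b V) (f ?t V) (s' - s) (v j) z + 2 * Lam * \<delta> + c + e2 * (s' - s)"
  using moll_lip_near[OF \<delta>(1) lP, of "s' - s" z] s st[of s] unfolding w_def by (simp add: abs_le_iff algebra_simps)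
 finally show ?thesis .
qed

end

section \<open>Smooth interpolation in time\<close>

text \<open>
 Averaging the piecewise linear interpolant of a sequence over \<open>[u, u + 1]\<close> gives a function with
 Lipschitz derivative. The weights are written through the primitives of the positive part.
\<close>

definition ramp :: "real \<Rightarrow> real" where "ramp x = max 0 x - max 0 (x - 1)"
definition ramp_int :: "real \<Rightarrow> real" where "ramp_int x = (max 0 x)\<^sup>2 / 2 - (max 0 (x - 1))\<^sup>2 / 2"

definition smooth_interp :: "(nat \<Rightarrow> real) \<Rightarrow> nat \<Rightarrow> real \<Rightarrow> real" where
 "smooth_interp a n u = a 0 + (\<Sum>i<n. (a (Suc i) - a i) * (ramp_int (u + 1 - i) - ramp_int (u - i)))"

definition smooth_interp' :: "(nat \<Rightarrow> real) \<Rightarrow> nat \<Rightarrow> real \<Rightarrow> real" where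
 "smooth_interp' a n u = (\<Sum>i<n. (a (Suc i) - a i) * (ramp (u + 1 - i) - ramp (u - i)))"

text \<open>\<open>ramp\<close> is a difference of two positive parts; each is the derivative of
  half a squared positive part, with remainder at most \<open>(y - x)\<^sup>2 / 2\<close>.\<close>

lemma ramp_int_quadratic: "\<bar>ramp_int y - ramp_int x - (y - x) * ramp x\<bar> \<le> (y - x)\<^sup>2"
proof -
 have q: "\<bar>(max 0 y)\<^sup>2 / 2 - (max 0 x)\<^sup>2 / 2 - (y - x) * max 0 x\<bar> \<le> (y - x)\<^sup>2 / 2" for x y :: real
 proof -
  consider "0 \<le> x" "0 \<le> y" | "0 \<le> x" "y < 0" | "x < 0" "0 \<le> y" | "x < 0" "y < 0" by linarith
  then show ?thesis
  proof cases
   case 1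
   then have "(max 0 y)\<^sup>2 / 2 - (max 0 x)\<^sup>2 / 2 - (y - x) * max 0 x = (y - x)\<^sup>2 / 2"
    by (simp add: power2_eq_square field_simps)
   moreover have "0 \<le> (y - x)\<^sup>2 / 2" by simp
   ultimately show ?thesis by linarith
  next
   case 2
   have "(max 0 y)\<^sup>2 / 2 - (max 0 x)\<^sup>2 / 2 - (y - x) * max 0 x = x\<^sup>2 / 2 - y * x"
    using 2 by (simp add: power2_eq_square algebra_simps)
   moreover have "0 \<le> - (y * x)" using 2 by (simp add: mult_nonpos_nonneg)
   moreover have "(y - x)\<^sup>2 / 2 = x\<^sup>2 / 2 - y * x + y\<^sup>2 / 2" by (simp add: power2_eq_square field_simps)
   ultimately show ?thesis using zero_le_power2[of x] zero_le_power2[of y] by linarith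
  next
   case 3
   then have "y\<^sup>2 \<le> (y - x)\<^sup>2" by (intro power_mono) auto
   then show ?thesis using 3 by simp
  next
   case 4
   then show ?thesis by simp
  qed
 qed
 define P where "P = (\<lambda>x::real. max 0 x)"
 have P': "max 0 x = P x" for x unfolding P_def ..
 have 1: "\<bar>(P y)\<^sup>2 / 2 - (P x)\<^sup>2 / 2 - (y - x) * P x\<bar> \<le> (y - x)\<^sup>2 / 2" for x y
  unfolding P_def by (rule q)
 have 2: "\<bar>(P (y - 1))\<^sup>2 / 2 - (P (x - 1))\<^sup>2 / 2 - (y - x) * P (x - 1)\<bar> \<le> (y - x)\<^sup>2 / 2"
  using 1[of "y - 1" "x - 1"] by simp
 have "ramp_int y - ramp_int x - (y - x) * ramp x
   = ((P y)\<^sup>2 / 2 - (P x)\<^sup>2 / 2 - (y - x) * P x) - ((P (y - 1))\<^sup>2 / 2 - (P (x - 1))\<^sup>2 / 2 - (y - x) * P (x - 1))"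
  unfolding ramp_int_def ramp_def P' by (simp add: algebra_simps)
 then show ?thesis using 1[of y x] 2 by linarith
qed

lemma ramp_int_diff: "\<bar>ramp_int y - ramp_int x\<bar> \<le> \<bar>y - x\<bar>"
proof -
 have d: "(ramp_int has_real_derivative ramp x) (at x)" for x
 proof -
  have "\<bar>ramp_int y - ramp_int x - (y - x) * ramp x\<bar> \<le> 1 * (y - x)\<^sup>2" for y
   using ramp_int_quadratic[of y x] by simp
  then show ?thesis by (rule has_real_derivative_quadratic)
 qed
 have "norm (ramp_int y - ramp_int x) \<le> 1 * norm (y - x)"
 proof (rule field_differentiable_bound[of UNIV ramp_int ramp])
  show "norm (ramp x) \<le> 1" for x by (auto simp: ramp_def)
 qed (use d in auto)
 then show ?thesis by simp
qed

lemma smooth_interp_quadratic: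
 assumes "\<And>i. i < n \<Longrightarrow> \<bar>a (Suc i) - a i\<bar> \<le> c"
 shows "\<bar>smooth_interp a n y - smooth_interp a n x - (y - x) * smooth_interp' a n x\<bar> \<le> 2 * real n * c * (y - x)\<^sup>2"
  "\<bar>smooth_interp a n y - smooth_interp a n x\<bar> \<le> 2 * real n * c * \<bar>y - x\<bar>"
proof -
 let ?r = "\<lambda>i. (a (Suc i) - a i) * ((ramp_int (y + 1 - i) - ramp_int (x + 1 - i) - (y - x) * ramp (x + 1 - i))
   - (ramp_int (y - i) - ramp_int (x - i) - (y - x) * ramp (x - i)))"
 have e1: "smooth_interp a n y - smooth_interp a n x - (y - x) * smooth_interp' a n x = (\<Sum>i<n. ?r i)"
  unfolding smooth_interp_def smooth_interp'_def
  by (simp add: sum_distrib_left sum_subtractf[symmetric] algebra_simps)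
 have b1: "\<bar>\<Sum>i<n. ?r i\<bar> \<le> (\<Sum>i<n. c * (2 * (y - x)\<^sup>2))"
 proof (rule order_trans[OF sum_abs sum_mono])
  fix i assume "i \<in> {..<n}"
  then have ai: "\<bar>a (Suc i) - a i\<bar> \<le> c" using assms by simp
  have "\<bar>(ramp_int (y + 1 - i) - ramp_int (x + 1 - i) - (y - x) * ramp (x + 1 - i))
   - (ramp_int (y - i) - ramp_int (x - i) - (y - x) * ramp (x - i))\<bar> \<le> 2 * (y - x)\<^sup>2"
  proof -
   have e: "y + 1 - real i - (x + 1 - real i) = y - x" "y - real i - (x - real i) = y - x" by simp_all
   have "\<bar>A\<bar> \<le> h \<Longrightarrow> \<bar>A'\<bar> \<le> h \<Longrightarrow> \<bar>A - A'\<bar> \<le> 2 * h" for A A' h :: real by linarith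
   from this[OF ramp_int_quadratic[of "y + 1 - i" "x + 1 - i", unfolded e(1)] ramp_int_quadratic[of "y - i" "x - i", unfolded e(2)]]
   show ?thesis .
  qed
  from mult_mono[OF ai this order_trans[OF abs_ge_zero ai] abs_ge_zero]
  show "\<bar>?r i\<bar> \<le> c * (2 * (y - x)\<^sup>2)" unfolding abs_mult .
 qed
 have s1: "(\<Sum>i<n. c * (2 * (y - x)\<^sup>2)) = 2 * real n * c * (y - x)\<^sup>2"
  unfolding sum_constant card_lessThan by (simp only: mult_ac)
 show "\<bar>smooth_interp a n y - smooth_interp a n x - (y - x) * smooth_interp' a n x\<bar> \<le> 2 * real n * c * (y - x)\<^sup>2"
  using b1 unfolding e1 s1 .
 let ?s = "\<lambda>i. (a (Suc i) - a i) * ((ramp_int (y + 1 - i) - ramp_int (x + 1 - i)) - (ramp_int (y - i) - ramp_int (x - i)))"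
 have e2: "smooth_interp a n y - smooth_interp a n x = (\<Sum>i<n. ?s i)"
  unfolding smooth_interp_def
  by (simp only: add_diff_cancel_left sum_subtractf[symmetric] right_diff_distrib[symmetric]) (simp add: algebra_simps)
 have b2: "\<bar>\<Sum>i<n. ?s i\<bar> \<le> (\<Sum>i<n. c * (2 * \<bar>y - x\<bar>))"
 proof (rule order_trans[OF sum_abs sum_mono])
  fix i assume "i \<in> {..<n}"
  then have ai: "\<bar>a (Suc i) - a i\<bar> \<le> c" using assms by simp
  have "\<bar>(ramp_int (y + 1 - i) - ramp_int (x + 1 - i)) - (ramp_int (y - i) - ramp_int (x - i))\<bar> \<le> 2 * \<bar>y - x\<bar>"
  proof -
   have e: "y + 1 - real i - (x + 1 - real i) = y - x" "y - real i - (x - real i) = y - x" by simp_all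
   have "\<bar>A\<bar> \<le> h \<Longrightarrow> \<bar>A'\<bar> \<le> h \<Longrightarrow> \<bar>A - A'\<bar> \<le> 2 * h" for A A' h :: real by linarith
   from this[OF ramp_int_diff[of "y + 1 - i" "x + 1 - i", unfolded e(1)] ramp_int_diff[of "y - i" "x - i", unfolded e(2)]]
   show ?thesis .
  qed
  from mult_mono[OF ai this order_trans[OF abs_ge_zero ai] abs_ge_zero]
  show "\<bar>?s i\<bar> \<le> c * (2 * \<bar>y - x\<bar>)" unfolding abs_mult .
 qed
 have s2: "(\<Sum>i<n. c * (2 * \<bar>y - x\<bar>)) = 2 * real n * c * \<bar>y - x\<bar>"
  unfolding sum_constant card_lessThan by (simp only: mult_ac)
 show "\<bar>smooth_interp a n y - smooth_interp a n x\<bar> \<le> 2 * real n * c * \<bar>y - x\<bar>"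
  using b2 unfolding e2 s2 .
qed

text \<open>On a cell the average is the quadratic B-spline combination of three consecutive values,
  and its derivative interpolates the forward differences linearly. So the time derivative inherits
  every bound that holds for both adjacent differences.\<close>

lemma smooth_interp_cell:
 assumes u: "u = real k + l" "0 \<le> l" "l \<le> 1" and k: "k + 2 \<le> n"
 shows "smooth_interp a n u = (1 - l)\<^sup>2 / 2 * a k + (1 / 2 + l - l\<^sup>2) * a (Suc k) + l\<^sup>2 / 2 * a (Suc (Suc k))"
  "smooth_interp' a n u = (1 - l) * (a (Suc k) - a k) + l * (a (Suc (Suc k)) - a (Suc k))"
proof -
 have split: "(\<Sum>i<n. g i) = (\<Sum>i<k. g i) + g k + g (Suc k) + (\<Sum>i\<in>{Suc (Suc k)..<n}. g i)" for g :: "nat \<Rightarrow> real"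
 proof -
  have "(\<Sum>i<n. g i) = (\<Sum>i<Suc (Suc k). g i) + (\<Sum>i\<in>{Suc (Suc k)..<n}. g i)"
   unfolding lessThan_atLeast0 by (rule sum.atLeastLessThan_concat[symmetric]) (use k in auto)
  then show ?thesis by simp
 qed
 have lo: "ramp_int (u + 1 - i) - ramp_int (u - i) = 1" "ramp (u + 1 - i) - ramp (u - i) = 0" if "i < k" for i
 proof -
  have "1 \<le> u - i" using u that by simp
  then show "ramp_int (u + 1 - i) - ramp_int (u - i) = 1" "ramp (u + 1 - i) - ramp (u - i) = 0"
   by (simp_all add: ramp_int_def ramp_def power2_eq_square field_simps)
 qed
 have hi: "ramp_int (u + 1 - i) - ramp_int (u - i) = 0" "ramp (u + 1 - i) - ramp (u - i) = 0" if "i \<ge> Suc (Suc k)" for i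
 proof -
  have "real (Suc (Suc k)) \<le> real i" using that by (simp only: of_nat_le_iff)
  then have "u + 1 - i \<le> 0" using u by simp
  then show "ramp_int (u + 1 - i) - ramp_int (u - i) = 0" "ramp (u + 1 - i) - ramp (u - i) = 0"
   by (simp_all add: ramp_int_def ramp_def)
 qed
 have k0: "ramp_int (u + 1 - k) - ramp_int (u - k) = 1 / 2 + l - l\<^sup>2 / 2" "ramp (u + 1 - k) - ramp (u - k) = 1 - l"
  using u by (simp_all add: ramp_int_def ramp_def power2_eq_square field_simps)
 have k1: "ramp_int (u + 1 - Suc k) - ramp_int (u - Suc k) = l\<^sup>2 / 2" "ramp (u + 1 - Suc k) - ramp (u - Suc k) = l"
  using u by (simp_all add: ramp_int_def ramp_def power2_eq_square field_simps)
 have t: "(\<Sum>i<k. (a (Suc i) - a i) * (ramp_int (u + 1 - i) - ramp_int (u - i))) = a k - a 0"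
  using lo by (simp add: sum_lessThan_telescope)
 show "smooth_interp a n u = (1 - l)\<^sup>2 / 2 * a k + (1 / 2 + l - l\<^sup>2) * a (Suc k) + l\<^sup>2 / 2 * a (Suc (Suc k))"
  unfolding smooth_interp_def split t k0 k1 using hi by (simp add: power2_eq_square field_simps)
 show "smooth_interp' a n u = (1 - l) * (a (Suc k) - a k) + l * (a (Suc (Suc k)) - a (Suc k))"
  unfolding smooth_interp'_def split k0 k1 using hi lo by (simp add: algebra_simps)
qed

context scheme_run
begin

text \<open>The variable \<open>u\<close> is the time to the horizon in units of the grid. The bound
  \<open>N + 2\<close> is needed because the cell at \<open>k\<close> involves the values with
  indices \<open>k\<close>, \<open>k + 1\<close> and \<open>k + 2\<close>, where \<open>k\<close>
  may equal \<open>N\<close>.\<close>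

definition Vh :: "real \<Rightarrow> 'a \<Rightarrow> real" where "Vh u y = smooth_interp (\<lambda>j. v j y) (N + 2) u"
definition Vh' :: "real \<Rightarrow> 'a \<Rightarrow> real" where "Vh' u y = smooth_interp' (\<lambda>j. v j y) (N + 2) u"

lemma Vh_cell:
 assumes "0 \<le> u" "u \<le> real N"
 obtains k :: nat and l :: real where "k \<le> N" "u = real k + l" "0 \<le> l" "l \<le> 1" "real k \<le> u" "u \<le> real k + 1"
  "\<And>y. Vh u y = (1 - l)\<^sup>2 / 2 * v k y + (1 / 2 + l - l\<^sup>2) * v (Suc k) y + l\<^sup>2 / 2 * v (Suc (Suc k)) y"
  "\<And>y. Vh' u y = (1 - l) * (v (Suc k) y - v k y) + l * (v (Suc (Suc k)) y - v (Suc k) y)"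
  "0 \<le> 1 / 2 + l - l\<^sup>2" "(1 - l)\<^sup>2 / 2 + (1 / 2 + l - l\<^sup>2) + l\<^sup>2 / 2 = 1"
proof -
 \<comment> \<open>At \<open>u = N\<close> the floor yields \<open>k = N\<close> and
   \<open>l = 0\<close>, so the right end of the range needs no separate cell.\<close>
 define k where "k = nat \<lfloor>u\<rfloor>"
 define l where "l = u - k"
 have k: "real k \<le> u" "u \<le> real k + 1" unfolding k_def using assms by linarith+
 have kN: "k \<le> N" using k assms by linarith
 have l: "u = real k + l" "0 \<le> l" "l \<le> 1" unfolding l_def using k by auto
 have "l\<^sup>2 \<le> l" using l by (simp add: power2_eq_square mult_left_le)
 then have l2: "0 \<le> 1 / 2 + l - l\<^sup>2" by linarith
 have l3: "(1 - l)\<^sup>2 / 2 + (1 / 2 + l - l\<^sup>2) + l\<^sup>2 / 2 = 1" by (simp add: power2_eq_square field_simps)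
 have "Vh u y = (1 - l)\<^sup>2 / 2 * v k y + (1 / 2 + l - l\<^sup>2) * v (Suc k) y + l\<^sup>2 / 2 * v (Suc (Suc k)) y"
    "Vh' u y = (1 - l) * (v (Suc k) y - v k y) + l * (v (Suc (Suc k)) y - v (Suc k) y)" for y
  unfolding Vh_def Vh'_def using smooth_interp_cell[OF l, of "N + 2" "\<lambda>j. v j y"] kN by auto
 with that kN l k l2 l3 show ?thesis by blast
qed

declare v.simps(2) [simp del]

lemma convex3:
 fixes \<alpha> \<beta>' \<gamma> :: real
 assumes "0 \<le> \<alpha>" "0 \<le> \<beta>'" "0 \<le> \<gamma>" "\<alpha> + \<beta>' + \<gamma> = 1" "\<bar>x - t\<bar> \<le> c" "\<bar>y - t\<bar> \<le> c" "\<bar>z - t\<bar> \<le> c"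
 shows "\<bar>\<alpha> * x + \<beta>' * y + \<gamma> * z - t\<bar> \<le> c"
proof -
 have "\<alpha> * x + \<beta>' * y + \<gamma> * z - t = \<alpha> * x + \<beta>' * y + \<gamma> * z - (\<alpha> + \<beta>' + \<gamma>) * t" using assms(4) by simp
 also have "\<dots> = \<alpha> * (x - t) + \<beta>' * (y - t) + \<gamma> * (z - t)" by (simp add: algebra_simps)
 finally have "\<bar>\<alpha> * x + \<beta>' * y + \<gamma> * z - t\<bar> \<le> \<alpha> * \<bar>x - t\<bar> + \<beta>' * \<bar>y - t\<bar> + \<gamma> * \<bar>z - t\<bar>"
  using assms(1-3) abs_triangle_ineq[of "\<alpha> * (x - t) + \<beta>' * (y - t)" "\<gamma> * (z - t)"]
   abs_triangle_ineq[of "\<alpha> * (x - t)" "\<beta>' * (y - t)"] by (simp add: abs_mult)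
 also have "\<dots> \<le> \<alpha> * c + \<beta>' * c + \<gamma> * c" using assms by (intro add_mono mult_left_mono) auto
 also have "\<dots> = c" using assms(4) by (simp add: distrib_right[symmetric])
 finally show ?thesis .
qed

lemma Vh_near:
 assumes "0 \<le> u" "u \<le> real N" "j \<le> N + 1" "\<bar>u - j\<bar> \<le> 1"
 shows "\<bar>Vh u y - v j y\<bar> \<le> 3 * \<eta>"
proof -
 obtain k :: nat and l :: real where c: "k \<le> N" "0 \<le> l" "l \<le> 1" "real k \<le> u" "u \<le> real k + 1"
  "Vh u y = (1 - l)\<^sup>2 / 2 * v k y + (1 / 2 + l - l\<^sup>2) * v (Suc k) y + l\<^sup>2 / 2 * v (Suc (Suc k)) y"
  "0 \<le> 1 / 2 + l - l\<^sup>2" "(1 - l)\<^sup>2 / 2 + (1 / 2 + l - l\<^sup>2) + l\<^sup>2 / 2 = 1"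
  using Vh_cell[OF assms(1,2)] by metis
 have st: "\<bar>v (Suc j) y - v j y\<bar> \<le> \<eta>" if "j \<le> N + 1" for j by (rule v_step[OF that])
 \<comment> \<open>The three values of the cell then have indices at distance at most 3 from
   \<open>j\<close>, and neighbouring values differ by at most \<open>\<eta>\<close>.\<close>
 have "real k \<le> real j + 1" "real j \<le> real k + 2" using c assms by linarith+
 then have "k \<le> j + 1" "j \<le> k + 2" by linarith+
 then consider "j = k" | "j = Suc k" | "j = Suc (Suc k)" | "k = Suc j" by linarith
 then have "\<bar>v k y - v j y\<bar> \<le> 3 * \<eta> \<and> \<bar>v (Suc k) y - v j y\<bar> \<le> 3 * \<eta> \<and> \<bar>v (Suc (Suc k)) y - v j y\<bar> \<le> 3 * \<eta>"
  using st[of k] st[of "Suc k"] st[of j] c \<eta>_pos by cases (auto simp: abs_le_iff)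
 then show ?thesis unfolding c(6) using c by (intro convex3) auto
qed

lemma Vh_lip: "0 \<le> u \<Longrightarrow> u \<le> real N \<Longrightarrow> lip Lam (Vh u)"
 unfolding lip_def
proof safe
 assume u: "0 \<le> u" "u \<le> real N"
 fix y z
 obtain k :: nat and l :: real where c: "k \<le> N" "0 \<le> l" "l \<le> 1"
  "\<And>y. Vh u y = (1 - l)\<^sup>2 / 2 * v k y + (1 / 2 + l - l\<^sup>2) * v (Suc k) y + l\<^sup>2 / 2 * v (Suc (Suc k)) y"
  "0 \<le> 1 / 2 + l - l\<^sup>2" "(1 - l)\<^sup>2 / 2 + (1 / 2 + l - l\<^sup>2) + l\<^sup>2 / 2 = 1"
  using Vh_cell[OF u] by metis
 have "\<bar>(1 - l)\<^sup>2 / 2 * (v k y - v k z) + (1 / 2 + l - l\<^sup>2) * (v (Suc k) y - v (Suc k) z)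
   + l\<^sup>2 / 2 * (v (Suc (Suc k)) y - v (Suc (Suc k)) z) - 0\<bar> \<le> Lam * norm (y - z)"
  by (rule convex3) (use c v_lip in \<open>auto intro!: lipD\<close>)
 then show "\<bar>Vh u y - Vh u z\<bar> \<le> Lam * norm (y - z)" unfolding c(4) by (simp add: algebra_simps)
qed

lemma Vh_bounds: "0 \<le> u \<Longrightarrow> u \<le> real N \<Longrightarrow> 0 \<le> Vh u y \<and> Vh u y \<le> Mx"
proof -
 assume u: "0 \<le> u" "u \<le> real N"
 obtain k :: nat and l :: real where c: "k \<le> N" "0 \<le> l" "l \<le> 1"
  "\<And>y. Vh u y = (1 - l)\<^sup>2 / 2 * v k y + (1 / 2 + l - l\<^sup>2) * v (Suc k) y + l\<^sup>2 / 2 * v (Suc (Suc k)) y"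
  "0 \<le> 1 / 2 + l - l\<^sup>2" "(1 - l)\<^sup>2 / 2 + (1 / 2 + l - l\<^sup>2) + l\<^sup>2 / 2 = 1"
  using Vh_cell[OF u] by metis
 have b: "\<bar>v j y - Mx / 2\<bar> \<le> Mx / 2" if "j \<le> N + 2" for j using v_bounds(1)[of j y] v_bounds(2)[OF that, of y] by linarith
 have "\<bar>Vh u y - Mx / 2\<bar> \<le> Mx / 2" unfolding c(4) by (rule convex3) (use c b in auto)
 then show ?thesis by linarith
qed

text \<open>Time runs backwards in the scheme, hence the reversal of \<open>t\<close>; the scale
  \<open>\<delta>\<close> stays a parameter because it is fixed independently of the one used for
  comparison.\<close>

definition W :: "real \<Rightarrow> real \<Rightarrow> 'a \<Rightarrow> real" where "W \<delta> t z = moll \<delta> (Vh ((T - t) / \<tau>)) z"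

lemma u_range: "t \<in> {0..T} \<Longrightarrow> 0 \<le> (T - t) / \<tau> \<and> (T - t) / \<tau> \<le> N"
 using \<tau>_pos \<tau>_def by (simp add: divide_le_eq mult.commute)

lemma Vh_continuous: "continuous_on UNIV (Vh u)" "continuous_on UNIV (Vh' u)"
proof -
 have c: "continuous_on UNIV (v j)" for j using v_props[of j] lip_continuous by blast
 show "continuous_on UNIV (Vh u)" "continuous_on UNIV (Vh' u)"
  unfolding Vh_def[abs_def] Vh'_def[abs_def] smooth_interp_def smooth_interp'_def
  by (intro continuous_intros c)+
qed

lemma Vh_quadratic:
 "\<bar>Vh u' y - Vh u y - (u' - u) * Vh' u y\<bar> \<le> 2 * real (N + 2) * \<eta> * (u' - u)\<^sup>2"
 "\<bar>Vh u' y - Vh u y\<bar> \<le> 2 * real (N + 2) * \<eta> * \<bar>u' - u\<bar>"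
 unfolding Vh_def Vh'_def by (rule smooth_interp_quadratic; rule v_step; simp)+

lemma W_bounds:
 assumes "0 < \<delta>" "t \<in> {0..T}"
 shows "0 \<le> W \<delta> t z" "W \<delta> t z \<le> Mx"
 unfolding W_def using moll_bounds[OF assms(1) Vh_continuous(1)] Vh_bounds u_range[OF assms(2)] by blast+

lemma W_near_Vh: "0 < \<delta> \<Longrightarrow> t \<in> {0..T} \<Longrightarrow> \<bar>W \<delta> t z - Vh ((T - t) / \<tau>) z\<bar> \<le> Lam * \<delta>"
 unfolding W_def using u_range by (intro moll_lip_near Vh_lip) auto

lemma W_lip:
 assumes "0 < \<delta>"
 shows "\<exists>K. \<forall>t\<in>{0..T}. \<forall>t'\<in>{0..T}. \<forall>z z'. \<bar>W \<delta> t z - W \<delta> t' z'\<bar> \<le> K * (\<bar>t - t'\<bar> + norm (z - z'))"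
proof (rule exI[of _ "max (2 * real (N + 2) * \<eta> / \<tau>) Lam"], intro ballI allI)
 fix t t' z z' assume t: "t \<in> {0..T}" "t' \<in> {0..T}"
 let ?K = "2 * real (N + 2) * \<eta> / \<tau>"
 have "\<bar>W \<delta> t z - W \<delta> t z'\<bar> \<le> Lam * norm (z - z')"
  unfolding W_def by (rule lipD[OF moll_lip[OF assms Vh_lip]]) (use u_range[OF t(1)] in auto)
 moreover have "\<bar>W \<delta> t z' - W \<delta> t' z'\<bar> \<le> ?K * \<bar>t - t'\<bar>"
  unfolding W_def
 proof (rule moll_dist[OF assms Vh_continuous(1) Vh_continuous(1)])
  fix y
  have "\<bar>(T - t) / \<tau> - (T - t') / \<tau>\<bar> = \<bar>t - t'\<bar> / \<tau>"
   using \<tau>_pos by (simp add: diff_divide_distrib[symmetric] abs_divide abs_minus_commute)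
  then show "\<bar>Vh ((T - t) / \<tau>) y - Vh ((T - t') / \<tau>) y\<bar> \<le> ?K * \<bar>t - t'\<bar>"
   using Vh_quadratic(2)[of "(T - t) / \<tau>" y "(T - t') / \<tau>"] by simp
 qed
 moreover have "?K * \<bar>t - t'\<bar> \<le> max ?K Lam * \<bar>t - t'\<bar>" "Lam * norm (z - z') \<le> max ?K Lam * norm (z - z')"
  by (intro mult_right_mono; simp)+
 ultimately show "\<bar>W \<delta> t z - W \<delta> t' z'\<bar> \<le> max ?K Lam * (\<bar>t - t'\<bar> + norm (z - z'))"
  unfolding distrib_left by linarith
qed

lemma W_jet:
 assumes \<delta>: "0 < \<delta>" "\<delta> \<le> 1" and t: "t \<in> {0<..<T}"
 shows "has_jet (W \<delta>) t z (- moll \<delta> (Vh' ((T - t) / \<tau>)) z / \<tau>) (moll1 \<delta> (Vh ((T - t) / \<tau>)) z) (moll2 \<delta> (Vh ((T - t) / \<tau>)) z)"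
proof -
 let ?u = "\<lambda>t. (T - t) / \<tau>"
 have u: "0 \<le> ?u t" "?u t \<le> N" using u_range[of t] t by auto
 have b': "\<bar>Vh' (?u t) y\<bar> \<le> \<eta>" for y
 proof -
  obtain k :: nat and l :: real where c: "k \<le> N" "0 \<le> l" "l \<le> 1"
   "Vh' (?u t) y = (1 - l) * (v (Suc k) y - v k y) + l * (v (Suc (Suc k)) y - v (Suc k) y)"
   using Vh_cell[OF u] by metis
  have "\<bar>(1 - l) * (v (Suc k) y - v k y) + l * (v (Suc (Suc k)) y - v (Suc k) y) + 0 * 0 - 0\<bar> \<le> \<eta>"
   by (rule convex3) (use c v_step[of k y] v_step[of "Suc k" y] \<eta>_pos in auto)
  then show ?thesis unfolding c(4) by simp
 qed
 define m where "m = max Mx (\<eta> / \<tau>)"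
 have "has_jet (\<lambda>t. moll \<delta> (Vh (?u t))) t z (moll \<delta> (\<lambda>y. (- 1 / \<tau>) * Vh' (?u t) y) z) (moll1 \<delta> (Vh (?u t)) z) (moll2 \<delta> (Vh (?u t)) z)"
 proof (rule moll_jet[OF \<delta> zero_less_one, where m=m and K="2 * real (N + 2) * \<eta> / \<tau>\<^sup>2"])
  show "continuous_on UNIV (\<lambda>y. (- 1 / \<tau>) * Vh' (?u t) y)" by (intro continuous_intros Vh_continuous)
  show "\<bar>Vh (?u t) y\<bar> \<le> m" for y using Vh_bounds[OF u, of y] unfolding m_def by auto
  show "\<bar>- 1 / \<tau> * Vh' (?u t) y\<bar> \<le> m" for y
   using divide_right_mono[OF b'[of y], of \<tau>] \<tau>_pos unfolding m_def by (auto simp: abs_mult abs_divide)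
  fix t' y
  have e: "?u t' - ?u t = - (t' - t) / \<tau>" using \<tau>_pos by (simp add: diff_divide_distrib[symmetric])
  show "\<bar>Vh (?u t') y - Vh (?u t) y - (t' - t) * (- 1 / \<tau> * Vh' (?u t) y)\<bar> \<le> 2 * real (N + 2) * \<eta> / \<tau>\<^sup>2 * (t' - t)\<^sup>2"
  proof -
   have "(?u t' - ?u t) * Vh' (?u t) y = (t' - t) * (- 1 / \<tau> * Vh' (?u t) y)" unfolding e by (simp add: left_diff_distrib diff_divide_distrib)
   moreover have "(?u t' - ?u t)\<^sup>2 = (t' - t)\<^sup>2 / \<tau>\<^sup>2" unfolding e by (simp add: power_divide power2_commute)
   ultimately show ?thesis using Vh_quadratic(1)[of "?u t'" y "?u t"] by simp
  qed
 qed (rule Vh_continuous)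
 then show ?thesis unfolding moll_cmult W_def[abs_def] by simp
qed


lemma W_sub:
 assumes \<delta>: "0 < \<delta>" "\<delta> \<le> 1" and G: "gen_const \<sigma> \<delta> \<beta> C d0" and d: "d \<le> d0" and t: "t \<in> {0<..<T}" and V: "V \<in> Vs"
  and ft: "\<And>t t' z. \<bar>t - t'\<bar> \<le> 2 * \<tau> \<Longrightarrow> \<bar>f t V z - f t' V z\<bar> \<le> e3"
 shows "- (\<delta> * (L * (Lam + 1)) + C * Mx * sqrt d + 4 * C * \<eta> + e3)
   \<le> - moll \<delta> (Vh' ((T - t) / \<tau>)) z / \<tau> + gen \<sigma> \<delta> (b V z) (Vh ((T - t) / \<tau>)) z + f t V z"
proof -
 let ?u = "(T - t) / \<tau>" and ?m = "\<lambda>j. moll \<delta> (v j) z" and ?g = "\<lambda>\<phi>. gen \<sigma> \<delta> (b V z) \<phi> z"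
 let ?e = "\<delta> * (L * (Lam + 1)) + C * Mx * sqrt d + C * \<eta>"
 have u: "0 \<le> ?u" "?u \<le> real N" using u_range[of t] t by auto
 obtain k :: nat and l :: real where c: "k \<le> N" "?u = real k + l" "0 \<le> l" "l \<le> 1" "real k \<le> ?u" "?u \<le> real k + 1"
   "\<And>y. Vh' ?u y = (1 - l) * (v (Suc k) y - v k y) + l * (v (Suc (Suc k)) y - v (Suc k) y)"
  using Vh_cell[OF u] by metis
 have cv: "continuous_on UNIV (v j)" for j using v_props[of j] lip_continuous by blast
 have cd: "continuous_on UNIV (\<lambda>y. v i y - v j y)" "continuous_on UNIV (\<lambda>y. r * (v i y - v j y))" for i j r
  by (intro continuous_intros cv)+
 have "moll \<delta> (Vh' ?u) z = (1 - l) * (?m (Suc k) - ?m k) + l * (?m (Suc (Suc k)) - ?m (Suc k))"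
  unfolding c(7)[abs_def] moll_add[OF \<delta>(1) cd(2) cd(2)] moll_cmult moll_diff[OF \<delta>(1) cv cv] ..
 have step: "(?m (Suc j) - ?m j) / \<tau> \<le> ?g (Vh ?u) + f t V z + ?e + 3 * C * \<eta> + e3" if j: "j = k \<or> j = Suc k" for j
 proof -
  have jN: "j \<le> N + 1" "\<bar>?u - real j\<bar> \<le> 1" using c j by auto
  have "\<bar>T - Suc j * \<tau> - t\<bar> \<le> 2 * \<tau>"
  proof -
   have "T - t = ?u * \<tau>" using \<tau>_pos by simp
   then have e: "T - Suc j * \<tau> - t = (?u - Suc j) * \<tau>" by (simp add: algebra_simps)
   have "\<bar>?u - Suc j\<bar> \<le> 2" using jN by simp
   then show ?thesis unfolding e abs_mult using \<tau>_pos by (intro mult_mono) auto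
  qed
  then have f: "f (T - Suc j * \<tau>) V z \<le> f t V z + e3" using ft[of "T - Suc j * \<tau>" t z] by linarith
  have "\<bar>?g (Vh ?u) - ?g (v j)\<bar> \<le> C * (3 * \<eta>)"
   by (rule gen_dist[OF G \<delta>(1) Vh_continuous(1) cv Vh_near[OF u jN] b_bound[OF V]])
  then have g: "?g (v j) \<le> ?g (Vh ?u) + 3 * C * \<eta>" by simp
  have "?m (Suc j) - ?m j \<le> \<tau> * (?g (v j) + f (T - Suc j * \<tau>) V z + ?e)"
   using moll_v_step[OF V jN(1) \<delta>(1) G d, of z] by simp
  then have "(?m (Suc j) - ?m j) / \<tau> \<le> ?g (v j) + f (T - Suc j * \<tau>) V z + ?e"
   using \<tau>_pos by (simp add: divide_le_eq mult.commute)
  then show ?thesis using f g by linarith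
 qed
 let ?K = "?g (Vh ?u) + f t V z + ?e + 3 * C * \<eta> + e3"
 have "moll \<delta> (Vh' ?u) z / \<tau> = (1 - l) * ((?m (Suc k) - ?m k) / \<tau>) + l * ((?m (Suc (Suc k)) - ?m (Suc k)) / \<tau>)"
  unfolding \<open>moll \<delta> (Vh' ?u) z = _\<close> by (simp add: add_divide_distrib)
 also have "\<dots> \<le> (1 - l) * ?K + l * ?K"
  using c step by (intro add_mono mult_left_mono) auto
 also have "\<dots> = ?K" by (simp add: algebra_simps)
 finally show ?thesis by simp
qed

text \<open>Induction over the grid: \<open>CP_step\<close> compares with every single control on an
  interval, and the infimum over controls is taken at its earlier end. Each interval loses
  \<open>c\<close>, so the scale \<open>\<delta>'\<close> enters multiplied by \<open>N\<close>; it
  is therefore kept apart from the scale \<open>\<delta>\<close> of \<open>W\<close>.\<close>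

lemma W_super:
 assumes \<delta>: "0 < \<delta>" and \<delta>': "0 < \<delta>'" "\<delta>' \<le> 1" and G: "gen_const \<sigma> \<delta>' \<beta> C d0" and d: "d \<le> d0"
  and CP: "CP D U" and UT: "\<And>z. z \<in> D \<Longrightarrow> U T z \<le> h z"
  and ft: "\<And>V t t' z. V \<in> Vs \<Longrightarrow> \<bar>t - t'\<bar> \<le> \<tau> \<Longrightarrow> \<bar>f t V z - f t' V z\<bar> \<le> e3"
  and e2: "e3 + \<delta>' * (L * (Lam + 1)) + C * Mx * sqrt d \<le> e2" "0 \<le> e2"
  and t: "t \<in> {0<..T}" and z: "z \<in> D"
 shows "U t z \<le> W \<delta> t z + (Lam * \<delta> + 4 * \<eta> + N * (2 * Lam * \<delta>') + T * e2)"
proof -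
 define c where "c = 2 * Lam * \<delta>' + e2 * \<tau>"
 have Lam0: "0 \<le> Lam" using lip_nonneg[OF v_lip[of 0]] by simp
 have c0: "0 \<le> c" unfolding c_def using Lam0 \<delta>' e2 \<tau>_pos by simp
 have 1: "\<forall>z\<in>D. U (T - j * \<tau>) z \<le> v j z + j * c" if "j < N" for j
  using that
 proof (induction j)
  case 0 then show ?case using UT by simp
 next
  case (Suc j)
  show ?case
  proof
   fix z assume z: "z \<in> D"
   have "Suc j * \<tau> < N * \<tau>" using Suc.prems \<tau>_pos by (intro mult_strict_right_mono) auto
   then have s: "0 < T - Suc j * \<tau>" "T - Suc j * \<tau> < T - j * \<tau>" "T - Suc j * \<tau> \<le> T - Suc j * \<tau>" "(T - j * \<tau>) - (T - Suc j * \<tau>) = \<tau>"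
    using \<tau>_def \<tau>_pos by (simp_all add: algebra_simps)
   have *: "U (T - Suc j * \<tau>) z - (2 * Lam * \<delta>' + j * c + e2 * \<tau>) \<le> ev \<sigma> d (b V) (f (T - Suc j * \<tau>) V) \<tau> (v j) z"
    if V: "V \<in> Vs" for V
   proof -
    have "U (T - Suc j * \<tau>) z \<le> ev \<sigma> d (b V) (f (T - Suc j * \<tau>) V) ((T - j * \<tau>) - (T - Suc j * \<tau>)) (v j) z
      + 2 * Lam * \<delta>' + j * c + e2 * ((T - j * \<tau>) - (T - Suc j * \<tau>))"
     by (rule CP_step[OF V _ \<delta>' G d CP refl s(1-3) _ _ ft[OF V] e2(1) z]) (use Suc c0 in auto)
    then show ?thesis unfolding s(4) by linarith
   qed
   have "U (T - Suc j * \<tau>) z - (2 * Lam * \<delta>' + j * c + e2 * \<tau>) \<le> v (Suc j) z"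
    unfolding v.simps by (rule cINF_greatest[OF Vs_ne *])
   then show "U (T - Suc j * \<tau>) z \<le> v (Suc j) z + Suc j * c" unfolding c_def by (simp add: algebra_simps)
  qed
 qed
 let ?u = "(T - t) / \<tau>"
 define j where "j = nat \<lfloor>?u\<rfloor>"
 have u: "0 \<le> ?u" "?u \<le> real N" using u_range[of t] t by auto
 have uN: "?u < real N" using t \<tau>_def \<tau>_pos by (simp add: divide_less_eq mult.commute)
 have j: "real j \<le> ?u" "?u < real j + 1" unfolding j_def using u by linarith+
 then have jN: "j < N" using uN by linarith
 have tu: "t = T - ?u * \<tau>" using \<tau>_pos by simp
 have "real j * \<tau> \<le> ?u * \<tau>" "?u * \<tau> \<le> (real j + 1) * \<tau>" using j \<tau>_pos by (intro mult_right_mono; simp)+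
 then have tj: "t \<le> T - j * \<tau>" "T - Suc j * \<tau> \<le> t" using tu by (simp_all add: algebra_simps)
 have "U t z \<le> v j z + \<eta> + Suc j * c"
 proof (cases "t = T - j * \<tau>")
  case True
  then show ?thesis using 1[OF jN] z \<eta>_pos c0 by (simp add: algebra_simps) (smt (verit))
 next
  case False
  then have tlt: "t < T - j * \<tau>" using tj by simp
  \<comment> \<open>Between grid points one arbitrary control suffices: \<open>near\<close> shows
    that its evolution has moved by at most \<open>\<eta>\<close> since the last grid time.\<close>
  obtain V where V: "V \<in> Vs" using Vs_ne by blast
  let ?r = "(T - j * \<tau>) - t"
  have r: "0 \<le> ?r" "?r \<le> \<tau>" using tlt tj by (simp_all add: algebra_simps)
  have "U t z \<le> ev \<sigma> d (b V) (f (T - Suc j * \<tau>) V) ?r (v j) z + 2 * Lam * \<delta>' + j * c + e2 * ?r"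
   by (rule CP_step[OF V jN \<delta>' G d CP refl _ tlt tj(2) _ _ ft[OF V] e2(1) z]) (use 1[OF jN] c0 t in auto)
  moreover have "\<bar>ev \<sigma> d (b V) (f (T - Suc j * \<tau>) V) ?r (v j) z - v j z\<bar> \<le> \<eta>"
   using near[OF V v_lip _ _ r, of j] v_bounds[of j] jN by simp
  moreover have "e2 * ?r \<le> e2 * \<tau>" using r e2 by (intro mult_left_mono) auto
  moreover have "real (Suc j) * c = j * c + c" by (simp add: algebra_simps)
  ultimately show ?thesis using c_def by linarith
 qed
 moreover have "real (Suc j) * c \<le> N * c" using jN c0 by (intro mult_right_mono) auto
 moreover have "N * c = N * (2 * Lam * \<delta>') + T * e2"
  unfolding c_def using \<tau>_def by (simp add: algebra_simps)
 moreover have "\<bar>Vh ?u z - v j z\<bar> \<le> 3 * \<eta>" by (rule Vh_near[OF u]) (use j jN in auto)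
 moreover have "\<bar>W \<delta> t z - Vh ?u z\<bar> \<le> Lam * \<delta>" by (rule W_near_Vh[OF \<delta>]) (use t in auto)
 ultimately show ?thesis by linarith
qed

end

context scheme
begin

text \<open>All difficulty lies in the order of the choices. The scale \<open>\<delta>\<close> comes
  from \<open>\<theta>\<close>; it determines \<open>C1\<close>, hence \<open>\<eta>\<close>; this
  gives the admissible grid length and so \<open>N\<close>; then \<open>\<delta>'\<close> is chosen
  against \<open>N\<close>, which determines \<open>C3\<close>; the step \<open>d\<close> comes last
  and makes the terms with \<open>sqrt d\<close> small for both constants. Both
  \<open>\<eta>\<close> and the grid length can precede \<open>d\<close> because
  \<open>P_near_id\<close> is uniform in \<open>d\<close>.\<close>

theorem approximation:
 assumes \<theta>: "0 < \<theta>"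
 obtains W K where
  "\<forall>t\<in>{0..T}. \<forall>t'\<in>{0..T}. \<forall>z z'. \<bar>W t z - W t' z'\<bar> \<le> K * (\<bar>t - t'\<bar> + norm (z - z'))"
  "\<forall>t\<in>{0..T}. \<forall>z. 0 \<le> W t z \<and> W t z \<le> Mx"
  "\<forall>t\<in>{0<..<T}. \<forall>z. \<exists>a p Q. has_jet W t z a p Q \<and>
    (\<forall>V\<in>Vs. - \<theta> \<le> a + p (b V z) + (\<Sum>i\<in>UNIV. Q (\<sigma> i) (\<sigma> i)) / 2 + f t V z)"
  "\<forall>z. \<bar>W T z - h z\<bar> \<le> \<theta>"
  "\<And>D U. CP D U \<Longrightarrow> \<forall>z\<in>D. U T z \<le> h z \<Longrightarrow> \<forall>t\<in>{0<..T}. \<forall>z\<in>D. U t z \<le> W t z + \<theta>"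
proof -
 have Lam: "0 < Lam" unfolding Lam_def using L_ge by (intro mult_pos_pos) auto
 have Mx: "0 \<le> Mx" unfolding Mx_def using B_nonneg T_pos by simp
 define Q where "Q = Lam + L * (Lam + 1)"
 have Q: "0 < Q" "Lam \<le> Q" "L * (Lam + 1) \<le> Q" unfolding Q_def using Lam L_ge by (auto intro: add_pos_nonneg)
 have small: "\<exists>\<delta>. 0 < \<delta> \<and> \<delta> \<le> 1 \<and> \<delta> * q \<le> e" if "0 < e" "0 \<le> q" for e q :: real
 proof (intro exI conjI)
  show "0 < min 1 (e / (q + 1))" "min 1 (e / (q + 1)) \<le> 1" using that by auto
  have "min 1 (e / (q + 1)) * q \<le> e / (q + 1) * (q + 1)" using that by (intro mult_mono) auto
  then show "min 1 (e / (q + 1)) * q \<le> e" using that by simp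
 qed
 obtain \<delta> where \<delta>: "0 < \<delta>" "\<delta> \<le> 1" "\<delta> * Q \<le> \<theta> / 8" using small[of "\<theta> / 8" Q] \<theta> Q by auto
 have \<delta>L: "Lam * \<delta> \<le> \<theta> / 8" "\<delta> * (L * (Lam + 1)) \<le> \<theta> / 8"
  using \<delta> mult_left_mono[OF Q(2), of \<delta>] mult_left_mono[OF Q(3), of \<delta>] mult.commute[of Lam \<delta>] by linarith+
 obtain C1 d1 where G1: "gen_const \<sigma> \<delta> \<beta> C1 d1" using gen_const_exists[OF \<delta>(1,2) \<beta>_nonneg] by blast
 have C1: "0 \<le> C1" "0 < d1" using G1 by (auto simp: gen_const_def)
 obtain \<eta> where \<eta>: "0 < \<eta>" "\<eta> * (4 + 4 * C1) \<le> \<theta> / 8" using small[of "\<theta> / 8" "4 + 4 * C1"] \<theta> C1 by auto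
 have \<eta>C: "4 * \<eta> \<le> \<theta> / 8" "4 * C1 * \<eta> \<le> \<theta> / 8"
 proof -
  have "\<eta> * (4 + 4 * C1) = 4 * \<eta> + 4 * C1 * \<eta>" "0 \<le> 4 * C1 * \<eta>" using \<eta> C1 by (simp_all add: algebra_simps)
  then show "4 * \<eta> \<le> \<theta> / 8" "4 * C1 * \<eta> \<le> \<theta> / 8" using \<eta> by linarith+
 qed
 obtain s0 d2 where s0: "0 < s0" "0 < d2" and nr: "\<And>d (b::'a \<Rightarrow> 'a) g \<phi> r z. one_control d b g L B \<Longrightarrow> d \<le> d2 \<Longrightarrow> (\<And>z. norm (b z) \<le> \<beta>)
   \<Longrightarrow> lip Lam \<phi> \<Longrightarrow> (\<And>y. 0 \<le> \<phi> y) \<Longrightarrow> (\<And>y. \<phi> y \<le> Mx) \<Longrightarrow> 0 \<le> r \<Longrightarrow> r \<le> s0 \<Longrightarrow> \<bar>ev \<sigma> d b g r \<phi> z - \<phi> z\<bar> \<le> \<eta>"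
  using P_near_id[OF \<eta>(1) less_imp_le[OF Lam] Mx L_ge B_nonneg \<beta>_nonneg, of \<sigma>] by metis
 \<comment> \<open>The second entry is for the comparison bound, in which the error is multiplied by
   the horizon \<open>T\<close>.\<close>
 define e3 where "e3 = min (\<theta> / 8) (\<theta> / (8 * T))"
 have e3: "0 < e3" "e3 \<le> \<theta> / 8" "e3 \<le> \<theta> / (8 * T)" unfolding e3_def using \<theta> T_pos by auto
 obtain r3 where r3: "0 < r3" "\<And>t t' V z. V \<in> Vs \<Longrightarrow> \<bar>t - t'\<bar> \<le> r3 \<Longrightarrow> \<bar>f t V z - f t' V z\<bar> \<le> e3"
  using f_time[OF e3(1)] by metis
 obtain N :: nat where N: "T / min s0 (r3 / 2) < real N" using reals_Archimedean2 by blast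
 have mp: "0 < min s0 (r3 / 2)" using s0 r3 by auto
 have N0: "0 < N" using N T_pos mp by (metis divide_pos_pos less_trans of_nat_0_less_iff)
 define \<tau> where "\<tau> = T / N"
 have \<tau>N: "\<tau> * N = T" unfolding \<tau>_def using N0 by simp
 \<comment> \<open>The half of \<open>r3\<close> is taken because \<open>W_sub\<close> compares
   costs at times up to \<open>2 * \<tau>\<close> apart.\<close>
 have "\<tau> \<le> min s0 (r3 / 2)" 
 proof -
  have "T < real N * min s0 (r3 / 2)" using N unfolding pos_divide_less_eq[OF mp] .
  moreover have N': "0 < real N" using N0 by simp
  ultimately show ?thesis unfolding \<tau>_def pos_divide_le_eq[OF N'] by (simp only: mult.commute less_imp_le)
 qed
 then have \<tau>: "\<tau> \<le> s0" "2 * \<tau> \<le> r3" by auto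
 have \<tau>p: "0 < \<tau>" unfolding \<tau>_def using T_pos N0 by simp
 \<comment> \<open>Mollification at scale \<open>\<delta>'\<close> is paid on each of the
   \<open>N\<close> intervals, and the commutator error over the total time
   \<open>T\<close>.\<close>
 obtain \<delta>' where \<delta>': "0 < \<delta>'" "\<delta>' \<le> 1" "\<delta>' * (N * 2 * Lam + T * (L * (Lam + 1))) \<le> \<theta> / 8"
  using small[of "\<theta> / 8" "N * 2 * Lam + T * (L * (Lam + 1))"] \<theta> Lam L_ge T_pos by auto
 have nn: "0 \<le> \<delta>' * (N * 2 * Lam)" "0 \<le> \<delta>' * (T * (L * (Lam + 1)))" using \<delta>' Lam L_ge T_pos by auto
 have \<delta>'L: "N * (2 * Lam * \<delta>') \<le> \<theta> / 8" "\<delta>' * (T * (L * (Lam + 1))) \<le> \<theta> / 8"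
  using \<delta>'(3) nn by (simp_all add: distrib_left mult_ac)
 have "T * (\<delta>' * (L * (Lam + 1))) \<le> \<theta> / 8" using \<delta>'L(2) by (simp add: mult_ac)
 then have \<delta>'T: "\<delta>' * (L * (Lam + 1)) \<le> \<theta> / (8 * T)" using T_pos by (simp add: pos_le_divide_eq mult_ac)
 obtain C3 d3 where G3: "gen_const \<sigma> \<delta>' \<beta> C3 d3" using gen_const_exists[OF \<delta>'(1,2) \<beta>_nonneg] by blast
 have C3: "0 \<le> C3" "0 < d3" using G3 by (auto simp: gen_const_def)
 obtain q where q: "0 < q" "q \<le> 1" "q * (C1 * Mx + C3 * Mx) \<le> e3" using small[OF e3(1), of "C1 * Mx + C3 * Mx"] C1 C3 Mx by auto
 define d where "d = min (min d1 d2) (min d3 (q\<^sup>2))"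
 have d: "0 < d" "d \<le> d1" "d \<le> d2" "d \<le> d3" "d \<le> q\<^sup>2" unfolding d_def using C1 C3 s0 q by auto
 have "sqrt d \<le> q" using d q by (simp add: real_le_lsqrt)
 then have sd: "C1 * Mx * sqrt d \<le> C1 * Mx * q" "C3 * Mx * sqrt d \<le> C3 * Mx * q" using C1 C3 Mx by (auto intro!: mult_left_mono)
 have nn: "0 \<le> q * (C1 * Mx)" "0 \<le> q * (C3 * Mx)" using q C1 C3 Mx by auto
 have sd: "C1 * Mx * sqrt d \<le> e3" "C3 * Mx * sqrt d \<le> e3" using sd q(3) nn by (simp_all add: distrib_left mult_ac)
 interpret scheme_run \<sigma> b f h Vs L B \<beta> T N \<tau> d \<eta>
 proof (unfold_locales, goal_cases)
  case (5 V t \<phi> r z)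
  show ?case by (rule nr[OF oc[OF 5(1) d(1)] d(3) b_bound[OF 5(1)] 5(2-5)]) (use 5 \<tau> in auto)
 qed (use N0 \<tau>N d \<eta> in auto)
 obtain K where K: "\<forall>t\<in>{0..T}. \<forall>t'\<in>{0..T}. \<forall>z z'. \<bar>W \<delta> t z - W \<delta> t' z'\<bar> \<le> K * (\<bar>t - t'\<bar> + norm (z - z'))"
  using W_lip[OF \<delta>(1)] by blast
 show ?thesis
 proof (rule that[OF K])
  show "\<forall>t\<in>{0..T}. \<forall>z. 0 \<le> W \<delta> t z \<and> W \<delta> t z \<le> Mx" using W_bounds[OF \<delta>(1)] by blast
  show "\<forall>t\<in>{0<..<T}. \<forall>z. \<exists>a p Q. has_jet (W \<delta>) t z a p Q \<and>
    (\<forall>V\<in>Vs. - \<theta> \<le> a + p (b V z) + (\<Sum>i\<in>UNIV. Q (\<sigma> i) (\<sigma> i)) / 2 + f t V z)"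
  proof (intro ballI allI, rule exI, rule exI, rule exI, rule conjI, rule W_jet[OF \<delta>(1,2)], assumption, rule ballI)
   fix t z V assume t: "t \<in> {0<..<T}" and V: "V \<in> Vs"
   have "- (\<delta> * (L * (Lam + 1)) + C1 * Mx * sqrt d + 4 * C1 * \<eta> + e3)
    \<le> - moll \<delta> (Vh' ((T - t) / \<tau>)) z / \<tau> + gen \<sigma> \<delta> (b V z) (Vh ((T - t) / \<tau>)) z + f t V z"
    by (rule W_sub[OF \<delta>(1,2) G1 d(2) t V r3(2)[OF V]]) (use \<tau> in auto)
   then show "- \<theta> \<le> - moll \<delta> (Vh' ((T - t) / \<tau>)) z / \<tau> + moll1 \<delta> (Vh ((T - t) / \<tau>)) z (b V z)
    + (\<Sum>i\<in>UNIV. moll2 \<delta> (Vh ((T - t) / \<tau>)) z (\<sigma> i) (\<sigma> i)) / 2 + f t V z"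
    unfolding gen_def using \<delta>L \<eta>C sd e3 \<theta> by linarith
  qed
  show "\<forall>z. \<bar>W \<delta> T z - h z\<bar> \<le> \<theta>"
  proof
   fix z
   have "\<bar>W \<delta> T z - Vh 0 z\<bar> \<le> Lam * \<delta>" using W_near_Vh[OF \<delta>(1), of T z] T_pos by simp
   moreover have "\<bar>Vh 0 z - h z\<bar> \<le> 3 * \<eta>" using Vh_near[of 0 0 z] by simp
   ultimately show "\<bar>W \<delta> T z - h z\<bar> \<le> \<theta>" using \<delta>L \<eta>C \<theta> by linarith
  qed
  fix D U assume CP: "CP D U" and UT: "\<forall>z\<in>D. U T z \<le> h z"
  show "\<forall>t\<in>{0<..T}. \<forall>z\<in>D. U t z \<le> W \<delta> t z + \<theta>"
  proof (intro ballI)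
   fix t z assume t: "t \<in> {0<..T}" and z: "z \<in> D"
   have "U t z \<le> W \<delta> t z + (Lam * \<delta> + 4 * \<eta> + N * (2 * Lam * \<delta>') + T * (3 * (\<theta> / (8 * T))))"
   proof (rule W_super[OF \<delta>(1) \<delta>'(1,2) G3 d(4) CP _ r3(2) _ _ t z])
    show "e3 + \<delta>' * (L * (Lam + 1)) + C3 * Mx * sqrt d \<le> 3 * (\<theta> / (8 * T))" using sd e3 \<delta>'T by linarith
   qed (use UT \<tau> \<tau>p \<theta> T_pos in auto)
   moreover have "T * (3 * (\<theta> / (8 * T))) = 3 * \<theta> / 8" using T_pos by simp
   ultimately show "U t z \<le> W \<delta> t z + \<theta>" using \<delta>L \<eta>C \<delta>'L \<theta> by linarith
  qed
 qed
qed

end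

abbreviation pos_simplex :: "(real ^ 'n::finite) set" ("\<P>") where
 "\<P> \<equiv> prob_simplex_int"

abbreviation (input) open_domain :: "real \<Rightarrow> (real \<times> (real ^ 'n::finite) \<times> (real ^ 'n)) set" ("\<D>") where
 "\<D> T \<equiv> {0<..<T} \<times> \<P> \<times> UNIV"

abbreviation (input) domain_with_end :: "real \<Rightarrow> (real \<times> (real ^ 'n::finite) \<times> (real ^ 'n)) set" ("\<Q>") where
 "\<Q> T \<equiv> {0<..T} \<times> \<P> \<times> UNIV"

subsection \<open>The simplex\<close>

lemma prob_simplex_alt: "prob_simplex = {r :: real ^ 'n::finite. (\<forall>i. 0 \<le> r $ i) \<and> (\<Sum>i\<in>UNIV. r $ i) = 1}"
proof -
 have "r $ i \<le> 1" if "\<forall>i. 0 \<le> r $ i" "(\<Sum>i\<in>UNIV. r $ i) = 1" for r :: "real ^ 'n" and i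
  using member_le_sum[of i UNIV "\<lambda>i. r $ i"] that by simp
 then show ?thesis unfolding prob_simplex_def by blast
qed

lemma convex_prob_simplex: "convex (prob_simplex :: (real ^ 'n::finite) set)"
 unfolding prob_simplex_alt convex_def
 by (auto simp: sum.distrib sum_distrib_left[symmetric] intro!: add_nonneg_nonneg)

lemma axis_in_prob_simplex: "axis i 1 \<in> (prob_simplex :: (real ^ 'n::finite) set)"
 unfolding prob_simplex_alt by (auto simp: axis_def)

text \<open>Every segment ending at a relative interior point can be prolonged beyond it. Prolonging
  away from the vertex \<open>axis i 1\<close> shows that coordinate \<open>i\<close> is positive;
  conversely the smallest coordinate of \<open>r\<close> is a possible length of prolongation for
  all starting points.\<close>

lemma prob_simplex_int_iff:
 "r \<in> \<P> \<longleftrightarrow> (\<forall>i. 0 < r $ i) \<and> (\<Sum>i\<in>UNIV. r $ i) = 1" for r :: "real ^ 'n::finite"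
proof -
 have ne: "(prob_simplex :: (real ^ 'n) set) \<noteq> {}" using axis_in_prob_simplex by blast
 have "r \<in> \<P> \<longleftrightarrow> (\<forall>x\<in>prob_simplex. \<exists>e>1. (1 - e) *\<^sub>R x + e *\<^sub>R r \<in> prob_simplex)"
  by (rule convex_rel_interior_iff[OF convex_prob_simplex ne])
 also have "\<dots> \<longleftrightarrow> (\<forall>i. 0 < r $ i) \<and> (\<Sum>i\<in>UNIV. r $ i) = 1"
 proof safe
  fix i assume "\<forall>x\<in>prob_simplex. \<exists>e>1. (1 - e) *\<^sub>R x + e *\<^sub>R r \<in> prob_simplex"
  then obtain e where e: "1 < e" "(1 - e) *\<^sub>R axis i 1 + e *\<^sub>R r \<in> prob_simplex" using axis_in_prob_simplex by blast
  then have "0 \<le> (1 - e) + e * r $ i" unfolding prob_simplex_alt by (auto dest: spec[of _ i])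
  then have "0 < e * r $ i" using e by simp
  then show "0 < r $ i" using e by (simp add: zero_less_mult_iff)
 next
  assume "\<forall>x\<in>prob_simplex. \<exists>e>1. (1 - e) *\<^sub>R x + e *\<^sub>R r \<in> prob_simplex"
  then obtain e where e: "1 < e" "(1 - e) *\<^sub>R axis (undefined :: 'n) 1 + e *\<^sub>R r \<in> prob_simplex" using axis_in_prob_simplex by blast
  have "(\<Sum>i\<in>UNIV. axis (undefined :: 'n) 1 $ i) = (1::real)" by (simp add: axis_def)
  then have "(1 - e) + e * (\<Sum>i\<in>UNIV. r $ i) = 1"
   using e(2) unfolding prob_simplex_alt by (simp add: sum.distrib sum_distrib_left[symmetric])
  then have "e * ((\<Sum>i\<in>UNIV. r $ i) - 1) = 0" by (simp add: algebra_simps)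
  then show "(\<Sum>i\<in>UNIV. r $ i) = 1" using e by simp
 next
  fix x :: "real ^ 'n" assume p: "\<forall>i. 0 < r $ i" and s: "(\<Sum>i\<in>UNIV. r $ i) = 1" and x: "x \<in> prob_simplex"
  define m where "m = Min (range (\<lambda>i. r $ i))"
  have m: "m \<le> r $ i" for i unfolding m_def by (rule Min_le) auto
  have m0: "0 < m" unfolding m_def using p by (subst Min_gr_iff) auto
  have "0 \<le> (1 - (1 + m)) * x $ i + (1 + m) * r $ i" for i
  proof -
   have "m * x $ i \<le> m * 1" using x m0 unfolding prob_simplex_def by (intro mult_left_mono) auto
   moreover have "0 \<le> m * r $ i" using m0 p less_imp_le by (intro mult_nonneg_nonneg) auto
   ultimately show ?thesis using m[of i] by (simp add: algebra_simps)
  qed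
  moreover have "(\<Sum>i\<in>UNIV. (1 - (1 + m)) * x $ i + (1 + m) * r $ i) = 1"
   using x s unfolding prob_simplex_alt by (simp add: sum.distrib sum_subtractf sum_distrib_left[symmetric])
  ultimately have "(1 - (1 + m)) *\<^sub>R x + (1 + m) *\<^sub>R r \<in> prob_simplex" unfolding prob_simplex_alt by simp
  then show "\<exists>e>1. (1 - e) *\<^sub>R x + e *\<^sub>R r \<in> prob_simplex" using m0 by (intro exI[of _ "1 + m"]) auto
 qed
 finally show ?thesis .
qed

lemma prob_simplex_int_subset: "r \<in> \<P> \<Longrightarrow> r \<in> prob_simplex"
 by (meson rel_interior_subset subsetD)

text \<open>Negative \<open>s\<close> is included: the segment extends to both sides of an interior
  point, which makes derivatives on the simplex two-sided.\<close>

lemma prob_simplex_int_segment: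
 fixes r \<mu> :: "real ^ 'n::finite"
 assumes "r \<in> \<P>" "\<mu> \<in> prob_simplex"
 shows "\<exists>d>0. \<forall>s. \<bar>s\<bar> < d \<longrightarrow> (1 - s) *\<^sub>R r + s *\<^sub>R \<mu> \<in> \<P>"
proof -
 have p: "\<forall>i. 0 < r $ i" and s: "(\<Sum>i\<in>UNIV. r $ i) = 1" using assms by (auto simp: prob_simplex_int_iff)
 define m where "m = Min (range (\<lambda>i. r $ i))"
 have m: "m \<le> r $ i" for i unfolding m_def by (rule Min_le) auto
 have m0: "0 < m" unfolding m_def using p by (subst Min_gr_iff) auto
 have "(1 - R) *\<^sub>R r + R *\<^sub>R \<mu> \<in> \<P>" if R: "\<bar>R\<bar> < m" for R
 proof -
  have "0 < (1 - R) * r $ i + R * \<mu> $ i" for i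
  proof -
   have "\<bar>\<mu> $ i - r $ i\<bar> \<le> 1"
    using assms(2) prob_simplex_int_subset[OF assms(1)] unfolding prob_simplex_def by (auto simp: abs_le_iff dest!: spec[of _ i])
   then have "\<bar>R * (\<mu> $ i - r $ i)\<bar> \<le> \<bar>R\<bar>" unfolding abs_mult by (simp add: mult_left_le)
   then show ?thesis using R m[of i] by (simp add: algebra_simps)
  qed
  moreover have "(\<Sum>i\<in>UNIV. (1 - R) * r $ i + R * \<mu> $ i) = 1"
   using assms(2) s unfolding prob_simplex_alt by (simp add: sum.distrib sum_distrib_left[symmetric])
  ultimately show ?thesis unfolding prob_simplex_int_iff by simp
 qed
 then show ?thesis using m0 by blast
qed

text \<open>The orthogonal projection onto the vectors of coordinate sum 0; it sends a Euclidean
  gradient to the derivative on the simplex.\<close>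

definition tangential :: "real ^ 'n::finite \<Rightarrow> real ^ 'n" where
 "tangential p = (\<chi> i. p $ i - (\<Sum>j\<in>UNIV. p $ j) / real CARD('n))"

lemma tangential_sum: "(\<Sum>i\<in>UNIV. tangential p $ i) = 0"
 unfolding tangential_def by (simp add: sum_subtractf)

lemma tangential_inner:
 assumes "(\<Sum>i\<in>UNIV. v $ i) = 0"
 shows "tangential p \<bullet> v = p \<bullet> v"
 unfolding tangential_def inner_vec_def
 by (simp add: left_diff_distrib sum_subtractf sum_distrib_left[symmetric] sum_divide_distrib[symmetric] assms)

lemma simplex_diff_sum: "\<mu> \<in> prob_simplex \<Longrightarrow> r \<in> prob_simplex \<Longrightarrow> (\<Sum>i\<in>UNIV. (\<mu> - r) $ i) = 0"
 by (simp add: prob_simplex_alt sum_subtractf)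

text \<open>Testing with the vertices shows that all coordinates of \<open>p - p'\<close> agree, and
  their sum is 0.\<close>

lemma simplex_inner_unique:
 fixes p p' :: "real ^ 'n::finite"
 assumes "(\<Sum>i\<in>UNIV. p $ i) = 0" "(\<Sum>i\<in>UNIV. p' $ i) = 0"
  and e: "\<And>\<mu>. \<mu> \<in> prob_simplex \<Longrightarrow> p \<bullet> (\<mu> - r) = p' \<bullet> (\<mu> - r)"
 shows "p = p'"
proof -
 define c where "c = (p - p') \<bullet> r"
 have "(p - p') $ i = c" for i
  using e[OF axis_in_prob_simplex[of i]] unfolding c_def by (simp add: inner_diff_left inner_diff_right inner_axis algebra_simps)
 moreover have "(\<Sum>i\<in>UNIV. (p - p') $ i) = 0" using assms by (simp add: sum_subtractf)
 ultimately have "c = 0" by simp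
 with \<open>\<And>i. (p - p') $ i = c\<close> show ?thesis by (simp add: vec_eq_iff)
qed

lemma simplex_derivative_limit:
 assumes "r \<in> \<P>" "\<mu> \<in> prob_simplex"
 shows "at 0 within {s. (1 - s) *\<^sub>R r + s *\<^sub>R \<mu> \<in> prob_simplex} = at (0::real)"
proof -
 obtain d where "0 < d" "\<And>s. \<bar>s\<bar> < d \<Longrightarrow> (1 - s) *\<^sub>R r + s *\<^sub>R \<mu> \<in> \<P>"
  using prob_simplex_int_segment[OF assms] by blast
 then have "\<And>s. \<bar>s\<bar> < d \<Longrightarrow> (1 - s) *\<^sub>R r + s *\<^sub>R \<mu> \<in> prob_simplex" by (blast intro: prob_simplex_int_subset)
 with \<open>0 < d\<close> have "(0::real) \<in> interior {s. (1 - s) *\<^sub>R r + s *\<^sub>R \<mu> \<in> prob_simplex}"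
  unfolding mem_interior by (intro exI[of _ d]) (auto simp: dist_real_def)
 then show ?thesis by (rule at_within_interior)
qed

lemma has_simplex_derivative_iff:
 assumes "r \<in> \<P>"
 shows "has_simplex_derivative f p r \<longleftrightarrow> (\<Sum>i\<in>UNIV. p $ i) = 0 \<and>
  (\<forall>\<mu>\<in>prob_simplex. ((\<lambda>s. f (r + s *\<^sub>R (\<mu> - r))) has_real_derivative p \<bullet> (\<mu> - r)) (at 0))"
 unfolding has_simplex_derivative_def has_field_derivative_iff
 using simplex_derivative_limit[OF assms] by (simp add: algebra_simps)

lemma has_simplex_derivative_unique:
 fixes f :: "real ^ 'n::finite \<Rightarrow> real"
 assumes r: "r \<in> \<P>" and "has_simplex_derivative f p r" "has_simplex_derivative f p' r"
 shows "p = p'"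
proof (rule simplex_inner_unique[of p p' r])
 fix \<mu> :: "real ^ 'n" assume "\<mu> \<in> prob_simplex"
 then show "p \<bullet> (\<mu> - r) = p' \<bullet> (\<mu> - r)"
  using assms(2,3) DERIV_unique unfolding has_simplex_derivative_iff[OF r] by blast
qed (use assms in \<open>auto simp: has_simplex_derivative_iff[OF r]\<close>)

lemma simplex_derivative_eq:
 assumes "r \<in> \<P>" "has_simplex_derivative f p r"
 shows "simplex_derivative f r = p"
 unfolding simplex_derivative_def using assms has_simplex_derivative_unique by blast

lemma has_simplex_derivative_gradient:
 fixes f :: "real ^ 'n::finite \<Rightarrow> real"
 assumes r: "r \<in> \<P>" and f: "(f has_derivative (\<lambda>v. p \<bullet> v)) (at r)"
 shows "has_simplex_derivative f (tangential p) r"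
 unfolding has_simplex_derivative_iff[OF r]
proof (intro conjI ballI tangential_sum)
 fix \<mu> :: "real ^ 'n" assume \<mu>: "\<mu> \<in> prob_simplex"
 have "((\<lambda>s. r + s *\<^sub>R (\<mu> - r)) has_derivative (\<lambda>s. s *\<^sub>R (\<mu> - r))) (at 0)"
  by (auto intro!: derivative_eq_intros)
 then have "((\<lambda>s. f (r + s *\<^sub>R (\<mu> - r))) has_derivative (\<lambda>s. p \<bullet> (s *\<^sub>R (\<mu> - r)))) (at 0)"
  by (rule has_derivative_compose) (use f in simp)
 then have "((\<lambda>s. f (r + s *\<^sub>R (\<mu> - r))) has_real_derivative p \<bullet> (\<mu> - r)) (at 0)"
  unfolding has_field_derivative_def by (simp add: mult_commute_abs)
 then show "((\<lambda>s. f (r + s *\<^sub>R (\<mu> - r))) has_real_derivative tangential p \<bullet> (\<mu> - r)) (at 0)"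
  using tangential_inner[OF simplex_diff_sum[OF \<mu> prob_simplex_int_subset[OF r]]] by simp
qed

subsection \<open>Jets\<close>

text \<open>Neighbourhoods within the open domain as boxes, so that one variable at a time can be
  varied. The centre belongs to the box, unlike for the filter \<open>at\<close>, which explains the
  premise at the centre in \<open>eventually_near\<close>.\<close>

definition near :: "real \<Rightarrow> real \<Rightarrow> real ^ 'n::finite \<Rightarrow> real ^ 'n \<Rightarrow> (real \<Rightarrow> real ^ 'n \<Rightarrow> real ^ 'n \<Rightarrow> bool) \<Rightarrow> bool" where
 "near T t0 r0 x0 P \<longleftrightarrow> (\<exists>d>0. \<forall>t r x. t \<in> {0<..<T} \<and> r \<in> \<P> \<and> \<bar>t - t0\<bar> < d \<and> norm (r - r0) < d \<and> norm (x - x0) < d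
   \<longrightarrow> P t r x)"

lemma nearI: "0 < d \<Longrightarrow> (\<And>t r x. t \<in> {0<..<T} \<Longrightarrow> r \<in> \<P> \<Longrightarrow> \<bar>t - t0\<bar> < d \<Longrightarrow> norm (r - r0) < d
  \<Longrightarrow> norm (x - x0) < d \<Longrightarrow> P t r x) \<Longrightarrow> near T t0 r0 x0 P"
 unfolding near_def by blast

lemma near_mono: "near T t0 r0 x0 P \<Longrightarrow> (\<And>t r x. t \<in> {0<..<T} \<Longrightarrow> r \<in> \<P> \<Longrightarrow> P t r x \<Longrightarrow> Q t r x) \<Longrightarrow> near T t0 r0 x0 Q"
 unfolding near_def by blast

lemma near_conj: "near T t0 r0 x0 P \<Longrightarrow> near T t0 r0 x0 Q \<Longrightarrow> near T t0 r0 x0 (\<lambda>t r x. P t r x \<and> Q t r x)"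
 unfolding near_def
proof (elim exE conjE)
 fix d e assume "0 < d" "0 < e"
  "\<forall>t r x. t \<in> {0<..<T} \<and> r \<in> \<P> \<and> \<bar>t - t0\<bar> < d \<and> norm (r - r0) < d \<and> norm (x - x0) < d \<longrightarrow> P t r x"
  "\<forall>t r x. t \<in> {0<..<T} \<and> r \<in> \<P> \<and> \<bar>t - t0\<bar> < e \<and> norm (r - r0) < e \<and> norm (x - x0) < e \<longrightarrow> Q t r x"
 then show "\<exists>d>0. \<forall>t r x. t \<in> {0<..<T} \<and> r \<in> \<P> \<and> \<bar>t - t0\<bar> < d \<and> norm (r - r0) < d \<and> norm (x - x0) < d
   \<longrightarrow> P t r x \<and> Q t r x"
  by (intro exI[of _ "min d e"]) simp
qed

lemma near_eventually:
 fixes r0 x0 :: "real ^ 'n::finite"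
 assumes "near T t0 r0 x0 P"
 shows "\<forall>\<^sub>F (t, r, x) in at (t0, r0, x0) within \<D> T. P t r x"
proof -
 obtain d where d: "0 < d" "\<And>t r x. t \<in> {0<..<T} \<Longrightarrow> r \<in> \<P> \<Longrightarrow> \<bar>t - t0\<bar> < d \<Longrightarrow> norm (r - r0) < d \<Longrightarrow> norm (x - x0) < d \<Longrightarrow> P t r x"
  using assms unfolding near_def by blast
 show ?thesis
  unfolding eventually_at
 proof (rule exI[of _ d], intro conjI ballI impI d(1), elim conjE)
  fix z :: "real \<times> (real ^ 'n) \<times> (real ^ 'n)" assume z: "z \<in> \<D> T" "dist z (t0, r0, x0) < d"
  obtain t r x where e: "z = (t, r, x)" by (metis prod_cases3)
  have "dist t t0 \<le> dist z (t0, r0, x0)" "dist (r, x) (r0, x0) \<le> dist z (t0, r0, x0)"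
   "dist r r0 \<le> dist (r, x) (r0, x0)" "dist x x0 \<le> dist (r, x) (r0, x0)"
   unfolding e by (metis dist_fst_le dist_snd_le fst_conv snd_conv)+
  then show "case z of (t, r, x) \<Rightarrow> P t r x" using z d(2)[of t r x] unfolding e by (simp add: dist_norm)
 qed
qed

lemma eventually_near:
 fixes r0 x0 :: "real ^ 'n::finite"
 assumes "\<forall>\<^sub>F (t, r, x) in at (t0, r0, x0) within \<D> T. P t r x" and P0: "P t0 r0 x0"
 shows "near T t0 r0 x0 P"
proof -
 obtain d where d: "0 < d" "\<And>z. z \<in> \<D> T \<Longrightarrow> z \<noteq> (t0, r0, x0) \<Longrightarrow> dist z (t0, r0, x0) < d \<Longrightarrow> (case z of (t, r, x) \<Rightarrow> P t r x)"
  using assms(1) unfolding eventually_at by blast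
 show ?thesis
 proof (rule nearI[of "d / 3"])
  fix t r x assume a: "t \<in> {0<..<T}" "r \<in> \<P>" "\<bar>t - t0\<bar> < d / 3" "norm (r - r0) < d / 3" "norm (x - x0) < d / 3"
  have "dist (t, r, x) (t0, r0, x0) \<le> dist t t0 + dist (r, x) (r0, x0)" "dist (r, x) (r0, x0) \<le> dist r r0 + dist x x0"
   unfolding dist_Pair_Pair by (rule sqrt_sum_squares_le_sum; simp)+
  then have "dist (t, r, x) (t0, r0, x0) < d" using a by (simp add: dist_norm)
  then show "P t r x" using d(2)[of "(t, r, x)"] a P0 by (cases "(t, r, x) = (t0, r0, x0)") auto
 qed (use d in auto)
qed

lemma grad_has_derivative:
 fixes f :: "real ^ 'n::finite \<Rightarrow> real"
 assumes "f differentiable (at x)"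
 shows "(f has_derivative (\<lambda>v. grad f x \<bullet> v)) (at x)"
proof -
 let ?D = "frechet_derivative f (at x)"
 have D: "(f has_derivative ?D) (at x)" using assms frechet_derivative_works by blast
 then have l: "linear ?D" by (rule has_derivative_linear)
 have "?D v = grad f x \<bullet> v" for v
 proof -
  have "v = (\<Sum>i\<in>UNIV. v $ i *\<^sub>R axis i 1)"
   using basis_expansion[of v] by (simp add: scalar_mult_eq_scaleR)
  then have "?D v = (\<Sum>i\<in>UNIV. v $ i *\<^sub>R ?D (axis i 1))" using linear_sum[OF l] linear_scale[OF l] by (metis (no_types, lifting) sum.cong)
  then show ?thesis unfolding grad_def inner_vec_def by (simp add: mult.commute)
 qed
 then have "?D = (\<lambda>v. grad f x \<bullet> v)" by blast
 with D show ?thesis by simp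
qed

lemma grad_unique:
 fixes f :: "real ^ 'n::finite \<Rightarrow> real"
 assumes "(f has_derivative (\<lambda>v. p \<bullet> v)) (at x)"
 shows "grad f x = p"
 unfolding grad_def
 by (simp add: frechet_derivative_at[OF assms, symmetric] vec_eq_iff inner_axis)

lemma hessian_unique:
 fixes f :: "real ^ 'n::finite \<Rightarrow> real"
 assumes "(grad f has_derivative (\<lambda>v. Q *v v)) (at x)"
 shows "hessian f x = Q"
 unfolding hessian_def jacobian_def using frechet_derivative_at[OF assms]
 by (metis matrix_of_matrix_vector_mul)

text \<open>The Peano form of the expansion: the gradient is differentiable at \<open>x0\<close>
  only and the Hessian need not be continuous. Along a segment the quadratic polynomial is
  subtracted, and the derivative of the difference is the linearisation error of the
  gradient.\<close>

lemma twice_differentiable_taylor: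
 fixes f :: "real ^ 'n::finite \<Rightarrow> real"
 assumes f: "twice_differentiable_at f x0" and \<kappa>: "0 < \<kappa>"
 shows "\<exists>d>0. \<forall>x. norm (x - x0) < d \<longrightarrow>
  \<bar>f x - f x0 - grad f x0 \<bullet> (x - x0) - (x - x0) \<bullet> (hessian f x0 *v (x - x0)) / 2\<bar> \<le> \<kappa> * (norm (x - x0))\<^sup>2"
proof -
 let ?H = "hessian f x0"
 obtain d1 where d1: "0 < d1" "\<And>y. dist y x0 < d1 \<Longrightarrow> f differentiable (at y)"
  using f unfolding twice_differentiable_at_def eventually_nhds_metric by blast
 have "(grad f has_derivative (\<lambda>h. ?H *v h)) (at x0)"
  using f jacobian_works unfolding twice_differentiable_at_def hessian_def by blast
 then obtain d2 where d2: "0 < d2" "\<And>y. norm (y - x0) < d2 \<Longrightarrow> norm (grad f y - grad f x0 - ?H *v (y - x0)) \<le> \<kappa> * norm (y - x0)"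
  using \<kappa> unfolding has_derivative_at_alt by blast
 show ?thesis
 proof (rule exI[of _ "min d1 d2"], intro conjI allI impI)
  show "0 < min d1 d2" using d1 d2 by simp
  fix x assume x: "norm (x - x0) < min d1 d2"
  define h where "h = x - x0"
  let ?g = "\<lambda>s. f (x0 + s *\<^sub>R h) - s * (grad f x0 \<bullet> h) - s\<^sup>2 * (h \<bullet> (?H *v h)) / 2"
  let ?d = "\<lambda>s. grad f (x0 + s *\<^sub>R h) - grad f x0 - ?H *v (s *\<^sub>R h)"
  have "norm (?g 1 - ?g 0) \<le> \<kappa> * (norm h)\<^sup>2 * norm (1 - 0 :: real)"
  proof (rule field_differentiable_bound[of "{0..1}" ?g "\<lambda>s. (?d s) \<bullet> h"])
   fix s :: real assume s: "s \<in> {0..1}"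
   have ns: "norm (s *\<^sub>R h) \<le> norm h" using s by (simp add: mult_left_le_one_le)
   have "f differentiable (at (x0 + s *\<^sub>R h))" by (rule d1(2)) (use ns x in \<open>simp add: dist_norm h_def\<close>)
   then have D: "(f has_derivative (\<lambda>v. grad f (x0 + s *\<^sub>R h) \<bullet> v)) (at (x0 + s *\<^sub>R h))" by (rule grad_has_derivative)
   have "((\<lambda>s. x0 + s *\<^sub>R h) has_derivative (\<lambda>s. s *\<^sub>R h)) (at s)" by (auto intro!: derivative_eq_intros)
   from has_derivative_compose[OF this D]
   have "((\<lambda>s. f (x0 + s *\<^sub>R h)) has_real_derivative grad f (x0 + s *\<^sub>R h) \<bullet> h) (at s)"
    unfolding has_field_derivative_def by (simp add: mult_commute_abs)
   then have "(?g has_real_derivative grad f (x0 + s *\<^sub>R h) \<bullet> h - grad f x0 \<bullet> h - s * (h \<bullet> (?H *v h))) (at s)"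
    by (auto intro!: derivative_eq_intros)
   moreover have "grad f (x0 + s *\<^sub>R h) \<bullet> h - grad f x0 \<bullet> h - s * (h \<bullet> (?H *v h)) = (?d s) \<bullet> h"
    by (simp add: inner_diff_left inner_diff_right matrix_vector_mult_scaleR inner_commute)
   ultimately show "(?g has_real_derivative (?d s) \<bullet> h) (at s within {0..1})"
    by (simp add: has_field_derivative_at_within)
   have "norm (?d s) \<le> \<kappa> * norm (s *\<^sub>R h)"
    using d2(2)[of "x0 + s *\<^sub>R h"] ns x by (simp add: h_def)
   also have "\<dots> \<le> \<kappa> * norm h" using ns \<kappa> by (intro mult_left_mono) auto
   finally have "norm (?d s) * norm h \<le> \<kappa> * norm h * norm h"
    by (intro mult_right_mono) auto
   then show "norm ((?d s) \<bullet> h) \<le> \<kappa> * (norm h)\<^sup>2"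
    using Cauchy_Schwarz_ineq2[of "?d s" h]
    by (simp add: power2_eq_square mult.assoc)
  qed auto
  then show "\<bar>f x - f x0 - grad f x0 \<bullet> (x - x0) - (x - x0) \<bullet> (?H *v (x - x0)) / 2\<bar> \<le> \<kappa> * (norm (x - x0))\<^sup>2"
   by (simp add: h_def algebra_simps)
 qed
qed

text \<open>Expansions in each variable separately. Both test functions and functions with a joint
  expansion have them, and they suffice to compare derivatives at a touching point.\<close>

definition pjet :: "(real \<Rightarrow> real ^ 'n::finite \<Rightarrow> real ^ 'n \<Rightarrow> real) \<Rightarrow> real \<Rightarrow> real ^ 'n \<Rightarrow> real ^ 'n \<Rightarrow>
  real \<Rightarrow> real ^ 'n \<Rightarrow> real ^ 'n \<Rightarrow> real ^ 'n ^ 'n \<Rightarrow> bool" where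
 "pjet G t0 r0 x0 a P q Q \<longleftrightarrow>
   ((\<lambda>s. G s r0 x0) has_real_derivative a) (at t0) \<and>
   has_simplex_derivative (\<lambda>r. G t0 r x0) P r0 \<and>
   (\<forall>\<kappa>>0. \<exists>d>0. \<forall>x. norm (x - x0) < d \<longrightarrow>
    \<bar>G t0 r0 x - G t0 r0 x0 - q \<bullet> (x - x0) - (x - x0) \<bullet> (Q *v (x - x0)) / 2\<bar> \<le> \<kappa> * (norm (x - x0))\<^sup>2)"

lemma C112_derivatives:
 assumes "C112_on T \<phi>" "t \<in> {0<..<T}" "r \<in> \<P>"
 shows "((\<lambda>s. \<phi> s r x) has_real_derivative deriv (\<lambda>s. \<phi> s r x) t) (at t)"
  "has_simplex_derivative (\<lambda>r. \<phi> t r x) (simplex_derivative (\<lambda>r. \<phi> t r x) r) r"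
  "(\<phi> t r has_derivative (\<lambda>v. D_x (\<phi> t) r x \<bullet> v)) (at x)"
  "(grad (\<phi> t r) has_derivative (\<lambda>v. D2_x (\<phi> t) r x *v v)) (at x)"
proof -
 have *: "(\<lambda>s. \<phi> s r x) differentiable (at t)" "\<exists>p. has_simplex_derivative (\<lambda>r. \<phi> t r x) p r"
  "twice_differentiable_at (\<phi> t r) x"
  using assms unfolding C112_on_def Let_def by auto
 show "((\<lambda>s. \<phi> s r x) has_real_derivative deriv (\<lambda>s. \<phi> s r x) t) (at t)"
  using *(1) unfolding DERIV_deriv_iff_real_differentiable .
 obtain p where p: "has_simplex_derivative (\<lambda>r. \<phi> t r x) p r" using *(2) by blast
 show "has_simplex_derivative (\<lambda>r. \<phi> t r x) (simplex_derivative (\<lambda>r. \<phi> t r x) r) r"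
  using p simplex_derivative_eq[OF assms(3) p] by simp
 have "\<phi> t r differentiable (at x)" using *(3) unfolding twice_differentiable_at_def by (blast dest: eventually_nhds_x_imp_x)
 then show "(\<phi> t r has_derivative (\<lambda>v. D_x (\<phi> t) r x \<bullet> v)) (at x)" unfolding D_x_def by (rule grad_has_derivative)
 show "(grad (\<phi> t r) has_derivative (\<lambda>v. D2_x (\<phi> t) r x *v v)) (at x)"
  using *(3) unfolding twice_differentiable_at_def D2_x_def hessian_def by (simp add: jacobian_works[symmetric])
qed

lemma C112_pjet:
 assumes \<phi>: "C112_on T \<phi>" and t0: "t0 \<in> {0<..<T}" and r0: "r0 \<in> \<P>"
 shows "pjet \<phi> t0 r0 x0 (deriv (\<lambda>s. \<phi> s r0 x0) t0) (simplex_derivative (\<lambda>r. \<phi> t0 r x0) r0) (D_x (\<phi> t0) r0 x0) (D2_x (\<phi> t0) r0 x0)"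
proof -
 have "twice_differentiable_at (\<phi> t0 r0) x0" using assms unfolding C112_on_def Let_def by auto
 from twice_differentiable_taylor[OF this] show ?thesis
  using C112_derivatives(1,2)[OF \<phi> t0 r0] unfolding pjet_def D_x_def D2_x_def by simp
qed

text \<open>The necessary conditions at a maximum of \<open>G1 - G2\<close>. In time and along
  simplex segments the point is interior to a line, so first derivatives agree. Only the diagonal of
  the Hessians is compared, since the noise matrix is diagonal.\<close>

lemma pjet_touch:
 fixes G1 G2 :: "real \<Rightarrow> real ^ 'n::finite \<Rightarrow> real ^ 'n \<Rightarrow> real"
 assumes t0: "t0 \<in> {0<..<T}" and r0: "r0 \<in> \<P>"
  and 1: "pjet G1 t0 r0 x0 a1 P1 q1 Q1" and 2: "pjet G2 t0 r0 x0 a2 P2 q2 Q2"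
  and n: "near T t0 r0 x0 (\<lambda>t r x. G1 t r x - G2 t r x \<le> G1 t0 r0 x0 - G2 t0 r0 x0)"
 shows "a1 = a2" "P1 = P2" "q1 = q2" "Q1 $ i $ i \<le> Q2 $ i $ i"
proof -
 obtain d where d: "0 < d" and m: "\<And>t r x. t \<in> {0<..<T} \<Longrightarrow> r \<in> \<P> \<Longrightarrow> \<bar>t - t0\<bar> < d \<Longrightarrow> norm (r - r0) < d
   \<Longrightarrow> norm (x - x0) < d \<Longrightarrow> G1 t r x - G2 t r x \<le> G1 t0 r0 x0 - G2 t0 r0 x0"
  using n unfolding near_def by blast
 have D: "((\<lambda>s. G1 s r0 x0 - G2 s r0 x0) has_real_derivative a1 - a2) (at t0)"
  using 1 2 unfolding pjet_def by (auto intro: DERIV_diff)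
 have "a1 - a2 = 0"
 proof (rule DERIV_local_max[OF D])
  show "0 < min d (min t0 (T - t0))" using d t0 by auto
  show "\<forall>y. \<bar>t0 - y\<bar> < min d (min t0 (T - t0)) \<longrightarrow> G1 y r0 x0 - G2 y r0 x0 \<le> G1 t0 r0 x0 - G2 t0 r0 x0"
  proof (intro allI impI)
   fix y assume "\<bar>t0 - y\<bar> < min d (min t0 (T - t0))"
   then have "y \<in> {0<..<T}" "\<bar>y - t0\<bar> < d" by (auto simp: abs_less_iff)
   then show "G1 y r0 x0 - G2 y r0 x0 \<le> G1 t0 r0 x0 - G2 t0 r0 x0" using m r0 d by simp
  qed
 qed
 then show "a1 = a2" by simp
 show "P1 = P2"
 proof (rule simplex_inner_unique[of P1 P2 r0])
  fix \<mu> :: "real ^ 'n" assume \<mu>: "\<mu> \<in> prob_simplex"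
  have D: "((\<lambda>s. G1 t0 (r0 + s *\<^sub>R (\<mu> - r0)) x0 - G2 t0 (r0 + s *\<^sub>R (\<mu> - r0)) x0) has_real_derivative P1 \<bullet> (\<mu> - r0) - P2 \<bullet> (\<mu> - r0)) (at 0)"
   using 1 2 \<mu> unfolding pjet_def has_simplex_derivative_iff[OF r0] by (intro DERIV_diff) auto
  obtain e where e: "0 < e" "\<And>s. \<bar>s\<bar> < e \<Longrightarrow> (1 - s) *\<^sub>R r0 + s *\<^sub>R \<mu> \<in> \<P>"
   using prob_simplex_int_segment[OF r0 \<mu>] by blast
  have "P1 \<bullet> (\<mu> - r0) - P2 \<bullet> (\<mu> - r0) = 0"
  proof (rule DERIV_local_max[OF D])
   show "0 < min e (d / (norm (\<mu> - r0) + 1))" using d e by (auto simp: add_nonneg_pos)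
   show "\<forall>s. \<bar>0 - s\<bar> < min e (d / (norm (\<mu> - r0) + 1)) \<longrightarrow>
    G1 t0 (r0 + s *\<^sub>R (\<mu> - r0)) x0 - G2 t0 (r0 + s *\<^sub>R (\<mu> - r0)) x0
    \<le> G1 t0 (r0 + 0 *\<^sub>R (\<mu> - r0)) x0 - G2 t0 (r0 + 0 *\<^sub>R (\<mu> - r0)) x0"
   proof (intro allI impI)
    fix s assume s: "\<bar>0 - s\<bar> < min e (d / (norm (\<mu> - r0) + 1))"
    then have "\<bar>s\<bar> * (norm (\<mu> - r0) + 1) < d" by (simp add: pos_less_divide_eq add_nonneg_pos)
    moreover have "\<bar>s\<bar> * norm (\<mu> - r0) \<le> \<bar>s\<bar> * (norm (\<mu> - r0) + 1)" by (intro mult_left_mono) auto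
    ultimately have "norm (s *\<^sub>R (\<mu> - r0)) < d" by simp
    moreover have "r0 + s *\<^sub>R (\<mu> - r0) \<in> \<P>" using e(2)[of s] s by (simp add: algebra_simps)
    ultimately show "G1 t0 (r0 + s *\<^sub>R (\<mu> - r0)) x0 - G2 t0 (r0 + s *\<^sub>R (\<mu> - r0)) x0
     \<le> G1 t0 (r0 + 0 *\<^sub>R (\<mu> - r0)) x0 - G2 t0 (r0 + 0 *\<^sub>R (\<mu> - r0)) x0"
     using m[of t0 "r0 + s *\<^sub>R (\<mu> - r0)" x0] t0 d by simp
   qed
  qed
  then show "P1 \<bullet> (\<mu> - r0) = P2 \<bullet> (\<mu> - r0)" by simp
 qed (use 1 2 in \<open>auto simp: pjet_def has_simplex_derivative_def\<close>)
 define q where "q = q1 - q2"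
 have key: "\<exists>e>0. \<forall>h. norm h < e \<longrightarrow> q \<bullet> h + (h \<bullet> (Q1 *v h) - h \<bullet> (Q2 *v h)) / 2 \<le> 2 * \<kappa> * (norm h)\<^sup>2" if \<kappa>: "0 < \<kappa>" for \<kappa>
 proof -
  obtain e1 where e1: "0 < e1" "\<And>x. norm (x - x0) < e1 \<Longrightarrow>
    \<bar>G1 t0 r0 x - G1 t0 r0 x0 - q1 \<bullet> (x - x0) - (x - x0) \<bullet> (Q1 *v (x - x0)) / 2\<bar> \<le> \<kappa> * (norm (x - x0))\<^sup>2"
   using 1 \<kappa> unfolding pjet_def by blast
  obtain e2 where e2: "0 < e2" "\<And>x. norm (x - x0) < e2 \<Longrightarrow>
    \<bar>G2 t0 r0 x - G2 t0 r0 x0 - q2 \<bullet> (x - x0) - (x - x0) \<bullet> (Q2 *v (x - x0)) / 2\<bar> \<le> \<kappa> * (norm (x - x0))\<^sup>2"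
   using 2 \<kappa> unfolding pjet_def by blast
  show ?thesis
  proof (rule exI[of _ "min d (min e1 e2)"], intro conjI allI impI)
   show "0 < min d (min e1 e2)" using d e1 e2 by auto
   fix h :: "real ^ 'n" assume "norm h < min d (min e1 e2)"
   then have h: "norm h < d" "norm h < e1" "norm h < e2" by auto
   have "G1 t0 r0 (x0 + h) - G2 t0 r0 (x0 + h) \<le> G1 t0 r0 x0 - G2 t0 r0 x0"
    using m[of t0 r0 "x0 + h"] t0 r0 d h by simp
   moreover have "q \<bullet> h = q1 \<bullet> h - q2 \<bullet> h" unfolding q_def by (rule inner_diff_left)
   ultimately show "q \<bullet> h + (h \<bullet> (Q1 *v h) - h \<bullet> (Q2 *v h)) / 2 \<le> 2 * \<kappa> * (norm h)\<^sup>2"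
    using e1(2)[of "x0 + h"] e2(2)[of "x0 + h"] h by (simp add: field_simps)
  qed
 qed
 have q0: "q = 0"
 proof (rule ccontr)
  assume "q \<noteq> 0"
  define A where "A = q \<bullet> q"
  have A: "0 < A" unfolding A_def using \<open>q \<noteq> 0\<close> by simp
  define c where "c = (q \<bullet> (Q1 *v q) - q \<bullet> (Q2 *v q)) / 2"
  obtain e where e: "0 < e" "\<And>h. norm h < e \<Longrightarrow> q \<bullet> h + (h \<bullet> (Q1 *v h) - h \<bullet> (Q2 *v h)) / 2 \<le> 2 * 1 * (norm h)\<^sup>2"
   using key[of 1] by auto
  \<comment> \<open>The second entry gives \<open>s * (2 * A + \<bar>c\<bar>) \<le> A / 2\<close>,
    so that the linear term \<open>s * A\<close> along \<open>q\<close> outweighs all quadratic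
    ones.\<close>
  define s where "s = min (e / (2 * norm q)) (A / (2 * (2 * A + \<bar>c\<bar>)))"
  have s0: "0 < s" unfolding s_def using e A \<open>q \<noteq> 0\<close> by (auto intro!: divide_pos_pos add_pos_nonneg)
  have "s * norm q \<le> e / (2 * norm q) * norm q" unfolding s_def by (intro mult_right_mono) auto
  also have "\<dots> < e" using e \<open>q \<noteq> 0\<close> by simp
  finally have "norm (s *\<^sub>R q) < e" using s0 by simp
  moreover have "(norm (s *\<^sub>R q))\<^sup>2 = s\<^sup>2 * A" unfolding A_def power2_norm_eq_inner by (simp add: power2_eq_square)
  ultimately have "q \<bullet> (s *\<^sub>R q) + ((s *\<^sub>R q) \<bullet> (Q1 *v (s *\<^sub>R q)) - (s *\<^sub>R q) \<bullet> (Q2 *v (s *\<^sub>R q))) / 2 \<le> 2 * (s\<^sup>2 * A)"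
   using e(2)[of "s *\<^sub>R q"] by simp
  then have "s * A + s\<^sup>2 * c \<le> 2 * (s\<^sup>2 * A)"
   unfolding c_def A_def by (simp add: matrix_vector_mult_scaleR power2_eq_square field_simps)
  then have "s * A \<le> s * (s * (2 * A - c))" by (simp add: power2_eq_square algebra_simps)
  then have "A \<le> s * (2 * A - c)" using s0 by simp
  also have "\<dots> \<le> s * (2 * A + \<bar>c\<bar>)" using s0 by (intro mult_left_mono) auto
  also have "\<dots> \<le> A / (2 * (2 * A + \<bar>c\<bar>)) * (2 * A + \<bar>c\<bar>)" unfolding s_def using A by (intro mult_right_mono) auto
  also have "\<dots> = A / 2" using A by (simp add: field_simps)
  finally show False using A by simp
 qed
 then show "q1 = q2" unfolding q_def by simp
 show "Q1 $ i $ i \<le> Q2 $ i $ i"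
 proof (rule field_le_epsilon)
  fix k :: real assume "0 < k"
  then obtain e where e: "0 < e" "\<And>h. norm h < e \<Longrightarrow> q \<bullet> h + (h \<bullet> (Q1 *v h) - h \<bullet> (Q2 *v h)) / 2 \<le> 2 * (k / 4) * (norm h)\<^sup>2"
   using key[of "k / 4"] by auto
  define s where "s = e / 2"
  have s0: "0 < s" "s < e" unfolding s_def using e by auto
  have quad: "(s *\<^sub>R axis i 1) \<bullet> (Q *v (s *\<^sub>R axis i 1)) = s\<^sup>2 * Q $ i $ i" for Q :: "real ^ 'n ^ 'n"
   by (simp add: matrix_vector_mult_scaleR matrix_vector_mul_component inner_axis inner_axis' power2_eq_square)
  have "norm (s *\<^sub>R (axis i 1 :: real ^ 'n)) < e" using s0 by simp
  from e(2)[OF this] have "s\<^sup>2 * (Q1 $ i $ i - Q2 $ i $ i) \<le> s\<^sup>2 * k"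
   unfolding quad q0 using s0 by (simp add: algebra_simps)
  then show "Q1 $ i $ i \<le> Q2 $ i $ i + k" using s0 by simp
 qed
qed

abbreviation (input) taylor_rest :: "(real \<Rightarrow> real ^ 'n::finite \<Rightarrow> real ^ 'n \<Rightarrow> real) \<Rightarrow> real \<Rightarrow> real ^ 'n \<Rightarrow> real ^ 'n \<Rightarrow>
  real \<Rightarrow> real ^ 'n \<Rightarrow> real ^ 'n \<Rightarrow> real ^ 'n ^ 'n \<Rightarrow> real \<Rightarrow> real ^ 'n \<Rightarrow> real ^ 'n \<Rightarrow> real" where
 "taylor_rest G t0 r0 x0 a p q Q t r x \<equiv> G t r x - G t0 r0 x0 - a * (t - t0) - p \<bullet> (r - r0) - q \<bullet> (x - x0)
   - (x - x0) \<bullet> (Q *v (x - x0)) / 2"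

abbreviation (input) taylor_err :: "real \<Rightarrow> real ^ 'n::finite \<Rightarrow> real ^ 'n \<Rightarrow> real \<Rightarrow> real \<Rightarrow> real \<Rightarrow> real ^ 'n \<Rightarrow> real ^ 'n \<Rightarrow> real" where
 "taylor_err t0 r0 x0 C k t r x \<equiv> C * ((t - t0)\<^sup>2 + (norm (r - r0))\<^sup>2) + k * (norm (x - x0))\<^sup>2"

text \<open>
 The error is quadratic in time and density and \<open>o((norm (x - x0))\<^sup>2)\<close> in the last variable, so that
 functions with such an expansion can be replaced by quadratic test functions.
\<close>

definition wjet :: "real \<Rightarrow> (real \<Rightarrow> real ^ 'n::finite \<Rightarrow> real ^ 'n \<Rightarrow> real) \<Rightarrow> real \<Rightarrow> real ^ 'n \<Rightarrow> real ^ 'n \<Rightarrow>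
  real \<Rightarrow> real ^ 'n \<Rightarrow> real ^ 'n \<Rightarrow> real ^ 'n ^ 'n \<Rightarrow> bool" where
 "wjet T G t0 r0 x0 a p q Q \<longleftrightarrow> (\<forall>\<kappa>>0. \<exists>C\<ge>0. near T t0 r0 x0 (\<lambda>t r x. \<bar>taylor_rest G t0 r0 x0 a p q Q t r x\<bar> \<le> taylor_err t0 r0 x0 C \<kappa> t r x))"

lemma wjet_add:
 assumes "wjet T G t0 r0 x0 a p q Q" "wjet T G' t0 r0 x0 a' p' q' Q'"
 shows "wjet T (\<lambda>t r x. G t r x + G' t r x) t0 r0 x0 (a + a') (p + p') (q + q') (Q + Q')"
 unfolding wjet_def
proof (intro allI impI)
 fix \<kappa> :: real assume "0 < \<kappa>"
 then have k: "0 < \<kappa> / 2" by simp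
 obtain C where C: "0 \<le> C" "near T t0 r0 x0 (\<lambda>t r x. \<bar>taylor_rest G t0 r0 x0 a p q Q t r x\<bar> \<le> taylor_err t0 r0 x0 C (\<kappa> / 2) t r x)"
  using assms(1) k unfolding wjet_def by blast
 obtain C' where C': "0 \<le> C'" "near T t0 r0 x0 (\<lambda>t r x. \<bar>taylor_rest G' t0 r0 x0 a' p' q' Q' t r x\<bar> \<le> taylor_err t0 r0 x0 C' (\<kappa> / 2) t r x)"
  using assms(2) k unfolding wjet_def by blast
 show "\<exists>C\<ge>0. near T t0 r0 x0 (\<lambda>t r x.
   \<bar>G t r x + G' t r x - (G t0 r0 x0 + G' t0 r0 x0) - (a + a') * (t - t0) - (p + p') \<bullet> (r - r0) - (q + q') \<bullet> (x - x0)
    - (x - x0) \<bullet> ((Q + Q') *v (x - x0)) / 2\<bar> \<le> taylor_err t0 r0 x0 C \<kappa> t r x)"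
 proof (rule exI[of _ "C + C'"], intro conjI near_mono[OF near_conj[OF C(2) C'(2)]], goal_cases)
  case 1 then show ?case using C C' by simp
 next
  case (2 t r x)
  have "(x - x0) \<bullet> ((Q + Q') *v (x - x0)) = (x - x0) \<bullet> (Q *v (x - x0)) + (x - x0) \<bullet> (Q' *v (x - x0))"
   by (simp add: matrix_vector_mult_add_rdistrib inner_add_right)
  moreover have "\<kappa> * (norm (x - x0))\<^sup>2 = \<kappa> / 2 * (norm (x - x0))\<^sup>2 + \<kappa> / 2 * (norm (x - x0))\<^sup>2" by simp
  ultimately show ?case using 2(3) unfolding distrib_right inner_add_left add_divide_distrib by linarith
 qed
qed

lemma wjet_cmult:
 assumes "wjet T G t0 r0 x0 a p q Q"
 shows "wjet T (\<lambda>t r x. c * G t r x) t0 r0 x0 (c * a) (c *\<^sub>R p) (c *\<^sub>R q) (c *\<^sub>R Q)"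
 unfolding wjet_def
proof (intro allI impI)
 fix \<kappa> :: real assume "0 < \<kappa>"
 then have k: "0 < \<kappa> / (\<bar>c\<bar> + 1)" by simp
 obtain C where C: "0 \<le> C" "near T t0 r0 x0 (\<lambda>t r x. \<bar>taylor_rest G t0 r0 x0 a p q Q t r x\<bar> \<le> taylor_err t0 r0 x0 C (\<kappa> / (\<bar>c\<bar> + 1)) t r x)"
  using assms(1) k unfolding wjet_def by blast
 show "\<exists>C\<ge>0. near T t0 r0 x0 (\<lambda>t r x.
   \<bar>c * G t r x - c * G t0 r0 x0 - c * a * (t - t0) - (c *\<^sub>R p) \<bullet> (r - r0) - (c *\<^sub>R q) \<bullet> (x - x0)
    - (x - x0) \<bullet> ((c *\<^sub>R Q) *v (x - x0)) / 2\<bar> \<le> taylor_err t0 r0 x0 C \<kappa> t r x)"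
 proof (rule exI[of _ "\<bar>c\<bar> * C"], intro conjI near_mono[OF C(2)], goal_cases)
  case 1 then show ?case using C by simp
 next
  case (2 t r x)
  have e: "(c *\<^sub>R Q) *v (x - x0) = c *\<^sub>R (Q *v (x - x0))"
   by (simp add: scaleR_matrix_vector_assoc)
  have "c * G t r x - c * G t0 r0 x0 - c * a * (t - t0) - (c *\<^sub>R p) \<bullet> (r - r0) - (c *\<^sub>R q) \<bullet> (x - x0)
    - (x - x0) \<bullet> ((c *\<^sub>R Q) *v (x - x0)) / 2
   = c * (G t r x - G t0 r0 x0 - a * (t - t0) - p \<bullet> (r - r0) - q \<bullet> (x - x0) - (x - x0) \<bullet> (Q *v (x - x0)) / 2)"
   unfolding e by (simp add: right_diff_distrib mult.assoc)
  then have "\<bar>c * G t r x - c * G t0 r0 x0 - c * a * (t - t0) - (c *\<^sub>R p) \<bullet> (r - r0) - (c *\<^sub>R q) \<bullet> (x - x0)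
    - (x - x0) \<bullet> ((c *\<^sub>R Q) *v (x - x0)) / 2\<bar>
   \<le> \<bar>c\<bar> * (C * ((t - t0)\<^sup>2 + (norm (r - r0))\<^sup>2) + \<kappa> / (\<bar>c\<bar> + 1) * (norm (x - x0))\<^sup>2)"
   unfolding abs_mult by (simp only: abs_mult) (rule mult_left_mono[OF 2(3)], simp)
  also have "\<dots> = \<bar>c\<bar> * C * ((t - t0)\<^sup>2 + (norm (r - r0))\<^sup>2) + \<bar>c\<bar> * (\<kappa> / (\<bar>c\<bar> + 1)) * (norm (x - x0))\<^sup>2"
   by (simp add: distrib_left)
  also have "\<dots> \<le> \<bar>c\<bar> * C * ((t - t0)\<^sup>2 + (norm (r - r0))\<^sup>2) + \<kappa> * (norm (x - x0))\<^sup>2"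
  proof -
   have "\<bar>c\<bar> * (\<kappa> / (\<bar>c\<bar> + 1)) \<le> (\<bar>c\<bar> + 1) * (\<kappa> / (\<bar>c\<bar> + 1))" using k by (intro mult_right_mono) auto
   then have "\<bar>c\<bar> * (\<kappa> / (\<bar>c\<bar> + 1)) \<le> \<kappa>" by simp
   then show ?thesis by (intro add_left_mono mult_right_mono) auto
  qed
  finally show ?case .
 qed
qed

lemma wjet_uminus: "wjet T G t0 r0 x0 a p q Q \<Longrightarrow> wjet T (\<lambda>t r x. - G t r x) t0 r0 x0 (- a) (- p) (- q) (- Q)"
 using wjet_cmult[of T G t0 r0 x0 a p q Q "-1"] by simp

text \<open>The product \<open>s * y\<close> is split with a weight that keeps the coefficient of
  \<open>y\<^sup>2\<close> below \<open>\<kappa>\<close>; any coefficient may be spent on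
  \<open>s\<^sup>2\<close> and \<open>R\<^sup>2\<close>. This asymmetry is the one in the definition
  of \<open>wjet\<close>.\<close>

lemma young_cross:
 fixes G \<kappa> s R y :: real
 assumes "0 \<le> G" "0 < \<kappa>" "0 \<le> s" "0 \<le> R" "0 \<le> y"
 shows "G * (s * (s + R + y)) \<le> (G\<^sup>2 / (2 * \<kappa>) + \<kappa> / 2 + G + G) * (s\<^sup>2 + R\<^sup>2) + \<kappa> * y\<^sup>2"
proof -
 define Z where "Z = G\<^sup>2 / (2 * \<kappa>)"
 have Z: "0 \<le> Z" unfolding Z_def using assms by simp
 have "0 \<le> (G * s - \<kappa> * y)\<^sup>2 / (2 * \<kappa>)" using assms by simp
 moreover have "(G * s - \<kappa> * y)\<^sup>2 / (2 * \<kappa>) = Z * s\<^sup>2 + \<kappa> / 2 * y\<^sup>2 - G * (s * y)"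
  unfolding Z_def using assms by (simp add: power2_eq_square field_simps)
 moreover have "0 \<le> G * (s - R)\<^sup>2 / 2" using assms by simp
 moreover have "G * (s - R)\<^sup>2 / 2 = G * s\<^sup>2 / 2 + G * R\<^sup>2 / 2 - G * (s * R)" by (simp add: power2_eq_square field_simps)
 moreover have "G * (s * (s + R + y)) = G * s\<^sup>2 + G * (s * R) + G * (s * y)" by (simp add: power2_eq_square algebra_simps)
 moreover have "(Z + \<kappa> / 2 + G + G) * (s\<^sup>2 + R\<^sup>2) + \<kappa> * y\<^sup>2 = Z * s\<^sup>2 + Z * R\<^sup>2 + \<kappa> / 2 * s\<^sup>2 + \<kappa> / 2 * R\<^sup>2
   + 2 * (G * s\<^sup>2) + 2 * (G * R\<^sup>2) + \<kappa> / 2 * y\<^sup>2 + \<kappa> / 2 * y\<^sup>2" by (simp add: field_simps)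
 moreover have "0 \<le> Z * R\<^sup>2" "0 \<le> \<kappa> / 2 * s\<^sup>2" "0 \<le> \<kappa> / 2 * R\<^sup>2" "0 \<le> G * s\<^sup>2" "0 \<le> G * R\<^sup>2" "0 \<le> \<kappa> / 2 * y\<^sup>2"
  using assms Z by simp_all
 ultimately show ?thesis unfolding Z_def[symmetric] by linarith
qed

text \<open>Cross terms between time and space are absorbed into the squares.\<close>

lemma wjet_time_mult:
 fixes Q :: "real ^ 'n::finite ^ 'n"
 assumes G: "wjet T (\<lambda>_. g) t0 r0 x0 0 p q Q" and f: "\<And>t. \<bar>t - t0\<bar> < R \<Longrightarrow> \<bar>f t - f t0 - (t - t0) * f'\<bar> \<le> K * (t - t0)\<^sup>2" and R: "0 < R"
 shows "wjet T (\<lambda>t r x. f t * g r x) t0 r0 x0 (f' * g r0 x0) (f t0 *\<^sub>R p) (f t0 *\<^sub>R q) (f t0 *\<^sub>R Q)"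
proof -
 have K0: "0 \<le> \<bar>K\<bar>" by simp
 obtain C1 where C1: "0 \<le> C1" "near T t0 r0 x0 (\<lambda>t r x.
   \<bar>g r x - g r0 x0 - 0 * (t - t0) - p \<bullet> (r - r0) - q \<bullet> (x - x0) - (x - x0) \<bullet> (Q *v (x - x0)) / 2\<bar> \<le> taylor_err t0 r0 x0 C1 1 t r x)"
  using G zero_less_one unfolding wjet_def by blast
 have bl: "\<exists>M\<ge>0. \<forall>h. \<bar>h \<bullet> (Q *v h) / 2\<bar> \<le> M * (norm h)\<^sup>2"
 proof -
  obtain M where M: "\<And>h. norm (Q *v h) \<le> norm h * M" "0 < M"
   using bounded_linear.pos_bounded[OF matrix_vector_mul_bounded_linear[of Q]] by auto
  have "\<bar>h \<bullet> (Q *v h) / 2\<bar> \<le> M * (norm h)\<^sup>2" for h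
  proof -
   have "\<bar>h \<bullet> (Q *v h)\<bar> \<le> norm h * (norm h * M)"
    using Cauchy_Schwarz_ineq2[of h "Q *v h"] mult_left_mono[OF M(1)[of h], of "norm h"] by simp
   moreover have "0 \<le> norm h * (norm h * M)" using M by simp
   ultimately show ?thesis by (simp add: power2_eq_square mult_ac)
  qed
  then show ?thesis using M(2) less_imp_le by blast
 qed
 then obtain M where M: "0 \<le> M" "\<And>h. \<bar>h \<bullet> (Q *v h) / 2\<bar> \<le> M * (norm h)\<^sup>2" by blast
 define J where "J = \<bar>f'\<bar> + \<bar>K\<bar> * R + 1"
 define E where "E = norm p + norm q + C1 + 1 + M"
 have RE: "0 < J" "0 \<le> E" unfolding J_def E_def using R C1 M by (auto intro: add_nonneg_pos)
 have A: "wjet T (\<lambda>t r x. (f t - f t0) * g r0 x0) t0 r0 x0 (f' * g r0 x0) 0 0 0"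
  unfolding wjet_def
 proof (intro allI impI exI[of _ "\<bar>K\<bar> * \<bar>g r0 x0\<bar>"] conjI nearI[OF R])
  fix \<kappa> t :: real and r x :: "real ^ 'n" assume \<kappa>: "0 < \<kappa>" and t: "\<bar>t - t0\<bar> < R"
  have "\<bar>(f t - f t0) * g r0 x0 - (f t0 - f t0) * g r0 x0 - f' * g r0 x0 * (t - t0) - 0 \<bullet> (r - r0) - 0 \<bullet> (x - x0) - (x - x0) \<bullet> (0 *v (x - x0)) / 2\<bar>
   = \<bar>f t - f t0 - (t - t0) * f'\<bar> * \<bar>g r0 x0\<bar>"
   by (simp add: abs_mult[symmetric] algebra_simps)
  also have "\<dots> \<le> (\<bar>K\<bar> * (t - t0)\<^sup>2) * \<bar>g r0 x0\<bar>"
   using f[OF t] mult_right_mono[OF abs_ge_self[of K], of "(t - t0)\<^sup>2"] by (intro mult_right_mono) auto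
  also have "\<dots> \<le> \<bar>K\<bar> * \<bar>g r0 x0\<bar> * ((t - t0)\<^sup>2 + (norm (r - r0))\<^sup>2) + \<kappa> * (norm (x - x0))\<^sup>2"
   using \<kappa> by (simp add: algebra_simps)
  finally show "\<bar>(f t - f t0) * g r0 x0 - (f t0 - f t0) * g r0 x0 - f' * g r0 x0 * (t - t0) - 0 \<bullet> (r - r0) - 0 \<bullet> (x - x0) - (x - x0) \<bullet> (0 *v (x - x0)) / 2\<bar>
   \<le> \<bar>K\<bar> * \<bar>g r0 x0\<bar> * ((t - t0)\<^sup>2 + (norm (r - r0))\<^sup>2) + \<kappa> * (norm (x - x0))\<^sup>2" .
 qed simp
 have B: "wjet T (\<lambda>t r x. (f t - f t0) * (g r x - g r0 x0)) t0 r0 x0 0 0 0 0"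
  unfolding wjet_def
 proof (intro allI impI)
  fix \<kappa> :: real assume \<kappa>: "0 < \<kappa>"
  define C where "C = (J * E)\<^sup>2 / (2 * \<kappa>) + \<kappa> / 2 + J * E + (J * E)"
  have near1: "near T t0 r0 x0 (\<lambda>t r x. \<bar>t - t0\<bar> < min R 1 \<and> norm (r - r0) < 1 \<and> norm (x - x0) < 1)"
   by (rule nearI[of "min R 1"]) (use R in auto)
  show "\<exists>C\<ge>0. near T t0 r0 x0 (\<lambda>t r x. \<bar>(f t - f t0) * (g r x - g r0 x0) - (f t0 - f t0) * (g r0 x0 - g r0 x0) - 0 * (t - t0)
    - 0 \<bullet> (r - r0) - 0 \<bullet> (x - x0) - (x - x0) \<bullet> (0 *v (x - x0)) / 2\<bar> \<le> taylor_err t0 r0 x0 C \<kappa> t r x)"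
  proof (rule exI[of _ C], intro conjI near_mono[OF near_conj[OF C1(2) near1]], goal_cases)
   case 1 show ?case unfolding C_def using \<kappa> RE by (intro add_nonneg_nonneg) auto
  next
   case (2 t r x)
   let ?t = "\<bar>t - t0\<bar>" and ?R = "norm (r - r0)" and ?x = "norm (x - x0)"
   have small: "?t < R" "?t < 1" "?R < 1" "?x < 1" using 2(3) by auto
   have ft: "\<bar>f t - f t0\<bar> \<le> J * ?t"
   proof -
    have "\<bar>K * (t - t0)\<^sup>2\<bar> \<le> \<bar>K\<bar> * R * ?t"
     using small mult_left_mono[of ?t R "\<bar>K\<bar> * ?t"] by (simp add: abs_mult power2_eq_square mult_ac abs_mult_self_eq)
    then have "\<bar>f t - f t0\<bar> \<le> \<bar>(t - t0) * f'\<bar> + \<bar>K\<bar> * R * ?t" using f[OF small(1)] by linarith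
    also have "\<dots> \<le> J * ?t" unfolding J_def abs_mult by (simp add: algebra_simps)
    finally show ?thesis .
   qed
   have sq: "(t - t0)\<^sup>2 \<le> ?t" "?R\<^sup>2 \<le> ?R" "?x\<^sup>2 \<le> ?x"
   proof -
    have "s\<^sup>2 \<le> s" if "0 \<le> s" "s < 1" for s :: real using that by (simp add: power2_eq_square mult_left_le)
    from this[of ?t] this[of ?R] this[of ?x] small
    show "(t - t0)\<^sup>2 \<le> ?t" "?R\<^sup>2 \<le> ?R" "?x\<^sup>2 \<le> ?x" by simp_all
   qed
   have g: "\<bar>g r x - g r0 x0\<bar> \<le> E * (?t + ?R + ?x)"
   proof -
    have "\<bar>g r x - g r0 x0\<bar> \<le> \<bar>p \<bullet> (r - r0)\<bar> + \<bar>q \<bullet> (x - x0)\<bar> + \<bar>(x - x0) \<bullet> (Q *v (x - x0)) / 2\<bar>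
      + (C1 * ((t - t0)\<^sup>2 + ?R\<^sup>2) + ?x\<^sup>2)" 
     using 2(3) unfolding mult_zero_left mult_1 by linarith
    also have "\<dots> \<le> norm p * ?R + norm q * ?x + M * ?x + (C1 * (?t + ?R) + ?x)"
     using Cauchy_Schwarz_ineq2[of p "r - r0"] Cauchy_Schwarz_ineq2[of q "x - x0"] M(2)[of "x - x0"] sq
      mult_left_mono[OF sq(3) M(1)] C1(1)
     by (intro add_mono mult_left_mono) auto
    also have "\<dots> \<le> E * (?t + ?R + ?x)"
    proof -
     have "0 \<le> (norm p + norm q + 1 + M) * ?t" "0 \<le> (norm q + 1 + M) * ?R" "0 \<le> (norm p + C1) * ?x"
      using M C1 by (auto intro!: mult_nonneg_nonneg add_nonneg_nonneg)
     then show ?thesis unfolding E_def by (simp add: algebra_simps)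
    qed
    finally show ?thesis .
   qed
   have "\<bar>(f t - f t0) * (g r x - g r0 x0)\<bar> \<le> (J * ?t) * (E * (?t + ?R + ?x))"
    unfolding abs_mult using ft g RE by (intro mult_mono) auto
   then have "\<bar>(f t - f t0) * (g r x - g r0 x0)\<bar> \<le> C * (?t\<^sup>2 + ?R\<^sup>2) + \<kappa> * ?x\<^sup>2"
    unfolding C_def using young_cross[of "J * E" \<kappa> ?t ?R ?x] RE \<kappa> by (simp add: mult_ac)
   then show ?case by simp
  qed
 qed
 \<comment> \<open>The product is split into a multiple of \<open>g\<close>, a function of time
   alone, and a product of two increments, which is pure error.\<close>
 have "(\<lambda>t r x. f t * g r x) = (\<lambda>t r x. f t0 * g r x + ((f t - f t0) * g r0 x0 + (f t - f t0) * (g r x - g r0 x0)))"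
  by (simp add: fun_eq_iff algebra_simps)
 then show ?thesis using wjet_add[OF wjet_cmult[OF G, of "f t0"] wjet_add[OF A B]] by simp
qed

lemma wjet_const: "wjet T (\<lambda>t r x. c) t0 r0 x0 0 0 0 0"
 unfolding wjet_def by (intro allI impI exI[of _ 0] conjI nearI[OF zero_less_one]) auto

lemma wjet_time:
 assumes f: "\<And>t. \<bar>t - t0\<bar> < R \<Longrightarrow> \<bar>f t - f t0 - (t - t0) * f'\<bar> \<le> K * (t - t0)\<^sup>2" and R: "0 < R"
 shows "wjet T (\<lambda>t r x. f t) t0 r0 x0 f' 0 0 0"
 using wjet_time_mult[OF wjet_const[of T 1 t0 r0 x0] f R] by simp

lemma wjet_norm_sq: "wjet T (\<lambda>t r x. (norm x)\<^sup>2) t0 r0 x0 0 0 (2 *\<^sub>R x0) (2 *\<^sub>R mat 1)"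
 unfolding wjet_def
proof (intro allI impI exI[of _ 0] conjI nearI[OF zero_less_one], goal_cases)
 case (2 \<kappa> t r x)
 have "(2 *\<^sub>R mat 1) *v (x - x0) = 2 *\<^sub>R (x - x0)" by (metis matrix_vector_mul_lid scaleR_matrix_vector_assoc)
 then have z: "(norm x)\<^sup>2 - (norm x0)\<^sup>2 - 0 * (t - t0) - 0 \<bullet> (r - r0) - (2 *\<^sub>R x0) \<bullet> (x - x0) - (x - x0) \<bullet> ((2 *\<^sub>R mat 1) *v (x - x0)) / 2 = 0"
  unfolding \<open>(2 *\<^sub>R mat 1) *v (x - x0) = 2 *\<^sub>R (x - x0)\<close>
  by (simp add: power2_norm_eq_inner inner_diff_left inner_diff_right inner_commute)
 show ?case unfolding z using 2 by simp
qed simp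

text \<open>A joint expansion on the product space is weakened to the asymmetric one. The parts of
  \<open>Q\<close> that involve the density, and the mixed remainder, go into the free constant by
  Young's inequality; the cubic remainder becomes quadratic with a small factor on a small
  ball.\<close>

lemma wjet_has_jet:
 fixes w :: "real \<Rightarrow> (real ^ 'n::finite) \<times> (real ^ 'n) \<Rightarrow> real"
 assumes "has_jet w t0 (r0, x0) a p Q"
 shows "wjet T (\<lambda>t r x. w t (r, x)) t0 r0 x0 a (\<chi> i. p (axis i 1, 0)) (\<chi> i. p (0, axis i 1)) (\<chi> i j. Q (0, axis i 1) (0, axis j 1))"
  "\<And>u v. p (u, v) = (\<chi> i. p (axis i 1, 0)) \<bullet> u + (\<chi> i. p (0, axis i 1)) \<bullet> v"
  "\<And>c i. Q (0, c *\<^sub>R axis i 1) (0, c *\<^sub>R axis i 1) = c\<^sup>2 * Q (0, axis i 1) (0, axis i 1)"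
proof -
 have lp: "linear p" and lQ: "\<And>e. linear (Q e)" and sQ: "\<And>e e'. Q e e' = Q e' e" using assms unfolding has_jet_def by auto
 obtain C R where R: "0 < R" and J: "\<And>t' e. \<bar>t' - t0\<bar> < R \<Longrightarrow> norm e < R \<Longrightarrow>
   \<bar>w t' ((r0, x0) + e) - w t0 (r0, x0) - (t' - t0) * a - p e - Q e e / 2\<bar>
     \<le> C * ((t' - t0)\<^sup>2 + \<bar>t' - t0\<bar> * norm e + norm e ^ 3)"
  using assms unfolding has_jet_def by blast
 have ex: "u = (\<Sum>i\<in>UNIV. u $ i *\<^sub>R axis i 1)" for u :: "real ^ 'n"
  using basis_expansion[of u] by (simp add: scalar_mult_eq_scaleR)
 have l1: "linear (\<lambda>u::real ^ 'n. (u, 0::real ^ 'n))" "linear (\<lambda>v::real ^ 'n. (0::real ^ 'n, v))"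
  by (auto intro!: linearI simp: )
 have fun1: "l u = (\<Sum>i\<in>UNIV. u $ i * l (axis i 1))" if "linear l" for l :: "real ^ 'n \<Rightarrow> real" and u
  using linear_sum[OF that, of "\<lambda>i. u $ i *\<^sub>R axis i 1" UNIV] linear_scale[OF that] ex[of u] by simp
 have lpu: "linear (\<lambda>u. p (u, 0))" "linear (\<lambda>v. p (0, v))" "linear (\<lambda>v. Q e (0, v))" for e
  using linear_compose[OF l1(1) lp] linear_compose[OF l1(2) lp] linear_compose[OF l1(2) lQ[of e]] by (simp_all add: o_def)
 show p: "p (u, v) = (\<chi> i. p (axis i 1, 0)) \<bullet> u + (\<chi> i. p (0, axis i 1)) \<bullet> v" for u v
 proof -
  have "p (u, v) = p (u, 0) + p (0, v)" using linear_add[OF lp, of "(u, 0)" "(0, v)"] by simp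
  then show ?thesis using fun1[OF lpu(1), of u] fun1[OF lpu(2), of v] by (simp add: inner_vec_def mult.commute)
 qed
 show "Q (0, c *\<^sub>R axis i 1) (0, c *\<^sub>R axis i 1) = c\<^sup>2 * Q (0, axis i 1) (0, axis i 1)" for c i
 proof -
  have "Q e (0, c *\<^sub>R y) = c * Q e (0, y)" for e and y using linear_scale[OF lpu(3)[of e], of c y] by simp
  then show ?thesis using sQ by (simp add: power2_eq_square)
 qed
 have Qx: "Q (0, h) (0, h) = h \<bullet> ((\<chi> i j. Q (0, axis i 1) (0, axis j 1)) *v h)" for h
 proof -
  have "Q (0, h) (0, h) = (\<Sum>i\<in>UNIV. h $ i * Q (0, h) (0, axis i 1))" by (rule fun1[OF lpu(3)])
  also have "\<dots> = (\<Sum>i\<in>UNIV. h $ i * Q (0, axis i 1) (0, h))" by (simp add: sQ)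
  also have "\<dots> = (\<Sum>i\<in>UNIV. h $ i * (\<Sum>j\<in>UNIV. h $ j * Q (0, axis i 1) (0, axis j 1)))"
   using fun1[OF lpu(3)] by (intro sum.cong refl arg_cong2[where f="(*)"])
  finally show ?thesis by (simp add: inner_vec_def matrix_vector_mult_def mult.commute)
 qed
 have Qe: "\<exists>M\<ge>0. \<forall>u h. \<bar>Q (u, h) (u, h) / 2 - Q (0, h) (0, h) / 2\<bar> \<le> M * (norm u * (norm u + norm h))"
 proof -
  have bil: "bilinear Q" unfolding bilinear_def using lQ sQ by simp
  then obtain M where M: "\<And>x y. norm (Q x y) \<le> M * norm x * norm y" "0 < M" using bilinear_bounded_pos by blast
  have "\<bar>Q (u, h) (u, h) / 2 - Q (0, h) (0, h) / 2\<bar> \<le> M * (norm u * (norm u + norm h))" for u h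
  proof -
   have "(u, h) = (u, 0) + (0, h)" by simp
   then have "Q (u, h) (u, h) = Q (u, 0) (u, 0) + Q (u, 0) (0, h) + (Q (0, h) (u, 0) + Q (0, h) (0, h))"
    using bilinear_ladd[OF bil] bilinear_radd[OF bil] by (metis (no_types, lifting))
   then have "Q (u, h) (u, h) / 2 - Q (0, h) (0, h) / 2 = Q (u, 0) (u, 0) / 2 + Q (u, 0) (0, h)" using sQ[of "(0, h)" "(u, 0)"] by (simp add: field_simps)
   moreover have "\<bar>Q (u, 0) (u, 0)\<bar> \<le> M * norm u * norm u" "\<bar>Q (u, 0) (0, h)\<bar> \<le> M * norm u * norm h"
    using M(1)[of "(u, 0)" "(u, 0)"] M(1)[of "(u, 0)" "(0, h)"] by (simp_all add: norm_Pair)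
   moreover have "0 \<le> M * norm u * norm u" using M by simp
   moreover have "M * (norm u * (norm u + norm h)) = M * norm u * norm u + M * norm u * norm h" by (simp add: algebra_simps)
   ultimately show ?thesis by linarith
  qed
  then show ?thesis using M(2) less_imp_le by blast
 qed
 then obtain M where M: "0 \<le> M" "\<And>u h. \<bar>Q (u, h) (u, h) / 2 - Q (0, h) (0, h) / 2\<bar> \<le> M * (norm u * (norm u + norm h))" by blast
 show "wjet T (\<lambda>t r x. w t (r, x)) t0 r0 x0 a (\<chi> i. p (axis i 1, 0)) (\<chi> i. p (0, axis i 1)) (\<chi> i j. Q (0, axis i 1) (0, axis j 1))"
  unfolding wjet_def
 proof (intro allI impI)
  fix \<kappa> :: real assume \<kappa>: "0 < \<kappa>"
  define c where "c = \<bar>C\<bar> + M + 1"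
  have c: "0 < c" unfolding c_def using M by simp
  \<comment> \<open>On this ball \<open>norm (r - r0, x - x0) \<le> 2 * d\<close>, so one factor of
    the cubic remainder is at most \<open>\<kappa> / 4\<close> after multiplication by
    \<open>c\<close>.\<close>
  define d where "d = min (min (R / 2) 1) (\<kappa> / (8 * c))"
  have d: "0 < d" "d \<le> 1" "2 * d \<le> R" "8 * c * d \<le> \<kappa>"
  proof -
   show "0 < d" "d \<le> 1" "2 * d \<le> R" unfolding d_def using R \<kappa> c by auto
   have "8 * c * d \<le> 8 * c * (\<kappa> / (8 * c))" unfolding d_def using c by (intro mult_left_mono) auto
   then show "8 * c * d \<le> \<kappa>" using c by simp
  qed
  show "\<exists>C\<ge>0. near T t0 r0 x0 (\<lambda>t r x.
   \<bar>w t (r, x) - w t0 (r0, x0) - a * (t - t0) - (\<chi> i. p (axis i 1, 0)) \<bullet> (r - r0) - (\<chi> i. p (0, axis i 1)) \<bullet> (x - x0)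
    - (x - x0) \<bullet> ((\<chi> i j. Q (0, axis i 1) (0, axis j 1)) *v (x - x0)) / 2\<bar> \<le> taylor_err t0 r0 x0 C \<kappa> t r x)"
  proof (rule exI[of _ "20 * c + \<kappa> + c\<^sup>2 / \<kappa> * 4"], intro conjI nearI[OF d(1)], goal_cases)
   case 1 show ?case using c \<kappa> by simp
  next
   case (2 t r x)
   define A where "A = \<bar>t - t0\<bar>"
   define u where "u = norm (r - r0)"
   define y where "y = norm (x - x0)"
   define N where "N = norm (r - r0, x - x0)"
   have pos: "0 \<le> A" "0 \<le> u" "0 \<le> y" "0 \<le> N" unfolding A_def u_def y_def N_def by auto
   have Ny: "N \<le> u + y" unfolding N_def u_def y_def by (rule norm_Pair_le)
   have lt: "A < d" "u < d" "y < d" using 2 unfolding A_def u_def y_def by auto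
   have Nr: "N < R" "N \<le> 2 * d" using Ny lt d by linarith+
   have "(r0, x0) + (r - r0, x - x0) = (r, x)" by simp
   then have j: "\<bar>w t (r, x) - w t0 (r0, x0) - (t - t0) * a - p (r - r0, x - x0) - Q (r - r0, x - x0) (r - r0, x - x0) / 2\<bar>
     \<le> C * (A\<^sup>2 + A * N + N ^ 3)"
    using J[of t "(r - r0, x - x0)"] lt d Nr unfolding A_def N_def by simp
   have "C * (A\<^sup>2 + A * N + N ^ 3) \<le> c * (A\<^sup>2 + A * N + N ^ 3)"
    unfolding c_def using pos M by (intro mult_right_mono add_nonneg_nonneg) auto
   moreover have "M * (u * (u + y)) \<le> c * (u * (u + y))" unfolding c_def using pos M by (intro mult_right_mono) auto
   ultimately have tot: "\<bar>w t (r, x) - w t0 (r0, x0) - (t - t0) * a - p (r - r0, x - x0) - Q (0, x - x0) (0, x - x0) / 2\<bar>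
     \<le> c * (A\<^sup>2 + A * N + N ^ 3) + c * (u * (u + y))"
    using j M(2)[of "r - r0" "x - x0"] unfolding u_def y_def by linarith
   have N2: "N\<^sup>2 \<le> 2 * u\<^sup>2 + 2 * y\<^sup>2"
   proof -
    have "N\<^sup>2 \<le> (u + y)\<^sup>2" using Ny pos by (intro power_mono) auto
    also have "\<dots> = 2 * u\<^sup>2 + 2 * y\<^sup>2 - (u - y)\<^sup>2" by (simp add: power2_eq_square algebra_simps)
    finally show ?thesis using zero_le_power2[of "u - y"] by linarith
   qed
   have N3: "c * N ^ 3 \<le> \<kappa> / 4 * (2 * u\<^sup>2 + 2 * y\<^sup>2)"
   proof -
    have "c * N ^ 3 = (c * N) * N\<^sup>2" by (simp add: power3_eq_cube power2_eq_square)
    also have "\<dots> \<le> (c * (2 * d)) * (2 * u\<^sup>2 + 2 * y\<^sup>2)" using c pos Nr N2 by (intro mult_mono) auto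
    also have "\<dots> \<le> \<kappa> / 4 * (2 * u\<^sup>2 + 2 * y\<^sup>2)" using d(4) by (intro mult_right_mono) auto
    finally show ?thesis .
   qed
   have young: "c * (s * y) \<le> c\<^sup>2 / \<kappa> * 2 * s\<^sup>2 + \<kappa> / 8 * y\<^sup>2" for s
   proof -
    have "0 \<le> 2 * (c * s - \<kappa> / 4 * y)\<^sup>2 / \<kappa>" using \<kappa> by simp
    also have "\<dots> = c\<^sup>2 / \<kappa> * 2 * s\<^sup>2 + \<kappa> / 8 * y\<^sup>2 - c * (s * y)" using \<kappa> by (simp add: power2_eq_square field_simps)
    finally show ?thesis by linarith
   qed
   have Au: "A * u \<le> A\<^sup>2 + u\<^sup>2"
   proof -
    have "(A - u)\<^sup>2 = A\<^sup>2 + u\<^sup>2 - 2 * (A * u)" by (simp add: power2_eq_square algebra_simps)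
    then show ?thesis using zero_le_power2[of "A - u"] zero_le_power2[of A] zero_le_power2[of u] by linarith
   qed
   have "c * (A * N) \<le> c * (A * (u + y))" using c pos Ny by (intro mult_left_mono) auto
   also have "\<dots> = c * (A * u) + c * (A * y)" by (simp add: algebra_simps)
   also have "\<dots> \<le> c * (A\<^sup>2 + u\<^sup>2) + (c\<^sup>2 / \<kappa> * 2 * A\<^sup>2 + \<kappa> / 8 * y\<^sup>2)"
    using young[of A] Au c by (intro add_mono mult_left_mono) auto
   finally have AN: "c * (A * N) \<le> c * (A\<^sup>2 + u\<^sup>2) + (c\<^sup>2 / \<kappa> * 2 * A\<^sup>2 + \<kappa> / 8 * y\<^sup>2)" .
   have uy: "c * (u * (u + y)) \<le> c * u\<^sup>2 + (c\<^sup>2 / \<kappa> * 2 * u\<^sup>2 + \<kappa> / 8 * y\<^sup>2)"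
    using young[of u] by (simp add: power2_eq_square algebra_simps)
   have "c * (A\<^sup>2 + A * N + N ^ 3) + c * (u * (u + y)) \<le> (20 * c + \<kappa> + c\<^sup>2 / \<kappa> * 4) * (A\<^sup>2 + u\<^sup>2) + \<kappa> * y\<^sup>2"
   proof -
    define k where "k = c\<^sup>2 / \<kappa>"
    have k: "0 \<le> k" unfolding k_def using \<kappa> by simp
    have "c * (A\<^sup>2 + A * N + N ^ 3) + c * (u * (u + y)) = c * A\<^sup>2 + c * (A * N) + c * N ^ 3 + c * (u * (u + y))"
     by (simp add: algebra_simps)
    also have "\<dots> \<le> c * A\<^sup>2 + (c * (A\<^sup>2 + u\<^sup>2) + (k * 2 * A\<^sup>2 + \<kappa> / 8 * y\<^sup>2)) + \<kappa> / 4 * (2 * u\<^sup>2 + 2 * y\<^sup>2)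
      + (c * u\<^sup>2 + (k * 2 * u\<^sup>2 + \<kappa> / 8 * y\<^sup>2))"
     unfolding k_def using AN N3 uy by linarith
    also have "\<dots> = (20 * c + \<kappa> + k * 4) * (A\<^sup>2 + u\<^sup>2) + \<kappa> * y\<^sup>2
      - (18 * c * A\<^sup>2 + 18 * c * u\<^sup>2 + \<kappa> * A\<^sup>2 + \<kappa> / 2 * u\<^sup>2 + 2 * k * A\<^sup>2 + 2 * k * u\<^sup>2 + \<kappa> / 4 * y\<^sup>2)"
     by (simp add: field_simps)
    also have "\<dots> \<le> (20 * c + \<kappa> + k * 4) * (A\<^sup>2 + u\<^sup>2) + \<kappa> * y\<^sup>2"
    proof -
     have "0 \<le> 18 * c * A\<^sup>2 + 18 * c * u\<^sup>2 + \<kappa> * A\<^sup>2 + \<kappa> / 2 * u\<^sup>2 + 2 * k * A\<^sup>2 + 2 * k * u\<^sup>2 + \<kappa> / 4 * y\<^sup>2"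
      using c \<kappa> k by (intro add_nonneg_nonneg mult_nonneg_nonneg) auto
     then show ?thesis by linarith
    qed
    finally show ?thesis unfolding k_def .
   qed
   moreover have tA: "(t - t0)\<^sup>2 = A\<^sup>2" unfolding A_def by simp
   ultimately show ?case
    unfolding u_def[symmetric] y_def[symmetric] tA mult.commute[of a "t - t0"]
    using tot p[of "r - r0" "x - x0"] Qx[of "x - x0"] by linarith
  qed
 qed
qed

subsection \<open>Quadratic test functions and the Hamiltonian\<close>

lemma has_real_derivative_quadratic_at:
 assumes "0 < R" "\<And>y. \<bar>y - x\<bar> < R \<Longrightarrow> \<bar>F y - F x - (y - x) * a\<bar> \<le> C * (y - x)\<^sup>2"
 shows "(F has_real_derivative a) (at x)"
proof -
 have "(F has_real_derivative a) (at x within ball x R)"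
  by (rule has_real_derivative_quadratic[where C=C]) (use assms(2) in \<open>auto simp: dist_real_def abs_minus_commute\<close>)
 then show ?thesis using assms(1) by (simp add: at_within_open[of x "ball x R"])
qed

lemma wjetE:
 assumes "wjet T G t0 r0 x0 a p q Q" "0 < \<kappa>"
 obtains C d where "0 \<le> C" "0 < d" "\<And>t r x. t \<in> {0<..<T} \<Longrightarrow> r \<in> \<P> \<Longrightarrow> \<bar>t - t0\<bar> < d \<Longrightarrow> norm (r - r0) < d \<Longrightarrow> norm (x - x0) < d \<Longrightarrow>
  \<bar>taylor_rest G t0 r0 x0 a p q Q t r x\<bar> \<le> taylor_err t0 r0 x0 C \<kappa> t r x"
proof -
 from assms obtain C where C: "0 \<le> C" "near T t0 r0 x0 (\<lambda>t r x. \<bar>taylor_rest G t0 r0 x0 a p q Q t r x\<bar> \<le> taylor_err t0 r0 x0 C \<kappa> t r x)" unfolding wjet_def by blast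
 show thesis
  using C(2) unfolding near_def 
  by (elim exE conjE) (rule that[OF C(1)], assumption, (drule spec)+, erule mp, intro conjI, assumption+)
qed

lemma wjet_pjet:
 fixes G :: "real \<Rightarrow> real ^ 'n::finite \<Rightarrow> real ^ 'n \<Rightarrow> real"
 assumes t0: "t0 \<in> {0<..<T}" and r0: "r0 \<in> \<P>" and w: "wjet T G t0 r0 x0 a p q Q"
 shows "pjet G t0 r0 x0 a (tangential p) q Q"
 unfolding pjet_def
proof (intro conjI allI impI)
 obtain C d where C: "0 \<le> C" "0 < d" and J: "\<And>t r x. t \<in> {0<..<T} \<Longrightarrow> r \<in> \<P> \<Longrightarrow> \<bar>t - t0\<bar> < d \<Longrightarrow> norm (r - r0) < d \<Longrightarrow> norm (x - x0) < d \<Longrightarrow>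
  \<bar>taylor_rest G t0 r0 x0 a p q Q t r x\<bar> \<le> taylor_err t0 r0 x0 C 1 t r x"
  using wjetE[OF w zero_less_one] by metis
 show "((\<lambda>s. G s r0 x0) has_real_derivative a) (at t0)"
 proof (rule has_real_derivative_quadratic_at[of "min d (min t0 (T - t0))"])
  show "0 < min d (min t0 (T - t0))" using t0 C by auto
  fix y assume "\<bar>y - t0\<bar> < min d (min t0 (T - t0))"
  then have "y \<in> {0<..<T}" "\<bar>y - t0\<bar> < d" by (auto simp: abs_less_iff)
  then show "\<bar>G y r0 x0 - G t0 r0 x0 - (y - t0) * a\<bar> \<le> C * (y - t0)\<^sup>2"
   using J[of y r0 x0] r0 C by (simp add: mult.commute)
 qed
 show "has_simplex_derivative (\<lambda>r. G t0 r x0) (tangential p) r0"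
  unfolding has_simplex_derivative_iff[OF r0]
 proof (intro conjI ballI tangential_sum)
  fix \<mu> :: "real ^ 'n" assume \<mu>: "\<mu> \<in> prob_simplex"
  obtain e where e: "0 < e" "\<And>s. \<bar>s\<bar> < e \<Longrightarrow> (1 - s) *\<^sub>R r0 + s *\<^sub>R \<mu> \<in> \<P>"
   using prob_simplex_int_segment[OF r0 \<mu>] by blast
  show "((\<lambda>s. G t0 (r0 + s *\<^sub>R (\<mu> - r0)) x0) has_real_derivative tangential p \<bullet> (\<mu> - r0)) (at 0)"
  proof (rule has_real_derivative_quadratic_at[of "min e (d / (norm (\<mu> - r0) + 1))"])
   show "0 < min e (d / (norm (\<mu> - r0) + 1))" using e C by (auto simp: add_nonneg_pos)
   fix s :: real assume s: "\<bar>s - 0\<bar> < min e (d / (norm (\<mu> - r0) + 1))"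
   then have "\<bar>s\<bar> * (norm (\<mu> - r0) + 1) < d" by (simp add: pos_less_divide_eq add_nonneg_pos)
   moreover have "\<bar>s\<bar> * norm (\<mu> - r0) \<le> \<bar>s\<bar> * (norm (\<mu> - r0) + 1)" by (intro mult_left_mono) auto
   ultimately have "norm (s *\<^sub>R (\<mu> - r0)) < d" by simp
   moreover have "r0 + s *\<^sub>R (\<mu> - r0) \<in> \<P>" using e(2)[of s] s by (simp add: algebra_simps)
   ultimately show "\<bar>G t0 (r0 + s *\<^sub>R (\<mu> - r0)) x0 - G t0 (r0 + 0 *\<^sub>R (\<mu> - r0)) x0 - (s - 0) * (tangential p \<bullet> (\<mu> - r0))\<bar>
     \<le> C * (norm (\<mu> - r0))\<^sup>2 * (s - 0)\<^sup>2"
    using J[of t0 "r0 + s *\<^sub>R (\<mu> - r0)" x0] t0 C tangential_inner[OF simplex_diff_sum[OF \<mu> prob_simplex_int_subset[OF r0]], of p]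
    by (simp add: power_mult_distrib mult_ac)
  qed
 qed
 fix \<kappa> :: real assume "0 < \<kappa>"
 from wjetE[OF w this] obtain C d where C: "0 \<le> C" "0 < d" and J: "\<And>t r x. t \<in> {0<..<T} \<Longrightarrow> r \<in> \<P> \<Longrightarrow> \<bar>t - t0\<bar> < d \<Longrightarrow> norm (r - r0) < d \<Longrightarrow> norm (x - x0) < d \<Longrightarrow>
  \<bar>taylor_rest G t0 r0 x0 a p q Q t r x\<bar> \<le> taylor_err t0 r0 x0 C \<kappa> t r x"
  by metis
 then show "\<exists>d>0. \<forall>x. norm (x - x0) < d \<longrightarrow>
    \<bar>G t0 r0 x - G t0 r0 x0 - q \<bullet> (x - x0) - (x - x0) \<bullet> (Q *v (x - x0)) / 2\<bar> \<le> \<kappa> * (norm (x - x0))\<^sup>2"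
  using J[of t0 r0] t0 r0 by (intro exI[of _ d]) auto
qed

text \<open>The polynomial of a \<open>wjet\<close> plus its error bound. Thus a function touched by
  one with a \<open>wjet\<close> is also touched by an admissible test function with almost the same
  derivatives at the point.\<close>

definition quad :: "real \<Rightarrow> real ^ 'n \<Rightarrow> real ^ 'n \<Rightarrow> real \<Rightarrow> real ^ 'n \<Rightarrow> real ^ 'n \<Rightarrow> real ^ 'n ^ 'n \<Rightarrow> real \<Rightarrow> real \<Rightarrow>
  real \<Rightarrow> real ^ 'n \<Rightarrow> real ^ 'n \<Rightarrow> real" where
 "quad t0 r0 x0 a p q Q C k t r x = a * (t - t0) + p \<bullet> (r - r0) + q \<bullet> (x - x0) + (x - x0) \<bullet> (Q *v (x - x0)) / 2
   + C * ((t - t0)\<^sup>2 + (norm (r - r0))\<^sup>2) + k * (norm (x - x0))\<^sup>2"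

lemma continuous_on_tangential [continuous_intros]:
 assumes "continuous_on S f"
 shows "continuous_on S (\<lambda>z. tangential (f z))"
 unfolding tangential_def using assms by (intro continuous_intros continuous_on_vec_lambda) auto

lemma quad_derivatives:
 fixes Q :: "real ^ 'n::finite ^ 'n"
 assumes Q: "transpose Q = Q"
 shows "((\<lambda>s. quad t0 r0 x0 a p q Q C k s r x) has_real_derivative a + 2 * C * (t - t0)) (at t)"
  "((\<lambda>r. quad t0 r0 x0 a p q Q C k t r x) has_derivative (\<lambda>v. (p + (2 * C) *\<^sub>R (r - r0)) \<bullet> v)) (at r)"
  "((\<lambda>y. quad t0 r0 x0 a p q Q C k t r y) has_derivative (\<lambda>v. (q + Q *v (x - x0) + (2 * k) *\<^sub>R (x - x0)) \<bullet> v)) (at x)"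
  "((\<lambda>y. q + Q *v (y - x0) + (2 * k) *\<^sub>R (y - x0)) has_derivative (\<lambda>v. (Q + (2 * k) *\<^sub>R mat 1) *v v)) (at x)"
proof -
 have bl: "bounded_linear ((*v) Q)" by (rule matrix_vector_mul_bounded_linear)
 have sym: "u \<bullet> (Q *v v) = (Q *v u) \<bullet> v" for u v using dot_lmul_matrix[of u Q v] Q by (metis matrix_vector_mul(2) transpose_matrix_vector)
 show "((\<lambda>s. quad t0 r0 x0 a p q Q C k s r x) has_real_derivative a + 2 * C * (t - t0)) (at t)"
  unfolding quad_def by (auto intro!: derivative_eq_intros)
 show "((\<lambda>r. quad t0 r0 x0 a p q Q C k t r x) has_derivative (\<lambda>v. (p + (2 * C) *\<^sub>R (r - r0)) \<bullet> v)) (at r)"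
  unfolding quad_def power2_norm_eq_inner
  by (auto intro!: derivative_eq_intros simp: fun_eq_iff inner_add_left inner_commute algebra_simps)
 have dQ: "((\<lambda>y. Q *v (y - x0)) has_derivative (\<lambda>v. Q *v v)) (at x)" for x
  by (rule bounded_linear.has_derivative[OF bl]) (auto intro!: derivative_eq_intros)
 show "((\<lambda>y. quad t0 r0 x0 a p q Q C k t r y) has_derivative (\<lambda>v. (q + Q *v (x - x0) + (2 * k) *\<^sub>R (x - x0)) \<bullet> v)) (at x)"
 proof -
  have d1: "((\<lambda>y. y - x0) has_derivative (\<lambda>v. v)) (at x)" by (auto intro!: derivative_eq_intros)
  have "((\<lambda>y. a * (t - t0) + p \<bullet> (r - r0) + q \<bullet> (y - x0) + ((y - x0) \<bullet> (Q *v (y - x0))) / 2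
    + C * ((t - t0)\<^sup>2 + (norm (r - r0))\<^sup>2) + k * ((y - x0) \<bullet> (y - x0)))
   has_derivative (\<lambda>v. 0 + q \<bullet> v + ((x - x0) \<bullet> (Q *v v) + v \<bullet> (Q *v (x - x0))) / 2 + 0 + k * ((x - x0) \<bullet> v + v \<bullet> (x - x0)))) (at x)"
   by (intro has_derivative_add has_derivative_const has_derivative_inner_right[OF d1] has_derivative_mult_right
     bounded_linear.has_derivative[OF bounded_linear_divide] has_derivative_inner[OF d1 dQ] has_derivative_inner[OF d1 d1])
  moreover have "0 + q \<bullet> v + ((x - x0) \<bullet> (Q *v v) + v \<bullet> (Q *v (x - x0))) / 2 + 0 + k * ((x - x0) \<bullet> v + v \<bullet> (x - x0))
    = (q + Q *v (x - x0) + (2 * k) *\<^sub>R (x - x0)) \<bullet> v" for v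
   unfolding sym[of "x - x0" v] inner_commute[of v "Q *v (x - x0)"] inner_commute[of v "x - x0"] inner_add_left inner_scaleR_left by simp
  ultimately show ?thesis unfolding quad_def power2_norm_eq_inner by simp
 qed
 show "((\<lambda>y. q + Q *v (y - x0) + (2 * k) *\<^sub>R (y - x0)) has_derivative (\<lambda>v. (Q + (2 * k) *\<^sub>R mat 1) *v v)) (at x)"
 proof -
  have d1: "((\<lambda>y. y - x0) has_derivative (\<lambda>v. v)) (at x)" by (auto intro!: derivative_eq_intros)
  have "((\<lambda>y. q + Q *v (y - x0) + (2 * k) *\<^sub>R (y - x0)) has_derivative (\<lambda>v. 0 + Q *v v + (2 * k) *\<^sub>R v)) (at x)"
   by (intro has_derivative_add has_derivative_const dQ has_derivative_scaleR_right d1)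
  moreover have "0 + Q *v v + (2 * k) *\<^sub>R v = (Q + (2 * k) *\<^sub>R mat 1) *v v" for v
   by (simp add: matrix_vector_mult_add_rdistrib scaleR_matrix_vector_assoc[symmetric])
  ultimately show ?thesis by simp
 qed
qed

lemma quad_C112:
 fixes Q :: "real ^ 'n::finite ^ 'n"
 assumes Q: "transpose Q = Q"
 shows "C112_on T (quad t0 r0 x0 a p q Q C k)"
  "deriv (\<lambda>s. quad t0 r0 x0 a p q Q C k s r x) t = a + 2 * C * (t - t0)"
  "r \<in> \<P> \<Longrightarrow> simplex_derivative (\<lambda>r. quad t0 r0 x0 a p q Q C k t r x) r = tangential (p + (2 * C) *\<^sub>R (r - r0))"
  "D_x (quad t0 r0 x0 a p q Q C k t) r x = q + Q *v (x - x0) + (2 * k) *\<^sub>R (x - x0)"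
  "D2_x (quad t0 r0 x0 a p q Q C k t) r x = Q + (2 * k) *\<^sub>R mat 1"
proof -
 let ?\<phi> = "quad t0 r0 x0 a p q Q C k"
 note D = quad_derivatives[OF Q]
 show 1: "deriv (\<lambda>s. ?\<phi> s r x) t = a + 2 * C * (t - t0)" for t r x using D(1) DERIV_imp_deriv by blast
 show 2: "simplex_derivative (\<lambda>r. ?\<phi> t r x) r = tangential (p + (2 * C) *\<^sub>R (r - r0))" if "r \<in> \<P>" for t r x
  by (rule simplex_derivative_eq[OF that has_simplex_derivative_gradient[OF that D(2)]])
 have g: "grad (\<lambda>y. ?\<phi> t r y) = (\<lambda>x. q + Q *v (x - x0) + (2 * k) *\<^sub>R (x - x0))" for t r
  using grad_unique[OF D(3)] by blast
 show 3: "D_x (?\<phi> t) r x = q + Q *v (x - x0) + (2 * k) *\<^sub>R (x - x0)" for t r x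
  unfolding D_x_def using fun_cong[OF g] by simp
 show 4: "D2_x (?\<phi> t) r x = Q + (2 * k) *\<^sub>R mat 1" for t r x
  unfolding D2_x_def by (rule hessian_unique) (use D(4) g in simp)
 have td: "twice_differentiable_at (?\<phi> t r) x" for t r x
 proof -
  have "?\<phi> t r differentiable (at y)" for y using D(3)[of t0 r0 x0 a p q C k t r y] unfolding differentiable_def by blast
  moreover have "grad (?\<phi> t r) differentiable (at x)" unfolding g using D(4)[of q x0 k x] unfolding differentiable_def by blast
  ultimately show ?thesis unfolding twice_differentiable_at_def by simp
 qed
 show "C112_on T ?\<phi>"
  unfolding C112_on_def Let_def
 proof (intro conjI)
  show "\<forall>(t, r, x)\<in>\<D> T. (\<lambda>s. ?\<phi> s r x) differentiable at t \<and>
      (\<exists>p. has_simplex_derivative (\<lambda>r. ?\<phi> t r x) p r) \<and> twice_differentiable_at (?\<phi> t r) x"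
  proof clarify
   fix t :: real and r x :: "real ^ 'n" assume r: "r \<in> \<P>"
   have "(\<lambda>s. ?\<phi> s r x) differentiable at t" using D(1) real_differentiable_def by blast
   then show "(\<lambda>s. ?\<phi> s r x) differentiable at t \<and>
      (\<exists>p. has_simplex_derivative (\<lambda>r. ?\<phi> t r x) p r) \<and> twice_differentiable_at (?\<phi> t r) x"
    using has_simplex_derivative_gradient[OF r D(2)] td by blast
  qed
  show "continuous_on (\<D> T) (\<lambda>(t, r, x). ?\<phi> t r x)"
  proof -
   have "continuous_on (\<D> T) (\<lambda>z :: real \<times> (real ^ 'n) \<times> (real ^ 'n). Q *v (snd (snd z) - x0))"
    by (rule bounded_linear.continuous_on[OF matrix_vector_mul_bounded_linear[of Q]]) (intro continuous_intros)
   then show ?thesis unfolding quad_def case_prod_unfold by (intro continuous_intros) auto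
  qed
  show "continuous_on (\<D> T) (\<lambda>(t, r, x). deriv (\<lambda>s. ?\<phi> s r x) t)"
   unfolding 1 case_prod_unfold by (intro continuous_intros)
  have "continuous_on (\<D> T) (\<lambda>(t::real, r, x::real ^ 'n). tangential (p + (2 * C) *\<^sub>R (r - r0)))"
   unfolding case_prod_unfold by (intro continuous_intros)
  then show "continuous_on (\<D> T) (\<lambda>(t, r, x). simplex_derivative (\<lambda>r. ?\<phi> t r x) r)"
   by (rule continuous_on_eq) (auto simp: 2)
  show "continuous_on (\<D> T) (\<lambda>(t, r, x). D_x (?\<phi> t) r x)"
   unfolding 3 case_prod_unfold
   by (intro continuous_on_add continuous_on_const continuous_on_scaleR bounded_linear.continuous_on[OF matrix_vector_mul_bounded_linear[of Q]]
     continuous_on_diff continuous_on_snd continuous_on_id)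
  show "continuous_on (\<D> T) (\<lambda>(t, r, x). D2_x (?\<phi> t) r x)"
   unfolding 4 case_prod_unfold by (intro continuous_intros)
 qed
qed

lemma trace_diag: "trace (diag_mat \<sigma> ** transpose (diag_mat \<sigma>) ** Q) = (\<Sum>i\<in>UNIV. (\<sigma> $ i)\<^sup>2 * Q $ i $ i)"
proof -
 have "diag_mat \<sigma> ** transpose (diag_mat \<sigma>) = (\<chi> i j. if i = j then (\<sigma> $ i)\<^sup>2 else 0)"
  unfolding diag_mat_def transpose_def matrix_matrix_mult_def
  by (auto simp: vec_eq_iff if_distrib[of "\<lambda>u. u * _"] power2_eq_square cong: if_cong)
 then show ?thesis
  unfolding trace_def matrix_matrix_mult_def by (simp add: if_distrib[of "\<lambda>u. u * _"] cong: if_cong)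
qed

locale hjb =
 fixes E :: "('n::finite \<times> 'n) set" and H0 h :: "real ^ 'n \<Rightarrow> real ^ 'n \<Rightarrow> real"
  and F :: "real \<Rightarrow> real ^ 'n \<Rightarrow> real ^ 'n \<Rightarrow> real ^ 'n \<Rightarrow> real" and l T :: real and \<sigma> :: "real ^ 'n"
 assumes energy: "admissible_energy E H0" and l_pos: "0 < l" and T_pos: "0 < T" and costs: "admissible_costs E H0 T l F h"
  and second_derivatives: "\<And>r x. r \<in> \<P> \<Longrightarrow> twice_differentiable_at (H0 r) x"
  and growth: "\<exists>C1>0. \<exists>C2>0. \<forall>r\<in>\<P>. \<forall>x. \<forall>V\<in>cball 0 l.
     norm (D_x (controlled_energy H0 V) r x) + (\<Sum>i\<in>UNIV. \<bar>D2_x (controlled_energy H0 V) r x $ i $ i\<bar>)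
     \<le> C1 * controlled_energy H0 V r x + C2"
  and mass_conservation: "\<And>r x. r \<in> \<P> \<Longrightarrow> (\<Sum>i\<in>UNIV. D_x H0 r x $ i) = 0"
  and F_bounded: "\<exists>M. \<forall>t\<in>{0..T}. \<forall>r\<in>\<P>. \<forall>x. \<forall>V\<in>cball 0 l. \<bar>F t r x V\<bar> \<le> M"
  and h_bounded: "\<exists>M. \<forall>r\<in>\<P>. \<forall>x. \<bar>h r x\<bar> \<le> M"
begin

text \<open>The expression under the infimum in the Hamiltonian for one control, with the
  derivatives of the controlled energy computed: \<open>V\<close> enters through
  \<open>q \<bullet> V\<close> and the cost only.\<close>

definition Hval :: "real \<Rightarrow> real ^ 'n \<Rightarrow> real ^ 'n \<Rightarrow> real ^ 'n \<Rightarrow> real ^ 'n \<Rightarrow> real ^ 'n ^ 'n \<Rightarrow> real ^ 'n \<Rightarrow> real" where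
 "Hval t r x p q Q V = p \<bullet> D_x H0 r x - q \<bullet> (D_\<rho> H0 r x + V) + (\<Sum>i\<in>UNIV. (\<sigma> $ i)\<^sup>2 * Q $ i $ i) / 2 + F t r x V"

lemma H0_Ck: obtains W where "open W" "\<P> \<times> UNIV \<subseteq> W" "Ck_on 1 W (\<lambda>(r, x). H0 r x)"
 using energy unfolding admissible_energy_def class_Pr_def by blast

lemma H0_differentiable: "r \<in> \<P> \<Longrightarrow> (\<lambda>(r, x). H0 r x) differentiable (at (r, x))"
proof -
 assume "r \<in> \<P>"
 moreover obtain W where "\<P> \<times> UNIV \<subseteq> W" "Ck_on 1 W (\<lambda>(r, x). H0 r x)" using H0_Ck by blast
 ultimately show ?thesis by auto
qed

lemma H0_derivative_\<rho>:
 assumes "r \<in> \<P>"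
 shows "((\<lambda>r. H0 r x) has_derivative (\<lambda>v. D_\<rho> H0 r x \<bullet> v)) (at r)"
proof -
 have "(\<lambda>(r, x). H0 r x) differentiable (at (r, x))" by (rule H0_differentiable[OF assms])
 then obtain D where D: "((\<lambda>(r, x). H0 r x) has_derivative D) (at (r, x))" unfolding differentiable_def by blast
 have "((\<lambda>R. (R, x)) has_derivative (\<lambda>v. (v, 0))) (at r)" by (auto intro!: derivative_eq_intros)
 from has_derivative_compose[OF this, of "\<lambda>(r, x). H0 r x" D] D
 have "((\<lambda>r. H0 r x) has_derivative (\<lambda>v. D (v, 0))) (at r)" by simp
 then have "(\<lambda>r. H0 r x) differentiable (at r)" unfolding differentiable_def by blast
 then show ?thesis unfolding D_\<rho>_def by (rule grad_has_derivative)
qed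

lemma H0_derivative_x:
 assumes "r \<in> \<P>"
 shows "(H0 r has_derivative (\<lambda>v. D_x H0 r x \<bullet> v)) (at x)"
proof -
 have "H0 r differentiable (at x)"
  using second_derivatives[OF assms] unfolding twice_differentiable_at_def eventually_nhds by blast
 then show ?thesis unfolding D_x_def by (rule grad_has_derivative)
qed

lemma H0_continuous: "continuous_on (\<P> \<times> UNIV) (\<lambda>(r, x). H0 r x)"
proof (rule continuous_at_imp_continuous_on, clarify)
 fix r x :: "real ^ 'n" assume "r \<in> \<P>"
 then show "isCont (\<lambda>(r, x). H0 r x) (r, x)" by (rule differentiable_imp_continuous_within[OF H0_differentiable])
qed

lemma controlled_derivatives:
 assumes "r \<in> \<P>"
 shows "D_x (controlled_energy H0 V) r x = D_x H0 r x" "D_\<rho> (controlled_energy H0 V) r x = D_\<rho> H0 r x + V"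
  "D2_x (controlled_energy H0 V) r x = D2_x H0 r x"
proof -
 let ?c = "\<Sum>i\<in>UNIV. V $ i * r $ i"
 have d: "((\<lambda>x. H0 r x + ?c) has_derivative (\<lambda>v. D_x H0 r x \<bullet> v)) (at x)" for x
  using H0_derivative_x[OF assms, of x] by (auto intro!: derivative_eq_intros)
 have e: "controlled_energy H0 V r = (\<lambda>x. H0 r x + ?c)" unfolding controlled_energy_def by auto
 show 1: "D_x (controlled_energy H0 V) r x = D_x H0 r x" for x
  unfolding D_x_def[of "controlled_energy H0 V"] e by (rule grad_unique[OF d])
 have "grad (controlled_energy H0 V r) = grad (H0 r)" using 1 unfolding D_x_def by blast
 then show "D2_x (controlled_energy H0 V) r x = D2_x H0 r x" unfolding D2_x_def hessian_def by simp
 have e2: "(\<lambda>r. controlled_energy H0 V r x) = (\<lambda>r. H0 r x + V \<bullet> r)" unfolding controlled_energy_def inner_vec_def by auto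
 show "D_\<rho> (controlled_energy H0 V) r x = D_\<rho> H0 r x + V"
  unfolding D_\<rho>_def[of "controlled_energy H0 V"] e2
  by (rule grad_unique) (use H0_derivative_\<rho>[OF assms, of x] in \<open>auto intro!: derivative_eq_intros simp: inner_add_left\<close>)
qed

lemma F_nonneg: "t \<in> {0..T} \<Longrightarrow> r \<in> \<P> \<Longrightarrow> V \<in> cball 0 l \<Longrightarrow> 0 \<le> F t r x V"
 using costs unfolding admissible_costs_def by blast

lemma h_nonneg: "r \<in> \<P> \<Longrightarrow> 0 \<le> h r x"
 using costs unfolding admissible_costs_def by blast

lemma operator_eq:
 assumes "r \<in> \<P>"
 shows "viscosity_operator H0 (diag_mat \<sigma>) l F \<phi> t r x = deriv (\<lambda>s. \<phi> s r x) t
  + (INF V\<in>cball 0 l. Hval t r x (simplex_derivative (\<lambda>r. \<phi> t r x) r) (D_x (\<phi> t) r x) (D2_x (\<phi> t) r x) V)"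
 unfolding viscosity_operator_def hamiltonian_def trace_diag controlled_derivatives[OF assms] Hval_def by simp

lemma Hval_bdd:
 assumes "t \<in> {0..T}" "r \<in> \<P>"
 shows "bdd_below ((\<lambda>V. Hval t r x p q Q V) ` cball 0 l)"
proof (rule bdd_belowI2[of _ "p \<bullet> D_x H0 r x - q \<bullet> D_\<rho> H0 r x - norm q * l + (\<Sum>i\<in>UNIV. (\<sigma> $ i)\<^sup>2 * Q $ i $ i) / 2"])
 fix V :: "real ^ 'n" assume V: "V \<in> cball 0 l"
 have "q \<bullet> V \<le> norm q * norm V" by (rule norm_cauchy_schwarz)
 also have "\<dots> \<le> norm q * l" using V by (intro mult_left_mono) auto
 finally show "p \<bullet> D_x H0 r x - q \<bullet> D_\<rho> H0 r x - norm q * l + (\<Sum>i\<in>UNIV. (\<sigma> $ i)\<^sup>2 * Q $ i $ i) / 2 \<le> Hval t r x p q Q V"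
  unfolding Hval_def inner_add_right using F_nonneg[OF assms V, of x] by simp
qed

lemma operator_le:
 assumes "t \<in> {0..T}" "r \<in> \<P>" "V \<in> cball 0 l"
 shows "viscosity_operator H0 (diag_mat \<sigma>) l F \<phi> t r x \<le> deriv (\<lambda>s. \<phi> s r x) t
  + Hval t r x (simplex_derivative (\<lambda>r. \<phi> t r x) r) (D_x (\<phi> t) r x) (D2_x (\<phi> t) r x) V"
 unfolding operator_eq[OF assms(2)] by (intro add_left_mono cINF_lower Hval_bdd assms)

lemma operator_ge:
 assumes "r \<in> \<P>"
  "\<And>V. V \<in> cball 0 l \<Longrightarrow> e \<le> deriv (\<lambda>s. \<phi> s r x) t
  + Hval t r x (simplex_derivative (\<lambda>r. \<phi> t r x) r) (D_x (\<phi> t) r x) (D2_x (\<phi> t) r x) V"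
 shows "e \<le> viscosity_operator H0 (diag_mat \<sigma>) l F \<phi> t r x"
proof -
 have "e - deriv (\<lambda>s. \<phi> s r x) t
  \<le> (INF V\<in>cball 0 l. Hval t r x (simplex_derivative (\<lambda>r. \<phi> t r x) r) (D_x (\<phi> t) r x) (D2_x (\<phi> t) r x) V)"
 proof (rule cINF_greatest)
  show "cball (0 :: real ^ 'n) l \<noteq> {}" using l_pos by simp
  show "e - deriv (\<lambda>s. \<phi> s r x) t \<le> Hval t r x (simplex_derivative (\<lambda>r. \<phi> t r x) r) (D_x (\<phi> t) r x) (D2_x (\<phi> t) r x) V"
   if "V \<in> cball 0 l" for V using assms(2)[OF that] by linarith
 qed
 then show ?thesis unfolding operator_eq[OF assms(1)] by linarith
qed

text \<open>\<open>D_x H0\<close> has coordinate sum 0, so the Hamiltonian sees only the tangential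
  part of a density gradient. This reconciles Euclidean gradients with derivatives on the
  simplex.\<close>

lemma Hval_tangential: "r \<in> \<P> \<Longrightarrow> Hval t r x (tangential p) q Q V = Hval t r x p q Q V"
 unfolding Hval_def using tangential_inner[OF mass_conservation] by simp

abbreviation "op \<equiv> viscosity_operator H0 (diag_mat \<sigma>) l F"
abbreviation "sub U \<equiv> viscosity_subsolution H0 (diag_mat \<sigma>) l T F h U"
abbreviation "super U \<equiv> viscosity_supersolution H0 (diag_mat \<sigma>) l T F h U"

text \<open>Expansions carry an arbitrary matrix \<open>Q\<close>, whereas the gradient formula for
  \<open>quad\<close> is stated for symmetric ones; the symmetric part has the same quadratic form
  and the same diagonal.\<close>

lemma sym_part:
 fixes Q :: "real ^ 'n ^ 'n"
 obtains S where "transpose S = S" "\<And>v. v \<bullet> (S *v v) = v \<bullet> (Q *v v)" "\<And>i. S $ i $ i = Q $ i $ i"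
proof
 let ?S = "(1 / 2) *\<^sub>R (Q + transpose Q)"
 show "transpose ?S = ?S" by (simp add: transpose_def vec_eq_iff add.commute)
 show "?S $ i $ i = Q $ i $ i" for i by (simp add: transpose_def)
 have "v \<bullet> (transpose Q *v v) = v \<bullet> (Q *v v)" for v
  by (metis dot_lmul_matrix inner_commute transpose_matrix_vector)
 then show "v \<bullet> (?S *v v) = v \<bullet> (Q *v v)" for v
  by (simp add: scaleR_matrix_vector_assoc[symmetric] matrix_vector_mult_add_rdistrib inner_add_right)
qed

text \<open>The polynomial test function raises the second order term by \<open>\<kappa>\<close>
  times the trace of the noise, and \<open>\<kappa>\<close> tends to 0. The infimum is at most its
  value at any control, so a subsolution satisfies each linear inequality separately.\<close>

lemma sub_jet:
 assumes U: "sub U" and t0: "t0 \<in> {0<..<T}" and r0: "r0 \<in> \<P>" and w: "wjet T G t0 r0 x0 a p q Q"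
  and n: "near T t0 r0 x0 (\<lambda>t r x. U t r x - G t r x \<le> U t0 r0 x0 - G t0 r0 x0)" and V: "V \<in> cball 0 l"
 shows "0 \<le> a + Hval t0 r0 x0 p q Q V"
proof -
 obtain S where S: "transpose S = S" "\<And>v. v \<bullet> (S *v v) = v \<bullet> (Q *v v)" "\<And>i. S $ i $ i = Q $ i $ i" using sym_part by blast
 define s where "s = (\<Sum>i\<in>UNIV. (\<sigma> $ i)\<^sup>2)"
 have s: "0 \<le> s" unfolding s_def by (simp add: sum_nonneg)
 have k: "0 \<le> a + Hval t0 r0 x0 p q Q V + \<kappa> * s" if \<kappa>: "0 < \<kappa>" for \<kappa>
 proof -
  obtain C where C: "near T t0 r0 x0 (\<lambda>t r x. \<bar>taylor_rest G t0 r0 x0 a p q Q t r x\<bar> \<le> taylor_err t0 r0 x0 C \<kappa> t r x)" using w \<kappa> unfolding wjet_def by blast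
  let ?\<phi> = "quad t0 r0 x0 a p q S C \<kappa>"
  have "near T t0 r0 x0 (\<lambda>t r x. U t r x - ?\<phi> t r x \<le> U t0 r0 x0 - ?\<phi> t0 r0 x0)"
   by (rule near_mono[OF near_conj[OF n C]]) (auto simp: quad_def S(2))
  then have "0 \<le> op ?\<phi> t0 r0 x0"
   using U t0 r0 quad_C112(1)[OF S(1)] near_eventually unfolding viscosity_subsolution_def by blast
  also have "\<dots> \<le> a + Hval t0 r0 x0 (tangential p) q (S + (2 * \<kappa>) *\<^sub>R mat 1) V"
   using operator_le[of t0 r0 V ?\<phi> x0] t0 r0 V by (simp add: quad_C112[OF S(1)])
  also have "\<dots> = a + Hval t0 r0 x0 p q Q V + \<kappa> * s"
   unfolding Hval_tangential[OF r0] unfolding Hval_def s_def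
   by (simp add: S(3) mat_def distrib_left sum.distrib sum_distrib_left add_divide_distrib sum_divide_distrib mult_ac)
  finally show ?thesis .
 qed
 show ?thesis
 proof (rule field_le_epsilon)
  fix e :: real assume e: "0 < e"
  have "e / (s + 1) * s \<le> e / (s + 1) * (s + 1)" using e s by (intro mult_left_mono) auto
  then have "e / (s + 1) * s \<le> e" using s by simp
  then show "0 \<le> a + Hval t0 r0 x0 p q Q V + e" using k[of "e / (s + 1)"] e s by simp
 qed
qed

text \<open>The same test functions with opposite signs of the error terms. A supersolution only
  yields information on the infimum, so the lower bound \<open>e\<close> has to hold for all
  controls at once.\<close>

lemma super_jet:
 assumes U: "super U" and t0: "t0 \<in> {0<..<T}" and r0: "r0 \<in> \<P>" and w: "wjet T G t0 r0 x0 a p q Q"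
  and n: "near T t0 r0 x0 (\<lambda>t r x. U t0 r0 x0 - G t0 r0 x0 \<le> U t r x - G t r x)"
  and e: "\<And>V. V \<in> cball 0 l \<Longrightarrow> e \<le> a + Hval t0 r0 x0 p q Q V"
 shows "e \<le> 0"
proof -
 obtain S where S: "transpose S = S" "\<And>v. v \<bullet> (S *v v) = v \<bullet> (Q *v v)" "\<And>i. S $ i $ i = Q $ i $ i" using sym_part by blast
 define s where "s = (\<Sum>i\<in>UNIV. (\<sigma> $ i)\<^sup>2)"
 have s: "0 \<le> s" unfolding s_def by (simp add: sum_nonneg)
 have k: "e - \<kappa> * s \<le> 0" if \<kappa>: "0 < \<kappa>" for \<kappa>
 proof -
  obtain C where C: "near T t0 r0 x0 (\<lambda>t r x. \<bar>taylor_rest G t0 r0 x0 a p q Q t r x\<bar> \<le> taylor_err t0 r0 x0 C \<kappa> t r x)" using w \<kappa> unfolding wjet_def by blast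
  let ?\<phi> = "quad t0 r0 x0 a p q S (- C) (- \<kappa>)"
  have "near T t0 r0 x0 (\<lambda>t r x. U t0 r0 x0 - ?\<phi> t0 r0 x0 \<le> U t r x - ?\<phi> t r x)"
   by (rule near_mono[OF near_conj[OF n C]]) (auto simp: quad_def S(2))
  then have "op ?\<phi> t0 r0 x0 \<le> 0"
   using U t0 r0 quad_C112(1)[OF S(1)] near_eventually unfolding viscosity_supersolution_def by blast
  moreover have "e - \<kappa> * s \<le> op ?\<phi> t0 r0 x0"
  proof (rule operator_ge[OF r0])
   fix V :: "real ^ 'n" assume "V \<in> cball 0 l"
   then have "e - \<kappa> * s \<le> a + Hval t0 r0 x0 p q Q V - \<kappa> * s" using e by simp
   also have "\<dots> = a + Hval t0 r0 x0 (tangential p) q (S + (2 * - \<kappa>) *\<^sub>R mat 1) V"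
    unfolding Hval_tangential[OF r0] unfolding Hval_def s_def
    by (simp add: S(3) mat_def right_diff_distrib sum_subtractf sum_distrib_left diff_divide_distrib sum_divide_distrib mult_ac)
   finally show "e - \<kappa> * s \<le> deriv (\<lambda>s. ?\<phi> s r0 x0) t0
    + Hval t0 r0 x0 (simplex_derivative (\<lambda>r. ?\<phi> t0 r x0) r0) (D_x (?\<phi> t0) r0 x0) (D2_x (?\<phi> t0) r0 x0) V"
    by (simp add: quad_C112[OF S(1)] r0)
  qed
  ultimately show ?thesis by linarith
 qed
 show ?thesis
 proof (rule field_le_epsilon)
  fix R :: real assume R: "0 < R"
  have "R / (s + 1) * s \<le> R / (s + 1) * (s + 1)" using R s by (intro mult_left_mono) auto
  then have "R / (s + 1) * s \<le> R" using s by simp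
  then show "e \<le> 0 + R" using k[of "R / (s + 1)"] R s by simp
 qed
qed

text \<open>A classical inequality at a point implies the viscosity inequality there: a test
  function above \<open>G\<close> that touches it has the same first derivatives and at least its
  diagonal second derivatives.\<close>

lemma operator_ge_pjet:
 assumes \<phi>: "C112_on T \<phi>" and t0: "t0 \<in> {0<..<T}" and r0: "r0 \<in> \<P>" and j: "pjet G t0 r0 x0 a P q Q"
  and n: "near T t0 r0 x0 (\<lambda>t r x. G t r x - \<phi> t r x \<le> G t0 r0 x0 - \<phi> t0 r0 x0)"
  and e: "\<And>V. V \<in> cball 0 l \<Longrightarrow> e \<le> a + Hval t0 r0 x0 P q Q V"
 shows "e \<le> op \<phi> t0 r0 x0"
proof (rule operator_ge[OF r0])
 fix V :: "real ^ 'n" assume V: "V \<in> cball 0 l"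
 note touch = pjet_touch[OF t0 r0 j C112_pjet[OF \<phi> t0 r0] n]
 have "(\<Sum>i\<in>UNIV. (\<sigma> $ i)\<^sup>2 * Q $ i $ i) \<le> (\<Sum>i\<in>UNIV. (\<sigma> $ i)\<^sup>2 * D2_x (\<phi> t0) r0 x0 $ i $ i)"
  by (intro sum_mono mult_left_mono touch(4)) auto
 then show "e \<le> deriv (\<lambda>s. \<phi> s r0 x0) t0
  + Hval t0 r0 x0 (simplex_derivative (\<lambda>r. \<phi> t0 r x0) r0) (D_x (\<phi> t0) r0 x0) (D2_x (\<phi> t0) r0 x0) V"
  using e[OF V] unfolding touch(1-3)[symmetric] Hval_def by linarith
qed

end

subsection \<open>Penalisation\<close>

lemma exp_taylor: "\<bar>h\<bar> \<le> 1 \<Longrightarrow> \<bar>exp h - 1 - h\<bar> \<le> (h::real)\<^sup>2"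
proof -
 assume h: "\<bar>h\<bar> \<le> 1"
 have "exp h \<le> 1 + h + h\<^sup>2"
 proof (cases "0 \<le> h")
  case True then show ?thesis using exp_bound[of h] h by simp
 next
  case False
  have "1 \<le> (1 + - h) * (1 + h + h\<^sup>2)" using False by (simp add: power2_eq_square algebra_simps mult_nonneg_nonpos2 mult_nonpos_nonpos)
  also have "\<dots> \<le> exp (- h) * (1 + h + h\<^sup>2)"
   using exp_ge_add_one_self[of "- h"] h by (intro mult_right_mono) (auto simp: abs_le_iff add_nonneg_nonneg)
  finally have "exp h * 1 \<le> exp h * (exp (- h) * (1 + h + h\<^sup>2))" by (intro mult_left_mono) auto
  then show ?thesis by (simp add: mult.assoc[symmetric] exp_add[symmetric])
 qed
 then show ?thesis using exp_ge_add_one_self[of h] zero_le_power2[of h] unfolding abs_le_iff by linarith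
qed

lemma exp_time_quadratic:
 fixes k t t0 T :: real
 assumes k: "0 < k" and t: "\<bar>t - t0\<bar> < 1 / k"
 shows "\<bar>exp (k * (T - t)) - exp (k * (T - t0)) - (t - t0) * (- k * exp (k * (T - t0)))\<bar> \<le> (exp (k * (T - t0)) * k\<^sup>2) * (t - t0)\<^sup>2"
proof -
 let ?h = "- k * (t - t0)" and ?e = "exp (k * (T - t0))"
 have "\<bar>t - t0\<bar> * k < 1" using t unfolding pos_less_divide_eq[OF k] .
 then have h: "\<bar>?h\<bar> \<le> 1" unfolding abs_mult using k by (simp add: mult.commute)
 have "k * (T - t) = k * (T - t0) + ?h" by (simp add: algebra_simps)
 then have e: "exp (k * (T - t)) = ?e * exp ?h" by (simp only: exp_add)
 have "y * z - y - (t - t0) * (- k * y) = y * (z - 1 - ?h)" for y z :: real by (simp add: algebra_simps)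
 then have "\<bar>?e * exp ?h - ?e - (t - t0) * (- k * ?e)\<bar> = ?e * \<bar>exp ?h - 1 - ?h\<bar>" by (simp only: abs_mult abs_exp_cancel)
 also have "\<dots> \<le> ?e * ?h\<^sup>2" by (rule mult_left_mono[OF exp_taylor[OF h]]) simp
 also have "?e * ?h\<^sup>2 = (?e * k\<^sup>2) * (t - t0)\<^sup>2" by (simp only: power_mult_distrib power2_minus mult.assoc)
 finally show ?thesis unfolding e .
qed

lemma inverse_time_quadratic:
 fixes s t t0 :: real
 assumes s: "s < t0" and t: "\<bar>t - t0\<bar> < (t0 - s) / 2"
 shows "\<bar>1 / (t - s) - 1 / (t0 - s) - (t - t0) * (- (1 / (t0 - s)\<^sup>2))\<bar> \<le> (2 / (t0 - s) ^ 3) * (t - t0)\<^sup>2"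
proof -
 define y where "y = t0 - s"
 define h where "h = t - t0"
 have y: "0 < y" and h: "\<bar>h\<bar> < y / 2" using assms by (auto simp: y_def h_def)
 have ts: "t - s = y + h" by (simp add: y_def h_def)
 have yh: "y / 2 < y + h" using h by (simp add: abs_less_iff)
 have ne: "y \<noteq> 0" "y + h \<noteq> 0" using y yh by auto
 have "1 / (y + h) = (1 * (y * y)) / (y\<^sup>2 * (y + h))" "1 / y = (y * (y + h)) / (y\<^sup>2 * (y + h))" "h / y\<^sup>2 = (h * (y + h)) / (y\<^sup>2 * (y + h))"
  using ne by (simp_all add: power2_eq_square)
 then have "1 / (y + h) - 1 / y + h / y\<^sup>2 = (1 * (y * y) - y * (y + h) + h * (y + h)) / (y\<^sup>2 * (y + h))"
  by (simp only: diff_divide_distrib add_divide_distrib)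
 also have "1 * (y * y) - y * (y + h) + h * (y + h) = h\<^sup>2" by (simp add: power2_eq_square algebra_simps)
 finally have "1 / (y + h) - 1 / y + h / y\<^sup>2 = h\<^sup>2 / (y\<^sup>2 * (y + h))" .
 moreover have "h\<^sup>2 / (y\<^sup>2 * (y + h)) \<le> h\<^sup>2 / (y\<^sup>2 * (y / 2))"
  using y yh by (intro divide_left_mono mult_left_mono) auto
 moreover have "h\<^sup>2 / (y\<^sup>2 * (y / 2)) = 2 / y ^ 3 * h\<^sup>2" by (simp add: power2_eq_square power3_eq_cube field_simps)
 moreover have "0 \<le> h\<^sup>2 / (y\<^sup>2 * (y + h))" using y yh by simp
 ultimately have "\<bar>1 / (y + h) - 1 / y + h / y\<^sup>2\<bar> \<le> 2 / y ^ 3 * h\<^sup>2" by linarith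
 then show ?thesis unfolding ts y_def[symmetric] h_def[symmetric] by simp
qed

section \<open>Compact cores of the simplex and Lipschitz bounds on them\<close>

definition simplex_core :: "real \<Rightarrow> (real ^ 'n::finite) set" where
 "simplex_core c = {r. (\<forall>i. c \<le> r $ i) \<and> (\<Sum>i\<in>UNIV. r $ i) = 1}"

lemma simplex_core_subset: "0 < c \<Longrightarrow> r \<in> simplex_core c \<Longrightarrow> r \<in> \<P>"
 unfolding simplex_core_def prob_simplex_int_iff by (auto intro: less_le_trans)

lemma compact_simplex_core:
 assumes "0 < c"
 shows "compact (simplex_core c :: (real ^ 'n::finite) set)"
proof -
 have "closed (simplex_core c :: (real ^ 'n) set)"
  unfolding simplex_core_def by (intro closed_Collect_conj closed_Collect_all closed_Collect_le closed_Collect_eq continuous_intros)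
 moreover have "bounded (simplex_core c :: (real ^ 'n) set)"
 proof (rule boundedI)
  fix r :: "real ^ 'n" assume "r \<in> simplex_core c"
  then have r: "\<And>i. 0 \<le> r $ i" "(\<Sum>i\<in>UNIV. r $ i) = 1" using assms unfolding simplex_core_def by (auto intro: order_trans less_imp_le)
  have "norm r \<le> (\<Sum>i\<in>UNIV. \<bar>r $ i\<bar>)" by (rule norm_le_l1_cart)
  then show "norm r \<le> 1" using r by simp
 qed
 ultimately show ?thesis by (simp add: compact_eq_bounded_closed)
qed

lemma simplex_core_neighbourhood:
 fixes r0 :: "real ^ 'n::finite"
 assumes "r0 \<in> \<P>"
 obtains c where "0 < c" "r0 \<in> simplex_core c" "\<And>r. r \<in> \<P> \<Longrightarrow> norm (r - r0) \<le> c \<Longrightarrow> r \<in> simplex_core c"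
proof -
 define m where "m = Min (range (\<lambda>i. r0 $ i))"
 have m: "m \<le> r0 $ i" for i unfolding m_def by (rule Min_le) auto
 have m0: "0 < m" unfolding m_def using assms by (subst Min_gr_iff) (auto simp: prob_simplex_int_iff)
 have near: "r \<in> simplex_core (m / 2)" if r: "r \<in> \<P>" "norm (r - r0) \<le> m / 2" for r
 proof -
  have "m / 2 \<le> r $ i" for i
   using component_le_norm_cart[of "r - r0" i] r(2) m[of i] by simp
  then show ?thesis using r(1) unfolding simplex_core_def by (simp add: prob_simplex_int_iff)
 qed
 show thesis by (rule that[of "m / 2"]) (use m0 near[of r0] near assms in auto)
qed

lemma locally_lipschitz_core:
 fixes f :: "real ^ 'n::finite \<Rightarrow> real ^ 'n \<Rightarrow> real"
 assumes f: "locally_lipschitz E f" and c: "0 < c" and R: "0 \<le> R"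
 obtains L where "0 < L" "\<And>r \<mu> x y. r \<in> simplex_core c \<Longrightarrow> \<mu> \<in> simplex_core c \<Longrightarrow> norm x \<le> R \<Longrightarrow> norm y \<le> R \<Longrightarrow>
   \<bar>f r x - f \<mu> y\<bar> \<le> L * (norm (r - \<mu>) + norm (x - y))"
proof -
 let ?n = "real CARD('n)"
 have n: "0 < ?n" by simp
 \<comment> \<open>The definition of local Lipschitz continuity asks for a radius strictly below
   \<open>1 / CARD('n)\<close>. On the ball of radius \<open>R\<close> coordinate differences are at
   most \<open>2 * R\<close>, and the added 1 keeps that bound positive.\<close>
 let ?J1 = "min c (1 / (2 * ?n))"
 have J1: "0 < ?J1" "?J1 < 1 / ?n" using c n by (auto simp: min_less_iff_disj intro!: disjI2 divide_strict_left_mono)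
 have R1: "0 < 2 * R + 1" using R by simp
 obtain L where L0: "0 < L \<and> (\<forall>r\<in>\<P>. \<forall>\<mu>\<in>\<P>. \<forall>x y.
     (\<forall>i. ?J1 \<le> r $ i \<and> ?J1 \<le> \<mu> $ i) \<and>
     (\<forall>(i, j)\<in>E. \<bar>x $ i - x $ j\<bar> \<le> 2 * R + 1 \<and> \<bar>y $ i - y $ j\<bar> \<le> 2 * R + 1) \<longrightarrow>
     \<bar>f r x - f \<mu> y\<bar> \<le> L * (norm (r - \<mu>) + norm (x - y)))"
  using f[unfolded locally_lipschitz_def, THEN spec, THEN spec, THEN mp, OF conjI[OF J1(1) conjI[OF J1(2) R1]]] by (rule exE)
 note L = conjunct1[OF L0] conjunct2[OF L0]
 show ?thesis
 proof (rule that[OF L(1)])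
  fix r \<mu> x y :: "real ^ 'n" assume a: "r \<in> simplex_core c" "\<mu> \<in> simplex_core c" "norm x \<le> R" "norm y \<le> R"
  have e: "\<bar>z $ i - z $ j\<bar> \<le> 2 * R + 1" if "norm z \<le> R" for z :: "real ^ 'n" and i j
   using component_le_norm_cart[of z i] component_le_norm_cart[of z j] that by linarith
  have "\<forall>i. ?J1 \<le> r $ i \<and> ?J1 \<le> \<mu> $ i" 
   using a(1,2) min.cobounded1[of c "1 / (2 * ?n)"] unfolding simplex_core_def mem_Collect_eq by (meson order_trans)
  moreover have "\<forall>(i, j)\<in>E. \<bar>x $ i - x $ j\<bar> \<le> 2 * R + 1 \<and> \<bar>y $ i - y $ j\<bar> \<le> 2 * R + 1" using e[OF a(3)] e[OF a(4)] by simp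
  ultimately show "\<bar>f r x - f \<mu> y\<bar> \<le> L * (norm (r - \<mu>) + norm (x - y))"
   by (intro L(2)[rule_format, OF simplex_core_subset[OF c a(1)] simplex_core_subset[OF c a(2)]] conjI)
 qed
qed

lemma locally_lipschitz_core_vec:
 fixes f :: "real ^ 'n::finite \<Rightarrow> real ^ 'n \<Rightarrow> real ^ 'n"
 assumes f: "\<And>i. locally_lipschitz E (\<lambda>r x. f r x $ i)" and c: "0 < c" and R: "0 \<le> R"
 obtains L where "0 < L" "\<And>r \<mu> x y. r \<in> simplex_core c \<Longrightarrow> \<mu> \<in> simplex_core c \<Longrightarrow> norm x \<le> R \<Longrightarrow> norm y \<le> R \<Longrightarrow>
   norm (f r x - f \<mu> y) \<le> L * (norm (r - \<mu>) + norm (x - y))"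
proof -
 have "\<exists>L>0. \<forall>r \<mu> x y. r \<in> simplex_core c \<longrightarrow> \<mu> \<in> simplex_core c \<longrightarrow> norm x \<le> R \<longrightarrow> norm y \<le> R \<longrightarrow>
   \<bar>f r x $ i - f \<mu> y $ i\<bar> \<le> L * (norm (r - \<mu>) + norm (x - y))" for i
  using locally_lipschitz_core[OF f[of i] c R] by metis
 then obtain L where L: "\<And>i. 0 < L i" "\<And>i r \<mu> x y. r \<in> simplex_core c \<Longrightarrow> \<mu> \<in> simplex_core c \<Longrightarrow> norm x \<le> R \<Longrightarrow> norm y \<le> R \<Longrightarrow>
   \<bar>f r x $ i - f \<mu> y $ i\<bar> \<le> L i * (norm (r - \<mu>) + norm (x - y))" by metis
 show ?thesis
 proof (rule that[of "\<Sum>i\<in>UNIV. L i"])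
  show "0 < (\<Sum>i\<in>UNIV. L i)" using L(1) by (intro sum_pos) auto
  fix r \<mu> x y :: "real ^ 'n" assume a: "r \<in> simplex_core c" "\<mu> \<in> simplex_core c" "norm x \<le> R" "norm y \<le> R"
  have "norm (f r x - f \<mu> y) \<le> (\<Sum>i\<in>UNIV. \<bar>(f r x - f \<mu> y) $ i\<bar>)" by (rule norm_le_l1_cart)
  also have "\<dots> \<le> (\<Sum>i\<in>UNIV. L i * (norm (r - \<mu>) + norm (x - y)))" using L(2)[OF a] by (intro sum_mono) simp
  finally show "norm (f r x - f \<mu> y) \<le> (\<Sum>i\<in>UNIV. L i) * (norm (r - \<mu>) + norm (x - y))" by (simp add: sum_distrib_right)
 qed
qed

context hjb
begin

text \<open>No joint second order differentiability is available. At fixed density the Peano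
  expansion is used; from \<open>r0\<close> to \<open>r\<close> the Lipschitz continuity of
  \<open>D_\<rho> H0\<close> in both variables gives an error
  \<open>L * (norm (r - r0) + norm (x - x0)) * norm (r - r0)\<close>, and Young's inequality splits
  the mixed product.\<close>

lemma H0_wjet:
 assumes r0: "r0 \<in> \<P>"
 shows "wjet T (\<lambda>_. H0) t0 r0 x0 0 (D_\<rho> H0 r0 x0) (D_x H0 r0 x0) (D2_x H0 r0 x0)"
 unfolding wjet_def
proof (intro allI impI)
 fix \<kappa> :: real assume \<kappa>: "0 < \<kappa>"
 obtain c where c: "0 < c" and nb: "\<And>r. r \<in> \<P> \<Longrightarrow> norm (r - r0) \<le> c \<Longrightarrow> r \<in> simplex_core c"
  using simplex_core_neighbourhood[OF r0] by metis
 have "\<And>i. locally_lipschitz E (\<lambda>r x. D_\<rho> H0 r x $ i)" using energy unfolding admissible_energy_def by blast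
 then obtain L where L: "0 < L" "\<And>r \<mu> x y. r \<in> simplex_core c \<Longrightarrow> \<mu> \<in> simplex_core c \<Longrightarrow> norm x \<le> norm x0 + 1 \<Longrightarrow> norm y \<le> norm x0 + 1 \<Longrightarrow>
   norm (D_\<rho> H0 r x - D_\<rho> H0 \<mu> y) \<le> L * (norm (r - \<mu>) + norm (x - y))"
  by (rule locally_lipschitz_core_vec[OF _ c, of E "D_\<rho> H0" "norm x0 + 1"]) auto
 obtain d1 where d1: "0 < d1" "\<And>x. norm (x - x0) < d1 \<Longrightarrow>
   \<bar>H0 r0 x - H0 r0 x0 - D_x H0 r0 x0 \<bullet> (x - x0) - (x - x0) \<bullet> (D2_x H0 r0 x0 *v (x - x0)) / 2\<bar> \<le> \<kappa> / 2 * (norm (x - x0))\<^sup>2"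
  using twice_differentiable_taylor[OF second_derivatives[OF r0], of "\<kappa> / 2" x0] \<kappa> unfolding D_x_def D2_x_def by auto
 show "\<exists>C\<ge>0. near T t0 r0 x0 (\<lambda>t r x. \<bar>H0 r x - H0 r0 x0 - 0 * (t - t0) - D_\<rho> H0 r0 x0 \<bullet> (r - r0) - D_x H0 r0 x0 \<bullet> (x - x0)
   - (x - x0) \<bullet> (D2_x H0 r0 x0 *v (x - x0)) / 2\<bar> \<le> C * ((t - t0)\<^sup>2 + (norm (r - r0))\<^sup>2) + \<kappa> * (norm (x - x0))\<^sup>2)"
 proof (rule exI[of _ "L + L\<^sup>2 / (2 * \<kappa>)"], intro conjI nearI[of "min d1 (min c 1)"], goal_cases)
  case 1 show ?case using L \<kappa> by simp
 next
  case 2 show ?case using d1 c by simp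
 next
  case (3 t r x)
  let ?v = "r - r0" and ?y = "norm (x - x0)"
  let ?u = "norm ?v"
  have small: "?u < c" "?y < d1" "?y < 1" using 3 by auto
  have nx: "norm x \<le> norm x0 + 1" using norm_triangle_sub[of x x0] small by simp
  have seg: "r0 + s *\<^sub>R ?v \<in> simplex_core c" "norm (s *\<^sub>R ?v) \<le> ?u" if "s \<in> {0..1}" for s
  proof -
   show n: "norm (s *\<^sub>R ?v) \<le> ?u" using that by (simp add: mult_left_le_one_le)
   have "(1 - s) *\<^sub>R r0 + s *\<^sub>R r \<in> \<P>"
    by (rule convexD[OF convex_rel_interior[OF convex_prob_simplex]]) (use r0 3 that in auto)
   then have "r0 + s *\<^sub>R ?v \<in> \<P>" by (simp add: algebra_simps)
   then show "r0 + s *\<^sub>R ?v \<in> simplex_core c" using n small by (intro nb) auto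
  qed
  let ?D = "D_\<rho> H0 r0 x0"
  let ?g = "\<lambda>s. H0 (r0 + s *\<^sub>R ?v) x - s * (?D \<bullet> ?v)"
  have "norm (?g 1 - ?g 0) \<le> (L * (?u + ?y) * ?u) * norm (1 - 0 :: real)"
  proof (rule field_differentiable_bound[of "{0..1}" ?g "\<lambda>s. (D_\<rho> H0 (r0 + s *\<^sub>R ?v) x - ?D) \<bullet> ?v"])
   fix s :: real assume s: "s \<in> {0..1}"
   have "((\<lambda>s. r0 + s *\<^sub>R ?v) has_derivative (\<lambda>s. s *\<^sub>R ?v)) (at s)" by (auto intro!: derivative_eq_intros)
   from has_derivative_compose[OF this H0_derivative_\<rho>[OF simplex_core_subset[OF c seg(1)[OF s]]]]
   have "((\<lambda>s. H0 (r0 + s *\<^sub>R ?v) x) has_real_derivative D_\<rho> H0 (r0 + s *\<^sub>R ?v) x \<bullet> ?v) (at s)"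
    unfolding has_field_derivative_def by (simp add: mult_commute_abs)
   then have "(?g has_real_derivative D_\<rho> H0 (r0 + s *\<^sub>R ?v) x \<bullet> ?v - ?D \<bullet> ?v) (at s)"
    by (auto intro!: derivative_eq_intros)
   then show "(?g has_real_derivative (D_\<rho> H0 (r0 + s *\<^sub>R ?v) x - ?D) \<bullet> ?v) (at s within {0..1})"
    by (simp add: has_field_derivative_at_within inner_diff_left)
   have "norm (D_\<rho> H0 (r0 + s *\<^sub>R ?v) x - ?D) \<le> L * (norm (s *\<^sub>R ?v) + ?y)"
    using L(2)[OF seg(1)[OF s] seg(1)[of 0] nx, of x0] by simp
   also have "\<dots> \<le> L * (?u + ?y)" using seg(2)[OF s] L by (intro mult_left_mono) auto
   finally show "norm ((D_\<rho> H0 (r0 + s *\<^sub>R ?v) x - ?D) \<bullet> ?v) \<le> L * (?u + ?y) * ?u"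
    using Cauchy_Schwarz_ineq2[of "D_\<rho> H0 (r0 + s *\<^sub>R ?v) x - ?D" ?v] mult_right_mono[of _ "L * (?u + ?y)" ?u] by (simp add: order_trans)
  qed auto
  then have 1: "\<bar>H0 r x - H0 r0 x - ?D \<bullet> ?v\<bar> \<le> L * (?u + ?y) * ?u" by simp
  have 2: "L * (?u + ?y) * ?u \<le> (L + L\<^sup>2 / (2 * \<kappa>)) * ?u\<^sup>2 + \<kappa> / 2 * ?y\<^sup>2"
  proof -
   have "0 \<le> (L * ?u - \<kappa> * ?y)\<^sup>2 / (2 * \<kappa>)" using \<kappa> by simp
   also have "\<dots> = L\<^sup>2 / (2 * \<kappa>) * ?u\<^sup>2 + \<kappa> / 2 * ?y\<^sup>2 - L * ?y * ?u" using \<kappa> by (simp add: power2_eq_square field_simps)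
   finally show ?thesis by (simp add: power2_eq_square algebra_simps)
  qed
  have "(L + L\<^sup>2 / (2 * \<kappa>)) * ?u\<^sup>2 \<le> (L + L\<^sup>2 / (2 * \<kappa>)) * ((t - t0)\<^sup>2 + ?u\<^sup>2)" using L \<kappa> by (intro mult_left_mono) auto
  moreover have "\<kappa> * ?y\<^sup>2 = \<kappa> / 2 * ?y\<^sup>2 + \<kappa> / 2 * ?y\<^sup>2" by simp
  ultimately show ?case using 1 2 d1(2)[OF small(2)] by linarith
 qed
qed

lemma class_Pr_levels:
 "\<forall>J>0. \<exists>c C1 C2. 0 < c \<and> c < 1 \<and> 0 < C1 \<and> 0 < C2 \<and>
    (\<forall>r\<in>\<P>. \<forall>x. H0 r x \<le> J \<longrightarrow>
      norm (D_\<rho> H0 r x) \<le> C1 \<and> norm (D_x H0 r x) \<le> C1 \<and>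
      (\<forall>i. c \<le> r $ i) \<and> (\<forall>(i, j)\<in>E. \<bar>x $ i - x $ j\<bar> \<le> C2))"
 using energy[unfolded admissible_energy_def, THEN conjunct1, unfolded class_Pr_def, THEN conjunct2, THEN conjunct2, THEN conjunct1] .

lemma H0_bounded_below: "\<exists>m. \<forall>r\<in>\<P>. \<forall>x. m \<le> H0 r x"
 using energy[unfolded admissible_energy_def, THEN conjunct1, unfolded class_Pr_def, THEN conjunct2, THEN conjunct1] .

text \<open>The part of \<open>Hval\<close> that is linear in the derivatives, without the cost; it
  applies to differences of functions and to the penalty.\<close>

definition pen_val :: "real ^ 'n \<Rightarrow> real ^ 'n \<Rightarrow> real ^ 'n \<Rightarrow> real ^ 'n \<Rightarrow> real ^ 'n ^ 'n \<Rightarrow> real ^ 'n \<Rightarrow> real" where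
 "pen_val r x p q Q V = p \<bullet> D_x H0 r x - q \<bullet> (D_\<rho> H0 r x + V) + (\<Sum>i\<in>UNIV. (\<sigma> $ i)\<^sup>2 * Q $ i $ i) / 2"

lemma Hval_pen: "Hval t r x p q Q V = pen_val r x p q Q V + F t r x V"
 unfolding Hval_def pen_val_def by simp

lemma pen_val_add: "pen_val r x (p + p') (q + q') (Q + Q') V = pen_val r x p q Q V + pen_val r x p' q' Q' V"
 unfolding pen_val_def by (simp add: inner_add_left distrib_left sum.distrib add_divide_distrib)

lemma pen_val_scale: "pen_val r x (c *\<^sub>R p) (c *\<^sub>R q) (c *\<^sub>R Q) V = c * pen_val r x p q Q V"
proof -
 have "(\<Sum>i\<in>UNIV. (\<sigma> $ i)\<^sup>2 * (c * Q $ i $ i)) = c * (\<Sum>i\<in>UNIV. (\<sigma> $ i)\<^sup>2 * Q $ i $ i)"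
  by (simp add: sum_distrib_left mult.left_commute)
 then show ?thesis unfolding pen_val_def by (simp add: algebra_simps)
qed

lemma pen_val_uminus: "pen_val r x (- p) (- q) (- Q) V = - pen_val r x p q Q V"
 using pen_val_scale[of r x "-1" p q Q V] by simp

text \<open>Along the uncontrolled Hamiltonian flow the energy is conserved: the products of
  \<open>D_\<rho> H0\<close> and \<open>D_x H0\<close> cancel. What remains comes from the control
  and the noise, and the growth condition bounds it by the energy itself.\<close>

lemma lyapunov:
 obtains C0 K0 where "0 \<le> K0" "\<And>r x. r \<in> \<P> \<Longrightarrow> 1 \<le> H0 r x + C0"
  "\<And>r x V. r \<in> \<P> \<Longrightarrow> V \<in> cball 0 l \<Longrightarrow>
    \<bar>pen_val r x (D_\<rho> H0 r x) (D_x H0 r x) (D2_x H0 r x) V\<bar> \<le> K0 * (H0 r x + C0)"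
proof -
 obtain C1 C2 where C: "0 < C1" "0 < C2" and g: "\<And>r x V. r \<in> \<P> \<Longrightarrow> V \<in> cball 0 l \<Longrightarrow>
   norm (D_x (controlled_energy H0 V) r x) + (\<Sum>i\<in>UNIV. \<bar>D2_x (controlled_energy H0 V) r x $ i $ i\<bar>)
     \<le> C1 * controlled_energy H0 V r x + C2" using growth by blast
 obtain m where m: "\<And>r x. r \<in> \<P> \<Longrightarrow> m \<le> H0 r x"
  using H0_bounded_below by blast
 define s where "s = (\<Sum>i\<in>UNIV. (\<sigma> $ i)\<^sup>2)"
 have s: "0 \<le> s" "(\<sigma> $ i)\<^sup>2 \<le> s" for i unfolding s_def by (auto intro: sum_nonneg member_le_sum)
 \<comment> \<open>The part \<open>\<bar>m\<bar> + 1\<close> makes \<open>H0 + C0\<close> at least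
   1; the part \<open>C2 / C1\<close> absorbs the additive constant of the growth condition.\<close>
 define C0 where "C0 = \<bar>m\<bar> + 1 + C2 / C1"
 have g0: "norm (D_x H0 r x) + (\<Sum>i\<in>UNIV. \<bar>D2_x H0 r x $ i $ i\<bar>) \<le> C1 * (H0 r x + C0)" if r: "r \<in> \<P>" for r x
 proof -
  have "norm (D_x H0 r x) + (\<Sum>i\<in>UNIV. \<bar>D2_x H0 r x $ i $ i\<bar>) \<le> C1 * H0 r x + C2"
   using g[OF r, of 0 x] l_pos unfolding controlled_derivatives[OF r] by (simp add: controlled_energy_def)
  also have "\<dots> \<le> C1 * (H0 r x + C0)"
  proof -
   have "C1 * (C2 / C1) = C2" using C by simp
   moreover have "0 \<le> C1 * (\<bar>m\<bar> + 1)" using C by simp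
   ultimately show ?thesis unfolding C0_def by (simp only: distrib_left)
  qed
  finally show ?thesis .
 qed
 show ?thesis
 proof (rule that[of "(l + s) * C1" C0])
  show "0 \<le> (l + s) * C1" using l_pos s C by simp
  show "1 \<le> H0 r x + C0" if "r \<in> \<P>" for r x
   using m[OF that, of x] divide_pos_pos[OF C(2,1)] unfolding C0_def by linarith
  fix r x V :: "real ^ 'n" assume r: "r \<in> \<P>" and V: "V \<in> cball 0 l"
  let ?N = "norm (D_x H0 r x)" and ?S = "\<Sum>i\<in>UNIV. \<bar>D2_x H0 r x $ i $ i\<bar>"
  have "pen_val r x (D_\<rho> H0 r x) (D_x H0 r x) (D2_x H0 r x) V = - (D_x H0 r x \<bullet> V) + (\<Sum>i\<in>UNIV. (\<sigma> $ i)\<^sup>2 * D2_x H0 r x $ i $ i) / 2"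
   unfolding pen_val_def by (simp add: inner_add_right inner_commute)
  moreover have "\<bar>D_x H0 r x \<bullet> V\<bar> \<le> ?N * l"
   using Cauchy_Schwarz_ineq2[of "D_x H0 r x" V] mult_left_mono[of "norm V" l ?N] V by simp
  moreover have "\<bar>\<Sum>i\<in>UNIV. (\<sigma> $ i)\<^sup>2 * D2_x H0 r x $ i $ i\<bar> \<le> s * ?S"
   unfolding sum_distrib_left using s
   by (intro order_trans[OF sum_abs] sum_mono) (simp add: abs_mult mult_right_mono)
  moreover have "0 \<le> ?S" by (simp add: sum_nonneg)
  moreover have "0 \<le> s * ?S" "0 \<le> ?N * s" "0 \<le> l * ?S" using s l_pos \<open>0 \<le> ?S\<close> by simp_all
  moreover have "(l + s) * (?N + ?S) = ?N * l + ?N * s + l * ?S + s * ?S" by (simp add: algebra_simps)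
  ultimately have "\<bar>pen_val r x (D_\<rho> H0 r x) (D_x H0 r x) (D2_x H0 r x) V\<bar> \<le> (l + s) * (?N + ?S)" by linarith
  also have "\<dots> \<le> (l + s) * (C1 * (H0 r x + C0))" using g0[OF r] l_pos s by (intro mult_left_mono) auto
  finally show "\<bar>pen_val r x (D_\<rho> H0 r x) (D_x H0 r x) (D2_x H0 r x) V\<bar> \<le> (l + s) * C1 * (H0 r x + C0)" by (simp add: mult.assoc)
 qed
qed

text \<open>Sublevel sets lie in a compact cylinder, and the inequality for
  \<open>a + \<bar>pen_val ...\<bar>\<close> is strict and uniform over controls. The absolute value
  lets the same penalty be added in the comparison of subsolutions and subtracted in that of
  supersolutions. The jet is required only where \<open>\<Psi> \<le> M\<close>, the region in which
  maxima can occur.\<close>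

definition penalty :: "real \<Rightarrow> real \<Rightarrow> real \<Rightarrow> real \<Rightarrow> (real \<Rightarrow> real ^ 'n \<Rightarrow> real ^ 'n \<Rightarrow> real) \<Rightarrow> bool" where
 "penalty \<epsilon> M c R \<Psi> \<longleftrightarrow> 0 < c \<and> 0 \<le> R \<and>
   continuous_on (UNIV \<times> \<P> \<times> UNIV) (\<lambda>(t, r, x). \<Psi> t r x) \<and>
   (\<forall>t r x. r \<in> \<P> \<longrightarrow> 0 \<le> \<Psi> t r x) \<and>
   (\<forall>t\<in>{0..T}. \<forall>r\<in>\<P>. \<forall>x. \<Psi> t r x \<le> M \<longrightarrow> r \<in> simplex_core c \<and> norm x \<le> R) \<and>
   (\<forall>t0\<in>{0<..<T}. \<forall>r0\<in>\<P>. \<forall>x0. \<Psi> t0 r0 x0 \<le> M \<longrightarrow> (\<exists>a p q Q. wjet T \<Psi> t0 r0 x0 a p q Q \<and>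
    (\<forall>V\<in>cball 0 l. a + \<bar>pen_val r0 x0 p q Q V\<bar> \<le> - \<epsilon>)))"

text \<open>
 The penalty is a combination of \<open>H0\<close> and \<open>1 + (norm x)\<^sup>2\<close> with exponential weights in time. The first
 summand is a Lyapunov function by the growth condition. The coefficient of the second one may
 depend on the sublevel set fixed by the first one, where \<open>D_\<rho> H0\<close> is bounded; it is needed because
 \<open>H0\<close> controls only differences of the coordinates of \<open>x\<close>.
\<close>

lemma penalty_exists:
 obtains G where "continuous_on (\<P> \<times> UNIV) (\<lambda>(r, x). G r x)" "\<And>r x. r \<in> \<P> \<Longrightarrow> 0 \<le> G r x"
  "\<And>\<epsilon> M. 0 < \<epsilon> \<Longrightarrow> 0 \<le> M \<Longrightarrow> \<exists>\<Psi> c R. penalty \<epsilon> M c R \<Psi> \<and> (\<forall>t\<in>{0..T}. \<forall>r\<in>\<P>. \<forall>x. \<Psi> t r x \<le> \<epsilon> * G r x)"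
proof -
 obtain C0 K0 where K0: "0 \<le> K0" and H1: "\<And>r x. r \<in> \<P> \<Longrightarrow> 1 \<le> H0 r x + C0"
  and Ly: "\<And>r x V. r \<in> \<P> \<Longrightarrow> V \<in> cball 0 l \<Longrightarrow>
    \<bar>pen_val r x (D_\<rho> H0 r x) (D_x H0 r x) (D2_x H0 r x) V\<bar> \<le> K0 * (H0 r x + C0)" by (rule lyapunov) metis
 \<comment> \<open>The surplus 1 over \<open>K0\<close> leaves the term
   \<open>- exp (K * (T - t)) * (\<epsilon> * (H0 r x + C0))\<close>, which is at most
   \<open>- \<epsilon>\<close>: this is the source of strictness.\<close>
 define K where "K = K0 + 1"
 have K: "0 < K" unfolding K_def using K0 by simp
 define G where "G r x = exp (K * T) * (H0 r x + C0) + (1 + (norm x)\<^sup>2)" for r x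
 show ?thesis
 proof (rule that[of G])
  show "continuous_on (\<P> \<times> UNIV) (\<lambda>(r, x). G r x)"
   using H0_continuous unfolding G_def case_prod_unfold by (intro continuous_intros)
  show "0 \<le> G r x" if "r \<in> \<P>" for r x
  proof -
   have "0 \<le> H0 r x + C0" using H1[OF that, of x] by linarith
   then have "0 \<le> exp (K * T) * (H0 r x + C0)" by (rule mult_nonneg_nonneg[OF exp_ge_zero])
   then show ?thesis unfolding G_def by (simp add: add_nonneg_nonneg)
  qed
  fix \<epsilon> M :: real assume \<epsilon>: "0 < \<epsilon>" and M: "0 \<le> M"
  \<comment> \<open>Where \<open>\<Psi> \<le> M\<close>, the first summand bounds the energy by
    \<open>J\<close>. The properties of the class then provide the core constant \<open>c\<close>
    and the bound \<open>CR\<close> for the density gradient.\<close>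
  define J where "J = M / \<epsilon> + \<bar>C0\<bar> + 1"
  have J: "0 < J" unfolding J_def using M \<epsilon> by (simp add: add_nonneg_pos)
  have cf: "\<exists>c C1 C2. 0 < c \<and> c < 1 \<and> 0 < C1 \<and> 0 < C2 \<and>
    (\<forall>r\<in>\<P>. \<forall>x. H0 r x \<le> J \<longrightarrow>
      norm (D_\<rho> H0 r x) \<le> C1 \<and> norm (D_x H0 r x) \<le> C1 \<and>
      (\<forall>i. c \<le> r $ i) \<and> (\<forall>(i, j)\<in>E. \<bar>x $ i - x $ j\<bar> \<le> C2))"
   using class_Pr_levels J by blast
  then obtain c CR where c: "0 < c" "0 < CR" and sub: "\<And>r x. r \<in> \<P> \<Longrightarrow> H0 r x \<le> J \<Longrightarrow> norm (D_\<rho> H0 r x) \<le> CR \<and> (\<forall>i. c \<le> r $ i)"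
   by metis
  define s where "s = (\<Sum>i\<in>UNIV. (\<sigma> $ i)\<^sup>2)"
  have s: "0 \<le> s" unfolding s_def by (auto intro: sum_nonneg)
  \<comment> \<open>On the sublevel set this bounds the generator of
    \<open>1 + (norm x)\<^sup>2\<close> by \<open>K1\<close> times that function, because
    \<open>2 * norm x \<le> 1 + (norm x)\<^sup>2\<close>. The exponential weight of rate
    \<open>K1\<close> cancels it exactly.\<close>
  define K1 where "K1 = CR + l + s"
  have K1: "0 < K1" unfolding K1_def using c l_pos s by simp
  \<comment> \<open>The factor offsets the largest value of \<open>exp (K1 * (T - t))\<close>. Hence
    this summand stays below \<open>\<epsilon> * (1 + (norm x)\<^sup>2)\<close> although
    \<open>K1\<close> depends on \<open>\<epsilon>\<close> and \<open>M\<close>, and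
    \<open>G\<close> can be chosen once and for all.\<close>
  define \<delta> where "\<delta> = \<epsilon> * exp (- (K1 * T))"
  have \<delta>: "0 < \<delta>" unfolding \<delta>_def using \<epsilon> by simp
  define R where "R = M / \<delta> + 1"
  have R: "0 \<le> R" unfolding R_def using M \<delta> by simp
  let ?e = "\<lambda>t. exp (K * (T - t))" and ?e1 = "\<lambda>t. exp (K1 * (T - t))"
  define \<Psi> where "\<Psi> t r x = ?e t * (\<epsilon> * (H0 r x + C0)) + ?e1 t * (\<delta> * (1 + (norm x)\<^sup>2))" for t r x
  have pos: "0 \<le> ?e t * (\<epsilon> * (H0 r x + C0))" "0 \<le> ?e1 t * (\<delta> * (1 + (norm x)\<^sup>2))" if "r \<in> \<P>" for t r x
  proof -
   have "0 \<le> H0 r x + C0" using H1[OF that, of x] by linarith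
   then show "0 \<le> ?e t * (\<epsilon> * (H0 r x + C0))" using \<epsilon> by simp
   show "0 \<le> ?e1 t * (\<delta> * (1 + (norm x)\<^sup>2))" using \<delta> by simp
  qed
  have region: "H0 r x \<le> J \<and> norm x \<le> R" if t: "t \<le> T" and r: "r \<in> \<P>" and P: "\<Psi> t r x \<le> M" for t r x
  proof
   have e1: "1 \<le> ?e t" "1 \<le> ?e1 t" using t K K1 by auto
   have a: "\<epsilon> * (H0 r x + C0) \<le> M"
   proof -
    have "0 \<le> H0 r x + C0" using H1[OF r, of x] by linarith
    then have "1 * (\<epsilon> * (H0 r x + C0)) \<le> ?e t * (\<epsilon> * (H0 r x + C0))" using \<epsilon> by (intro mult_right_mono[OF e1(1)]) simp
    then show ?thesis using pos(2)[OF r, of t x] P unfolding \<Psi>_def by linarith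
   qed
   then have "H0 r x + C0 \<le> M / \<epsilon>" using \<epsilon> by (simp add: pos_le_divide_eq mult.commute)
   then show "H0 r x \<le> J" unfolding J_def by linarith
   have "0 \<le> \<delta> * (1 + (norm x)\<^sup>2)" using \<delta> by (intro mult_nonneg_nonneg) auto
   then have "\<delta> * (1 + (norm x)\<^sup>2) \<le> M"
    using mult_right_mono[OF e1(2), of "\<delta> * (1 + (norm x)\<^sup>2)"] pos(1)[OF r, of t x] P unfolding \<Psi>_def by simp
   then have "1 + (norm x)\<^sup>2 \<le> M / \<delta>" using \<delta> by (simp add: pos_le_divide_eq mult.commute)
   moreover have "2 * norm x \<le> 1 + (norm x)\<^sup>2" using zero_le_power2[of "norm x - 1"] by (simp add: power2_eq_square algebra_simps)
   ultimately show "norm x \<le> R" unfolding R_def using norm_ge_zero[of x] by linarith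
  qed
  have pen: "penalty \<epsilon> M c R \<Psi>"
   unfolding penalty_def
  proof (intro conjI allI ballI impI c(1) R)
   show "continuous_on (UNIV \<times> \<P> \<times> UNIV) (\<lambda>(t, r, x). \<Psi> t r x)"
   proof -
    have "continuous_on (UNIV \<times> \<P> \<times> UNIV) (\<lambda>z. (\<lambda>(r, x). H0 r x) (snd z))"
     by (rule continuous_on_compose2[OF H0_continuous]) (auto intro!: continuous_intros)
    then show ?thesis unfolding \<Psi>_def case_prod_unfold by (intro continuous_intros)
   qed
   show "0 \<le> \<Psi> t r x" if "r \<in> \<P>" for t r x unfolding \<Psi>_def using pos[OF that] by simp
   show "r \<in> simplex_core c" if "t \<in> {0..T}" "r \<in> \<P>" "\<Psi> t r x \<le> M" for t r x
    using region[of t r x] sub[of r x] that unfolding simplex_core_def by (auto simp: prob_simplex_int_iff)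
   show "norm x \<le> R" if "t \<in> {0..T}" "r \<in> \<P>" "\<Psi> t r x \<le> M" for t r x
    using region[of t r x] that by simp
   fix t0 r0 x0 assume t0: "t0 \<in> {0<..<T}" and r0: "r0 \<in> \<P>" and P: "\<Psi> t0 r0 x0 \<le> M"
   let ?Dr = "D_\<rho> H0 r0 x0" and ?Dx = "D_x H0 r0 x0" and ?DD = "D2_x H0 r0 x0" and ?H = "H0 r0 x0 + C0" and ?X = "1 + (norm x0)\<^sup>2"
   let ?p = "?e t0 *\<^sub>R \<epsilon> *\<^sub>R ?Dr + ?e1 t0 *\<^sub>R \<delta> *\<^sub>R 0" and ?q = "?e t0 *\<^sub>R \<epsilon> *\<^sub>R ?Dx + ?e1 t0 *\<^sub>R \<delta> *\<^sub>R 2 *\<^sub>R x0"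
    and ?Q = "?e t0 *\<^sub>R \<epsilon> *\<^sub>R ?DD + ?e1 t0 *\<^sub>R \<delta> *\<^sub>R 2 *\<^sub>R mat 1"
   have reg: "H0 r0 x0 \<le> J" using region[of t0 r0 x0] t0 r0 P by simp
   have "wjet T (\<lambda>t r x. H0 r x + C0) t0 r0 x0 0 (?Dr) (?Dx) (?DD)"
    using wjet_add[OF H0_wjet[OF r0] wjet_const[of T C0 t0 r0 x0]] by simp
   then have "wjet T (\<lambda>t r x. \<epsilon> * (H0 r x + C0)) t0 r0 x0 0 (\<epsilon> *\<^sub>R ?Dr) (\<epsilon> *\<^sub>R ?Dx) (\<epsilon> *\<^sub>R ?DD)"
    using wjet_cmult[where c=\<epsilon>] by force
   from wjet_time_mult[OF this exp_time_quadratic[OF K, of _ t0 T], of "1 / K"] K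
   have w1: "wjet T (\<lambda>t r x. ?e t * (\<epsilon> * (H0 r x + C0))) t0 r0 x0 (- K * ?e t0 * (\<epsilon> * ?H))
    (?e t0 *\<^sub>R \<epsilon> *\<^sub>R ?Dr) (?e t0 *\<^sub>R \<epsilon> *\<^sub>R ?Dx) (?e t0 *\<^sub>R \<epsilon> *\<^sub>R ?DD)" by simp
   have "wjet T (\<lambda>t r x. 1 + (norm x)\<^sup>2) t0 r0 x0 0 0 (2 *\<^sub>R x0) (2 *\<^sub>R mat 1)"
    using wjet_add[OF wjet_const[of T 1 t0 r0 x0] wjet_norm_sq[of T t0 r0 x0]] by simp
   then have "wjet T (\<lambda>t r x. \<delta> * (1 + (norm x)\<^sup>2)) t0 r0 x0 0 (\<delta> *\<^sub>R 0) (\<delta> *\<^sub>R 2 *\<^sub>R x0) (\<delta> *\<^sub>R 2 *\<^sub>R mat 1)"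
    using wjet_cmult[where c=\<delta>] by force
   from wjet_time_mult[OF this exp_time_quadratic[OF K1, of _ t0 T], of "1 / K1"] K1
   have w2: "wjet T (\<lambda>t r x. ?e1 t * (\<delta> * (1 + (norm x)\<^sup>2))) t0 r0 x0 (- K1 * ?e1 t0 * (\<delta> * ?X))
    (?e1 t0 *\<^sub>R \<delta> *\<^sub>R 0) (?e1 t0 *\<^sub>R \<delta> *\<^sub>R 2 *\<^sub>R x0) (?e1 t0 *\<^sub>R \<delta> *\<^sub>R 2 *\<^sub>R mat 1)" by simp
   show "\<exists>a p q Q. wjet T \<Psi> t0 r0 x0 a p q Q \<and> (\<forall>V\<in>cball 0 l. a + \<bar>pen_val r0 x0 p q Q V\<bar> \<le> - \<epsilon>)"
   proof (intro exI conjI ballI)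
    show "wjet T \<Psi> t0 r0 x0 (- K * ?e t0 * (\<epsilon> * ?H) + - K1 * ?e1 t0 * (\<delta> * ?X))
     ?p ?q ?Q"
     using wjet_add[OF w1 w2] unfolding \<Psi>_def .
    fix V :: "real ^ 'n" assume V: "V \<in> cball 0 l"
    let ?P1 = "pen_val r0 x0 (?Dr) (?Dx) (?DD) V"
    let ?P2 = "pen_val r0 x0 0 (2 *\<^sub>R x0) (2 *\<^sub>R mat 1) V"
    have P1: "\<bar>?P1\<bar> \<le> K0 * ?H" by (rule Ly[OF r0 V])
    have P2: "\<bar>?P2\<bar> \<le> K1 * ?X"
    proof -
     have "(\<Sum>i\<in>UNIV. (\<sigma> $ i)\<^sup>2 * (2 *\<^sub>R mat 1 :: real ^ 'n ^ 'n) $ i $ i) / 2 = s"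
      unfolding s_def by (simp add: mat_def sum_distrib_right[symmetric])
     then have e: "?P2 = s - 2 * (x0 \<bullet> (?Dr + V))" unfolding pen_val_def by simp
     have "norm (?Dr + V) \<le> CR + l" using sub[OF r0 reg] V norm_triangle_ineq[of "?Dr" V] by simp
     then have "\<bar>x0 \<bullet> (?Dr + V)\<bar> \<le> norm x0 * (CR + l)"
      using Cauchy_Schwarz_ineq2[of x0 "?Dr + V"] mult_left_mono[of _ "CR + l" "norm x0"] by (meson norm_ge_zero order_trans)
     then have "\<bar>?P2\<bar> \<le> s + (2 * norm x0) * (CR + l)" unfolding e using s by linarith
     also have "\<dots> \<le> s * ?X + ?X * (CR + l)"
     proof (intro add_mono mult_right_mono)
      show "2 * norm x0 \<le> ?X" using zero_le_power2[of "norm x0 - 1"] by (simp add: power2_eq_square algebra_simps)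
      show "s \<le> s * ?X" using s by (simp add: distrib_left)
     qed (use c l_pos in auto)
     also have "\<dots> = K1 * ?X" unfolding K1_def by (simp add: algebra_simps)
     finally show ?thesis .
    qed
    have eq: "pen_val r0 x0 ?p ?q ?Q V = ?e t0 * (\<epsilon> * ?P1) + ?e1 t0 * (\<delta> * ?P2)"
     unfolding pen_val_add pen_val_scale ..
    have "\<bar>?e t0 * (\<epsilon> * ?P1)\<bar> \<le> ?e t0 * (\<epsilon> * (K0 * ?H))" unfolding abs_mult using P1 \<epsilon> by (simp add: mult_left_mono)
    moreover have "\<bar>?e1 t0 * (\<delta> * ?P2)\<bar> \<le> ?e1 t0 * (\<delta> * (K1 * ?X))" unfolding abs_mult using P2 \<delta> by (simp add: mult_left_mono)
    moreover have "- K * ?e t0 * (\<epsilon> * ?H) + ?e t0 * (\<epsilon> * (K0 * ?H)) = - (?e t0 * (\<epsilon> * ?H))" unfolding K_def by (simp add: algebra_simps)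
    moreover have "- K1 * ?e1 t0 * (\<delta> * ?X) + ?e1 t0 * (\<delta> * (K1 * ?X)) = 0" by (simp add: mult_ac)
    moreover have "\<epsilon> \<le> ?e t0 * (\<epsilon> * ?H)"
    proof -
     have "1 * (\<epsilon> * 1) \<le> ?e t0 * (\<epsilon> * ?H)" using t0 K H1[OF r0, of x0] \<epsilon> by (intro mult_mono mult_left_mono) auto
     then show ?thesis by simp
    qed
    ultimately show "- K * ?e t0 * (\<epsilon> * ?H) + - K1 * ?e1 t0 * (\<delta> * ?X) + \<bar>pen_val r0 x0 ?p ?q ?Q V\<bar> \<le> - \<epsilon>"
     unfolding eq by linarith
   qed
  qed
  have "\<Psi> t r x \<le> \<epsilon> * G r x" if t: "t \<in> {0..T}" and r: "r \<in> \<P>" for t r x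
  proof -
   have "?e t \<le> exp (K * T)" using t K by simp
   then have "?e t * (\<epsilon> * (H0 r x + C0)) \<le> exp (K * T) * (\<epsilon> * (H0 r x + C0))" using H1[OF r, of x] \<epsilon> by (intro mult_right_mono) auto
   moreover have "?e1 t * \<delta> \<le> \<epsilon>"
   proof -
    have "?e1 t * \<delta> = \<epsilon> * exp (- (K1 * t))" unfolding \<delta>_def by (simp add: exp_add[symmetric] algebra_simps)
    also have "\<dots> \<le> \<epsilon> * 1" using \<epsilon> t K1 by (intro mult_left_mono) auto
    finally show ?thesis by simp
   qed
   then have "?e1 t * \<delta> * (1 + (norm x)\<^sup>2) \<le> \<epsilon> * (1 + (norm x)\<^sup>2)" by (intro mult_right_mono) auto
   ultimately show ?thesis unfolding \<Psi>_def G_def by (simp add: algebra_simps)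
  qed
  then show "\<exists>\<Psi> c R. penalty \<epsilon> M c R \<Psi> \<and> (\<forall>t\<in>{0..T}. \<forall>r\<in>\<P>. \<forall>x. \<Psi> t r x \<le> \<epsilon> * G r x)" using pen by blast
 qed
qed

end

subsection \<open>Extension of the coefficients\<close>

text \<open>
 The costs are continuous, but their Lipschitz constants may depend on time and control; the
 inf-convolution over a compact convex set makes them uniform at the price of a small error.
\<close>

definition inf_conv :: "'a::euclidean_space set \<Rightarrow> real \<Rightarrow> ('a \<Rightarrow> real) \<Rightarrow> 'a \<Rightarrow> real" where
 "inf_conv K \<kappa> g z = (INF \<zeta>\<in>K. g \<zeta> + \<kappa> * norm (closest_point K z - \<zeta>))"

lemma inf_conv_lower:
 assumes "\<And>\<zeta>. \<zeta> \<in> K \<Longrightarrow> 0 \<le> g \<zeta>" "0 \<le> \<kappa>" "\<zeta> \<in> K"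
 shows "inf_conv K \<kappa> g z \<le> g \<zeta> + \<kappa> * norm (closest_point K z - \<zeta>)"
 unfolding inf_conv_def
 by (rule cINF_lower[OF bdd_belowI2[of _ 0] assms(3)]) (use assms in \<open>simp add: add_nonneg_nonneg\<close>)

lemma inf_conv_greatest:
 assumes "K \<noteq> {}" "\<And>\<zeta>. \<zeta> \<in> K \<Longrightarrow> m \<le> g \<zeta> + \<kappa> * norm (closest_point K z - \<zeta>)"
 shows "m \<le> inf_conv K \<kappa> g z"
 unfolding inf_conv_def by (rule cINF_greatest[OF assms])

lemma lip_inf_conv:
 assumes K: "convex K" "closed K" "K \<noteq> {}" and g: "\<And>\<zeta>. \<zeta> \<in> K \<Longrightarrow> 0 \<le> g \<zeta>" and l: "0 \<le> \<kappa>"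
 shows "lip \<kappa> (inf_conv K \<kappa> g)"
proof -
 have le: "inf_conv K \<kappa> g y \<le> inf_conv K \<kappa> g z + \<kappa> * norm (y - z)" for y z
 proof -
  have "inf_conv K \<kappa> g y - \<kappa> * norm (y - z) \<le> inf_conv K \<kappa> g z"
  proof (rule inf_conv_greatest[OF K(3)])
   fix \<zeta> assume \<zeta>: "\<zeta> \<in> K"
   have "norm (closest_point K y - \<zeta>) \<le> norm (y - z) + norm (closest_point K z - \<zeta>)"
    using norm_triangle_ineq[of "closest_point K y - closest_point K z" "closest_point K z - \<zeta>"]
     closest_point_lipschitz[OF K, of y z] by (simp add: dist_norm)
   from mult_left_mono[OF this l] have "\<kappa> * norm (closest_point K y - \<zeta>) \<le> \<kappa> * norm (y - z) + \<kappa> * norm (closest_point K z - \<zeta>)"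
    by (simp add: distrib_left)
   then show "inf_conv K \<kappa> g y - \<kappa> * norm (y - z) \<le> g \<zeta> + \<kappa> * norm (closest_point K z - \<zeta>)"
    using inf_conv_lower[of K g \<kappa> \<zeta> y, OF g l \<zeta>] by linarith
  qed
  then show ?thesis by linarith
 qed
 show ?thesis unfolding lip_def
 proof (intro allI)
  fix y z show "\<bar>inf_conv K \<kappa> g y - inf_conv K \<kappa> g z\<bar> \<le> \<kappa> * norm (y - z)"
   using le[of y z] le[of z y] by (simp add: norm_minus_commute abs_le_iff)
 qed
qed

lemma inf_conv_bounds:
 assumes K: "closed K" "K \<noteq> {}" and g: "\<And>\<zeta>. \<zeta> \<in> K \<Longrightarrow> 0 \<le> g \<zeta> \<and> g \<zeta> \<le> B" and l: "0 \<le> \<kappa>"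
 shows "0 \<le> inf_conv K \<kappa> g z" "inf_conv K \<kappa> g z \<le> B" "z \<in> K \<Longrightarrow> inf_conv K \<kappa> g z \<le> g z"
proof -
 note c = closest_point_in_set[OF K, of z]
 show "0 \<le> inf_conv K \<kappa> g z" using g l by (intro inf_conv_greatest[OF K(2)]) (simp add: add_nonneg_nonneg)
 have 1: "inf_conv K \<kappa> g z \<le> g (closest_point K z)" using inf_conv_lower[of K g \<kappa>, OF _ l c, of z] g by simp
 then show "inf_conv K \<kappa> g z \<le> B" using g[OF c] by linarith
 show "z \<in> K \<Longrightarrow> inf_conv K \<kappa> g z \<le> g z" using 1 by (simp add: closest_point_self)
qed

text \<open>Competitors farther away than \<open>R\<close> pay at least \<open>\<kappa> * R\<close>,
  which exceeds every possible gain \<open>B\<close>; nearer ones differ in value by at most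
  \<open>e\<close>.\<close>

lemma inf_conv_approx:
 assumes g: "\<And>\<zeta>. \<zeta> \<in> K \<Longrightarrow> 0 \<le> g \<zeta> \<and> g \<zeta> \<le> B" and l: "0 \<le> \<kappa>" and z: "z \<in> K" and e: "0 \<le> e" and R: "B \<le> \<kappa> * R"
  and u: "\<And>\<zeta>. \<zeta> \<in> K \<Longrightarrow> norm (z - \<zeta>) \<le> R \<Longrightarrow> \<bar>g z - g \<zeta>\<bar> \<le> e"
 shows "g z \<le> inf_conv K \<kappa> g z + e"
proof -
 have "g z - e \<le> inf_conv K \<kappa> g z"
 proof (rule inf_conv_greatest)
  show "K \<noteq> {}" using z by blast
  fix \<zeta> assume \<zeta>: "\<zeta> \<in> K"
  show "g z - e \<le> g \<zeta> + \<kappa> * norm (closest_point K z - \<zeta>)"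
  proof (cases "norm (z - \<zeta>) \<le> R")
   case True
   then show ?thesis using u[OF \<zeta>] l by (simp add: abs_le_iff add_increasing2)
  next
   case False
   then have "B \<le> \<kappa> * norm (z - \<zeta>)" using R l by (intro order_trans[OF R mult_left_mono]) auto
   then show ?thesis using g[OF z] g[OF \<zeta>] e by (simp add: closest_point_self[OF z])
  qed
 qed
 then show ?thesis by linarith
qed

lemma inf_conv_close:
 assumes K: "K \<noteq> {}" and g: "\<And>\<zeta>. \<zeta> \<in> K \<Longrightarrow> 0 \<le> g \<zeta> \<and> 0 \<le> g' \<zeta> \<and> \<bar>g \<zeta> - g' \<zeta>\<bar> \<le> e" and l: "0 \<le> \<kappa>"
 shows "\<bar>inf_conv K \<kappa> g z - inf_conv K \<kappa> g' z\<bar> \<le> e"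
proof -
 have "inf_conv K \<kappa> g z - e \<le> inf_conv K \<kappa> g' z"
 proof (rule inf_conv_greatest[OF K])
  fix \<zeta> assume \<zeta>: "\<zeta> \<in> K"
  have "inf_conv K \<kappa> g z \<le> g \<zeta> + \<kappa> * norm (closest_point K z - \<zeta>)" by (rule inf_conv_lower[OF _ l \<zeta>]) (use g in blast)
  then show "inf_conv K \<kappa> g z - e \<le> g' \<zeta> + \<kappa> * norm (closest_point K z - \<zeta>)" using g[OF \<zeta>] by linarith
 qed
 moreover have "inf_conv K \<kappa> g' z - e \<le> inf_conv K \<kappa> g z"
 proof (rule inf_conv_greatest[OF K])
  fix \<zeta> assume \<zeta>: "\<zeta> \<in> K"
  have "inf_conv K \<kappa> g' z \<le> g' \<zeta> + \<kappa> * norm (closest_point K z - \<zeta>)" by (rule inf_conv_lower[OF _ l \<zeta>]) (use g in blast)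
  then show "inf_conv K \<kappa> g' z - e \<le> g \<zeta> + \<kappa> * norm (closest_point K z - \<zeta>)" using g[OF \<zeta>] by linarith
 qed
 ultimately show ?thesis unfolding abs_le_iff by linarith
qed

lemma convex_simplex_core: "convex (simplex_core c :: (real ^ 'n::finite) set)"
proof (rule convexI)
 fix x y :: "real ^ 'n" and u v :: real assume *: "x \<in> simplex_core c" "y \<in> simplex_core c" "0 \<le> u" "0 \<le> v" "u + v = 1"
 have "u * c + v * c \<le> u * x $ i + v * y $ i" for i using * unfolding simplex_core_def by (intro add_mono mult_left_mono) auto
 moreover have "u * c + v * c = c" using * by (metis distrib_right mult_1)
 moreover have "(\<Sum>i\<in>UNIV. u * x $ i + v * y $ i) = 1"
  using * unfolding simplex_core_def by (simp add: sum.distrib sum_distrib_left[symmetric])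
 ultimately show "u *\<^sub>R x + v *\<^sub>R y \<in> simplex_core c" unfolding simplex_core_def by simp
qed

definition cylinder :: "real \<Rightarrow> real \<Rightarrow> ((real ^ 'n::finite) \<times> (real ^ 'n)) set" where
 "cylinder c R = simplex_core c \<times> cball 0 R"

lemma cylinder_iff: "(r, x) \<in> cylinder c R \<longleftrightarrow> r \<in> simplex_core c \<and> norm x \<le> R"
 unfolding cylinder_def by simp

lemma cylinder_props:
 assumes "0 < c"
 shows "compact (cylinder c R)" "convex (cylinder c R)" "closed (cylinder c R)"
proof -
 show "compact (cylinder c R)" unfolding cylinder_def by (intro compact_Times compact_simplex_core assms compact_cball)
 then show "closed (cylinder c R)" by (rule compact_imp_closed)
 show "convex (cylinder c R)" unfolding cylinder_def by (intro convex_Times convex_simplex_core convex_cball)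
qed

lemma cylinder_nonempty:
 assumes "c \<le> 1 / real CARD('n::finite)" "0 \<le> R"
 shows "(cylinder c R :: ((real ^ 'n) \<times> (real ^ 'n)) set) \<noteq> {}"
proof -
 have "((\<chi> i. 1 / real CARD('n)) :: real ^ 'n, 0) \<in> cylinder c R" using assms by (simp add: cylinder_iff simplex_core_def)
 then show ?thesis by blast
qed

context hjb
begin

definition noise :: "'n \<Rightarrow> (real ^ 'n) \<times> (real ^ 'n)" where
 "noise i = (0, (\<sigma> $ i) *\<^sub>R axis i 1)"

abbreviation half_trace :: "((real ^ 'n) \<times> (real ^ 'n) \<Rightarrow> (real ^ 'n) \<times> (real ^ 'n) \<Rightarrow> real) \<Rightarrow> real" where
 "half_trace Q \<equiv> (\<Sum>i\<in>UNIV. Q (noise i) (noise i)) / 2"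

text \<open>The controlled Hamiltonian vector field on pairs of density and potential.\<close>

definition drift :: "real ^ 'n \<Rightarrow> real ^ 'n \<Rightarrow> real ^ 'n \<Rightarrow> (real ^ 'n) \<times> (real ^ 'n)" where
 "drift V r x = (D_x H0 r x, - (D_\<rho> H0 r x + V))"

text \<open>The dictionary between the scheme, which sees one product space with a drift and noise
  vectors, and the equation, which separates density and potential.\<close>

lemma jet_pen:
 assumes "has_jet w t (r, x) a p Q"
 obtains P q Q' where "wjet T (\<lambda>t r x. w t (r, x)) t r x a P q Q'"
  "\<And>V. p (drift V r x) + half_trace Q = pen_val r x P q Q' V"
proof (rule that[OF wjet_has_jet(1)[OF assms]])
 fix V
 show "p (drift V r x) + half_trace Q
  = pen_val r x (\<chi> i. p (axis i 1, 0)) (\<chi> i. p (0, axis i 1)) (\<chi> i j. Q (0, axis i 1) (0, axis j 1)) V"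
 proof -
  have 1: "p (drift V r x) = (\<chi> i. p (axis i 1, 0)) \<bullet> D_x H0 r x + (\<chi> i. p (0, axis i 1)) \<bullet> - (D_\<rho> H0 r x + V)"
   unfolding drift_def by (rule wjet_has_jet(2)[OF assms])
  have 2: "Q (noise i) (noise i) = (\<sigma> $ i)\<^sup>2 * (\<chi> i j. Q (0, axis i 1) (0, axis j 1)) $ i $ i" for i
   unfolding noise_def wjet_has_jet(3)[OF assms] by simp
  show ?thesis unfolding pen_val_def 1 2 inner_minus_right by linarith
 qed
qed

lemma cost_bound:
 obtains B where "0 \<le> B" "\<And>r x. r \<in> \<P> \<Longrightarrow> h r x \<le> B"
  "\<And>t r x V. t \<in> {0..T} \<Longrightarrow> r \<in> \<P> \<Longrightarrow> V \<in> cball 0 l \<Longrightarrow> F t r x V \<le> B"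
proof -
 obtain M1 where M1: "\<forall>t\<in>{0..T}. \<forall>r\<in>\<P>. \<forall>x. \<forall>V\<in>cball 0 l. \<bar>F t r x V\<bar> \<le> M1" using F_bounded by blast
 obtain M2 where M2: "\<forall>r\<in>\<P>. \<forall>x. \<bar>h r x\<bar> \<le> M2" using h_bounded by blast
 show thesis
 proof (rule that[of "\<bar>M1\<bar> + \<bar>M2\<bar>"])
  show "h r x \<le> \<bar>M1\<bar> + \<bar>M2\<bar>" if "r \<in> \<P>" for r x
   using M2[rule_format, OF that, of x] by linarith
  show "F t r x V \<le> \<bar>M1\<bar> + \<bar>M2\<bar>" if "t \<in> {0..T}" "r \<in> \<P>" "V \<in> cball 0 l" for t r x V
   using M1[rule_format, OF that, of x] by linarith
 qed simp
qed

lemma F_continuous: "continuous_on ({0..T} \<times> \<P> \<times> UNIV \<times> cball 0 l) (\<lambda>(s, r, x, V). F s r x V)"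
 using costs[unfolded admissible_costs_def, THEN conjunct2, THEN conjunct2, THEN conjunct1] .

lemma h_continuous: "continuous_on (\<P> \<times> UNIV) (\<lambda>(r, x). h r x)"
 using costs[unfolded admissible_costs_def, THEN conjunct2, THEN conjunct2, THEN conjunct2, THEN conjunct1] .

lemma F_uniform:
 assumes c: "0 < c" and e: "0 < e"
 obtains d where "0 < d" "\<And>t t' r r' x x' V. t \<in> {0..T} \<Longrightarrow> t' \<in> {0..T} \<Longrightarrow> (r, x) \<in> cylinder c R \<Longrightarrow> (r', x') \<in> cylinder c R \<Longrightarrow>
  V \<in> cball 0 l \<Longrightarrow> \<bar>t - t'\<bar> \<le> d \<Longrightarrow> norm ((r, x) - (r', x')) \<le> d \<Longrightarrow> \<bar>F t r x V - F t' r' x' V\<bar> \<le> e"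
proof -
 let ?S = "{0..T} \<times> (simplex_core c :: (real ^ 'n) set) \<times> cball (0 :: real ^ 'n) R \<times> cball (0 :: real ^ 'n) l"
 have "compact ?S" by (intro compact_Times compact_simplex_core c compact_cball compact_Icc)
 moreover have "?S \<subseteq> {0..T} \<times> \<P> \<times> UNIV \<times> cball 0 l" using simplex_core_subset[OF c] by auto
 ultimately have "uniformly_continuous_on ?S (\<lambda>(s, r, x, V). F s r x V)"
  using compact_uniformly_continuous continuous_on_subset[OF F_continuous] by blast
 then obtain d where d: "0 < d" "\<And>z z'. z \<in> ?S \<Longrightarrow> z' \<in> ?S \<Longrightarrow> dist z' z < d \<Longrightarrow> dist ((\<lambda>(s, r, x, V). F s r x V) z') ((\<lambda>(s, r, x, V). F s r x V) z) < e"
  using e unfolding uniformly_continuous_on_def by metis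
 show thesis
 proof (rule that[of "d / 4"])
  show "0 < d / 4" using d by simp
  fix t t' :: real and r r' x x' V :: "real ^ 'n" assume a: "t \<in> {0..T}" "t' \<in> {0..T}" "(r, x) \<in> cylinder c R" "(r', x') \<in> cylinder c R"
   "V \<in> cball 0 l" "\<bar>t - t'\<bar> \<le> d / 4" "norm ((r, x) - (r', x')) \<le> d / 4"
  have f: "norm (r - r') \<le> d / 4" "norm (x - x') \<le> d / 4"
   using a(7) norm_fst_le[of "r - r'" "x - x'"] norm_snd_le[of "x - x'" "r - r'"] by auto
  have "dist (t, r, x, V) (t', r', x', V) = norm (t - t', r - r', x - x', 0 :: real ^ 'n)" unfolding dist_norm by simp
  also have "\<dots> \<le> norm (t - t') + (norm (r - r') + (norm (x - x') + norm (0 :: real ^ 'n)))"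
   using norm_Pair_le[of "t - t'" "(r - r', x - x', 0 :: real ^ 'n)"] norm_Pair_le[of "r - r'" "(x - x', 0 :: real ^ 'n)"]
    norm_Pair_le[of "x - x'" "0 :: real ^ 'n"] by linarith
  also have "\<dots> < d" using f a(6) d(1) by simp
  finally show "\<bar>F t r x V - F t' r' x' V\<bar> \<le> e"
   using d(2)[of "(t', r', x', V)" "(t, r, x, V)"] a by (simp add: cylinder_iff dist_real_def)
 qed
qed

lemma h_uniform:
 assumes c: "0 < c" and e: "0 < e"
 obtains d where "0 < d" "\<And>r r' x x'. (r, x) \<in> cylinder c R \<Longrightarrow> (r', x') \<in> cylinder c R \<Longrightarrow>
  norm ((r, x) - (r', x')) \<le> d \<Longrightarrow> \<bar>h r x - h r' x'\<bar> \<le> e"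
proof -
 have "cylinder c R \<subseteq> \<P> \<times> UNIV" using simplex_core_subset[OF c] by (auto simp: cylinder_iff)
 then have "uniformly_continuous_on (cylinder c R) (\<lambda>(r, x). h r x)"
  using compact_uniformly_continuous[OF continuous_on_subset[OF h_continuous] cylinder_props(1)[OF c]] by blast
 then obtain d where d: "0 < d" "\<And>z z'. z \<in> cylinder c R \<Longrightarrow> z' \<in> cylinder c R \<Longrightarrow> dist z' z < d \<Longrightarrow> dist ((\<lambda>(r, x). h r x) z') ((\<lambda>(r, x). h r x) z) < e"
  using e unfolding uniformly_continuous_on_def by metis
 show thesis
 proof (rule that[of "d / 2"])
  show "0 < d / 2" using d by simp
  fix r r' x x' :: "real ^ 'n" assume a: "(r, x) \<in> cylinder c R" "(r', x') \<in> cylinder c R" "norm ((r, x) - (r', x')) \<le> d / 2"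
  then have "dist (r, x) (r', x') < d" using d(1) unfolding dist_norm by linarith
  then show "\<bar>h r x - h r' x'\<bar> \<le> e" using d(2)[OF a(2,1)] by (simp add: dist_real_def)
 qed
qed

lemma drift_lipschitz:
 assumes c: "0 < c" and R: "0 \<le> R"
 obtains L where "0 < L" "\<And>r \<mu> x y V. (r, x) \<in> cylinder c R \<Longrightarrow> (\<mu>, y) \<in> cylinder c R \<Longrightarrow>
   norm (drift V r x - drift V \<mu> y) \<le> L * norm ((r, x) - (\<mu>, y))"
proof -
 have "\<And>i. locally_lipschitz E (\<lambda>r x. D_\<rho> H0 r x $ i)" "\<And>i. locally_lipschitz E (\<lambda>r x. D_x H0 r x $ i)"
  using energy unfolding admissible_energy_def by blast+
 note * = this
 obtain L1 where L1: "0 < L1" "\<And>r \<mu> x y. r \<in> simplex_core c \<Longrightarrow> \<mu> \<in> simplex_core c \<Longrightarrow> norm x \<le> R \<Longrightarrow> norm y \<le> R \<Longrightarrow>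
   norm (D_\<rho> H0 r x - D_\<rho> H0 \<mu> y) \<le> L1 * (norm (r - \<mu>) + norm (x - y))"
  by (rule locally_lipschitz_core_vec[OF *(1) c R]) blast
 obtain L2 where L2: "0 < L2" "\<And>r \<mu> x y. r \<in> simplex_core c \<Longrightarrow> \<mu> \<in> simplex_core c \<Longrightarrow> norm x \<le> R \<Longrightarrow> norm y \<le> R \<Longrightarrow>
   norm (D_x H0 r x - D_x H0 \<mu> y) \<le> L2 * (norm (r - \<mu>) + norm (x - y))"
  by (rule locally_lipschitz_core_vec[OF *(2) c R]) blast
 show thesis
 proof (rule that[of "(L1 + L2) * 2"])
  show "0 < (L1 + L2) * 2" using L1 L2 by simp
  fix r \<mu> x y V :: "real ^ 'n" assume a: "(r, x) \<in> cylinder c R" "(\<mu>, y) \<in> cylinder c R"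
  have "drift V r x - drift V \<mu> y = (D_x H0 r x - D_x H0 \<mu> y, - (D_\<rho> H0 r x - D_\<rho> H0 \<mu> y))" unfolding drift_def by simp
  then have "norm (drift V r x - drift V \<mu> y) \<le> norm (D_x H0 r x - D_x H0 \<mu> y) + norm (D_\<rho> H0 r x - D_\<rho> H0 \<mu> y)"
   using norm_Pair_le[of "D_x H0 r x - D_x H0 \<mu> y" "- (D_\<rho> H0 r x - D_\<rho> H0 \<mu> y)"] by (simp only: norm_minus_cancel)
  also have "\<dots> \<le> L2 * (norm (r - \<mu>) + norm (x - y)) + L1 * (norm (r - \<mu>) + norm (x - y))"
   using a by (intro add_mono L1(2) L2(2)) (auto simp: cylinder_iff)
  also have "\<dots> = (L1 + L2) * (norm (r - \<mu>) + norm (x - y))" by (simp add: distrib_right)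
  also have "\<dots> \<le> (L1 + L2) * (2 * norm ((r, x) - (\<mu>, y)))"
   using norm_fst_le[of "r - \<mu>" "x - y"] norm_snd_le[of "x - y" "r - \<mu>"] L1(1) L2(1) by (intro mult_left_mono) auto
  finally show "norm (drift V r x - drift V \<mu> y) \<le> (L1 + L2) * 2 * norm ((r, x) - (\<mu>, y))" by (simp only: mult.assoc)
 qed
qed

text \<open>The projection onto the compact convex cylinder is 1-Lipschitz, so drift and costs can
  be evaluated at the projected point without loss; time is projected onto \<open>[0, T]\<close> in
  the same way. The extended costs lie below the true ones by at most \<open>e\<close>, a one-sided
  error that both comparisons tolerate.\<close>

lemma frozen_coefficients:
 assumes c: "0 < c" "c \<le> 1 / real CARD('n)" and R: "0 \<le> R" and e: "0 < e" and B: "0 \<le> B"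
  and hB: "\<And>r x. r \<in> \<P> \<Longrightarrow> h r x \<le> B"
  and FB: "\<And>t r x V. t \<in> {0..T} \<Longrightarrow> r \<in> \<P> \<Longrightarrow> V \<in> cball 0 l \<Longrightarrow> F t r x V \<le> B"
 obtains b f hh L \<beta> where "scheme b f hh (cball 0 l) L B \<beta> T"
  "\<And>V r x. (r, x) \<in> cylinder c R \<Longrightarrow> b V (r, x) = drift V r x"
  "\<And>t V r x. t \<in> {0..T} \<Longrightarrow> V \<in> cball 0 l \<Longrightarrow> (r, x) \<in> cylinder c R \<Longrightarrow> f t V (r, x) \<le> F t r x V \<and> F t r x V \<le> f t V (r, x) + e"
  "\<And>r x. (r, x) \<in> cylinder c R \<Longrightarrow> hh (r, x) \<le> h r x \<and> h r x \<le> hh (r, x) + e"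
proof -
 let ?K = "cylinder c R :: ((real ^ 'n) \<times> (real ^ 'n)) set"
 note K = cylinder_props(2,3)[OF c(1), of R] cylinder_nonempty[OF c(2) R]
 have Kin: "fst z \<in> \<P>" if "z \<in> ?K" for z
  using that simplex_core_subset[OF c(1)] unfolding cylinder_def by auto
 have Ti: "convex {0..T}" "closed {0..T}" "{0..T} \<noteq> {}" using T_pos by auto
 let ?\<pi> = "closest_point ?K" and ?\<tau> = "closest_point {0..T}"
 have \<pi>: "?\<pi> z \<in> ?K" for z by (rule closest_point_in_set[OF K(2,3)])
 have \<tau>: "?\<tau> t \<in> {0..T}" for t by (rule closest_point_in_set[OF Ti(2,3)])
 obtain L1 where L1: "0 < L1" "\<And>r \<mu> x y V. (r, x) \<in> ?K \<Longrightarrow> (\<mu>, y) \<in> ?K \<Longrightarrow>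
   norm (drift V r x - drift V \<mu> y) \<le> L1 * norm ((r, x) - (\<mu>, y))" using drift_lipschitz[OF c(1) R] by metis
 obtain d1 where d1: "0 < d1" "\<And>t t' r r' x x' V. t \<in> {0..T} \<Longrightarrow> t' \<in> {0..T} \<Longrightarrow> (r, x) \<in> ?K \<Longrightarrow> (r', x') \<in> ?K \<Longrightarrow>
  V \<in> cball 0 l \<Longrightarrow> \<bar>t - t'\<bar> \<le> d1 \<Longrightarrow> norm ((r, x) - (r', x')) \<le> d1 \<Longrightarrow> \<bar>F t r x V - F t' r' x' V\<bar> \<le> e"
  using F_uniform[OF c(1) e] by metis
 obtain d2 where d2: "0 < d2" "\<And>r r' x x'. (r, x) \<in> ?K \<Longrightarrow> (r', x') \<in> ?K \<Longrightarrow>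
  norm ((r, x) - (r', x')) \<le> d2 \<Longrightarrow> \<bar>h r x - h r' x'\<bar> \<le> e"
  using h_uniform[OF c(1) e] by metis
 \<comment> \<open>The slope for which moving by the common modulus of continuity
   \<open>min d1 d2\<close> costs as much as the bound \<open>B\<close>.\<close>
 define \<kappa> where "\<kappa> = B / min d1 d2"
 have \<kappa>: "0 \<le> \<kappa>" "\<kappa> * min d1 d2 = B" unfolding \<kappa>_def using B d1(1) d2(1) by auto
 define L where "L = 1 + L1 + \<kappa>"
 let ?F = "\<lambda>t V z. F t (fst z) (snd z) V" and ?h = "\<lambda>z. h (fst z) (snd z)"
 have Fb: "0 \<le> ?F (?\<tau> t) V z \<and> ?F (?\<tau> t) V z \<le> B" if "V \<in> cball 0 l" "z \<in> ?K" for t V z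
  using F_nonneg[OF \<tau> Kin[OF that(2)] that(1)] FB[OF \<tau> Kin[OF that(2)] that(1)] by blast
 have hb: "0 \<le> ?h z \<and> ?h z \<le> B" if "z \<in> ?K" for z
  using h_nonneg[OF Kin[OF that]] hB[OF Kin[OF that]] by blast
 define b where "b V z = drift V (fst (?\<pi> z)) (snd (?\<pi> z))" for V z
 define f where "f t V = inf_conv ?K \<kappa> (?F (?\<tau> t) V)" for t V
 define hh where "hh = inf_conv ?K \<kappa> ?h"
 obtain k where k: "\<And>z. z \<in> ?K \<Longrightarrow> norm z \<le> k"
  using compact_imp_bounded[OF cylinder_props(1)[OF c(1)]] unfolding bounded_iff by metis
 obtain z0 where z0: "z0 \<in> ?K" using K(3) by blast
 define \<beta> where "\<beta> = norm (drift 0 (fst z0) (snd z0)) + l + L1 * (2 * k)"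
 have bK: "norm (drift V (fst y) (snd y) - drift V (fst z) (snd z)) \<le> L1 * norm (y - z)" if "y \<in> ?K" "z \<in> ?K" for V y z
  using L1(2)[of "fst y" "snd y" "fst z" "snd z" V] that by simp
 have bb: "norm (b V z) \<le> \<beta>" if V: "V \<in> cball 0 l" for V z
 proof -
  have "norm (?\<pi> z - z0) \<le> 2 * k" using norm_triangle_ineq4[of "?\<pi> z" z0] k[OF \<pi>[of z]] k[OF z0] by linarith
  from mult_left_mono[OF this, of L1] have "norm (b V z - drift V (fst z0) (snd z0)) \<le> L1 * (2 * k)"
   using bK[OF \<pi>[of z] z0, of V] L1(1) unfolding b_def by linarith
  moreover have "drift V (fst z0) (snd z0) = drift 0 (fst z0) (snd z0) + (0, - V)" unfolding drift_def by simp
  then have "norm (drift V (fst z0) (snd z0)) \<le> norm (drift 0 (fst z0) (snd z0)) + l"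
   using norm_triangle_ineq[of "drift 0 (fst z0) (snd z0)" "(0, - V)"] V by (simp add: norm_Pair)
  ultimately show ?thesis unfolding \<beta>_def using norm_triangle_sub[of "b V z" "drift V (fst z0) (snd z0)"] by linarith
 qed
 have lipL: "lip L \<phi>" if "lip \<kappa> \<phi>" for \<phi> :: "(real ^ 'n) \<times> (real ^ 'n) \<Rightarrow> real"
  unfolding lip_def
 proof (intro allI)
  fix y z :: "(real ^ 'n) \<times> (real ^ 'n)"
  have "\<kappa> * norm (y - z) \<le> L * norm (y - z)" unfolding L_def using L1(1) by (intro mult_right_mono) auto
  then show "\<bar>\<phi> y - \<phi> z\<bar> \<le> L * norm (y - z)" using lipD[OF that, of y z] by linarith
 qed
 have sch: "scheme b f hh (cball 0 l) L B \<beta> T"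
 proof
  show "1 \<le> L" unfolding L_def using L1(1) \<kappa>(1) by simp
  show "0 \<le> B" by (rule B)
  show "0 < T" by (rule T_pos)
  show "cball (0 :: real ^ 'n) l \<noteq> {}" using l_pos by simp
  show "norm (b V z) \<le> \<beta>" if "V \<in> cball 0 l" for V z by (rule bb[OF that])
  have "(0 :: real ^ 'n) \<in> cball 0 l" using l_pos by simp
  from bb[OF this] show "0 \<le> \<beta>" using norm_ge_zero order_trans by blast
  show "norm (b V y - b V z) \<le> L * norm (y - z)" for V y z
  proof -
   have "norm (b V y - b V z) \<le> L1 * norm (?\<pi> y - ?\<pi> z)" unfolding b_def by (rule bK[OF \<pi> \<pi>])
   also have "\<dots> \<le> L1 * norm (y - z)" using closest_point_lipschitz[OF K, of y z] L1(1) by (simp add: dist_norm)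
   also have "\<dots> \<le> L * norm (y - z)" unfolding L_def using \<kappa>(1) by (intro mult_right_mono) auto
   finally show ?thesis .
  qed
  show "lip L (f t V)" if "V \<in> cball 0 l" for t V
   unfolding f_def by (rule lipL[OF lip_inf_conv[OF K _ \<kappa>(1)]]) (use Fb[OF that] in blast)
  show "0 \<le> f t V z" "f t V z \<le> B" if "V \<in> cball 0 l" for t V z
   unfolding f_def using inf_conv_bounds(1,2)[of ?K "?F (?\<tau> t) V" B \<kappa> z, OF K(2,3) Fb[OF that] \<kappa>(1)] by blast+
  show "lip L hh" unfolding hh_def by (rule lipL[OF lip_inf_conv[OF K _ \<kappa>(1)]]) (use hb in blast)
  show "0 \<le> hh z" "hh z \<le> B" for z
   unfolding hh_def using inf_conv_bounds(1,2)[of ?K ?h B \<kappa> z, OF K(2,3) hb \<kappa>(1)] by blast+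
  show "\<exists>R>0. \<forall>t t'. \<forall>V\<in>cball 0 l. \<forall>z. \<bar>t - t'\<bar> \<le> R \<longrightarrow> \<bar>f t V z - f t' V z\<bar> \<le> e'" if e': "0 < e'" for e'
  proof -
   obtain d where d: "0 < d" "\<And>t t' r r' x x' V. t \<in> {0..T} \<Longrightarrow> t' \<in> {0..T} \<Longrightarrow> (r, x) \<in> ?K \<Longrightarrow> (r', x') \<in> ?K \<Longrightarrow>
    V \<in> cball 0 l \<Longrightarrow> \<bar>t - t'\<bar> \<le> d \<Longrightarrow> norm ((r, x) - (r', x')) \<le> d \<Longrightarrow> \<bar>F t r x V - F t' r' x' V\<bar> \<le> e'"
    using F_uniform[OF c(1) e'] by metis
   show ?thesis
   proof (intro exI[of _ d] conjI allI ballI impI d(1))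
    fix t t' :: real and V :: "real ^ 'n" and z assume V: "V \<in> cball 0 l" and t: "\<bar>t - t'\<bar> \<le> d"
    show "\<bar>f t V z - f t' V z\<bar> \<le> e'"
     unfolding f_def
    proof (rule inf_conv_close[OF K(3) _ \<kappa>(1)])
     fix \<zeta> assume \<zeta>: "\<zeta> \<in> ?K"
     have "\<bar>?\<tau> t - ?\<tau> t'\<bar> \<le> d" using closest_point_lipschitz[OF Ti, of t t'] t by (simp add: dist_real_def)
     then have "\<bar>?F (?\<tau> t) V \<zeta> - ?F (?\<tau> t') V \<zeta>\<bar> \<le> e'"
      using d(2)[OF \<tau>[of t] \<tau>[of t'], of "fst \<zeta>" "snd \<zeta>" "fst \<zeta>" "snd \<zeta>" V] \<zeta> V d(1) by simp
     then show "0 \<le> ?F (?\<tau> t) V \<zeta> \<and> 0 \<le> ?F (?\<tau> t') V \<zeta> \<and> \<bar>?F (?\<tau> t) V \<zeta> - ?F (?\<tau> t') V \<zeta>\<bar> \<le> e'"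
      using Fb[OF V \<zeta>, of t] Fb[OF V \<zeta>, of t'] by blast
    qed
   qed
  qed
 qed
 show thesis
 proof (rule that[OF sch])
  fix V r x :: "real ^ 'n" assume z: "(r, x) \<in> ?K"
  show "b V (r, x) = drift V r x" unfolding b_def by (simp add: closest_point_self[OF z])
  show "hh (r, x) \<le> h r x \<and> h r x \<le> hh (r, x) + e"
  proof
   show "hh (r, x) \<le> h r x" unfolding hh_def using inf_conv_bounds(3)[of ?K ?h B \<kappa> "(r, x)", OF K(2,3) hb \<kappa>(1) z] by simp
   have "?h (r, x) \<le> inf_conv ?K \<kappa> ?h (r, x) + e"
   proof (rule inf_conv_approx[of ?K ?h B \<kappa> "(r, x)" e "min d1 d2", OF hb \<kappa>(1) z _ eq_refl[OF \<kappa>(2)[symmetric]]])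
    show "\<bar>?h (r, x) - ?h \<zeta>\<bar> \<le> e" if "\<zeta> \<in> ?K" "norm ((r, x) - \<zeta>) \<le> min d1 d2" for \<zeta>
     using d2(2)[OF z, of "fst \<zeta>" "snd \<zeta>"] that by simp
   qed (use e in auto)
   then show "h r x \<le> hh (r, x) + e" unfolding hh_def by simp
  qed
 next
  fix t :: real and V r x :: "real ^ 'n" assume t: "t \<in> {0..T}" and V: "V \<in> cball 0 l" and z: "(r, x) \<in> ?K"
  have tt: "?\<tau> t = t" by (rule closest_point_self[OF t])
  show "f t V (r, x) \<le> F t r x V \<and> F t r x V \<le> f t V (r, x) + e"
  proof
   show "f t V (r, x) \<le> F t r x V" unfolding f_def using inf_conv_bounds(3)[of ?K "?F (?\<tau> t) V" B \<kappa> "(r, x)", OF K(2,3) Fb[OF V] \<kappa>(1) z] tt by simp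
   have "?F (?\<tau> t) V (r, x) \<le> inf_conv ?K \<kappa> (?F (?\<tau> t) V) (r, x) + e"
   proof (rule inf_conv_approx[of ?K "?F (?\<tau> t) V" B \<kappa> "(r, x)" e "min d1 d2", OF Fb[OF V] \<kappa>(1) z _ eq_refl[OF \<kappa>(2)[symmetric]]])
    show "\<bar>?F (?\<tau> t) V (r, x) - ?F (?\<tau> t) V \<zeta>\<bar> \<le> e" if "\<zeta> \<in> ?K" "norm ((r, x) - \<zeta>) \<le> min d1 d2" for \<zeta>
     using d1(2)[OF t t z, of "fst \<zeta>" "snd \<zeta>" V] that V d1(1) unfolding tt by simp
   qed (use e in auto)
   then show "F t r x V \<le> f t V (r, x) + e" unfolding f_def using tt by simp
  qed
 qed
qed

end

abbreviation (input) below :: "real \<Rightarrow> (real \<Rightarrow> real ^ 'n::finite \<Rightarrow> real ^ 'n \<Rightarrow> real) \<Rightarrow> real \<Rightarrow> bool" where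
 "below T U M \<equiv> \<forall>t\<in>{0<..T}. \<forall>r\<in>\<P>. \<forall>x. U t r x \<le> M"

abbreviation (input) above :: "real \<Rightarrow> real \<Rightarrow> (real \<Rightarrow> real ^ 'n::finite \<Rightarrow> real ^ 'n \<Rightarrow> real) \<Rightarrow> bool" where
 "above T M U \<equiv> \<forall>t\<in>{0<..T}. \<forall>r\<in>\<P>. \<forall>x. M \<le> U t r x"

subsection \<open>Comparison with smooth barriers\<close>

lemma joint_lipschitz_continuous:
 fixes w :: "real \<Rightarrow> 'a::real_normed_vector \<times> 'b::real_normed_vector \<Rightarrow> real"
 assumes "\<forall>t\<in>I. \<forall>t'\<in>I. \<forall>z z'. \<bar>w t z - w t' z'\<bar> \<le> K * (\<bar>t - t'\<bar> + norm (z - z'))"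
 shows "continuous_on (I \<times> X) (\<lambda>(t, r, x). w t (r, x))"
proof -
 have "(2 * \<bar>K\<bar>)-lipschitz_on (I \<times> X) (\<lambda>(t, r, x). w t (r, x))"
 proof (rule lipschitz_onI)
  fix z z' :: "real \<times> 'a \<times> 'b" assume z: "z \<in> I \<times> X" "z' \<in> I \<times> X"
  obtain t y t' y' where e: "z = (t, y)" "z' = (t', y')" by (metis surj_pair)
  have "\<bar>w t y - w t' y'\<bar> \<le> K * (\<bar>t - t'\<bar> + norm (y - y'))" using assms z unfolding e by blast
  also have "\<dots> \<le> \<bar>K\<bar> * (dist z z' + dist z z')"
  proof (intro mult_mono add_mono)
   show "\<bar>t - t'\<bar> \<le> dist z z'" using dist_fst_le[of z z'] unfolding e by (simp add: dist_real_def)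
   show "norm (y - y') \<le> dist z z'" using dist_snd_le[of z z'] unfolding e by (simp add: dist_norm)
  qed auto
  finally show "dist ((\<lambda>(t, r, x). w t (r, x)) z) ((\<lambda>(t, r, x). w t (r, x)) z') \<le> 2 * \<bar>K\<bar> * dist z z'"
   unfolding e by (simp add: dist_real_def case_prod_unfold)
 qed simp
 then show ?thesis by (rule lipschitz_on_continuous_on)
qed

lemma wjet_inverse_time:
 assumes "s < t0"
 shows "wjet T (\<lambda>t r x. k / (t - s)) t0 r0 x0 (- (k / (t0 - s)\<^sup>2)) 0 0 0"
proof -
 have "wjet T (\<lambda>t r x. 1 / (t - s)) t0 r0 x0 (- (1 / (t0 - s)\<^sup>2)) 0 0 0"
  by (rule wjet_time[where R="(t0 - s) / 2", OF inverse_time_quadratic[OF assms]]) (use assms in simp_all)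
 from wjet_cmult[OF this, of k] show ?thesis by simp
qed

text \<open>Nothing is known at the initial time \<open>s\<close>. The term
  \<open>k / (t - s)\<close> keeps the maximum away from it and has a time derivative of the
  favourable sign. Positive values occur only in a compact cylinder, and the condition at
  \<open>s'\<close> excludes the final time.\<close>

lemma interior_max:
 fixes \<Phi> :: "real \<Rightarrow> real ^ 'n::finite \<Rightarrow> real ^ 'n \<Rightarrow> real"
 assumes s: "0 \<le> s" "s < s'" and c: "0 < c"
  and cont: "continuous_on ({s<..s'} \<times> \<P> \<times> UNIV) (\<lambda>(t, r, x). \<Phi> t r x)"
  and N: "\<And>t r x. t \<in> {s<..s'} \<Longrightarrow> r \<in> \<P> \<Longrightarrow> \<Phi> t r x \<le> N"
  and off: "\<And>t r x. t \<in> {s<..s'} \<Longrightarrow> r \<in> \<P> \<Longrightarrow> 0 < \<Phi> t r x \<Longrightarrow> (r, x) \<in> cylinder c R"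
  and fin: "\<And>r x. r \<in> \<P> \<Longrightarrow> \<Phi> s' r x \<le> 0"
  and pos: "t1 \<in> {s<..s'}" "r1 \<in> \<P>" "0 < \<Phi> t1 r1 x1"
 obtains k t0 r0 x0 where "0 < k" "t0 \<in> {s<..<s'}" "r0 \<in> \<P>" "0 < \<Phi> t0 r0 x0"
  "near T t0 r0 x0 (\<lambda>t r x. \<Phi> t r x - k / (t - s) \<le> \<Phi> t0 r0 x0 - k / (t0 - s))"
proof -
 \<comment> \<open>With this choice half of the positive value at the given point survives the
   subtraction of \<open>k / (t - s)\<close>.\<close>
 define k where "k = \<Phi> t1 r1 x1 / 2 * (t1 - s)"
 have t1: "0 < t1 - s" using pos by simp
 have k: "0 < k" unfolding k_def using pos(3) t1 by simp
 have k1: "k / (t1 - s) = \<Phi> t1 r1 x1 / 2" unfolding k_def by (rule nonzero_mult_div_cancel_right) (use t1 in simp)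
 have N1: "\<Phi> t1 r1 x1 \<le> N" using N[OF pos(1,2)] .
 then have N0: "0 < N + 1" using pos(3) by linarith
 define d where "d = k / (N + 1)"
 have d: "0 < d" unfolding d_def using k N0 by simp
 have dk: "d \<le> t - s" if "s < t" "k / (t - s) \<le> N + 1" for t
  using that N0 unfolding d_def by (simp add: pos_divide_le_eq mult.commute)
 define g where "g = (\<lambda>(t, r, x). \<Phi> t r x - k / (t - s))"
 let ?C = "{s + d..s'} \<times> (simplex_core c :: (real ^ 'n) set) \<times> cball (0 :: real ^ 'n) R"
 have sub: "?C \<subseteq> {s<..s'} \<times> \<P> \<times> UNIV" using d simplex_core_subset[OF c] by auto
 have "compact ?C" by (intro compact_Times compact_Icc compact_simplex_core c compact_cball)
 moreover have "continuous_on ?C g"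
 proof -
  have "continuous_on ?C (\<lambda>z. (\<lambda>(t, r, x). \<Phi> t r x) z - k / (fst z - s))"
   using d by (intro continuous_on_diff continuous_on_subset[OF cont sub] continuous_intros) auto
  then show ?thesis unfolding g_def by (simp add: case_prod_unfold)
 qed
 moreover have z1: "(t1, r1, x1) \<in> ?C"
 proof -
  have "d \<le> t1 - s" using dk[of t1] t1 N1 pos(3) unfolding k1 by simp
  then show ?thesis using off[OF pos] pos(1) by (simp add: cylinder_iff)
 qed
 ultimately obtain z0 where z0: "z0 \<in> ?C" "\<And>z. z \<in> ?C \<Longrightarrow> g z \<le> g z0"
  using continuous_attains_sup[of ?C g] by blast
 obtain t0 r0 x0 where e: "z0 = (t0, r0, x0)" by (metis prod_cases3)
 have t0: "s < t0" "t0 \<le> s'" and r0: "r0 \<in> \<P>" using z0(1) d simplex_core_subset[OF c] unfolding e by auto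
 have "g (t1, r1, x1) = \<Phi> t1 r1 x1 / 2" unfolding g_def using k1 by simp
 then have g0: "0 < g z0" using z0(2)[OF z1] pos(3) by linarith
 have kt: "0 < k / (t - s)" if "s < t" for t using that k by simp
 have \<Phi>0: "0 < \<Phi> t0 r0 x0" using g0 kt[OF t0(1)] unfolding g_def e by simp
 have "t0 \<noteq> s'" using fin[OF r0, of x0] \<Phi>0 by force
 then have t0': "t0 < s'" using t0 by simp
 show thesis
 proof (rule that[OF k _ r0 \<Phi>0])
  show "t0 \<in> {s<..<s'}" using t0 t0' by simp
  show "near T t0 r0 x0 (\<lambda>t r x. \<Phi> t r x - k / (t - s) \<le> \<Phi> t0 r0 x0 - k / (t0 - s))"
  proof (rule nearI[of "min (t0 - s) (s' - t0)"])
   show "0 < min (t0 - s) (s' - t0)" using t0 t0' by simp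
   fix t :: real and r x :: "real ^ 'n" assume r: "r \<in> \<P>" and "\<bar>t - t0\<bar> < min (t0 - s) (s' - t0)"
   then have t: "s < t" "t < s'" by (auto simp: abs_less_iff)
   then have ti: "t \<in> {s<..s'}" by simp
   show "\<Phi> t r x - k / (t - s) \<le> \<Phi> t0 r0 x0 - k / (t0 - s)"
   proof (cases "0 < \<Phi> t r x - k / (t - s)")
    case True
    then have p: "0 < \<Phi> t r x" using kt[OF t(1)] by linarith
    have "d \<le> t - s" using dk[OF t(1)] True N[OF ti r, of x] by linarith
    then have "(t, r, x) \<in> ?C" using off[OF ti r p] t by (simp add: cylinder_iff)
    from z0(2)[OF this] show ?thesis unfolding g_def e by simp
   next
    case False
    then show ?thesis using g0 unfolding g_def e by simp
   qed
  qed
 qed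
qed

context hjb
begin

lemma pen_val_zero: "pen_val r x 0 0 0 V = 0"
 unfolding pen_val_def by simp

lemma sub_continuous: "sub U \<Longrightarrow> continuous_on (\<Q> T) (\<lambda>(t, r, x). U t r x)"
 unfolding viscosity_subsolution_def by blast

lemma super_continuous: "super U \<Longrightarrow> continuous_on (\<Q> T) (\<lambda>(t, r, x). U t r x)"
 unfolding viscosity_supersolution_def by blast

lemma penaltyD:
 assumes "penalty \<epsilon> M c R \<Psi>"
 shows "0 < c" "0 \<le> R" "continuous_on (UNIV \<times> \<P> \<times> UNIV) (\<lambda>(t, r, x). \<Psi> t r x)"
  "\<And>t r x. r \<in> \<P> \<Longrightarrow> 0 \<le> \<Psi> t r x"
  "\<And>t r x. t \<in> {0..T} \<Longrightarrow> r \<in> \<P> \<Longrightarrow> \<Psi> t r x \<le> M \<Longrightarrow> (r, x) \<in> cylinder c R"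
 using assms unfolding penalty_def cylinder_iff by blast+

lemma penalty_jet:
 assumes "penalty \<epsilon> M c R \<Psi>" "t0 \<in> {0<..<T}" "r0 \<in> \<P>" "\<Psi> t0 r0 x0 \<le> M"
 obtains a p q Q where "wjet T \<Psi> t0 r0 x0 a p q Q" "\<And>V. V \<in> cball 0 l \<Longrightarrow> a + \<bar>pen_val r0 x0 p q Q V\<bar> \<le> - \<epsilon>"
 using assms unfolding penalty_def by metis

text \<open>The penalty gains \<open>\<epsilon>\<close>, of which the approximate subsolution
  \<open>w\<close> loses at most half: \<open>w - \<Psi>\<close> is a strict classical subsolution
  where \<open>\<Psi> \<le> M\<close>.\<close>

lemma barrier_jet:
 assumes pen: "penalty \<epsilon> M c R \<Psi>" and t0: "t0 \<in> {0<..<T}" and r0: "r0 \<in> \<P>" and \<Psi>: "\<Psi> t0 r0 x0 \<le> M" and \<epsilon>: "0 < \<epsilon>"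
  and jet: "\<And>t r x. t \<in> {0<..<T} \<Longrightarrow> (r, x) \<in> cylinder c R \<Longrightarrow>
   \<exists>a p Q. has_jet w t (r, x) a p Q \<and> (\<forall>V\<in>cball 0 l. - \<epsilon> / 2 \<le> a + p (drift V r x) + half_trace Q + F t r x V)"
 obtains a p q Q where "wjet T (\<lambda>t r x. w t (r, x) + - \<Psi> t r x) t0 r0 x0 a p q Q"
  "\<And>V. V \<in> cball 0 l \<Longrightarrow> \<epsilon> / 2 \<le> a + Hval t0 r0 x0 p q Q V"
proof -
 obtain a1 p1 q1 Q1 where 1: "wjet T \<Psi> t0 r0 x0 a1 p1 q1 Q1" "\<And>V. V \<in> cball 0 l \<Longrightarrow> a1 + \<bar>pen_val r0 x0 p1 q1 Q1 V\<bar> \<le> - \<epsilon>"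
  by (rule penalty_jet[OF pen t0 r0 \<Psi>]) (rule that)
 have "t0 \<in> {0..T}" using t0 by simp
 from jet[OF t0 penaltyD(5)[OF pen this r0 \<Psi>]] obtain a p Q where j: "has_jet w t0 (r0, x0) a p Q"
  and je: "\<And>V. V \<in> cball 0 l \<Longrightarrow> - \<epsilon> / 2 \<le> a + p (drift V r0 x0) + half_trace Q + F t0 r0 x0 V"
  by blast
 obtain p2 q2 Q2 where 2: "wjet T (\<lambda>t r x. w t (r, x)) t0 r0 x0 a p2 q2 Q2"
  "\<And>V. p (drift V r0 x0) + half_trace Q = pen_val r0 x0 p2 q2 Q2 V"
  by (rule jet_pen[OF j]) (rule that)
 show thesis
 proof (rule that[OF wjet_add[OF 2(1) wjet_uminus[OF 1(1)]]])
  fix V :: "real ^ 'n" assume V: "V \<in> cball 0 l"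
  have "\<epsilon> / 2 \<le> a + - a1 + (pen_val r0 x0 p2 q2 Q2 V - pen_val r0 x0 p1 q1 Q1 V + F t0 r0 x0 V)"
   using 1(2)[OF V] 2(2)[of V] je[OF V] by linarith
  then show "\<epsilon> / 2 \<le> a + - a1 + Hval t0 r0 x0 (p2 + - p1) (q2 + - q1) (Q2 + - Q1) V"
   unfolding Hval_pen pen_val_add pen_val_uminus by simp
 qed
qed

text \<open>The maximum principle for one control. Where the difference is positive, the penalty is
  at most \<open>M\<close>, as \<open>w\<close> is nonnegative. At an interior maximum
  \<open>\<Psi> + w + k / (t - s)\<close> touches \<open>U\<close> from above, but the penalty makes
  this sum a strict supersolution even if \<open>w\<close> misses the inequality by
  \<open>\<epsilon> / 2\<close>.\<close>

lemma sub_below_barrier: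
 assumes U: "sub U" and UM: "\<And>t r x. t \<in> {0<..T} \<Longrightarrow> r \<in> \<P> \<Longrightarrow> U t r x \<le> M"
  and pen: "penalty \<epsilon> M c R \<Psi>" and \<epsilon>: "0 < \<epsilon>" and V: "V \<in> cball 0 l" and s: "0 < s" "s < s'" "s' \<le> T"
  and lip: "\<forall>t\<in>{s..s'}. \<forall>t'\<in>{s..s'}. \<forall>z z'. \<bar>w t z - w t' z'\<bar> \<le> K * (\<bar>t - t'\<bar> + norm (z - z'))"
  and pos: "\<forall>t\<in>{s..s'}. \<forall>z. 0 \<le> w t z"
  and jet: "\<And>t r x. t \<in> {s<..<s'} \<Longrightarrow> (r, x) \<in> cylinder c R \<Longrightarrow>
   \<exists>a p Q. has_jet w t (r, x) a p Q \<and> a + p (drift V r x) + half_trace Q + F t r x V \<le> \<epsilon> / 2"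
  and fin: "\<And>r x. r \<in> \<P> \<Longrightarrow> U s' r x - \<Psi> s' r x - \<delta> \<le> w s' (r, x)" and \<delta>: "0 \<le> \<delta>"
  and t: "t \<in> {s..s'}" and r: "r \<in> \<P>"
 shows "U t r x - \<Psi> t r x - \<delta> \<le> w t (r, x)"
proof -
 define \<Phi> where "\<Phi> t r x = U t r x - \<Psi> t r x - \<delta> - w t (r, x)" for t r x
 have cont: "continuous_on ({s..s'} \<times> \<P> \<times> UNIV) (\<lambda>(t, r, x). \<Phi> t r x)"
 proof -
  have "continuous_on ({s..s'} \<times> \<P> \<times> UNIV) (\<lambda>z. (\<lambda>(t, r, x). U t r x) z - (\<lambda>(t, r, x). \<Psi> t r x) z - \<delta> - (\<lambda>(t, r, x). w t (r, x)) z)"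
   by (intro continuous_on_diff continuous_on_const joint_lipschitz_continuous[OF lip]
     continuous_on_subset[OF sub_continuous[OF U]] continuous_on_subset[OF penaltyD(3)[OF pen]]) (use s in auto)
  then show ?thesis unfolding \<Phi>_def by (simp add: case_prod_unfold)
 qed
 have le: "\<Phi> t r x \<le> 0" if t: "t \<in> {s<..s'}" and r: "r \<in> \<P>" for t r x
 proof (rule ccontr)
  assume "\<not> \<Phi> t r x \<le> 0"
  then have p1: "0 < \<Phi> t r x" by simp
  have \<Phi>M: "\<Phi> t r x \<le> M - \<Psi> t r x" if "t \<in> {s<..s'}" "r \<in> \<P>" for t r x
   using UM[of t r x] pos[rule_format, of t "(r, x)"] that s \<delta> unfolding \<Phi>_def by simp
  have \<Psi>M: "\<Psi> t r x \<le> M" if "t \<in> {s<..s'}" "r \<in> \<P>" "0 < \<Phi> t r x" for t r x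
   using \<Phi>M[OF that(1,2), of x] that(3) by linarith
  obtain k t0 r0 x0 where k: "0 < k" and t0: "t0 \<in> {s<..<s'}" and r0: "r0 \<in> \<P>" and p0: "0 < \<Phi> t0 r0 x0"
   and n: "near T t0 r0 x0 (\<lambda>t r x. \<Phi> t r x - k / (t - s) \<le> \<Phi> t0 r0 x0 - k / (t0 - s))"
  proof (rule interior_max[of s s' c \<Phi> M R t r x])
   show "continuous_on ({s<..s'} \<times> \<P> \<times> UNIV) (\<lambda>(t, r, x). \<Phi> t r x)"
    by (rule continuous_on_subset[OF cont]) auto
   show "\<Phi> t r x \<le> M" if "t \<in> {s<..s'}" "r \<in> \<P>" for t r x
    using \<Phi>M[OF that, of x] penaltyD(4)[OF pen that(2), of t x] by linarith
   show "(r, x) \<in> cylinder c R" if "t \<in> {s<..s'}" "r \<in> \<P>" "0 < \<Phi> t r x" for t r x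
    by (rule penaltyD(5)[OF pen _ that(2) \<Psi>M[OF that]]) (use that(1) s in simp)
   show "\<Phi> s' r x \<le> 0" if "r \<in> \<P>" for r x using fin[OF that, of x] unfolding \<Phi>_def by simp
  qed (use s penaltyD(1)[OF pen] t r p1 in auto)
  have t0T: "t0 \<in> {0<..<T}" and t0s: "t0 \<in> {s<..s'}" "s < t0" "t0 \<in> {0..T}" using t0 s by auto
  note \<Psi>0 = \<Psi>M[OF t0s(1) r0 p0]
  obtain a1 p1 q1 Q1 where 1: "wjet T \<Psi> t0 r0 x0 a1 p1 q1 Q1" "\<And>V. V \<in> cball 0 l \<Longrightarrow> a1 + \<bar>pen_val r0 x0 p1 q1 Q1 V\<bar> \<le> - \<epsilon>"
   by (rule penalty_jet[OF pen t0T r0 \<Psi>0]) (rule that)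
  obtain a p Q where j: "has_jet w t0 (r0, x0) a p Q"
   and je: "a + p (drift V r0 x0) + half_trace Q + F t0 r0 x0 V \<le> \<epsilon> / 2"
   using jet[OF t0 penaltyD(5)[OF pen t0s(3) r0 \<Psi>0]] by blast
  obtain p2 q2 Q2 where 2: "wjet T (\<lambda>t r x. w t (r, x)) t0 r0 x0 a p2 q2 Q2"
   "\<And>V. p (drift V r0 x0) + half_trace Q = pen_val r0 x0 p2 q2 Q2 V"
   by (rule jet_pen[OF j]) (rule that)
  have "0 \<le> a1 + a + - (k / (t0 - s)\<^sup>2) + Hval t0 r0 x0 (p1 + p2 + 0) (q1 + q2 + 0) (Q1 + Q2 + 0) V"
  proof (rule sub_jet[OF U t0T r0 wjet_add[OF wjet_add[OF 1(1) 2(1)] wjet_inverse_time[OF t0s(2), of T k]] _ V])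
   show "near T t0 r0 x0 (\<lambda>t r x. U t r x - (\<Psi> t r x + w t (r, x) + k / (t - s)) \<le> U t0 r0 x0 - (\<Psi> t0 r0 x0 + w t0 (r0, x0) + k / (t0 - s)))"
    by (rule near_mono[OF n]) (simp add: \<Phi>_def)
  qed
  then have "0 \<le> a1 + a - k / (t0 - s)\<^sup>2 + pen_val r0 x0 p1 q1 Q1 V + pen_val r0 x0 p2 q2 Q2 V + F t0 r0 x0 V"
   unfolding Hval_pen by (simp add: pen_val_add)
  moreover have "0 < k / (t0 - s)\<^sup>2" using k t0s by simp
  ultimately show False using 1(2)[OF V] 2(2)[of V] je \<epsilon> by linarith
 qed
 \<comment> \<open>The initial time \<open>s\<close> is recovered by continuity, as the argument
   with \<open>k / (t - s)\<close> covers only later times.\<close>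
 have "\<Phi> t r x \<le> 0"
 proof (rule continuous_le_on_closure[of "{s<..s'}" "\<lambda>t. \<Phi> t r x"])
  have c: "closure {s<..s'} = {s..s'}" using s by simp
  have "continuous_on {s..s'} (\<lambda>t. (\<lambda>(t, r, x). \<Phi> t r x) (t, r, x))"
   by (rule continuous_on_compose2[OF cont]) (use r in \<open>auto intro!: continuous_intros\<close>)
  then show "continuous_on (closure {s<..s'}) (\<lambda>t. \<Phi> t r x)" unfolding c by simp
  show "t \<in> closure {s<..s'}" unfolding c by (rule t)
 qed (rule le[OF _ r])
 then show ?thesis unfolding \<Phi>_def by simp
qed

text \<open>The mirror image of \<open>sub_below_barrier\<close>: now
  \<open>w - \<Psi> - k / (t - 0)\<close> touches \<open>U\<close> from below. A supersolution can
  be tested only by a function that is a strict subsolution for all controls simultaneously, which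
  \<open>w - \<Psi>\<close> is.\<close>

lemma super_above:
 assumes U: "super U" and UM: "\<And>t r x. t \<in> {0<..T} \<Longrightarrow> r \<in> \<P> \<Longrightarrow> - M \<le> U t r x"
  and pen: "penalty \<epsilon> (M + N) c R \<Psi>" and \<epsilon>: "0 < \<epsilon>"
  and lip: "\<forall>t\<in>{0..T}. \<forall>t'\<in>{0..T}. \<forall>z z'. \<bar>w t z - w t' z'\<bar> \<le> K * (\<bar>t - t'\<bar> + norm (z - z'))"
  and wN: "\<forall>t\<in>{0..T}. \<forall>z. w t z \<le> N"
  and jet: "\<And>t r x. t \<in> {0<..<T} \<Longrightarrow> (r, x) \<in> cylinder c R \<Longrightarrow>
   \<exists>a p Q. has_jet w t (r, x) a p Q \<and> (\<forall>V\<in>cball 0 l. - \<epsilon> / 2 \<le> a + p (drift V r x) + half_trace Q + F t r x V)"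
  and fin: "\<And>r x. (r, x) \<in> cylinder c R \<Longrightarrow> w T (r, x) \<le> h r x + \<epsilon>"
  and t: "t \<in> {0<..T}" and r: "r \<in> \<P>"
 shows "w t (r, x) - \<Psi> t r x - \<epsilon> \<le> U t r x"
proof (rule ccontr)
 define \<Phi> where "\<Phi> t r x = w t (r, x) - \<Psi> t r x - \<epsilon> - U t r x" for t r x
 assume "\<not> w t (r, x) - \<Psi> t r x - \<epsilon> \<le> U t r x"
 then have p1: "0 < \<Phi> t r x" unfolding \<Phi>_def by simp
 have cont: "continuous_on (\<Q> T) (\<lambda>(t, r, x). \<Phi> t r x)"
 proof -
  have "continuous_on (\<Q> T) (\<lambda>z. (\<lambda>(t, r, x). w t (r, x)) z - (\<lambda>(t, r, x). \<Psi> t r x) z - \<epsilon> - (\<lambda>(t, r, x). U t r x) z)"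
   by (intro continuous_on_diff continuous_on_const continuous_on_subset[OF joint_lipschitz_continuous[OF lip, of UNIV]]
     super_continuous[OF U] continuous_on_subset[OF penaltyD(3)[OF pen]]) auto
  then show ?thesis unfolding \<Phi>_def by (simp add: case_prod_unfold)
 qed
 have \<Phi>M: "\<Phi> t r x \<le> M + N - \<Psi> t r x" if "t \<in> {0<..T}" "r \<in> \<P>" for t r x
  using UM[of t r x] wN[rule_format, of t "(r, x)"] that \<epsilon> unfolding \<Phi>_def by simp
 have \<Psi>M: "\<Psi> t r x \<le> M + N" if "t \<in> {0<..T}" "r \<in> \<P>" "0 < \<Phi> t r x" for t r x
  using \<Phi>M[OF that(1,2), of x] that(3) by linarith
 have cyl: "(r, x) \<in> cylinder c R" if "t \<in> {0<..T}" "r \<in> \<P>" "0 < \<Phi> t r x" for t r x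
  by (rule penaltyD(5)[OF pen _ that(2) \<Psi>M[OF that]]) (use that(1) in simp)
 obtain k t0 r0 x0 where k: "0 < k" and t0: "t0 \<in> {0<..<T}" and r0: "r0 \<in> \<P>" and p0: "0 < \<Phi> t0 r0 x0"
  and n: "near T t0 r0 x0 (\<lambda>t r x. \<Phi> t r x - k / (t - 0) \<le> \<Phi> t0 r0 x0 - k / (t0 - 0))"
 proof (rule interior_max[of 0 T c \<Phi> "M + N" R t r x])
  show "continuous_on (\<Q> T) (\<lambda>(t, r, x). \<Phi> t r x)" by (rule cont)
  show "\<Phi> t r x \<le> M + N" if "t \<in> {0<..T}" "r \<in> \<P>" for t r x
   using \<Phi>M[OF that, of x] penaltyD(4)[OF pen that(2), of t x] by linarith
  show "(r, x) \<in> cylinder c R" if "t \<in> {0<..T}" "r \<in> \<P>" "0 < \<Phi> t r x" for t r x by (rule cyl[OF that])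
  show "\<Phi> T r x \<le> 0" if r: "r \<in> \<P>" for r x
  proof (rule ccontr)
   assume "\<not> \<Phi> T r x \<le> 0"
   then have "(r, x) \<in> cylinder c R" by (intro cyl[of T]) (use T_pos r in auto)
   moreover have "h r x \<le> U T r x" using U r unfolding viscosity_supersolution_def by blast
   ultimately have "\<Phi> T r x \<le> 0" using fin[of r x] penaltyD(4)[OF pen r, of T x] unfolding \<Phi>_def by linarith
   then show False using \<open>\<not> \<Phi> T r x \<le> 0\<close> by simp
  qed
 qed (use T_pos penaltyD(1)[OF pen] t r p1 in auto)
 have t0s: "t0 \<in> {0<..T}" "0 < t0" using t0 by auto
 obtain a p q Q where w: "wjet T (\<lambda>t r x. w t (r, x) + - \<Psi> t r x) t0 r0 x0 a p q Q"
  and aH: "\<And>V. V \<in> cball 0 l \<Longrightarrow> \<epsilon> / 2 \<le> a + Hval t0 r0 x0 p q Q V"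
  by (rule barrier_jet[OF pen t0 r0 \<Psi>M[OF t0s(1) r0 p0] \<epsilon> jet]; (rule that; assumption)?)
 have "\<epsilon> / 2 \<le> 0"
 proof (rule super_jet[OF U t0 r0 wjet_add[OF w wjet_inverse_time[OF t0s(2), of T "- k"]]])
  show "near T t0 r0 x0 (\<lambda>t r x. U t0 r0 x0 - (w t0 (r0, x0) + - \<Psi> t0 r0 x0 + - k / (t0 - 0)) \<le> U t r x - (w t (r, x) + - \<Psi> t r x + - k / (t - 0)))"
   by (rule near_mono[OF n]) (simp add: \<Phi>_def)
  fix V :: "real ^ 'n" assume V: "V \<in> cball 0 l"
  have "0 < k / (t0 - 0)\<^sup>2" using k t0s by simp
  then show "\<epsilon> / 2 \<le> a + - (- k / (t0 - 0)\<^sup>2) + Hval t0 r0 x0 (p + 0) (q + 0) (Q + 0) V"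
   unfolding add_0_right minus_divide_left[symmetric] minus_minus using aH[OF V] by linarith
 qed
 then show False using \<epsilon> by simp
qed

text \<open>Where the maximum is positive, it is the strict classical subsolution; elsewhere it is
  0, which is a subsolution because the costs are nonnegative. Truncation at 0 is needed since the
  inequality for \<open>w - \<Psi>\<close> is known only on a sublevel set of the penalty.\<close>

lemma sub_from_barrier:
 assumes pen: "penalty \<epsilon> N c R \<Psi>" and \<epsilon>: "0 < \<epsilon>"
  and lip: "\<forall>t\<in>{0..T}. \<forall>t'\<in>{0..T}. \<forall>z z'. \<bar>w t z - w t' z'\<bar> \<le> K * (\<bar>t - t'\<bar> + norm (z - z'))"
  and wN: "\<forall>t\<in>{0..T}. \<forall>z. w t z \<le> N"
  and jet: "\<And>t r x. t \<in> {0<..<T} \<Longrightarrow> (r, x) \<in> cylinder c R \<Longrightarrow>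
   \<exists>a p Q. has_jet w t (r, x) a p Q \<and> (\<forall>V\<in>cball 0 l. - \<epsilon> / 2 \<le> a + p (drift V r x) + half_trace Q + F t r x V)"
  and fin: "\<And>r x. (r, x) \<in> cylinder c R \<Longrightarrow> w T (r, x) \<le> h r x + \<epsilon>"
 shows "sub (\<lambda>t r x. max (w t (r, x) - \<Psi> t r x - \<epsilon>) 0)"
 unfolding viscosity_subsolution_def
proof (intro conjI allI ballI impI)
 define G where "G t r x = w t (r, x) - \<Psi> t r x - \<epsilon>" for t r x
 have cyl: "\<Psi> t r x \<le> N" "(r, x) \<in> cylinder c R" if "t \<in> {0<..T}" "r \<in> \<P>" "0 < G t r x" for t r x
 proof -
  have t: "t \<in> {0..T}" using that(1) by simp
  show "\<Psi> t r x \<le> N" using wN[rule_format, OF t, of "(r, x)"] that(3) \<epsilon> unfolding G_def by linarith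
  then show "(r, x) \<in> cylinder c R" by (rule penaltyD(5)[OF pen t that(2)])
 qed
 have "continuous_on (\<Q> T) (\<lambda>z. max ((\<lambda>(t, r, x). w t (r, x)) z - (\<lambda>(t, r, x). \<Psi> t r x) z - \<epsilon>) 0)"
  by (intro continuous_on_diff continuous_on_const continuous_on_max continuous_on_subset[OF joint_lipschitz_continuous[OF lip, of UNIV]]
     continuous_on_subset[OF penaltyD(3)[OF pen]]) auto
 then show "continuous_on (\<Q> T) (\<lambda>(t, r, x). max (w t (r, x) - \<Psi> t r x - \<epsilon>) 0)"
  by (simp add: case_prod_unfold)
 show "max (w T (r, x) - \<Psi> T r x - \<epsilon>) 0 \<le> h r x" if r: "r \<in> \<P>" for r x
 proof (cases "0 < G T r x")
  case True
  then have "w T (r, x) \<le> h r x + \<epsilon>" by (intro fin cyl(2)[of T]) (use T_pos r in auto)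
  then show ?thesis using penaltyD(4)[OF pen r, of T x] h_nonneg[OF r, of x] by simp
 next
  case False
  then show ?thesis using h_nonneg[OF r, of x] unfolding G_def by simp
 qed
 fix \<phi> and t0 :: real and r0 x0 :: "real ^ 'n" assume \<phi>: "C112_on T \<phi>" and t0: "t0 \<in> {0<..<T}" and r0: "r0 \<in> \<P>"
  and ev: "\<forall>\<^sub>F (t, r, x) in at (t0, r0, x0) within \<D> T.
    max (w t (r, x) - \<Psi> t r x - \<epsilon>) 0 - \<phi> t r x \<le> max (w t0 (r0, x0) - \<Psi> t0 r0 x0 - \<epsilon>) 0 - \<phi> t0 r0 x0"
 have n: "near T t0 r0 x0 (\<lambda>t r x. max (G t r x) 0 - \<phi> t r x \<le> max (G t0 r0 x0) 0 - \<phi> t0 r0 x0)"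
  unfolding G_def by (rule eventually_near[OF ev]) simp
 have t0s: "t0 \<in> {0<..T}" "t0 \<in> {0..T}" using t0 by auto
 show "0 \<le> op \<phi> t0 r0 x0"
 proof (cases "0 < G t0 r0 x0")
  case True
  obtain a p q Q where j: "wjet T (\<lambda>t r x. w t (r, x) + - \<Psi> t r x) t0 r0 x0 a p q Q"
   and aH: "\<And>V. V \<in> cball 0 l \<Longrightarrow> \<epsilon> / 2 \<le> a + Hval t0 r0 x0 p q Q V"
   by (rule barrier_jet[OF pen t0 r0 cyl(1)[OF t0s(1) r0 True] \<epsilon> jet]; (rule that; assumption)?)
  show ?thesis
  proof (rule operator_ge_pjet[OF \<phi> t0 r0 wjet_pjet[OF t0 r0 j]])
   show "near T t0 r0 x0 (\<lambda>t r x. w t (r, x) + - \<Psi> t r x - \<phi> t r x \<le> w t0 (r0, x0) + - \<Psi> t0 r0 x0 - \<phi> t0 r0 x0)"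
   proof (rule near_mono[OF n])
    fix t :: real and r x :: "real ^ 'n" assume "max (G t r x) 0 - \<phi> t r x \<le> max (G t0 r0 x0) 0 - \<phi> t0 r0 x0"
    moreover have "max (G t0 r0 x0) 0 = G t0 r0 x0" using True by simp
    ultimately show "w t (r, x) + - \<Psi> t r x - \<phi> t r x \<le> w t0 (r0, x0) + - \<Psi> t0 r0 x0 - \<phi> t0 r0 x0"
     using max.cobounded1[of "G t r x" 0] unfolding G_def by linarith
   qed
   fix V :: "real ^ 'n" assume V: "V \<in> cball 0 l"
   show "0 \<le> a + Hval t0 r0 x0 (tangential p) q Q V"
    unfolding Hval_tangential[OF r0] using aH[OF V] \<epsilon> by linarith
  qed
 next
  case False
  have j0: "pjet (\<lambda>t r x. 0) t0 r0 x0 0 (tangential 0) 0 0" by (rule wjet_pjet[OF t0 r0 wjet_const])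
  show ?thesis
  proof (rule operator_ge_pjet[OF \<phi> t0 r0 j0])
   show "near T t0 r0 x0 (\<lambda>t r x. 0 - \<phi> t r x \<le> 0 - \<phi> t0 r0 x0)"
   proof (rule near_mono[OF n])
    fix t :: real and r x :: "real ^ 'n" assume "max (G t r x) 0 - \<phi> t r x \<le> max (G t0 r0 x0) 0 - \<phi> t0 r0 x0"
    moreover have "max (G t0 r0 x0) 0 = 0" using False by simp
    ultimately show "0 - \<phi> t r x \<le> 0 - \<phi> t0 r0 x0" using max.cobounded2[of 0 "G t r x"] by linarith
   qed
   fix V :: "real ^ 'n" assume V: "V \<in> cball 0 l"
   show "0 \<le> 0 + Hval t0 r0 x0 (tangential 0) 0 0 V"
    unfolding Hval_tangential[OF r0] unfolding Hval_pen pen_val_zero using F_nonneg[OF t0s(2) r0 V, of x0] by simp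
  qed
 qed
qed

text \<open>A function \<open>W\<close> caught between all subsolutions and all supersolutions
  bounded by \<open>M\<close>, up to \<open>\<epsilon> * G\<close>, and a genuine subsolution
  \<open>S\<close> not far below it. The bound \<open>N\<close> does not vary with \<open>M\<close>,
  although \<open>W\<close> does; this independence leaves room for Perron's method.\<close>

definition sandwich :: "real \<Rightarrow> (real ^ 'n \<Rightarrow> real ^ 'n \<Rightarrow> real) \<Rightarrow> real \<Rightarrow> real \<Rightarrow> (real \<Rightarrow> real ^ 'n \<Rightarrow> real ^ 'n \<Rightarrow> real) \<Rightarrow>
  (real \<Rightarrow> real ^ 'n \<Rightarrow> real ^ 'n \<Rightarrow> real) \<Rightarrow> bool" where
 "sandwich N G \<epsilon> M W S \<longleftrightarrow> continuous_on ({0..T} \<times> \<P> \<times> UNIV) (\<lambda>(t, r, x). W t r x) \<and>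
   (\<forall>t\<in>{0..T}. \<forall>r x. W t r x \<le> N) \<and>
   (\<forall>U. sub U \<and> (below T U M) \<longrightarrow>
    (\<forall>t\<in>{0<..T}. \<forall>r\<in>\<P>. \<forall>x. U t r x \<le> W t r x + \<epsilon> * G r x)) \<and>
   (\<forall>U. super U \<and> (above T (- M) U) \<longrightarrow>
    (\<forall>t\<in>{0<..T}. \<forall>r\<in>\<P>. \<forall>x. W t r x - \<epsilon> * G r x \<le> U t r x)) \<and>
   sub S \<and> (\<forall>t\<in>{0<..T}. \<forall>r\<in>\<P>. \<forall>x. 0 \<le> S t r x \<and> S t r x \<le> N \<and> W t r x - \<epsilon> * G r x \<le> S t r x) \<and>
   (\<forall>r\<in>\<P>. \<forall>x. h r x \<le> W T r x + \<epsilon> * G r x)"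

text \<open>The \<open>\<epsilon>\<close> of the penalty is split into quarters: one for the
  extension of the costs and one for the scheme. Their sum is the \<open>\<epsilon> / 2\<close>
  tolerated by the barrier lemmas. Outside the cylinder the terminal inequalities hold because the
  penalty exceeds the bounds there.\<close>

lemma approximate_solution:
 assumes B: "0 \<le> B" and hB: "\<And>r x. r \<in> \<P> \<Longrightarrow> h r x \<le> B"
  and FB: "\<And>t r x V. t \<in> {0..T} \<Longrightarrow> r \<in> \<P> \<Longrightarrow> V \<in> cball 0 l \<Longrightarrow> F t r x V \<le> B"
  and \<epsilon>: "0 < \<epsilon>" and M: "0 \<le> M" and pen: "penalty \<epsilon> (M + (B + 3 * T * B)) c R \<Psi>"
  and g: "\<And>t r x. t \<in> {0..T} \<Longrightarrow> r \<in> \<P> \<Longrightarrow> \<Psi> t r x + \<epsilon> \<le> \<epsilon> * G r x"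
 shows "\<exists>W S. sandwich (B + 3 * T * B) G \<epsilon> M W S"
proof -
 let ?N = "B + 3 * T * B"
 have N: "0 \<le> ?N" using B T_pos by simp
 \<comment> \<open>Lowering \<open>c\<close> enlarges the cylinder, and below
   \<open>1 / CARD('n)\<close> it is nonempty, as the uniform distribution belongs to it.\<close>
 define c' where "c' = min c (1 / real CARD('n))"
 have c': "0 < c'" "c' \<le> 1 / real CARD('n)" unfolding c'_def using penaltyD(1)[OF pen] by simp_all
 have cyl: "(r, x) \<in> cylinder c' R" if "(r, x) \<in> cylinder c R" for r x
  using that unfolding cylinder_iff simplex_core_def c'_def by (auto intro: min.coboundedI1)
 have pen_mono: "penalty \<epsilon> M' c R \<Psi>" if "M' \<le> M + ?N" for M'
  using pen that unfolding penalty_def by (meson order_trans)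
 have e4: "0 < \<epsilon> / 4" using \<epsilon> by simp
 obtain b f hh L \<beta> where sch: "scheme b f hh (cball 0 l) L B \<beta> T"
  and bd: "\<And>V r x. (r, x) \<in> cylinder c' R \<Longrightarrow> b V (r, x) = drift V r x"
  and ff: "\<And>t V r x. t \<in> {0..T} \<Longrightarrow> V \<in> cball 0 l \<Longrightarrow> (r, x) \<in> cylinder c' R \<Longrightarrow> f t V (r, x) \<le> F t r x V \<and> F t r x V \<le> f t V (r, x) + \<epsilon> / 4"
  and hf: "\<And>r x. (r, x) \<in> cylinder c' R \<Longrightarrow> hh (r, x) \<le> h r x \<and> h r x \<le> hh (r, x) + \<epsilon> / 4"
  by (rule frozen_coefficients[OF c' penaltyD(2)[OF pen] e4 B]; (rule hB FB that; assumption))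
 interpret S: scheme noise b f hh "cball 0 l" L B \<beta> T by (rule sch)
 obtain w K where lip: "\<forall>t\<in>{0..T}. \<forall>t'\<in>{0..T}. \<forall>z z'. \<bar>w t z - w t' z'\<bar> \<le> K * (\<bar>t - t'\<bar> + norm (z - z'))"
  and wb: "\<forall>t\<in>{0..T}. \<forall>z. 0 \<le> w t z \<and> w t z \<le> S.Mx"
  and wj: "\<forall>t\<in>{0<..<T}. \<forall>z. \<exists>a p Q. has_jet w t z a p Q \<and>
    (\<forall>V\<in>cball 0 l. - (\<epsilon> / 4) \<le> a + p (b V z) + half_trace Q + f t V z)"
  and wT: "\<forall>z. \<bar>w T z - hh z\<bar> \<le> \<epsilon> / 4"
  and wU: "\<And>D U. S.CP D U \<Longrightarrow> \<forall>z\<in>D. U T z \<le> hh z \<Longrightarrow> \<forall>t\<in>{0<..T}. \<forall>z\<in>D. U t z \<le> w t z + \<epsilon> / 4"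
  by (rule S.approximation[OF e4]) (rule that)
 have wN: "\<forall>t\<in>{0..T}. \<forall>z. w t z \<le> ?N" using wb unfolding S.Mx_def by blast
 have jet: "\<exists>a p Q. has_jet w t (r, x) a p Q \<and> (\<forall>V\<in>cball 0 l. - \<epsilon> / 2 \<le> a + p (drift V r x) + half_trace Q + F t r x V)"
  if t: "t \<in> {0<..<T}" and z: "(r, x) \<in> cylinder c R" for t r x
 proof -
  obtain a p Q where j: "has_jet w t (r, x) a p Q"
   and je: "\<And>V. V \<in> cball 0 l \<Longrightarrow> - (\<epsilon> / 4) \<le> a + p (b V (r, x)) + half_trace Q + f t V (r, x)"
   using wj[rule_format, OF t, of "(r, x)"] by blast
  have "- \<epsilon> / 2 \<le> a + p (drift V r x) + half_trace Q + F t r x V" if V: "V \<in> cball 0 l" for V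
   using je[OF V] ff[of t V r x] V t cyl[OF z] \<epsilon> unfolding bd[OF cyl[OF z]] by simp
  then show ?thesis using j by blast
 qed
 have fin: "w T (r, x) \<le> h r x + \<epsilon>" if "(r, x) \<in> cylinder c R" for r x
  using wT[rule_format, of "(r, x)"] hf[OF cyl[OF that]] \<epsilon> by linarith
 have sub01: "t \<in> {0..T}" if "t \<in> {0<..T}" for t using that by simp
 show ?thesis
  unfolding sandwich_def
 proof (rule exI[of _ "\<lambda>t r x. w t (r, x)"], rule exI[of _ "\<lambda>t r x. max (w t (r, x) - \<Psi> t r x - \<epsilon>) 0"], intro conjI allI ballI impI)
  show "continuous_on ({0..T} \<times> \<P> \<times> UNIV) (\<lambda>(t, r, x). w t (r, x))"
   by (rule joint_lipschitz_continuous[OF lip])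
  show "sub (\<lambda>t r x. max (w t (r, x) - \<Psi> t r x - \<epsilon>) 0)"
   by (rule sub_from_barrier[OF pen_mono \<epsilon> lip wN jet fin]) (use M in auto)
  show "w t (r, x) \<le> ?N" if "t \<in> {0..T}" for t r x using wN that by blast
  show "h r x \<le> w T (r, x) + \<epsilon> * G r x" if r: "r \<in> \<P>" for r x
  proof -
   have TT: "T \<in> {0..T}" using T_pos by simp
   have "h r x \<le> w T (r, x) + \<Psi> T r x + \<epsilon>"
   proof (cases "\<Psi> T r x \<le> M + ?N")
    case True
    from cyl[OF penaltyD(5)[OF pen TT r True]]
    show ?thesis using wT[rule_format, of "(r, x)"] hf[of r x] penaltyD(4)[OF pen r, of T x] \<epsilon> unfolding abs_le_iff by linarith
   next
    case False
    moreover have "0 \<le> w T (r, x)" "0 \<le> T * B" using wb T_pos B by simp_all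
    ultimately show ?thesis using hB[OF r, of x] M \<epsilon> by simp
   qed
   then show ?thesis using g[OF TT r, of x] by linarith
  qed
 next
  fix t :: real and r x :: "real ^ 'n" assume t: "t \<in> {0<..T}" and r: "r \<in> \<P>"
  show "max (w t (r, x) - \<Psi> t r x - \<epsilon>) 0 \<le> ?N"
   using wN[rule_format, OF sub01[OF t], of "(r, x)"] penaltyD(4)[OF pen r, of t x] \<epsilon> N by simp
  show "w t (r, x) - \<epsilon> * G r x \<le> max (w t (r, x) - \<Psi> t r x - \<epsilon>) 0"
   using g[OF sub01[OF t] r, of x] max.cobounded1[of "w t (r, x) - \<Psi> t r x - \<epsilon>" 0] by linarith
  show "0 \<le> max (w t (r, x) - \<Psi> t r x - \<epsilon>) 0" by simp
 next
  fix U and t :: real and r x :: "real ^ 'n"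
  assume U: "super U \<and> (above T (- M) U)" and t: "t \<in> {0<..T}" and r: "r \<in> \<P>"
  have "w t (r, x) - \<Psi> t r x - \<epsilon> \<le> U t r x"
   by (rule super_above[OF conjunct1[OF U] conjunct2[OF U, rule_format] pen \<epsilon> lip wN jet fin t r])
  then show "w t (r, x) - \<epsilon> * G r x \<le> U t r x" using g[OF sub01[OF t] r, of x] by linarith
 next
  fix U and t :: real and r x :: "real ^ 'n" assume UU: "sub U \<and> (below T U M)"
   and t: "t \<in> {0<..T}" and r: "r \<in> \<P>"
  note U = conjunct1[OF UU] and UM = conjunct2[OF UU, rule_format]
  have penM: "penalty \<epsilon> M c R \<Psi>" by (rule pen_mono) (use N in simp)
  let ?D = "\<P> \<times> UNIV :: ((real ^ 'n) \<times> (real ^ 'n)) set"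
  \<comment> \<open>The quarter subtracted here covers the gap between \<open>h\<close> and its
    extension \<open>hh\<close> at the horizon.\<close>
  let ?U = "\<lambda>t z. U t (fst z) (snd z) - \<Psi> t (fst z) (snd z) - \<epsilon> / 4"
  have "S.CP ?D ?U"
   unfolding S.CP_def
  proof (intro ballI allI impI)
   fix V s s' w' K' z t
   assume V: "V \<in> cball 0 l" and z: "z \<in> ?D" and t: "t \<in> {s..s'}" and
    *: "0 < s \<and> s < s' \<and> s' \<le> T \<and>
     (\<forall>t\<in>{s..s'}. \<forall>t'\<in>{s..s'}. \<forall>z z'. \<bar>w' t z - w' t' z'\<bar> \<le> K' * (\<bar>t - t'\<bar> + norm (z - z'))) \<and>
     (\<forall>t\<in>{s..s'}. \<forall>z. 0 \<le> w' t z) \<and>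
     (\<forall>t\<in>{s<..<s'}. \<forall>z. \<exists>a p Q. has_jet w' t z a p Q \<and> a + p (b V z) + half_trace Q + f t V z \<le> 0) \<and>
     (\<forall>z\<in>?D. ?U s' z \<le> w' s' z)"
   note R1 = conjunct2[OF *] note R2 = conjunct2[OF R1] note R3 = conjunct2[OF R2] note R4 = conjunct2[OF R3] note R5 = conjunct2[OF R4]
   note s = conjunct1[OF *] conjunct1[OF R1] conjunct1[OF R2]
   note l = conjunct1[OF R3] and p = conjunct1[OF R4] and j = conjunct1[OF R5] and fi = conjunct2[OF R5]
   have "U t (fst z) (snd z) - \<Psi> t (fst z) (snd z) - \<epsilon> / 4 \<le> w' t (fst z, snd z)"
   proof (rule sub_below_barrier[OF U UM penM \<epsilon> V s l p _ _ _ t])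
    show "\<exists>a p Q. has_jet w' t (r, x) a p Q \<and> a + p (drift V r x) + half_trace Q + F t r x V \<le> \<epsilon> / 2"
     if t: "t \<in> {s<..<s'}" and z: "(r, x) \<in> cylinder c R" for t r x
    proof -
     obtain a p Q where j: "has_jet w' t (r, x) a p Q"
      and je: "a + p (b V (r, x)) + half_trace Q + f t V (r, x) \<le> 0"
      using j[rule_format, OF t, of "(r, x)"] by blast
     have "a + p (drift V r x) + half_trace Q + F t r x V \<le> \<epsilon> / 2"
      using je ff[of t V r x] V t s cyl[OF z] \<epsilon> unfolding bd[OF cyl[OF z]] by simp
     then show ?thesis using j by blast
    qed
    show "U s' r x - \<Psi> s' r x - \<epsilon> / 4 \<le> w' s' (r, x)" if "r \<in> \<P>" for r x
     using fi[rule_format, of "(r, x)"] that by simp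
    show "fst z \<in> \<P>" using z by auto
   qed (use \<epsilon> in auto)
   then show "?U t z \<le> w' t z" by simp
  qed
  moreover have "\<forall>z\<in>?D. ?U T z \<le> hh z"
  proof clarify
   fix r x :: "real ^ 'n" assume r: "r \<in> \<P>"
   have TT: "T \<in> {0<..T}" "T \<in> {0..T}" using T_pos by auto
   have Uh: "U T r x \<le> h r x" using U r unfolding viscosity_subsolution_def by blast
   show "?U T (r, x) \<le> hh (r, x)"
   proof (cases "\<Psi> T r x \<le> M")
    case True
    then show ?thesis using hf[OF cyl[OF penaltyD(5)[OF penM TT(2) r]]] Uh penaltyD(4)[OF pen r, of T x] by fastforce
   next
    case False
    then show ?thesis using UM[OF TT(1) r, of x] S.h_bounds(1)[of "(r, x)"] \<epsilon> by simp
   qed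
  qed
  ultimately have "\<forall>t\<in>{0<..T}. \<forall>z\<in>?D. ?U t z \<le> w t z + \<epsilon> / 4" by (rule wU)
  then have "?U t (r, x) \<le> w t (r, x) + \<epsilon> / 4" using t r by blast
  then show "U t r x \<le> w t (r, x) + \<epsilon> * G r x" using \<epsilon> g[OF sub01[OF t] r, of x] by simp
 qed
qed

end

subsection \<open>Perron's method\<close>

lemma C112_add:
 fixes \<phi> \<psi> :: "real \<Rightarrow> real ^ 'n::finite \<Rightarrow> real ^ 'n \<Rightarrow> real"
 assumes \<phi>: "C112_on T \<phi>" and \<psi>: "C112_on T \<psi>"
 defines "\<theta> \<equiv> \<lambda>t r x. \<phi> t r x + \<psi> t r x"
 shows "C112_on T \<theta>"
  and "\<And>t r x. t \<in> {0<..<T} \<Longrightarrow> r \<in> \<P> \<Longrightarrow> deriv (\<lambda>s. \<theta> s r x) t = deriv (\<lambda>s. \<phi> s r x) t + deriv (\<lambda>s. \<psi> s r x) t"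
  and "\<And>t r x. t \<in> {0<..<T} \<Longrightarrow> r \<in> \<P> \<Longrightarrow> simplex_derivative (\<lambda>r. \<theta> t r x) r
   = simplex_derivative (\<lambda>r. \<phi> t r x) r + simplex_derivative (\<lambda>r. \<psi> t r x) r"
  and "\<And>t r x. t \<in> {0<..<T} \<Longrightarrow> r \<in> \<P> \<Longrightarrow> D_x (\<theta> t) r x = D_x (\<phi> t) r x + D_x (\<psi> t) r x"
  and "\<And>t r x. t \<in> {0<..<T} \<Longrightarrow> r \<in> \<P> \<Longrightarrow> D2_x (\<theta> t) r x = D2_x (\<phi> t) r x + D2_x (\<psi> t) r x"
proof -
 note d1 = C112_derivatives[OF \<phi>] and d2 = C112_derivatives[OF \<psi>]
 have a: "((\<lambda>s. \<theta> s r x) has_real_derivative deriv (\<lambda>s. \<phi> s r x) t + deriv (\<lambda>s. \<psi> s r x) t) (at t)"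
  if "t \<in> {0<..<T}" "r \<in> \<P>" for t r x unfolding \<theta>_def by (rule DERIV_add[OF d1(1)[OF that] d2(1)[OF that]])
 have b: "has_simplex_derivative (\<lambda>r. \<theta> t r x) (simplex_derivative (\<lambda>r. \<phi> t r x) r + simplex_derivative (\<lambda>r. \<psi> t r x) r) r"
  if "t \<in> {0<..<T}" "r \<in> \<P>" for t r x
  using d1(2)[OF that, of x] d2(2)[OF that, of x] unfolding has_simplex_derivative_iff[OF that(2)] \<theta>_def
  by (auto simp: sum.distrib inner_add_left intro!: DERIV_add)
 have c: "(\<theta> t r has_derivative (\<lambda>v. (D_x (\<phi> t) r x + D_x (\<psi> t) r x) \<bullet> v)) (at x)"
  if "t \<in> {0<..<T}" "r \<in> \<P>" for t r x
  using has_derivative_add[OF d1(3)[OF that] d2(3)[OF that]] unfolding \<theta>_def inner_add_left .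
 have g: "grad (\<theta> t r) = (\<lambda>x. grad (\<phi> t r) x + grad (\<psi> t r) x)" if "t \<in> {0<..<T}" "r \<in> \<P>" for t r
  using grad_unique[OF c[OF that]] unfolding D_x_def by blast
 have e: "(grad (\<theta> t r) has_derivative (\<lambda>v. (D2_x (\<phi> t) r x + D2_x (\<psi> t) r x) *v v)) (at x)"
  if "t \<in> {0<..<T}" "r \<in> \<P>" for t r x
  unfolding g[OF that] matrix_vector_mult_add_rdistrib by (rule has_derivative_add[OF d1(4)[OF that] d2(4)[OF that]])
 show 1: "deriv (\<lambda>s. \<theta> s r x) t = deriv (\<lambda>s. \<phi> s r x) t + deriv (\<lambda>s. \<psi> s r x) t"
  if "t \<in> {0<..<T}" "r \<in> \<P>" for t r x by (rule DERIV_imp_deriv[OF a[OF that]])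
 show 2: "simplex_derivative (\<lambda>r. \<theta> t r x) r = simplex_derivative (\<lambda>r. \<phi> t r x) r + simplex_derivative (\<lambda>r. \<psi> t r x) r"
  if "t \<in> {0<..<T}" "r \<in> \<P>" for t r x by (rule simplex_derivative_eq[OF that(2) b[OF that]])
 show 3: "D_x (\<theta> t) r x = D_x (\<phi> t) r x + D_x (\<psi> t) r x"
  if "t \<in> {0<..<T}" "r \<in> \<P>" for t r x unfolding D_x_def[of "\<theta> t"] by (rule grad_unique[OF c[OF that]])
 show 4: "D2_x (\<theta> t) r x = D2_x (\<phi> t) r x + D2_x (\<psi> t) r x"
  if "t \<in> {0<..<T}" "r \<in> \<P>" for t r x unfolding D2_x_def[of "\<theta> t"] by (rule hessian_unique[OF e[OF that]])
 let ?D = "{0<..<T} \<times> (\<P> :: (real ^ 'n) set) \<times> (UNIV :: (real ^ 'n) set)"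
 have cc: "continuous_on ?D f" if "continuous_on ?D f1" "continuous_on ?D f2" "\<And>t r x. t \<in> {0<..<T} \<Longrightarrow> r \<in> \<P> \<Longrightarrow> f (t, r, x) = f1 (t, r, x) + f2 (t, r, x)"
  for f f1 f2 :: "real \<times> (real ^ 'n) \<times> (real ^ 'n) \<Rightarrow> 'b::real_normed_vector"
  by (rule continuous_on_eq[OF continuous_on_add[OF that(1,2)]]) (use that(3) in auto)
 note c1 = \<phi>[unfolded C112_on_def Let_def, THEN conjunct2] and c2 = \<psi>[unfolded C112_on_def Let_def, THEN conjunct2]
 note c1' = c1[THEN conjunct2] and c2' = c2[THEN conjunct2]
 note c1'' = c1'[THEN conjunct2] and c2'' = c2'[THEN conjunct2]
 note c1''' = c1''[THEN conjunct2] and c2''' = c2''[THEN conjunct2]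
 show "C112_on T \<theta>"
  unfolding C112_on_def Let_def
 proof (intro conjI)
  show "\<forall>(t, r, x)\<in>?D. (\<lambda>s. \<theta> s r x) differentiable at t \<and> (\<exists>p. has_simplex_derivative (\<lambda>r. \<theta> t r x) p r) \<and> twice_differentiable_at (\<theta> t r) x"
  proof clarify
   fix t :: real and r x :: "real ^ 'n" assume that: "t \<in> {0<..<T}" "r \<in> \<P>"
   have "(\<lambda>s. \<theta> s r x) differentiable at t" using a[OF that] real_differentiable_def by blast
   moreover have "\<theta> t r differentiable at y" for y using c[OF that] unfolding differentiable_def by blast
   moreover have "grad (\<theta> t r) differentiable at x" using e[OF that] unfolding differentiable_def by blast
   ultimately show "(\<lambda>s. \<theta> s r x) differentiable at t \<and> (\<exists>p. has_simplex_derivative (\<lambda>r. \<theta> t r x) p r) \<and> twice_differentiable_at (\<theta> t r) x"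
    using b[OF that] unfolding twice_differentiable_at_def by auto
  qed
  show "continuous_on ?D (\<lambda>(t, r, x). \<theta> t r x)"
   by (rule cc[OF c1[THEN conjunct1] c2[THEN conjunct1]]) (simp add: \<theta>_def)
  show "continuous_on ?D (\<lambda>(t, r, x). deriv (\<lambda>s. \<theta> s r x) t)"
   by (rule cc[OF c1'[THEN conjunct1] c2'[THEN conjunct1]]) (simp add: 1)
  show "continuous_on ?D (\<lambda>(t, r, x). simplex_derivative (\<lambda>r. \<theta> t r x) r)"
   by (rule cc[OF c1''[THEN conjunct1] c2''[THEN conjunct1]]) (simp add: 2)
  show "continuous_on ?D (\<lambda>(t, r, x). D_x (\<theta> t) r x)"
   by (rule cc[OF c1'''[THEN conjunct1] c2'''[THEN conjunct1]]) (simp add: 3)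
  show "continuous_on ?D (\<lambda>(t, r, x). D2_x (\<theta> t) r x)"
   by (rule cc[OF c1'''[THEN conjunct2] c2'''[THEN conjunct2]]) (simp add: 4)
 qed
qed

lemma locally_lipschitz_continuous:
 fixes f :: "real ^ 'n::finite \<Rightarrow> real ^ 'n \<Rightarrow> real ^ 'n"
 assumes f: "\<And>i. locally_lipschitz E (\<lambda>r x. f r x $ i)"
 shows "continuous_on (\<P> \<times> UNIV) (\<lambda>(r, x). f r x)"
 unfolding continuous_on_iff
proof clarify
 fix r0 x0 :: "real ^ 'n" and e :: real assume r0: "r0 \<in> \<P>" and e: "0 < e"
 obtain c where c: "0 < c" "r0 \<in> simplex_core c" "\<And>r. r \<in> \<P> \<Longrightarrow> norm (r - r0) \<le> c \<Longrightarrow> r \<in> simplex_core c"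
  by (rule simplex_core_neighbourhood[OF r0]) (rule that)
 have R: "0 \<le> norm x0 + 1" by simp
 obtain L where L: "0 < L" "\<And>r \<mu> x y. r \<in> simplex_core c \<Longrightarrow> \<mu> \<in> simplex_core c \<Longrightarrow> norm x \<le> norm x0 + 1 \<Longrightarrow> norm y \<le> norm x0 + 1 \<Longrightarrow>
   norm (f r x - f \<mu> y) \<le> L * (norm (r - \<mu>) + norm (x - y))"
  by (rule locally_lipschitz_core_vec[OF f c(1) R]) (rule that)
 show "\<exists>d>0. \<forall>z\<in>\<P> \<times> UNIV. dist z (r0, x0) < d \<longrightarrow> dist (case z of (r, x) \<Rightarrow> f r x) (f r0 x0) < e"
 proof (intro exI[of _ "min (min c 1) (e / (2 * L))"] conjI ballI impI)
  show "0 < min (min c 1) (e / (2 * L))" using c L e by simp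
  fix z :: "(real ^ 'n) \<times> (real ^ 'n)" assume z: "z \<in> \<P> \<times> UNIV" and d: "dist z (r0, x0) < min (min c 1) (e / (2 * L))"
  obtain r x where zz: "z = (r, x)" by (metis surj_pair)
  have le: "norm (r - r0) \<le> dist z (r0, x0)" "norm (x - x0) \<le> dist z (r0, x0)"
   using dist_fst_le[of z "(r0, x0)"] dist_snd_le[of z "(r0, x0)"] unfolding zz by (simp_all add: dist_norm)
  have "r \<in> simplex_core c" using le d z unfolding zz by (intro c(3)) auto
  moreover have "norm x \<le> norm x0 + 1" using norm_triangle_sub[of x x0] le d by simp
  ultimately have "norm (f r x - f r0 x0) \<le> L * (norm (r - r0) + norm (x - x0))" using c(2) by (intro L(2)) auto
  also have "\<dots> \<le> L * (2 * dist z (r0, x0))" using le L(1) by (intro mult_left_mono) auto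
  also have "\<dots> < e" using d L(1) by (simp add: pos_less_divide_eq mult_ac)
  finally show "dist (case z of (r, x) \<Rightarrow> f r x) (f r0 x0) < e" unfolding zz by (simp add: dist_norm)
 qed
qed

definition bump :: "real \<Rightarrow> real ^ 'n::finite \<Rightarrow> real ^ 'n \<Rightarrow> real \<Rightarrow> real ^ 'n \<Rightarrow> real ^ 'n \<Rightarrow> real" where
 "bump t0 r0 x0 t r x = (t - t0)\<^sup>2 + (norm (r - r0))\<^sup>2 + (norm (x - x0))\<^sup>2"

lemma quad_bump: "quad t0 r0 x0 0 0 0 0 k k t r x = k * bump t0 r0 x0 t r x"
 unfolding quad_def bump_def by (simp add: algebra_simps)

lemma bump_centre [simp]: "bump t0 r0 x0 t0 r0 x0 = 0"
 unfolding bump_def by simp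

lemma bump_nonneg: "0 \<le> bump t0 r0 x0 t r x"
 unfolding bump_def by simp

lemma bump_le:
 assumes "bump t0 r0 x0 t r x \<le> a\<^sup>2" "0 \<le> a"
 shows "\<bar>t - t0\<bar> \<le> a" "norm (r - r0) \<le> a" "norm (x - x0) \<le> a"
proof -
 have "\<bar>t - t0\<bar>\<^sup>2 \<le> a\<^sup>2" "(norm (r - r0))\<^sup>2 \<le> a\<^sup>2" "(norm (x - x0))\<^sup>2 \<le> a\<^sup>2"
  using assms(1) zero_le_power2[of "t - t0"] zero_le_power2[of "norm (r - r0)"] zero_le_power2[of "norm (x - x0)"]
  unfolding bump_def power2_abs by linarith+
 then show "\<bar>t - t0\<bar> \<le> a" "norm (r - r0) \<le> a" "norm (x - x0) \<le> a" using assms(2) power2_le_imp_le by blast+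
qed

lemma continuous_on_bump: "continuous_on S (\<lambda>(t, r, x). bump t0 r0 x0 t r x)"
 unfolding bump_def case_prod_unfold by (intro continuous_intros)

lemma bump_near:
 assumes "bump t1 r1 x1 t0 r0 x0 < a"
 shows "near T t0 r0 x0 (\<lambda>t r x. bump t1 r1 x1 t r x < a)"
proof (rule eventually_near)
 show "bump t1 r1 x1 t0 r0 x0 < a" by (rule assms)
 have "continuous_on UNIV (\<lambda>(t, r, x). bump t1 r1 x1 t r x)" by (rule continuous_on_bump)
 then have "((\<lambda>(t, r, x). bump t1 r1 x1 t r x) \<longlongrightarrow> (\<lambda>(t, r, x). bump t1 r1 x1 t r x) (t0, r0, x0)) (at (t0, r0, x0) within UNIV)"
  unfolding continuous_on_def by (rule bspec) simp
 from tendsto_within_subset[OF this subset_UNIV]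
 have "((\<lambda>(t, r, x). bump t1 r1 x1 t r x) \<longlongrightarrow> bump t1 r1 x1 t0 r0 x0) (at (t0, r0, x0) within \<D> T)"
  by (simp only: prod.case)
 from order_tendstoD(2)[OF this assms]
 show "\<forall>\<^sub>F (t, r, x) in at (t0, r0, x0) within \<D> T. bump t1 r1 x1 t r x < a"
  by (simp only: case_prod_unfold)
qed

context hjb
begin

lemma sandwich_exists:
 obtains N G where "0 \<le> N" "continuous_on (\<P> \<times> UNIV) (\<lambda>(r, x). G r x)" "\<And>r x. r \<in> \<P> \<Longrightarrow> 0 \<le> G r x"
  "\<And>\<epsilon> M. 0 < \<epsilon> \<Longrightarrow> 0 \<le> M \<Longrightarrow> \<exists>W S. sandwich N G \<epsilon> M W S"
proof -
 obtain B where B: "0 \<le> B" and hB: "\<And>r x. r \<in> \<P> \<Longrightarrow> h r x \<le> B"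
  and FB: "\<And>t r x V. t \<in> {0..T} \<Longrightarrow> r \<in> \<P> \<Longrightarrow> V \<in> cball 0 l \<Longrightarrow> F t r x V \<le> B"
  by (rule cost_bound) (rule that)
 obtain G where Gc: "continuous_on (\<P> \<times> UNIV) (\<lambda>(r, x). G r x)" and G0: "\<And>r x. r \<in> \<P> \<Longrightarrow> 0 \<le> G r x"
  and Gp: "\<And>\<epsilon> M. 0 < \<epsilon> \<Longrightarrow> 0 \<le> M \<Longrightarrow> \<exists>\<Psi> c R. penalty \<epsilon> M c R \<Psi> \<and> (\<forall>t\<in>{0..T}. \<forall>r\<in>\<P>. \<forall>x. \<Psi> t r x \<le> \<epsilon> * G r x)"
  by (rule penalty_exists) (rule that)
 let ?N = "B + 3 * T * B"
 have N: "0 \<le> ?N" using B T_pos by simp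
 show thesis
 \<comment> \<open>The added 1 lets \<open>\<epsilon> * (G r x + 1)\<close> cover the penalty
   together with the additive error \<open>\<epsilon>\<close>.\<close>
 proof (rule that[of ?N "\<lambda>r x. G r x + 1"])
  show "0 \<le> ?N" by (rule N)
  show "continuous_on (\<P> \<times> UNIV) (\<lambda>(r, x). G r x + 1)"
   using continuous_on_add[OF Gc continuous_on_const[of _ 1]] by (simp add: case_prod_unfold)
  show "0 \<le> G r x + 1" if "r \<in> \<P>" for r x using G0[OF that, of x] by simp
  fix \<epsilon> M :: real assume \<epsilon>: "0 < \<epsilon>" and M: "0 \<le> M"
  have MN: "0 \<le> M + ?N" using M N by simp
  obtain \<Psi> c R where pen: "penalty \<epsilon> (M + ?N) c R \<Psi>" and \<Psi>G: "\<forall>t\<in>{0..T}. \<forall>r\<in>\<P>. \<forall>x. \<Psi> t r x \<le> \<epsilon> * G r x"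
   using Gp[OF \<epsilon> MN] by blast
  have "\<Psi> t r x + \<epsilon> \<le> \<epsilon> * (G r x + 1)" if "t \<in> {0..T}" "r \<in> \<P>" for t r x
   using \<Psi>G that by (simp add: distrib_left)
  then show "\<exists>W S. sandwich ?N (\<lambda>r x. G r x + 1) \<epsilon> M W S"
   by (intro approximate_solution[OF B _ _ \<epsilon> M pen] hB FB)
 qed
qed

text \<open>The operator for one frozen control. Unlike the infimum it is visibly continuous jointly
  in the point and the control.\<close>

definition opV :: "(real \<Rightarrow> real ^ 'n \<Rightarrow> real ^ 'n \<Rightarrow> real) \<Rightarrow> real \<Rightarrow> real ^ 'n \<Rightarrow> real ^ 'n \<Rightarrow> real ^ 'n \<Rightarrow> real" where
 "opV \<phi> t r x V = deriv (\<lambda>s. \<phi> s r x) t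
  + Hval t r x (simplex_derivative (\<lambda>r. \<phi> t r x) r) (D_x (\<phi> t) r x) (D2_x (\<phi> t) r x) V"

lemma D_H0_continuous:
 "continuous_on (\<P> \<times> UNIV) (\<lambda>(r, x). D_\<rho> H0 r x)"
 "continuous_on (\<P> \<times> UNIV) (\<lambda>(r, x). D_x H0 r x)"
proof -
 have "\<And>i. locally_lipschitz E (\<lambda>r x. D_\<rho> H0 r x $ i)" "\<And>i. locally_lipschitz E (\<lambda>r x. D_x H0 r x $ i)"
  using energy unfolding admissible_energy_def by blast+
 then show "continuous_on (\<P> \<times> UNIV) (\<lambda>(r, x). D_\<rho> H0 r x)"
  "continuous_on (\<P> \<times> UNIV) (\<lambda>(r, x). D_x H0 r x)" using locally_lipschitz_continuous by blast+
qed

lemma opV_continuous: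
 assumes \<phi>: "C112_on T \<phi>"
 shows "continuous_on ({0<..<T} \<times> \<P> \<times> UNIV \<times> cball 0 l) (\<lambda>(t, r, x, V). opV \<phi> t r x V)"
proof -
 let ?S = "{0<..<T} \<times> (\<P> :: (real ^ 'n) set) \<times> (UNIV :: (real ^ 'n) set) \<times> cball (0 :: real ^ 'n) l"
 let ?p = "\<lambda>z :: real \<times> (real ^ 'n) \<times> (real ^ 'n) \<times> (real ^ 'n). (fst z, fst (snd z), fst (snd (snd z)))"
 let ?q = "\<lambda>z :: real \<times> (real ^ 'n) \<times> (real ^ 'n) \<times> (real ^ 'n). (fst (snd z), fst (snd (snd z)))"
 note c1 = \<phi>[unfolded C112_on_def Let_def, THEN conjunct2, THEN conjunct2] note c2 = c1[THEN conjunct2] note c3 = c2[THEN conjunct2]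
 have p: "continuous_on ?S (\<lambda>z. f (?p z))" if "continuous_on (\<D> T) f" for f :: "_ \<Rightarrow> 'b::topological_space"
  by (rule continuous_on_compose2[OF that]) (auto intro!: continuous_intros)
 have q: "continuous_on ?S (\<lambda>z. f (?q z))" if "continuous_on (\<P> \<times> UNIV) f" for f :: "_ \<Rightarrow> 'b::topological_space"
  by (rule continuous_on_compose2[OF that]) (auto intro!: continuous_intros)
 note k = p[OF c1[THEN conjunct1]] p[OF c2[THEN conjunct1]] p[OF c3[THEN conjunct1]] p[OF c3[THEN conjunct2]]
  q[OF D_H0_continuous(1)] q[OF D_H0_continuous(2)]
 have k7: "continuous_on ?S (\<lambda>(s, r, x, V). F s r x V)" by (rule continuous_on_subset[OF F_continuous]) auto
 show ?thesis
  unfolding opV_def Hval_def case_prod_unfold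
  by (intro continuous_intros k[unfolded case_prod_unfold fst_conv snd_conv] k7[unfolded case_prod_unfold]) auto
qed

text \<open>At its centre the bump has vanishing first derivatives and Hessian
  \<open>2 * mat 1\<close>, so only the noise term changes.\<close>

lemma opV_bump:
 assumes \<phi>: "C112_on T \<phi>" and t0: "t0 \<in> {0<..<T}" and r0: "r0 \<in> \<P>"
 shows "C112_on T (\<lambda>t r x. \<phi> t r x + k * bump t0 r0 x0 t r x)"
  "opV (\<lambda>t r x. \<phi> t r x + k * bump t0 r0 x0 t r x) t0 r0 x0 V = opV \<phi> t0 r0 x0 V + k * (\<Sum>i\<in>UNIV. (\<sigma> $ i)\<^sup>2)"
proof -
 let ?q = "quad t0 r0 x0 0 0 0 (0 :: real ^ 'n ^ 'n) k k"
 have Q: "transpose (0 :: real ^ 'n ^ 'n) = 0" by (simp add: transpose_def vec_eq_iff)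
 note C = C112_add[OF \<phi> quad_C112(1)[OF Q, of T t0 r0 x0 0 0 0 k k]]
 have e: "(\<lambda>t r x. \<phi> t r x + k * bump t0 r0 x0 t r x) = (\<lambda>t r x. \<phi> t r x + ?q t r x)" unfolding quad_bump ..
 show "C112_on T (\<lambda>t r x. \<phi> t r x + k * bump t0 r0 x0 t r x)" unfolding e by (rule C(1))
 have "opV (\<lambda>t r x. \<phi> t r x + ?q t r x) t0 r0 x0 V = deriv (\<lambda>s. \<phi> s r0 x0) t0
  + Hval t0 r0 x0 (tangential 0 + simplex_derivative (\<lambda>r. \<phi> t0 r x0) r0) (D_x (\<phi> t0) r0 x0) (D2_x (\<phi> t0) r0 x0 + (2 * k) *\<^sub>R mat 1) V"
  unfolding opV_def C(2-5)[OF t0 r0] quad_C112(2,4,5)[OF Q] quad_C112(3)[OF Q r0] by (simp add: add.commute)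
 also have "tangential (0 :: real ^ 'n) = 0" by (simp add: tangential_def vec_eq_iff)
 also have "deriv (\<lambda>s. \<phi> s r0 x0) t0
  + Hval t0 r0 x0 (0 + simplex_derivative (\<lambda>r. \<phi> t0 r x0) r0) (D_x (\<phi> t0) r0 x0) (D2_x (\<phi> t0) r0 x0 + (2 * k) *\<^sub>R mat 1) V
  = opV \<phi> t0 r0 x0 V + k * (\<Sum>i\<in>UNIV. (\<sigma> $ i)\<^sup>2)"
  unfolding opV_def Hval_def
  by (simp add: mat_def distrib_left sum.distrib sum_distrib_left add_divide_distrib sum_divide_distrib mult_ac)
 finally show "opV (\<lambda>t r x. \<phi> t r x + k * bump t0 r0 x0 t r x) t0 r0 x0 V = opV \<phi> t0 r0 x0 V + k * (\<Sum>i\<in>UNIV. (\<sigma> $ i)\<^sup>2)"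
  unfolding e .
qed

text \<open>Uniform continuity on a compact set that contains the whole control ball yields one
  radius for all controls; this is needed when a sign has to hold for the infimum near the
  point.\<close>

lemma opV_local:
 assumes \<phi>: "C112_on T \<phi>" and t0: "t0 \<in> {0<..<T}" and r0: "r0 \<in> \<P>" and e: "0 < e"
 obtains c R where "0 < c" "0 < R" "\<And>t r x V. r \<in> \<P> \<Longrightarrow> V \<in> cball 0 l \<Longrightarrow> bump t0 r0 x0 t r x \<le> R\<^sup>2 \<Longrightarrow>
  t \<in> {0<..<T} \<and> r \<in> simplex_core c \<and> \<bar>opV \<phi> t r x V - opV \<phi> t0 r0 x0 V\<bar> < e"
proof -
 obtain c where c: "0 < c" "r0 \<in> simplex_core c" "\<And>r. r \<in> \<P> \<Longrightarrow> norm (r - r0) \<le> c \<Longrightarrow> r \<in> simplex_core c"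
  by (rule simplex_core_neighbourhood[OF r0]) (rule that)
 define d where "d = min t0 (T - t0) / 2"
 have d: "0 < d" "2 * d \<le> t0" "2 * d \<le> T - t0" unfolding d_def using t0 by auto
 let ?S = "{t0 - d..t0 + d} \<times> (simplex_core c :: (real ^ 'n) set) \<times> cball x0 1 \<times> cball (0 :: real ^ 'n) l"
 have "compact ?S" by (intro compact_Times compact_Icc compact_simplex_core c compact_cball)
 moreover have sub: "?S \<subseteq> {0<..<T} \<times> \<P> \<times> UNIV \<times> cball 0 l" using d simplex_core_subset[OF c(1)] t0 by auto
 ultimately have "uniformly_continuous_on ?S (\<lambda>(t, r, x, V). opV \<phi> t r x V)"
  using compact_uniformly_continuous[OF continuous_on_subset[OF opV_continuous[OF \<phi>] sub]] by blast
 then obtain R where R: "0 < R" "\<And>z z'. z \<in> ?S \<Longrightarrow> z' \<in> ?S \<Longrightarrow> dist z' z < R \<Longrightarrow> dist ((\<lambda>(t, r, x, V). opV \<phi> t r x V) z') ((\<lambda>(t, r, x, V). opV \<phi> t r x V) z) < e"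
  using e unfolding uniformly_continuous_on_def by metis
 let ?R = "min (min d c) (min 1 (R / 4))"
 have R0: "0 < ?R" using d c R by simp
 show thesis
 proof (rule that[OF c(1) R0])
  fix t :: real and r x V :: "real ^ 'n" assume r: "r \<in> \<P>" and V: "V \<in> cball 0 l" and b: "bump t0 r0 x0 t r x \<le> ?R\<^sup>2"
  note n = bump_le[OF b less_imp_le[OF R0]]
  have m: "\<bar>t - t0\<bar> \<le> d" "norm (r - r0) \<le> c" "norm (x - x0) \<le> 1" using n by simp_all
  have t: "t \<in> {t0 - d..t0 + d}" using m(1) by (simp add: abs_le_iff)
  have rc: "r \<in> simplex_core c" by (rule c(3)[OF r m(2)])
  have z: "(t, r, x, V) \<in> ?S" "(t0, r0, x0, V) \<in> ?S" using t rc c(2) V m(3) d(1) by (auto simp: dist_norm norm_minus_commute)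
  have "dist (t, r, x, V) (t0, r0, x0, V) = norm (t - t0, r - r0, x - x0, 0 :: real ^ 'n)" unfolding dist_norm by simp
  also have "\<dots> \<le> norm (t - t0) + (norm (r - r0) + (norm (x - x0) + norm (0 :: real ^ 'n)))"
   using norm_Pair_le[of "t - t0" "(r - r0, x - x0, 0 :: real ^ 'n)"] norm_Pair_le[of "r - r0" "(x - x0, 0 :: real ^ 'n)"]
    norm_Pair_le[of "x - x0" "0 :: real ^ 'n"] by linarith
  also have "\<dots> < R" using n R(1) by simp
  finally show "t \<in> {0<..<T} \<and> r \<in> simplex_core c \<and> \<bar>opV \<phi> t r x V - opV \<phi> t0 r0 x0 V\<bar> < e"
   using R(2)[OF z(2,1)] rc t d t0 by (simp add: dist_real_def)
 qed
qed

end

lemma le_from_scaled_errors: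
 fixes a b g :: real
 assumes "\<And>\<epsilon>. 0 < \<epsilon> \<Longrightarrow> a \<le> b + \<epsilon> * g" "0 \<le> g"
 shows "a \<le> b"
proof (rule field_le_epsilon)
 fix e :: real assume e: "0 < e"
 have "e / (g + 1) * g \<le> e / (g + 1) * (g + 1)" using e assms(2) by (intro mult_left_mono) auto
 also have "\<dots> = e" using assms(2) by simp
 finally show "a \<le> b + e" using assms(1)[of "e / (g + 1)"] e assms(2) by simp
qed

lemma divide_mult_cancel: "b \<noteq> 0 \<Longrightarrow> a / b * b = (a :: real)"
 by simp

lemma nearE:
 assumes "near T t0 r0 x0 P"
 obtains d where "0 < d" "\<And>t r x. t \<in> {0<..<T} \<Longrightarrow> r \<in> \<P> \<Longrightarrow> \<bar>t - t0\<bar> < d \<Longrightarrow> norm (r - r0) < d \<Longrightarrow> norm (x - x0) < d \<Longrightarrow> P t r x"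
 using assms unfolding near_def by blast

context hjb
begin

lemma operator_le_opV:
 assumes "t \<in> {0<..<T}" "r \<in> \<P>" "V \<in> cball 0 l"
 shows "op \<phi> t r x \<le> opV \<phi> t r x V"
 unfolding opV_def using operator_le[of t r V \<phi> x] assms by simp

text \<open>The bump makes the touching of \<open>u\<close> strict. A member that nearly attains
  \<open>u\<close> at the centre then attains its maximum against the perturbed test function inside
  the small ball, where the operator for \<open>V\<close> would be negative. Only the member chosen
  at the centre is used, not an envelope, since \<open>u\<close> is known to be continuous.\<close>

lemma sub_Sup:
 fixes \<S> :: "(real \<Rightarrow> real ^ 'n \<Rightarrow> real ^ 'n \<Rightarrow> real) set"
 assumes sub: "\<And>S. S \<in> \<S> \<Longrightarrow> sub S"
  and le: "\<And>S t r x. S \<in> \<S> \<Longrightarrow> t \<in> {0<..T} \<Longrightarrow> r \<in> \<P> \<Longrightarrow> S t r x \<le> u t r x"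
  and app: "\<And>t r x e. t \<in> {0<..T} \<Longrightarrow> r \<in> \<P> \<Longrightarrow> 0 < e \<Longrightarrow> \<exists>S\<in>\<S>. u t r x - e < S t r x"
  and cont: "continuous_on (\<Q> T) (\<lambda>(t, r, x). u t r x)"
  and fin: "\<And>r x. r \<in> \<P> \<Longrightarrow> u T r x \<le> h r x"
 shows "sub u"
 unfolding viscosity_subsolution_def
proof (intro conjI allI ballI impI cont fin)
 fix \<phi> and t0 :: real and r0 x0 :: "real ^ 'n" assume \<phi>: "C112_on T \<phi>" and t0: "t0 \<in> {0<..<T}" and r0: "r0 \<in> \<P>"
  and ev: "\<forall>\<^sub>F (t, r, x) in at (t0, r0, x0) within \<D> T.
    u t r x - \<phi> t r x \<le> u t0 r0 x0 - \<phi> t0 r0 x0"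
 have "near T t0 r0 x0 (\<lambda>t r x. u t r x - \<phi> t r x \<le> u t0 r0 x0 - \<phi> t0 r0 x0)" by (rule eventually_near[OF ev]) simp
 then obtain d where d: "0 < d" and ud: "\<And>t r x. t \<in> {0<..<T} \<Longrightarrow> r \<in> \<P> \<Longrightarrow> \<bar>t - t0\<bar> < d \<Longrightarrow> norm (r - r0) < d \<Longrightarrow> norm (x - x0) < d
   \<Longrightarrow> u t r x - \<phi> t r x \<le> u t0 r0 x0 - \<phi> t0 r0 x0" by (rule nearE) (rule that)
 show "0 \<le> op \<phi> t0 r0 x0"
 proof (rule operator_ge[OF r0])
  fix V :: "real ^ 'n" assume V: "V \<in> cball 0 l"
  have "0 \<le> opV \<phi> t0 r0 x0 V"
  proof (rule ccontr)
   assume "\<not> 0 \<le> opV \<phi> t0 r0 x0 V"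
   define e where "e = - opV \<phi> t0 r0 x0 V"
   have e: "0 < e" unfolding e_def using \<open>\<not> 0 \<le> opV \<phi> t0 r0 x0 V\<close> by simp
   define s where "s = (\<Sum>i\<in>UNIV. (\<sigma> $ i)\<^sup>2)"
   have s: "0 \<le> s" unfolding s_def by (simp add: sum_nonneg)
   define k where "k = e / 2 / (s + 1)"
   have k: "0 < k" unfolding k_def using e s by simp
   have "k * s \<le> k * (s + 1)" using k by simp
   also have "k * (s + 1) = e / 2" unfolding k_def by (rule divide_mult_cancel) (use s in simp)
   finally have ks: "k * s \<le> e / 2" .
   let ?\<phi> = "\<lambda>t r x. \<phi> t r x + k * bump t0 r0 x0 t r x"
   note C = opV_bump(1)[OF \<phi> t0 r0, of k x0]
   have g0: "opV ?\<phi> t0 r0 x0 V \<le> - (e / 2)" unfolding opV_bump(2)[OF \<phi> t0 r0] using ks unfolding s_def[symmetric] e_def by linarith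
   have e2: "0 < e / 2" using e by simp
   obtain c R where c: "0 < c" and R: "0 < R" and loc: "\<And>t r x V. r \<in> \<P> \<Longrightarrow> V \<in> cball 0 l \<Longrightarrow> bump t0 r0 x0 t r x \<le> R\<^sup>2 \<Longrightarrow>
    t \<in> {0<..<T} \<and> r \<in> simplex_core c \<and> \<bar>opV ?\<phi> t r x V - opV ?\<phi> t0 r0 x0 V\<bar> < e / 2"
    by (rule opV_local[OF C t0 r0 e2]) (rule that)
   define a where "a = min R (d / 2)"
   have a: "0 < a" "a \<le> R" "a < d" unfolding a_def using R d by auto
   have ar: "a\<^sup>2 \<le> R\<^sup>2" using a by (intro power_mono) auto
   let ?B = "{t0 - a..t0 + a} \<times> (simplex_core c :: (real ^ 'n) set) \<times> cball x0 a"
   define C' where "C' = ?B \<inter> {z. (\<lambda>(t, r, x). bump t0 r0 x0 t r x) z \<le> a\<^sup>2}"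
   have "compact C'" unfolding C'_def
    by (intro compact_Int_closed compact_Times compact_Icc compact_simplex_core c compact_cball closed_Collect_le continuous_on_const continuous_on_bump)
   have inC: "(t, r, x) \<in> C'" if r: "r \<in> \<P>" and b: "bump t0 r0 x0 t r x \<le> a\<^sup>2" for t r x
   proof -
    have "bump t0 r0 x0 t r x \<le> R\<^sup>2" using b ar by linarith
    from loc[OF r V this] have "r \<in> simplex_core c" by blast
    moreover have "\<bar>t - t0\<bar> \<le> a" "norm (x - x0) \<le> a" using bump_le[OF b less_imp_le[OF a(1)]] by blast+
    ultimately show ?thesis unfolding C'_def using b by (simp add: abs_le_iff dist_norm norm_minus_commute)
   qed
   have Cd: "t \<in> {0<..<T}" "r \<in> \<P>" "bump t0 r0 x0 t r x \<le> a\<^sup>2" if "(t, r, x) \<in> C'" for t r x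
   proof -
    show r: "r \<in> \<P>" and b: "bump t0 r0 x0 t r x \<le> a\<^sup>2" using that simplex_core_subset[OF c] unfolding C'_def by auto
    have "bump t0 r0 x0 t r x \<le> R\<^sup>2" using b ar by linarith
    from loc[OF r V this] show "t \<in> {0<..<T}" by blast
   qed
   have Csub: "C' \<subseteq> \<D> T"
   proof
    fix z assume z: "z \<in> C'"
    obtain t r x where "z = (t, r, x)" by (metis prod_cases3)
    then show "z \<in> \<D> T" using Cd(1,2)[of t r x] z by simp
   qed
   have "0 < k * a\<^sup>2" using k a by simp
   moreover have t0': "t0 \<in> {0<..T}" using t0 by simp
   \<comment> \<open>The tolerance \<open>k * a\<^sup>2\<close> is the value of the perturbation on
     the boundary of the ball, so a maximiser there would contradict the choice of
     \<open>S\<close>.\<close>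
   ultimately obtain S where S: "S \<in> \<S>" and S0: "u t0 r0 x0 - k * a\<^sup>2 < S t0 r0 x0" using app[OF _ r0] by blast
   let ?g = "\<lambda>z. (\<lambda>(t, r, x). S t r x) z - (\<lambda>(t, r, x). ?\<phi> t r x) z"
   have "continuous_on C' ?g"
   proof (rule continuous_on_diff)
    show "continuous_on C' (\<lambda>(t, r, x). S t r x)"
     by (rule continuous_on_subset[OF sub_continuous[OF sub[OF S]]]) (use Csub in auto)
    show "continuous_on C' (\<lambda>(t, r, x). ?\<phi> t r x)"
     using C[unfolded C112_on_def Let_def, THEN conjunct2, THEN conjunct1] continuous_on_subset[OF _ Csub] by blast
   qed
   moreover have z0: "(t0, r0, x0) \<in> C'" by (rule inC[OF r0]) simp
   ultimately obtain z1 where z1: "z1 \<in> C'" and zm: "\<And>z. z \<in> C' \<Longrightarrow> ?g z \<le> ?g z1"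
    using continuous_attains_sup[OF \<open>compact C'\<close>] by blast
   obtain t1 r1 x1 where ze: "z1 = (t1, r1, x1)" by (metis prod_cases3)
   note D1 = Cd[OF z1[unfolded ze]]
   have m1: "S t r x - ?\<phi> t r x \<le> S t1 r1 x1 - ?\<phi> t1 r1 x1" if "(t, r, x) \<in> C'" for t r x
    using zm[OF that] unfolding ze by simp
   have b1: "bump t0 r0 x0 t1 r1 x1 < a\<^sup>2"
   proof (rule ccontr)
    assume "\<not> bump t0 r0 x0 t1 r1 x1 < a\<^sup>2"
    then have "bump t0 r0 x0 t1 r1 x1 = a\<^sup>2" using D1(3) by linarith
    then have kb: "k * bump t0 r0 x0 t1 r1 x1 = k * a\<^sup>2" by simp
    have "u t1 r1 x1 - \<phi> t1 r1 x1 \<le> u t0 r0 x0 - \<phi> t0 r0 x0"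
     using bump_le[OF D1(3) less_imp_le[OF a(1)]] a(3) by (intro ud[OF D1(1,2)]) linarith+
    moreover have "S t1 r1 x1 \<le> u t1 r1 x1" using le[OF S _ D1(2)] D1(1) by simp
    moreover have "S t0 r0 x0 - \<phi> t0 r0 x0 \<le> S t1 r1 x1 - (\<phi> t1 r1 x1 + k * bump t0 r0 x0 t1 r1 x1)" using m1[OF z0] by simp
    ultimately show False using S0 kb by linarith
   qed
   have "near T t1 r1 x1 (\<lambda>t r x. S t r x - ?\<phi> t r x \<le> S t1 r1 x1 - ?\<phi> t1 r1 x1)"
    by (rule near_mono[OF bump_near[OF b1]]) (use m1 inC in auto)
   then have "0 \<le> op ?\<phi> t1 r1 x1"
    using sub[OF S] C D1(1,2) near_eventually unfolding viscosity_subsolution_def by blast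
   also have "\<dots> \<le> opV ?\<phi> t1 r1 x1 V" by (rule operator_le_opV[OF D1(1,2) V])
   finally have "0 \<le> opV ?\<phi> t1 r1 x1 V" .
   moreover have "bump t0 r0 x0 t1 r1 x1 \<le> R\<^sup>2" using b1 ar by linarith
   then have "\<bar>opV ?\<phi> t1 r1 x1 V - opV ?\<phi> t0 r0 x0 V\<bar> < e / 2" using loc[OF D1(2) V] by blast
   ultimately show False using g0 by linarith
  qed
  then show "0 \<le> deriv (\<lambda>s. \<phi> s r0 x0) t0
   + Hval t0 r0 x0 (simplex_derivative (\<lambda>r. \<phi> t0 r x0) r0) (D_x (\<phi> t0) r0 x0) (D2_x (\<phi> t0) r0 x0) V" unfolding opV_def .
 qed
qed

text \<open>If the supersolution inequality failed, the test function lowered by a bump would be a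
  classical subsolution on a small ball. Raised slightly, it stays below \<open>u\<close> on the
  boundary of the ball but exceeds \<open>u\<close> at the centre, so the maximum of both is a
  larger subsolution. The ball avoids the terminal time, so the terminal inequality is kept.\<close>

lemma super_of_maximal_sub:
 assumes sub: "sub u" and bnd: "\<And>t r x. t \<in> {0<..T} \<Longrightarrow> r \<in> \<P> \<Longrightarrow> 0 \<le> u t r x \<and> u t r x \<le> N"
  and maximal: "\<And>S t r x. sub S \<Longrightarrow> \<forall>t\<in>{0<..T}. \<forall>r\<in>\<P>. \<forall>x. 0 \<le> S t r x \<and> S t r x \<le> N + 1 \<Longrightarrow>
   t \<in> {0<..T} \<Longrightarrow> r \<in> \<P> \<Longrightarrow> S t r x \<le> u t r x"
  and fin: "\<And>r x. r \<in> \<P> \<Longrightarrow> h r x \<le> u T r x"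
 shows "super u"
 unfolding viscosity_supersolution_def
proof (intro conjI allI ballI impI sub_continuous[OF sub] fin)
 fix \<phi> and t0 :: real and r0 x0 :: "real ^ 'n" assume \<phi>: "C112_on T \<phi>" and t0: "t0 \<in> {0<..<T}" and r0: "r0 \<in> \<P>"
  and ev: "\<forall>\<^sub>F (t, r, x) in at (t0, r0, x0) within \<D> T.
    u t0 r0 x0 - \<phi> t0 r0 x0 \<le> u t r x - \<phi> t r x"
 have "near T t0 r0 x0 (\<lambda>t r x. u t0 r0 x0 - \<phi> t0 r0 x0 \<le> u t r x - \<phi> t r x)" by (rule eventually_near[OF ev]) simp
 then obtain d where d: "0 < d" and ud: "\<And>t r x. t \<in> {0<..<T} \<Longrightarrow> r \<in> \<P> \<Longrightarrow> \<bar>t - t0\<bar> < d \<Longrightarrow> norm (r - r0) < d \<Longrightarrow> norm (x - x0) < d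
   \<Longrightarrow> u t0 r0 x0 - \<phi> t0 r0 x0 \<le> u t r x - \<phi> t r x" by (rule nearE) (rule that)
 show "op \<phi> t0 r0 x0 \<le> 0"
 proof (rule ccontr)
  define e where "e = op \<phi> t0 r0 x0"
  assume "\<not> op \<phi> t0 r0 x0 \<le> 0"
  then have e: "0 < e" unfolding e_def by simp
  define s where "s = (\<Sum>i\<in>UNIV. (\<sigma> $ i)\<^sup>2)"
  have s: "0 \<le> s" unfolding s_def by (simp add: sum_nonneg)
  \<comment> \<open>With \<open>a \<le> 1\<close> chosen below, the entry 1 keeps the raise
    \<open>k * a\<^sup>2\<close> at most 1; the modified function then respects the bound
    \<open>N + 1\<close> in the maximality assumption.\<close>
  define k where "k = min 1 (e / 2 / (s + 1))"
  have k: "0 < k" "k \<le> 1" unfolding k_def using e s by simp_all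
  have "k * s \<le> k * (s + 1)" using k by simp
  also have "k * (s + 1) \<le> e / 2 / (s + 1) * (s + 1)" unfolding k_def using s by (intro mult_right_mono) auto
  also have "\<dots> = e / 2" by (rule divide_mult_cancel) (use s in simp)
  finally have ks: "k * s \<le> e / 2" .
  let ?\<phi> = "\<lambda>t r x. \<phi> t r x + - k * bump t0 r0 x0 t r x"
  note C = opV_bump(1)[OF \<phi> t0 r0, of "- k" x0]
  have g0: "e / 2 \<le> opV ?\<phi> t0 r0 x0 V" if "V \<in> cball 0 l" for V
   unfolding opV_bump(2)[OF \<phi> t0 r0] s_def[symmetric] using ks operator_le_opV[OF t0 r0 that, of \<phi> x0] unfolding e_def[symmetric] by simp
  have e2: "0 < e / 2" using e by simp
  obtain c R where c: "0 < c" and R: "0 < R" and loc: "\<And>t r x V. r \<in> \<P> \<Longrightarrow> V \<in> cball 0 l \<Longrightarrow> bump t0 r0 x0 t r x \<le> R\<^sup>2 \<Longrightarrow>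
   t \<in> {0<..<T} \<and> r \<in> simplex_core c \<and> \<bar>opV ?\<phi> t r x V - opV ?\<phi> t0 r0 x0 V\<bar> < e / 2"
   by (rule opV_local[OF C t0 r0 e2]) (rule that)
  define a where "a = min (min R 1) (d / 2)"
  have a: "0 < a" "a \<le> R" "a < d" "a \<le> 1" unfolding a_def using R d by auto
  have ar: "a\<^sup>2 \<le> R\<^sup>2" using a by (intro power_mono) auto
  have ka: "0 < k * a\<^sup>2" using k a by simp
  have "k * a\<^sup>2 \<le> 1 * 1" using k a by (intro mult_mono power_le_one) auto
  then have ka1: "k * a\<^sup>2 \<le> 1" by simp
  have V0: "(0 :: real ^ 'n) \<in> cball 0 l" using l_pos by simp
  let ?b = "\<lambda>t r x. bump t0 r0 x0 t r x"
  have tin: "t \<in> {0<..<T}" if "r \<in> \<P>" "?b t r x \<le> a\<^sup>2" for t r x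
   using loc[OF that(1) V0, of t x] that(2) ar by linarith
  have gpos: "0 \<le> opV ?\<phi> t r x V" if "r \<in> \<P>" "?b t r x \<le> a\<^sup>2" "V \<in> cball 0 l" for t r x V
  proof -
   have "?b t r x \<le> R\<^sup>2" using that(2) ar by linarith
   then have "\<bar>opV ?\<phi> t r x V - opV ?\<phi> t0 r0 x0 V\<bar> < e / 2" using loc[OF that(1,3)] by blast
   then show ?thesis using g0[OF that(3)] by linarith
  qed
  \<comment> \<open>The shift exceeds contact at the centre by \<open>k * a\<^sup>2\<close>, which
    the bump takes back entirely on the boundary of the ball.\<close>
  define m where "m = u t0 r0 x0 - \<phi> t0 r0 x0 + k * a\<^sup>2"
  have up: "?\<phi> t r x + m \<le> u t r x + (k * a\<^sup>2 - k * ?b t r x)" if r: "r \<in> \<P>" and b: "?b t r x \<le> a\<^sup>2" for t r x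
  proof -
   have "u t0 r0 x0 - \<phi> t0 r0 x0 \<le> u t r x - \<phi> t r x"
    using bump_le[OF b less_imp_le[OF a(1)]] a(3) by (intro ud[OF tin[OF r b] r]) linarith+
   then show ?thesis unfolding m_def by simp
  qed
  define S where "S t r x = (if ?b t r x \<le> a\<^sup>2 then max (u t r x) (?\<phi> t r x + m) else u t r x)" for t r x
  have uS: "u t r x \<le> S t r x" for t r x unfolding S_def by simp
  have "sub S"
   unfolding viscosity_subsolution_def
  proof (intro conjI allI ballI impI)
   let ?D = "{0<..T} \<times> (\<P> :: (real ^ 'n) set) \<times> (UNIV :: (real ^ 'n) set)"
   let ?bz = "\<lambda>(t, r, x). ?b t r x" and ?uz = "\<lambda>(t, r, x). u t r x" and ?fz = "\<lambda>(t, r, x). ?\<phi> t r x"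
   have "continuous_on ?D (\<lambda>z. if ?bz z \<le> a\<^sup>2 then max (?uz z) (?fz z + m) else ?uz z)"
   proof (rule continuous_on_cases_le)
    show "continuous_on ?D ?bz" by (rule continuous_on_bump)
    show "continuous_on {z \<in> ?D. a\<^sup>2 \<le> ?bz z} ?uz" by (rule continuous_on_subset[OF sub_continuous[OF sub]]) auto
    have "continuous_on (\<D> T) ?fz"
     using C[unfolded C112_on_def Let_def, THEN conjunct2, THEN conjunct1] .
    then have "continuous_on {z \<in> ?D. ?bz z \<le> a\<^sup>2} ?fz" by (rule continuous_on_subset) (use tin in auto)
    moreover have "continuous_on {z \<in> ?D. ?bz z \<le> a\<^sup>2} ?uz" by (rule continuous_on_subset[OF sub_continuous[OF sub]]) auto
    ultimately show "continuous_on {z \<in> ?D. ?bz z \<le> a\<^sup>2} (\<lambda>z. max (?uz z) (?fz z + m))"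
     by (intro continuous_on_max continuous_on_add continuous_on_const)
    fix z assume z: "z \<in> ?D" "?bz z = a\<^sup>2"
    obtain t r x where e: "z = (t, r, x)" by (metis prod_cases3)
    have b: "?b t r x = a\<^sup>2" and r: "r \<in> \<P>" using z unfolding e by auto
    then have "?\<phi> t r x + m \<le> u t r x" using up[OF r, of t x] by simp
    then show "max (?uz z) (?fz z + m) = ?uz z" unfolding e by (simp add: max_absorb1)
   qed
   then show "continuous_on ?D (\<lambda>(t, r, x). S t r x)" unfolding S_def by (simp only: case_prod_unfold)
   show "S T r x \<le> h r x" if r: "r \<in> \<P>" for r x
   proof -
    have "\<not> ?b T r x \<le> a\<^sup>2" using tin[OF r, of T x] by auto
    then have "S T r x = u T r x" unfolding S_def by simp
    then show ?thesis using sub r unfolding viscosity_subsolution_def by simp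
   qed
   fix \<psi> and t1 :: real and r1 x1 :: "real ^ 'n" assume \<psi>: "C112_on T \<psi>" and t1: "t1 \<in> {0<..<T}" and r1: "r1 \<in> \<P>"
    and ev: "\<forall>\<^sub>F (t, r, x) in at (t1, r1, x1) within \<D> T.
     S t r x - \<psi> t r x \<le> S t1 r1 x1 - \<psi> t1 r1 x1"
   have n: "near T t1 r1 x1 (\<lambda>t r x. S t r x - \<psi> t r x \<le> S t1 r1 x1 - \<psi> t1 r1 x1)" by (rule eventually_near[OF ev]) simp
   show "0 \<le> op \<psi> t1 r1 x1"
   proof (cases "S t1 r1 x1 = u t1 r1 x1")
    case True
    have "near T t1 r1 x1 (\<lambda>t r x. u t r x - \<psi> t r x \<le> u t1 r1 x1 - \<psi> t1 r1 x1)"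
    proof (rule near_mono[OF n])
     fix t :: real and r x :: "real ^ 'n" assume "S t r x - \<psi> t r x \<le> S t1 r1 x1 - \<psi> t1 r1 x1"
     then show "u t r x - \<psi> t r x \<le> u t1 r1 x1 - \<psi> t1 r1 x1" using uS[of t r x] True by linarith
    qed
    then show ?thesis using sub \<psi> t1 r1 near_eventually unfolding viscosity_subsolution_def by blast
   next
    case False
    then have b1: "?b t1 r1 x1 \<le> a\<^sup>2" unfolding S_def by (simp split: if_splits)
    have ne: "max (u t1 r1 x1) (?\<phi> t1 r1 x1 + m) \<noteq> u t1 r1 x1" using False b1 unfolding S_def by simp
    then have gt: "u t1 r1 x1 < ?\<phi> t1 r1 x1 + m" by (metis max.absorb1 not_le_imp_less)
    then have S1: "S t1 r1 x1 = ?\<phi> t1 r1 x1 + m" unfolding S_def using b1 by simp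
    have "k * ?b t1 r1 x1 < k * a\<^sup>2" using up[OF r1 b1] gt by linarith
    then have b2: "?b t1 r1 x1 < a\<^sup>2" using k by simp
    show ?thesis
    proof (rule operator_ge_pjet[OF \<psi> t1 r1 C112_pjet[OF C t1 r1]])
     show "near T t1 r1 x1 (\<lambda>t r x. ?\<phi> t r x - \<psi> t r x \<le> ?\<phi> t1 r1 x1 - \<psi> t1 r1 x1)"
     proof (rule near_mono[OF near_conj[OF n bump_near[OF b2]]], elim conjE)
      fix t :: real and r x :: "real ^ 'n" assume 1: "S t r x - \<psi> t r x \<le> S t1 r1 x1 - \<psi> t1 r1 x1" and 2: "?b t r x < a\<^sup>2"
      have "?\<phi> t r x + m \<le> S t r x" unfolding S_def using 2 by simp
      then show "?\<phi> t r x - \<psi> t r x \<le> ?\<phi> t1 r1 x1 - \<psi> t1 r1 x1" using 1 unfolding S1 by linarith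
     qed
     show "0 \<le> deriv (\<lambda>s. ?\<phi> s r1 x1) t1
      + Hval t1 r1 x1 (simplex_derivative (\<lambda>r. ?\<phi> t1 r x1) r1) (D_x (?\<phi> t1) r1 x1) (D2_x (?\<phi> t1) r1 x1) V" if "V \<in> cball 0 l" for V
      using gpos[OF r1 b1 that] unfolding opV_def .
    qed
   qed
  qed
  moreover have "\<forall>t\<in>{0<..T}. \<forall>r\<in>\<P>. \<forall>x. 0 \<le> S t r x \<and> S t r x \<le> N + 1"
  proof (intro ballI allI conjI)
   fix t :: real and r x :: "real ^ 'n" assume t: "t \<in> {0<..T}" and r: "r \<in> \<P>"
   note un = bnd[OF t r, of x]
   show "0 \<le> S t r x" using un uS[of t r x] by linarith
   have "?\<phi> t r x + m \<le> N + 1" if "?b t r x \<le> a\<^sup>2"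
   proof -
    have "0 \<le> k * ?b t r x" using k bump_nonneg by (intro mult_nonneg_nonneg) auto
    then show ?thesis using up[OF r that] un ka1 by linarith
   qed
   then show "S t r x \<le> N + 1" unfolding S_def using un by simp
  qed
  moreover have "t0 \<in> {0<..T}" using t0 by simp
  ultimately have "S t0 r0 x0 \<le> u t0 r0 x0" using maximal r0 by blast
  moreover have "?\<phi> t0 r0 x0 + m \<le> S t0 r0 x0" unfolding S_def by simp
  ultimately show False using ka unfolding m_def by simp
 qed
qed

lemma comparison:
 assumes U: "sub U" "below T U M"
  and U': "super U'" "above T (- M) U'"
  and M: "0 \<le> M" and t: "t \<in> {0<..T}" and r: "r \<in> \<P>"
 shows "U t r x \<le> U' t r x"
proof -
 obtain N G where G0: "\<And>r x. r \<in> \<P> \<Longrightarrow> 0 \<le> G r x"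
  and sw: "\<And>\<epsilon> M. 0 < \<epsilon> \<Longrightarrow> 0 \<le> M \<Longrightarrow> \<exists>W S. sandwich N G \<epsilon> M W S"
  by (rule sandwich_exists) (rule that)
 show ?thesis
 proof (rule le_from_scaled_errors[of _ _ "2 * G r x"])
  show "0 \<le> 2 * G r x" using G0[OF r] by simp
  fix \<epsilon> :: real assume "0 < \<epsilon>"
  from sw[OF this M] obtain W S where
   W1: "\<forall>U. sub U \<and> (below T U M) \<longrightarrow>
    (\<forall>t\<in>{0<..T}. \<forall>r\<in>\<P>. \<forall>x. U t r x \<le> W t r x + \<epsilon> * G r x)"
   and W2: "\<forall>U. super U \<and> (above T (- M) U) \<longrightarrow>
    (\<forall>t\<in>{0<..T}. \<forall>r\<in>\<P>. \<forall>x. W t r x - \<epsilon> * G r x \<le> U t r x)"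
   unfolding sandwich_def by (elim exE conjE) (rule that)
  have "U t r x \<le> W t r x + \<epsilon> * G r x" using W1 U t r by blast
  moreover have "W t r x - \<epsilon> * G r x \<le> U' t r x" using W2 U' t r by blast
  ultimately show "U t r x \<le> U' t r x + \<epsilon> * (2 * G r x)" by simp
 qed
qed

text \<open>Continuity of the supremum, usually the outcome of comparing semicontinuous envelopes,
  comes directly from the approximations: \<open>u\<close> is within \<open>\<epsilon> * G\<close>
  of a continuous function for every \<open>\<epsilon>\<close>, and \<open>G\<close> is locally
  bounded. The terminal value is obtained from the same estimate.\<close>

lemma perron:
 obtains u N where "viscosity_solution H0 (diag_mat \<sigma>) l T F h u" "\<And>t r x. t \<in> {0<..T} \<Longrightarrow> r \<in> \<P> \<Longrightarrow> 0 \<le> u t r x \<and> u t r x \<le> N"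
proof -
 obtain N G where N: "0 \<le> N" and Gc: "continuous_on (\<P> \<times> UNIV) (\<lambda>(r, x). G r x)"
  and G0: "\<And>r x. r \<in> \<P> \<Longrightarrow> 0 \<le> G r x"
  and sw: "\<And>\<epsilon> M. 0 < \<epsilon> \<Longrightarrow> 0 \<le> M \<Longrightarrow> \<exists>W S. sandwich N G \<epsilon> M W S"
  by (rule sandwich_exists) (rule that)
 have N1: "0 \<le> N + 1" using N by simp
 \<comment> \<open>The members may reach \<open>N + 1\<close>, but the supremum turns out to be at
   most \<open>N\<close>; the gap of 1 is what \<open>super_of_maximal_sub\<close> spends.\<close>
 define \<S> where "\<S> = {S. sub S \<and> (\<forall>t\<in>{0<..T}. \<forall>r\<in>\<P>. \<forall>x. 0 \<le> S t r x \<and> S t r x \<le> N + 1)}"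
 define u where "u t r x = (SUP S\<in>\<S>. S t r x)" for t r x
 have S_bounds: "0 \<le> S t r x" "S t r x \<le> N + 1" if "S \<in> \<S>" "t \<in> {0<..T}" "r \<in> \<P>" for S t r x
  using that unfolding \<S>_def by blast+
 have bdd: "bdd_above ((\<lambda>S. S t r x) ` \<S>)" if "t \<in> {0<..T}" "r \<in> \<P>" for t r x
  by (rule bdd_aboveI2[of _ _ "N + 1"]) (rule S_bounds(2)[OF _ that])
 have up: "S t r x \<le> u t r x" if "S \<in> \<S>" "t \<in> {0<..T}" "r \<in> \<P>" for S t r x
  unfolding u_def by (rule cSUP_upper[OF that(1) bdd[OF that(2,3)]])
 have approx: "\<exists>W. continuous_on ({0..T} \<times> \<P> \<times> UNIV) (\<lambda>(t, r, x). W t r x) \<and> (\<forall>t\<in>{0..T}. \<forall>r x. W t r x \<le> N) \<and>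
   (\<forall>t\<in>{0<..T}. \<forall>r\<in>\<P>. \<forall>x. \<bar>u t r x - W t r x\<bar> \<le> \<epsilon> * G r x) \<and>
   (\<forall>r\<in>\<P>. \<forall>x. h r x \<le> W T r x + \<epsilon> * G r x) \<and> \<S> \<noteq> {}" if \<epsilon>: "0 < \<epsilon>" for \<epsilon>
 proof -
  from sw[OF \<epsilon> N1] obtain W S where
   Wc: "continuous_on ({0..T} \<times> \<P> \<times> UNIV) (\<lambda>(t, r, x). W t r x)"
   and Wb: "\<forall>t\<in>{0..T}. \<forall>r x. W t r x \<le> N"
   and W1: "\<forall>U. sub U \<and> (\<forall>t\<in>{0<..T}. \<forall>r\<in>\<P>. \<forall>x. U t r x \<le> N + 1) \<longrightarrow>
    (\<forall>t\<in>{0<..T}. \<forall>r\<in>\<P>. \<forall>x. U t r x \<le> W t r x + \<epsilon> * G r x)"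
   and S: "sub S" and Sb: "\<forall>t\<in>{0<..T}. \<forall>r\<in>\<P>. \<forall>x. 0 \<le> S t r x \<and> S t r x \<le> N \<and> W t r x - \<epsilon> * G r x \<le> S t r x"
   and Wh: "\<forall>r\<in>\<P>. \<forall>x. h r x \<le> W T r x + \<epsilon> * G r x"
   unfolding sandwich_def by (elim exE conjE) (rule that)
  have "0 \<le> S t r x \<and> S t r x \<le> N + 1" if "t \<in> {0<..T}" "r \<in> \<P>" for t r x
   using Sb[rule_format, OF that, of x] by linarith
  then have S': "S \<in> \<S>" unfolding \<S>_def using S by blast
  have "\<bar>u t r x - W t r x\<bar> \<le> \<epsilon> * G r x" if t: "t \<in> {0<..T}" and r: "r \<in> \<P>" for t r x
  proof -
   have "u t r x \<le> W t r x + \<epsilon> * G r x"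
    unfolding u_def
   proof (rule cSUP_least)
    show "\<S> \<noteq> {}" using S' by blast
    fix S assume "S \<in> \<S>"
    then show "S t r x \<le> W t r x + \<epsilon> * G r x" using W1 t r unfolding \<S>_def by blast
   qed
   moreover have "W t r x - \<epsilon> * G r x \<le> S t r x" using Sb t r by blast
   ultimately show ?thesis using up[OF S' t r, of x] by (simp add: abs_le_iff)
  qed
  then show ?thesis using Wc Wb Wh S' by blast
 qed
 have ne: "\<S> \<noteq> {}" using approx[OF zero_less_one] by (elim exE conjE)
 have uN: "0 \<le> u t r x \<and> u t r x \<le> N" if t: "t \<in> {0<..T}" and r: "r \<in> \<P>" for t r x
 proof
  obtain S where S: "S \<in> \<S>" using ne by blast
  show "0 \<le> u t r x" using up[OF S t r, of x] S_bounds(1)[OF S t r, of x] by linarith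
  show "u t r x \<le> N"
  proof (rule le_from_scaled_errors[OF _ G0[OF r]])
   fix \<epsilon> :: real assume "0 < \<epsilon>"
   from approx[OF this] obtain W where "\<forall>t\<in>{0..T}. \<forall>r x. W t r x \<le> N"
    "\<forall>t\<in>{0<..T}. \<forall>r\<in>\<P>. \<forall>x. \<bar>u t r x - W t r x\<bar> \<le> \<epsilon> * G r x" by (elim exE conjE) (rule that)
   then have "W t r x \<le> N" "\<bar>u t r x - W t r x\<bar> \<le> \<epsilon> * G r x" using t r by auto
   then show "u t r x \<le> N + \<epsilon> * G r x" unfolding abs_le_iff by linarith
  qed
 qed
 have TT: "T \<in> {0<..T}" using T_pos by simp
 have uT: "u T r x \<le> h r x" "h r x \<le> u T r x" if r: "r \<in> \<P>" for r x
 proof -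
  show "u T r x \<le> h r x"
   unfolding u_def
  proof (rule cSUP_least[OF ne])
   fix S assume "S \<in> \<S>"
   then show "S T r x \<le> h r x" using r unfolding \<S>_def viscosity_subsolution_def by blast
  qed
  show "h r x \<le> u T r x"
  proof (rule le_from_scaled_errors[of _ _ "2 * G r x"])
   show "0 \<le> 2 * G r x" using G0[OF r] by simp
   fix \<epsilon> :: real assume "0 < \<epsilon>"
   from approx[OF this] obtain W where 1: "\<forall>t\<in>{0<..T}. \<forall>r\<in>\<P>. \<forall>x. \<bar>u t r x - W t r x\<bar> \<le> \<epsilon> * G r x"
    and 2: "\<forall>r\<in>\<P>. \<forall>x. h r x \<le> W T r x + \<epsilon> * G r x" by (elim exE conjE) (rule that)
   have "\<bar>u T r x - W T r x\<bar> \<le> \<epsilon> * G r x" "h r x \<le> W T r x + \<epsilon> * G r x" using 1 2 TT r by blast+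
   then show "h r x \<le> u T r x + \<epsilon> * (2 * G r x)" unfolding abs_le_iff by simp
  qed
 qed
 let ?D = "{0<..T} \<times> (\<P> :: (real ^ 'n) set) \<times> (UNIV :: (real ^ 'n) set)"
 have ucont: "continuous_on ?D (\<lambda>(t, r, x). u t r x)"
  unfolding continuous_on_iff
 proof (intro ballI allI impI)
  fix z0 and e :: real assume z0: "z0 \<in> ?D" and e: "0 < e"
  obtain t0 r0 x0 where z0e: "z0 = (t0, r0, x0)" by (metis prod_cases3)
  have t0: "t0 \<in> {0<..T}" and r0: "r0 \<in> \<P>" using z0 unfolding z0e by auto
  let ?g = "G r0 x0 + 1"
  have g: "0 < ?g" using G0[OF r0, of x0] by simp
  \<comment> \<open>Near the point \<open>G\<close> is at most \<open>?g\<close>, so the two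
    approximation errors and the oscillation of \<open>W\<close> get one third of \<open>e\<close>
    each.\<close>
  define \<epsilon> where "\<epsilon> = e / 3 / ?g"
  have \<epsilon>: "0 < \<epsilon>" unfolding \<epsilon>_def using e g by simp
  have \<epsilon>g: "\<epsilon> * ?g = e / 3" unfolding \<epsilon>_def by (rule divide_mult_cancel) (use g in simp)
  obtain W where Wc: "continuous_on ({0..T} \<times> \<P> \<times> UNIV) (\<lambda>(t, r, x). W t r x)"
   and W: "\<forall>t\<in>{0<..T}. \<forall>r\<in>\<P>. \<forall>x. \<bar>u t r x - W t r x\<bar> \<le> \<epsilon> * G r x"
   using approx[OF \<epsilon>] by (elim exE conjE) (rule that)
  have e3: "0 < e / 3" using e by simp
  have z0': "z0 \<in> {0..T} \<times> \<P> \<times> UNIV" using z0 by auto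
  obtain d1 where d1: "0 < d1" "\<And>z. z \<in> {0..T} \<times> \<P> \<times> UNIV \<Longrightarrow> dist z z0 < d1 \<Longrightarrow> dist ((\<lambda>(t, r, x). W t r x) z) ((\<lambda>(t, r, x). W t r x) z0) < e / 3"
   using Wc[unfolded continuous_on_iff, rule_format, OF z0' e3] by blast
  have z0'': "(r0, x0) \<in> \<P> \<times> UNIV" using r0 by simp
  obtain d2 where d2: "0 < d2" "\<And>y. y \<in> \<P> \<times> UNIV \<Longrightarrow> dist y (r0, x0) < d2 \<Longrightarrow> dist ((\<lambda>(r, x). G r x) y) ((\<lambda>(r, x). G r x) (r0, x0)) < 1"
   using Gc[unfolded continuous_on_iff, rule_format, OF z0'' zero_less_one] by blast
  show "\<exists>d>0. \<forall>z\<in>?D. dist z z0 < d \<longrightarrow> dist ((\<lambda>(t, r, x). u t r x) z) ((\<lambda>(t, r, x). u t r x) z0) < e"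
  proof (intro exI[of _ "min d1 d2"] conjI ballI impI)
   show "0 < min d1 d2" using d1 d2 by simp
   fix z assume z: "z \<in> ?D" and dz: "dist z z0 < min d1 d2"
   obtain t r x where ze: "z = (t, r, x)" by (metis prod_cases3)
   have t: "t \<in> {0<..T}" and r: "r \<in> \<P>" using z unfolding ze by auto
   have "z \<in> {0..T} \<times> \<P> \<times> UNIV" using z by auto
   from d1(2)[OF this] dz have 1: "\<bar>W t r x - W t0 r0 x0\<bar> < e / 3" unfolding ze z0e by (simp add: dist_real_def)
   have "dist (r, x) (r0, x0) < d2" using dist_snd_le[of z z0] dz unfolding ze z0e by simp
   then have "\<bar>G r x - G r0 x0\<bar> < 1" using d2(2)[of "(r, x)"] r by (simp add: dist_real_def)
   then have "\<epsilon> * G r x \<le> \<epsilon> * ?g" using \<epsilon> by (intro mult_left_mono) auto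
   moreover have "\<epsilon> * G r0 x0 \<le> \<epsilon> * ?g" using \<epsilon> by (intro mult_left_mono) auto
   moreover have "\<bar>u t r x - W t r x\<bar> \<le> \<epsilon> * G r x" "\<bar>u t0 r0 x0 - W t0 r0 x0\<bar> \<le> \<epsilon> * G r0 x0" using W t r t0 r0 by blast+
   ultimately have "\<bar>u t r x - u t0 r0 x0\<bar> < e" using 1 \<epsilon>g by linarith
   then show "dist ((\<lambda>(t, r, x). u t r x) z) ((\<lambda>(t, r, x). u t r x) z0) < e" unfolding ze z0e by (simp add: dist_real_def)
  qed
 qed
 have usub: "sub u"
 proof (rule sub_Sup[of \<S> u])
  show "S t r x \<le> u t r x" if "S \<in> \<S>" "t \<in> {0<..T}" "r \<in> \<P>" for S t r x by (rule up[OF that])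
  show "continuous_on ?D (\<lambda>(t, r, x). u t r x)" by (rule ucont)
  show "u T r x \<le> h r x" if "r \<in> \<P>" for r x by (rule uT(1)[OF that])
  show "sub S" if "S \<in> \<S>" for S using that unfolding \<S>_def by blast
  show "\<exists>S\<in>\<S>. u t r x - e < S t r x" if "t \<in> {0<..T}" "r \<in> \<P>" "0 < e" for t r x e
   using less_cSUP_iff[OF ne bdd[OF that(1,2)], of "u t r x - e" x] that(3) unfolding u_def by simp
 qed
 have "super u"
 proof (rule super_of_maximal_sub[of u N])
  show "sub u" by (rule usub)
  show "0 \<le> u t r x \<and> u t r x \<le> N" if "t \<in> {0<..T}" "r \<in> \<P>" for t r x by (rule uN[OF that])
  show "h r x \<le> u T r x" if "r \<in> \<P>" for r x by (rule uT(2)[OF that])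
  show "S t r x \<le> u t r x" if "sub S" "\<forall>t\<in>{0<..T}. \<forall>r\<in>\<P>. \<forall>x. 0 \<le> S t r x \<and> S t r x \<le> N + 1"
   "t \<in> {0<..T}" "r \<in> \<P>" for S t r x
   by (rule up[OF _ that(3,4)]) (use that(1,2) in \<open>simp add: \<S>_def\<close>)
 qed
 then show thesis using that[of u N] usub uN unfolding viscosity_solution_def by blast
qed

lemma existence_uniqueness:
 "\<exists>U. bounded_viscosity_solution H0 (diag_mat \<sigma>) l T F h U \<and>
   (\<forall>U'. bounded_viscosity_solution H0 (diag_mat \<sigma>) l T F h U' \<longrightarrow>
    (\<forall>t\<in>{0<..T}. \<forall>r\<in>\<P>. \<forall>x. U' t r x = U t r x))"
proof -
 obtain u N where u: "viscosity_solution H0 (diag_mat \<sigma>) l T F h u"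
  and uN: "\<And>t r x. t \<in> {0<..T} \<Longrightarrow> r \<in> \<P> \<Longrightarrow> 0 \<le> u t r x \<and> u t r x \<le> N"
  by (rule perron) (rule that)
 show ?thesis
 proof (intro exI[of _ u] conjI allI impI ballI)
  have "\<forall>t\<in>{0<..T}. \<forall>r\<in>\<P>. \<forall>x. \<bar>u t r x\<bar> \<le> N" using uN by simp
  then show "bounded_viscosity_solution H0 (diag_mat \<sigma>) l T F h u" using u unfolding bounded_viscosity_solution_def by blast
  fix U and t :: real and r x :: "real ^ 'n"
  assume U: "bounded_viscosity_solution H0 (diag_mat \<sigma>) l T F h U" and t: "t \<in> {0<..T}" and r: "r \<in> \<P>"
  obtain M where M: "\<forall>t\<in>{0<..T}. \<forall>r\<in>\<P>. \<forall>x. \<bar>U t r x\<bar> \<le> M"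
   using U unfolding bounded_viscosity_solution_def by blast
  \<comment> \<open>One bound for both solutions, so that \<open>comparison\<close> applies in both
    directions with the same constant.\<close>
  define J where "J = \<bar>M\<bar> + \<bar>N\<bar>"
  have J: "0 \<le> J" unfolding J_def by simp
  have UR: "U t r x \<le> J" "- J \<le> U t r x" "u t r x \<le> J" "- J \<le> u t r x" if "t \<in> {0<..T}" "r \<in> \<P>" for t r x
   using M[rule_format, OF that, of x] uN[OF that, of x] unfolding J_def by linarith+
  have s: "sub U" "super U" "sub u" "super u"
   using U u unfolding bounded_viscosity_solution_def viscosity_solution_def by blast+
  show "U t r x = u t r x"
  proof (rule antisym)
   show "U t r x \<le> u t r x" by (rule comparison[OF s(1) _ s(4) _ J t r]) (use UR in blast)+
   show "u t r x \<le> U t r x" by (rule comparison[OF s(3) _ s(2) _ J t r]) (use UR in blast)+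
  qed
 qed
qed

end

theorem theorem3p5:
  fixes E :: "('n::finite \<times> 'n) set"
    and \<omega> :: "'n \<Rightarrow> 'n \<Rightarrow> real"
    and g :: "real \<Rightarrow> real \<Rightarrow> real"
    and H0 h :: "real ^ 'n \<Rightarrow> real ^ 'n \<Rightarrow> real"
    and F :: "real \<Rightarrow> real ^ 'n \<Rightarrow> real ^ 'n \<Rightarrow> real ^ 'n \<Rightarrow> real"
    and l T \<beta> :: real
    and \<sigma> :: "real ^ 'n"
  assumes graph: "weighted_graph E \<omega>"
    and weight: "admissible_weight g"
    and energy: "admissible_energy E H0"
    and l_pos: "0 < l"
    and T_pos: "0 < T"
    and costs: "admissible_costs E H0 T l F h"
    and second_derivatives:
      "\<And>\<rho> x. \<rho> \<in> prob_simplex_int \<Longrightarrow> twice_differentiable_at (H0 \<rho>) x"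
    and growth:
      "\<exists>C1>0. \<exists>C2>0. \<forall>\<rho>\<in>prob_simplex_int. \<forall>x. \<forall>V\<in>cball 0 l.
         norm (D_x (controlled_energy H0 V) \<rho> x)
         + (\<Sum>i\<in>UNIV. \<bar>D2_x (controlled_energy H0 V) \<rho> x $ i $ i\<bar>)
         \<le> C1 * controlled_energy H0 V \<rho> x + C2"
    and mass_conservation:
      "\<And>\<rho> x. \<rho> \<in> prob_simplex_int \<Longrightarrow> (\<Sum>i\<in>UNIV. D_x H0 \<rho> x $ i) = 0"
    and \<beta>: "0 < \<beta>" "\<beta> < 1"
    and decay:
      "((\<lambda>R. SUP (\<rho>, x)\<in>prob_simplex_int \<times> UNIV.
           ereal (indicator {(r, y). R < H0 r y \<and> H0 r y < 2 * R} (\<rho>, x) *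
             (1 / R * norm (D2_x H0 \<rho> x) + 1 / R powr (2 - \<beta>) * (norm (D_x H0 \<rho> x))\<^sup>2)))
        \<longlongrightarrow> 0) at_top"
    and F_bounded:
      "\<exists>M. \<forall>t\<in>{0..T}. \<forall>\<rho>\<in>prob_simplex_int. \<forall>x. \<forall>V\<in>cball 0 l. \<bar>F t \<rho> x V\<bar> \<le> M"
    and h_bounded: "\<exists>M. \<forall>\<rho>\<in>prob_simplex_int. \<forall>x. \<bar>h \<rho> x\<bar> \<le> M"
  shows "\<exists>U. bounded_viscosity_solution H0 (diag_mat \<sigma>) l T F h U \<and>
           (\<forall>U'. bounded_viscosity_solution H0 (diag_mat \<sigma>) l T F h U' \<longrightarrow>
              (\<forall>t\<in>{0<..T}. \<forall>\<rho>\<in>prob_simplex_int. \<forall>x. U' t \<rho> x = U t \<rho> x))"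
proof -
 interpret hjb E H0 h F l T \<sigma>
  by (rule hjb.intro) (fact energy l_pos T_pos costs second_derivatives growth mass_conservation F_bounded h_bounded)+
 show ?thesis by (rule existence_uniqueness)
qed

end
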